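(* Let $\langle \lambda_i : i\le \alpha\rangle$ be a strictly increasing sequence of infinite cardinals. Assume that for each $i\le\alpha$ there is an AEC $(\mathbf K_0^i,\prec_{\mathbf K_0^i})$ which has models of cardinality $\lambda_i$ but no models of any larger cardinality. If every $(\mathbf K_0^i,\prec_{\mathbf K_0^i})$ satisfies JEP$(<\lambda_0)$, then there is an AEC $(\mathbf K^*,\prec_{\mathbf K^*})$ which (1) satisfies JEP$(<\lambda_0)$, while JEP fails for all larger cardinals; (2) fails AP in all infinite cardinals; (3) has $2^{\lambda_i^+}$ pairwise non-isomorphic maximal models of cardinality $\lambda_i^+$ for every $i\le\alpha$, but no maximal models in any other cardinality; (4) has arbitrarily large models; and (5) $LS(\mathbf K^* )=\max\{LS(\mathbf K_0^i): i\le\alpha\}$. Moreover, if all $(\mathbf K_0^i,\prec_{\mathbf K_0^i})$ are pure, then $(\mathbf K^*,\prec_{\mathbf K^*})$ is pure; and if $\alpha<\aleph_1$ and each $\mathbf K_0^i$ is the class of models of an $L_{\omega_1,\omega}$-sentence, then $\mathbf K^*$ is also the class of models of an $L_{\omega_1,\omega}$-sentence.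
   Context: AEC means abstract elementary class; $LS(\mathbf K)$ is its Löwenheim–Skolem number. Standing convention: properties of an AEC $\mathbf K$ are only considered at cardinals $\ge LS(\mathbf K)$. For an infinite cardinal $\kappa$: $\mathbf K$ has JEP$(\kappa)$ if any two models of $\mathbf K$ of cardinality $\kappa$ both $\prec_{\mathbf K}$-embed into a common model of $\mathbf K$; JEP$(\le\kappa)$ (resp. JEP$(<\kappa)$) is the same requirement for any two models of cardinalities $\le\kappa$ (resp. $<\kappa$), possibly of different cardinalities. AP$(\kappa)$: for any $M_0,M_1,M_2\in\mathbf K$ of cardinality $\kappa$ with $M_0\prec_{\mathbf K} M_1$, $M_0\prec_{\mathbf K}M_2$, there are $\prec_{\mathbf K}$-embeddings of $M_1,M_2$ into some $M_3\in\mathbf K$ agreeing on $M_0$. A model $M\in\mathbf K$ is maximal if it has no proper $\prec_{\mathbf K}$-extension in $\mathbf K$. For a class $\mathbf K$ of $\tau$-structures and $\tau_1\subseteq\tau$, $\mathbf K_{\tau_1}$ is the subclass of models in which all symbols not in $\tau_1$ have empty interpretation. An AEC $\mathbf K$ in vocabulary $\tau$ is hybrid if $\tau=\tau_1\cup\tau_2$, $\mathbf K=\mathbf K_{\tau_1}\cup\mathbf K_{\tau_2}$, and at least one of $\tau_1,\tau_2$ is not equal to $\tau$; otherwise it is pure.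
   Formalization: "Hybrid" requires both τ₁ and τ₂ to differ from τ (with only "at least one", every nonempty vocabulary is hybrid and the purity clause fails); max{LS(K_0^i)} is read as the least upper bound, since the maximum need not exist for infinite α. *)

theory Defs
  imports Main "HOL-Library.Countable_Set"
begin

unbundle cardinal_syntax

section \<open>The universe of sets\<close>

text \<open>
  An abstract elementary class is a proper class of structures whose models may have unbounded
  cardinality, so it cannot be modelled by all structures on types of HOL.  The points of the type
  \<open>'u\<close> play the role of the elements of all structures (and name all symbols), the sets of
  cardinality below that of \<open>'u\<close> (the small ones) play the role of sets, and arbitrary sets of small
  structures play the role of classes.  All that is asked of \<open>'u\<close> is that its cardinality is an
  uncountable limit cardinal; every strongly inaccessible cardinality (a Grothendieck universe,
  i.e. a model of second-order ZFC) is an instance.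
\<close>

definition small :: "'u set \<Rightarrow> bool" where
  "small X \<longleftrightarrow> |X| <o |UNIV :: 'u set|"

text \<open>Cardinals are cardinal orders on \<open>'u\<close>, compared by \<open>=o\<close>, \<open>\<le>o\<close> and \<open><o\<close>.\<close>

definition infinite_cardinal :: "'u rel \<Rightarrow> bool" where
  "infinite_cardinal \<kappa> \<longleftrightarrow> Cinfinite \<kappa> \<and> \<kappa> <o |UNIV :: 'u set|"

definition universe :: "'u itself \<Rightarrow> bool" where
  "universe _ \<longleftrightarrow>
     natLeq <o |UNIV :: 'u set| \<and>
     (\<forall>\<kappa> :: 'u rel. infinite_cardinal \<kappa> \<longrightarrow> cardSuc \<kappa> <o |UNIV :: 'u set| )"


section \<open>Vocabularies and structures\<close>

text \<open>
  A symbol carries its arity and its kind, so that a vocabulary is just a set of symbols.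
  Constants are function symbols of arity 0.
\<close>

datatype 'u symb = Rel nat 'u | Fun nat 'u

text \<open>
  A function symbol is interpreted by its graph.  Hence it makes sense for any symbol to have an
  empty interpretation, and the substructure relation is the same for both kinds of symbols:
  as interpretations of function symbols are total, the carrier of a substructure is closed under
  the functions.
\<close>

record 'u struct =
  carrier :: "'u set"
  interp :: "'u symb \<Rightarrow> 'u list set"

definition tuples :: "nat \<Rightarrow> 'u set \<Rightarrow> 'u list set" where
  "tuples n A = {xs. length xs = n \<and> set xs \<subseteq> A}"

fun wf_interp :: "'u set \<Rightarrow> 'u symb \<Rightarrow> 'u list set \<Rightarrow> bool" where
  "wf_interp A (Rel n _) R \<longleftrightarrow> R \<subseteq> tuples n A"
| "wf_interp A (Fun n _) R \<longleftrightarrow>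
     R \<subseteq> tuples (Suc n) A \<and> (\<forall>xs \<in> tuples n A. \<exists>!y. y \<in> A \<and> xs @ [y] \<in> R)"

definition is_struct :: "'u symb set \<Rightarrow> 'u struct \<Rightarrow> bool" where
  "is_struct \<tau> M \<longleftrightarrow>
     carrier M \<noteq> {} \<and> small (carrier M) \<and>
     (\<forall>s \<in> \<tau>. wf_interp (carrier M) s (interp M s)) \<and>
     (\<forall>s. s \<notin> \<tau> \<longrightarrow> interp M s = {})"

definition substruct :: "'u struct \<Rightarrow> 'u struct \<Rightarrow> bool" where
  "substruct M N \<longleftrightarrow>
     carrier M \<subseteq> carrier N \<and> (\<forall>s. interp M s = interp N s \<inter> lists (carrier M))"

definition iso :: "('u \<Rightarrow> 'u) \<Rightarrow> 'u struct \<Rightarrow> 'u struct \<Rightarrow> bool" where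
  "iso f M N \<longleftrightarrow>
     bij_betw f (carrier M) (carrier N) \<and> (\<forall>s. interp N s = map f ` interp M s)"

definition isomorphic :: "'u struct \<Rightarrow> 'u struct \<Rightarrow> bool" where
  "isomorphic M N \<longleftrightarrow> (\<exists>f. iso f M N)"

definition union_struct :: "'i set \<Rightarrow> ('i \<Rightarrow> 'u struct) \<Rightarrow> 'u struct" where
  "union_struct I M =
     \<lparr>carrier = (\<Union>i \<in> I. carrier (M i)), interp = (\<lambda>s. \<Union>i \<in> I. interp (M i) s)\<rparr>"


section \<open>Abstract elementary classes\<close>

record 'u eclass =
  vocab :: "'u symb set"
  models :: "'u struct set"
  strong :: "'u struct \<Rightarrow> 'u struct \<Rightarrow> bool"

definition has_LS_property :: "'u eclass \<Rightarrow> 'u rel \<Rightarrow> bool" where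
  "has_LS_property K \<kappa> \<longleftrightarrow>
     (\<forall>N \<in> models K. \<forall>X \<subseteq> carrier N.
        \<exists>M. strong K M N \<and> X \<subseteq> carrier M \<and> |carrier M| \<le>o |X| +c \<kappa>)"

text \<open>
  Chains are indexed by well-orders on \<open>'u\<close>; the union of a chain is considered only if it is
  a set, i.e. small.
\<close>

locale AEC =
  fixes K :: "'u eclass"
  assumes vocab_small: "|vocab K| <o |UNIV :: 'u set|"
    and models_struct: "M \<in> models K \<Longrightarrow> is_struct (vocab K) M"
    and models_iso: "M \<in> models K \<Longrightarrow> iso f M N \<Longrightarrow> N \<in> models K"
    and strong_iso: "strong K M N \<Longrightarrow> iso f N N' \<Longrightarrow> iso f M M' \<Longrightarrow> strong K M' N'"
    and strong_models: "strong K M N \<Longrightarrow> M \<in> models K \<and> N \<in> models K"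
    and strong_substruct: "strong K M N \<Longrightarrow> substruct M N"
    and strong_refl: "M \<in> models K \<Longrightarrow> strong K M M"
    and strong_trans: "strong K M N \<Longrightarrow> strong K N P \<Longrightarrow> strong K M P"
    and chain_models:
      "Well_order (r :: 'u rel) \<Longrightarrow> Field r \<noteq> {} \<Longrightarrow> (\<And>i j. (i, j) \<in> r \<Longrightarrow> strong K (Mi i) (Mi j)) \<Longrightarrow>
       small (\<Union>i \<in> Field r. carrier (Mi i)) \<Longrightarrow> union_struct (Field r) Mi \<in> models K"
    and chain_upper:
      "Well_order (r :: 'u rel) \<Longrightarrow> Field r \<noteq> {} \<Longrightarrow> (\<And>i j. (i, j) \<in> r \<Longrightarrow> strong K (Mi i) (Mi j)) \<Longrightarrow>
       small (\<Union>i \<in> Field r. carrier (Mi i)) \<Longrightarrow>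
       i \<in> Field r \<Longrightarrow> strong K (Mi i) (union_struct (Field r) Mi)"
    and chain_least:
      "Well_order (r :: 'u rel) \<Longrightarrow> Field r \<noteq> {} \<Longrightarrow> (\<And>i j. (i, j) \<in> r \<Longrightarrow> strong K (Mi i) (Mi j)) \<Longrightarrow>
       small (\<Union>i \<in> Field r. carrier (Mi i)) \<Longrightarrow>
       (\<And>i. i \<in> Field r \<Longrightarrow> strong K (Mi i) N) \<Longrightarrow> strong K (union_struct (Field r) Mi) N"
    and coherence: "strong K M P \<Longrightarrow> strong K N P \<Longrightarrow> substruct M N \<Longrightarrow> strong K M N"
    and LS_exists: "\<exists>\<kappa>. infinite_cardinal \<kappa> \<and> has_LS_property K \<kappa>"

text \<open>
  The Loewenheim-Skolem number is determined up to \<open>=o\<close>.  It is not required to bound the number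
  of symbols.
\<close>

definition is_LS :: "'u eclass \<Rightarrow> 'u rel \<Rightarrow> bool" where
  "is_LS K \<kappa> \<longleftrightarrow>
     infinite_cardinal \<kappa> \<and> has_LS_property K \<kappa> \<and>
     (\<forall>\<mu>. infinite_cardinal \<mu> \<and> has_LS_property K \<mu> \<longrightarrow> \<kappa> \<le>o \<mu>)"

definition LS :: "'u eclass \<Rightarrow> 'u rel" where
  "LS K = (SOME \<kappa>. is_LS K \<kappa>)"

text \<open>Properties of an AEC are considered only at cardinals from its Loewenheim-Skolem number on.\<close>

definition relevant_cardinal :: "'u eclass \<Rightarrow> 'u rel \<Rightarrow> bool" where
  "relevant_cardinal K \<kappa> \<longleftrightarrow> infinite_cardinal \<kappa> \<and> LS K \<le>o \<kappa>"

definition embedding :: "'u eclass \<Rightarrow> ('u \<Rightarrow> 'u) \<Rightarrow> 'u struct \<Rightarrow> 'u struct \<Rightarrow> bool" where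
  "embedding K f M N \<longleftrightarrow> (\<exists>M'. iso f M M' \<and> strong K M' N)"

definition jointly_embeddable :: "'u eclass \<Rightarrow> 'u struct \<Rightarrow> 'u struct \<Rightarrow> bool" where
  "jointly_embeddable K M N \<longleftrightarrow>
     (\<exists>P \<in> models K. (\<exists>f. embedding K f M P) \<and> (\<exists>g. embedding K g N P))"

definition JEP :: "'u eclass \<Rightarrow> 'u rel \<Rightarrow> bool" where
  "JEP K \<kappa> \<longleftrightarrow>
     (\<forall>M \<in> models K. \<forall>N \<in> models K.
        |carrier M| =o \<kappa> \<and> |carrier N| =o \<kappa> \<longrightarrow> jointly_embeddable K M N)"

definition JEP_less :: "'u eclass \<Rightarrow> 'u rel \<Rightarrow> bool" where
  "JEP_less K \<kappa> \<longleftrightarrow>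
     (\<forall>M \<in> models K. \<forall>N \<in> models K.
        LS K \<le>o |carrier M| \<and> |carrier M| <o \<kappa> \<and>
        LS K \<le>o |carrier N| \<and> |carrier N| <o \<kappa> \<longrightarrow> jointly_embeddable K M N)"

definition AP :: "'u eclass \<Rightarrow> 'u rel \<Rightarrow> bool" where
  "AP K \<kappa> \<longleftrightarrow>
     (\<forall>M0 M1 M2.
        |carrier M0| =o \<kappa> \<and> |carrier M1| =o \<kappa> \<and> |carrier M2| =o \<kappa> \<and>
        strong K M0 M1 \<and> strong K M0 M2 \<longrightarrow>
        (\<exists>M3 \<in> models K. \<exists>f g. embedding K f M1 M3 \<and> embedding K g M2 M3 \<and>
           (\<forall>x \<in> carrier M0. f x = g x)))"

definition maximal_model :: "'u eclass \<Rightarrow> 'u struct \<Rightarrow> bool" where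
  "maximal_model K M \<longleftrightarrow> M \<in> models K \<and> (\<forall>N. strong K M N \<longrightarrow> N = M)"

definition arbitrarily_large_models :: "'u eclass \<Rightarrow> bool" where
  "arbitrarily_large_models K \<longleftrightarrow>
     (\<forall>\<kappa> :: 'u rel. infinite_cardinal \<kappa> \<longrightarrow> (\<exists>M \<in> models K. \<kappa> \<le>o |carrier M| ))"

text \<open>The least upper bound, which is the maximum whenever a maximum exists.\<close>

definition is_cardinal_sup :: "'u rel \<Rightarrow> 'i set \<Rightarrow> ('i \<Rightarrow> 'u rel) \<Rightarrow> bool" where
  "is_cardinal_sup \<kappa> I \<mu> \<longleftrightarrow>
     infinite_cardinal \<kappa> \<and> (\<forall>i \<in> I. \<mu> i \<le>o \<kappa>) \<and>
     (\<forall>\<nu> :: 'u rel. infinite_cardinal \<nu> \<and> (\<forall>i \<in> I. \<mu> i \<le>o \<nu>) \<longrightarrow> \<kappa> \<le>o \<nu>)"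


section \<open>Hybrid and pure classes\<close>

definition models_in :: "'u eclass \<Rightarrow> 'u symb set \<Rightarrow> 'u struct set" where
  "models_in K \<tau>1 = {M \<in> models K. \<forall>s \<in> vocab K - \<tau>1. interp M s = {}}"

text \<open>
  Both subvocabularies have to be proper: \<open>\<tau>1 = vocab K\<close> and \<open>\<tau>2 = {}\<close> always cover all models.
\<close>

definition hybrid :: "'u eclass \<Rightarrow> bool" where
  "hybrid K \<longleftrightarrow>
     (\<exists>\<tau>1 \<tau>2. vocab K = \<tau>1 \<union> \<tau>2 \<and> \<tau>1 \<noteq> vocab K \<and> \<tau>2 \<noteq> vocab K \<and>
        models K = models_in K \<tau>1 \<union> models_in K \<tau>2)"

definition pure :: "'u eclass \<Rightarrow> bool" where
  "pure K \<longleftrightarrow> \<not> hybrid K"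


section \<open>The infinitary logic with countable conjunctions\<close>

datatype 'u trm = Var nat | App "'u symb" "'u trm list"

text \<open>
  Countable conjunctions are indexed by \<open>nat\<close>; finite ones are obtained by repetition.
\<close>

datatype 'u fm =
    Eq "'u trm" "'u trm"
  | Atom "'u symb" "'u trm list"
  | Neg "'u fm"
  | Conj "nat \<Rightarrow> 'u fm"
  | Ex nat "'u fm"

primrec val :: "'u struct \<Rightarrow> (nat \<Rightarrow> 'u) \<Rightarrow> 'u trm \<Rightarrow> 'u" where
  "val M e (Var x) = e x"
| "val M e (App f ts) = (THE y. map (val M e) ts @ [y] \<in> interp M f)"

primrec sat :: "'u struct \<Rightarrow> 'u fm \<Rightarrow> (nat \<Rightarrow> 'u) \<Rightarrow> bool" where
  "sat M (Eq s t) = (\<lambda>e. val M e s = val M e t)"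
| "sat M (Atom R ts) = (\<lambda>e. map (val M e) ts \<in> interp M R)"
| "sat M (Neg \<phi>) = (\<lambda>e. \<not> sat M \<phi> e)"
| "sat M (Conj \<Phi>) = (\<lambda>e. \<forall>n. sat M (\<Phi> n) e)"
| "sat M (Ex x \<phi>) = (\<lambda>e. \<exists>a \<in> carrier M. sat M \<phi> (e(x := a)))"

fun wf_trm :: "'u symb set \<Rightarrow> 'u trm \<Rightarrow> bool" where
  "wf_trm \<tau> (Var x) \<longleftrightarrow> True"
| "wf_trm \<tau> (App f ts) \<longleftrightarrow>
     f \<in> \<tau> \<and> (\<exists>c. f = Fun (length ts) c) \<and> (\<forall>t \<in> set ts. wf_trm \<tau> t)"

primrec wf_fm :: "'u symb set \<Rightarrow> 'u fm \<Rightarrow> bool" where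
  "wf_fm \<tau> (Eq s t) \<longleftrightarrow> wf_trm \<tau> s \<and> wf_trm \<tau> t"
| "wf_fm \<tau> (Atom R ts) \<longleftrightarrow>
     R \<in> \<tau> \<and> (\<exists>c. R = Rel (length ts) c) \<and> (\<forall>t \<in> set ts. wf_trm \<tau> t)"
| "wf_fm \<tau> (Neg \<phi>) \<longleftrightarrow> wf_fm \<tau> \<phi>"
| "wf_fm \<tau> (Conj \<Phi>) \<longleftrightarrow> (\<forall>n. wf_fm \<tau> (\<Phi> n))"
| "wf_fm \<tau> (Ex x \<phi>) \<longleftrightarrow> wf_fm \<tau> \<phi>"

fun fv_trm :: "'u trm \<Rightarrow> nat set" where
  "fv_trm (Var x) = {x}"
| "fv_trm (App f ts) = (\<Union>t \<in> set ts. fv_trm t)"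

primrec fv :: "'u fm \<Rightarrow> nat set" where
  "fv (Eq s t) = fv_trm s \<union> fv_trm t"
| "fv (Atom R ts) = (\<Union>t \<in> set ts. fv_trm t)"
| "fv (Neg \<phi>) = fv \<phi>"
| "fv (Conj \<Phi>) = (\<Union>n. fv (\<Phi> n))"
| "fv (Ex x \<phi>) = fv \<phi> - {x}"

definition sentence :: "'u symb set \<Rightarrow> 'u fm \<Rightarrow> bool" where
  "sentence \<tau> \<phi> \<longleftrightarrow> wf_fm \<tau> \<phi> \<and> fv \<phi> = {}"

definition Mod :: "'u symb set \<Rightarrow> 'u fm \<Rightarrow> 'u struct set" where
  "Mod \<tau> \<phi> = {M. is_struct \<tau> M \<and> (\<forall>e. range e \<subseteq> carrier M \<longrightarrow> sat M \<phi> e)}"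

text \<open>As usual, the sentences are those of a countable vocabulary.\<close>

definition L\<omega>1\<omega>_axiomatizable :: "'u eclass \<Rightarrow> bool" where
  "L\<omega>1\<omega>_axiomatizable K \<longleftrightarrow>
     countable (vocab K) \<and> (\<exists>\<phi>. sentence (vocab K) \<phi> \<and> models K = Mod (vocab K) \<phi>)"

end

theory Submission
  imports Defs
begin

text \<open>
  A model may carry one active token and one active lock.  An active token of type \<open>i\<close> lets every
  point be picked by one of its holders, each of which carries a model of the \<open>i\<close>-th class; as any two
  holders pick one another in one direction, the model has at most \<open>\<kappa> i\<^sup>+\<close> points, and a model of
  cardinality \<open>\<kappa> i\<close> can still be extended by a new holder.  Killing the token lifts the bound.  While a
  lock is active, a token can only be killed by a new column of the lock, whose cells have to be
  coloured by the model of the least class that the lock carries.  If that model is maximal and there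
  are more than \<open>\<kappa> bot\<close> rows, no new column can be coloured, so that a token becomes permanent and
  the model maximal.  Smaller models are glued along their locks, which exploits the joint embedding
  property of the least class, and the leftover points of the joint embedding colour a new column that
  kills the tokens.
\<close>


section \<open>Small sets\<close>

text \<open>Joint embeddings in the least class are only known between \<nu>, the Loewenheim-Skolem
  number aimed at, and \<kappa> \<open>bot\<close>. A lock whose model has fewer than \<nu> points
  must therefore not bind extensions: only \<open>heavy\<close> models make locks permanent, and
  \<open>raise_LS\<close> makes heaviness invariant under strong extension. From \<kappa>
  \<open>bot\<close> on joint embedding has to fail, whatever the least class does there. If it has
  two heavy models without a joint embedding, these are put into two locks. The flag
  \<open>loose\<close> separates these two cases. Amalgamation fails because an element has at most
  one killer, and the killer may be red or not. The many maximal models arise by coding a well-order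
  on the holders of the token, which leaves them no automorphism, and by painting an arbitrary set
  of them red.\<close>

declare Field_card_of [simp] card_of_card_order_on [simp] card_of_well_order_on [simp]

lemma Cinfinite_card_of: "infinite A \<Longrightarrow> Cinfinite |A|"
  by (simp add: cinfinite_def Field_card_of card_of_card_order_on)

lemma Cinfinite_infinite_cardinal: "infinite_cardinal \<kappa> \<Longrightarrow> Cinfinite \<kappa>"
  by (simp add: infinite_cardinal_def)

lemma Card_order_infinite_cardinal: "infinite_cardinal \<kappa> \<Longrightarrow> Card_order \<kappa>"
  by (simp add: infinite_cardinal_def)

lemma infinite_cardinal_small: "infinite_cardinal \<kappa> \<Longrightarrow> \<kappa> <o |UNIV :: 'u set|"
  for \<kappa> :: "'u rel"
  by (simp add: infinite_cardinal_def)

lemma infinite_cardinal_cong: "infinite_cardinal \<kappa> \<Longrightarrow> \<kappa>' =o \<kappa> \<Longrightarrow> infinite_cardinal \<kappa>'"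
  for \<kappa> \<kappa>' :: "'u rel"
  unfolding infinite_cardinal_def
  by (meson Cinfinite_cong ordIso_ordLess_trans ordIso_symmetric)

lemma infinite_cardinal_card_of:
  "infinite X \<Longrightarrow> small X \<Longrightarrow> infinite_cardinal |X|"
  unfolding infinite_cardinal_def small_def by (simp add: Cinfinite_card_of)

lemma subset_of_card:
  fixes r :: "'b rel"
  assumes "Card_order r" "r \<le>o |A|"
  shows "\<exists>B \<subseteq> A. |B| =o r"
proof -
  have "|Field r| \<le>o |A|"
    by (rule ordIso_ordLeq_trans[OF card_of_Field_ordIso[OF assms(1)] assms(2)])
  then obtain B where B: "B \<subseteq> A" "|Field r| =o |B|"
    using internalize_card_of_ordLeq2[of "Field r" A, THEN iffD1] by metis
  have "|B| =o r"
    by (rule ordIso_transitive[OF ordIso_symmetric[OF B(2)] card_of_Field_ordIso[OF assms(1)]])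
  with B(1) show ?thesis by blast
qed

lemma card_of_image_le: "|A| \<le>o r \<Longrightarrow> |f ` A| \<le>o r"
  by (rule ordLeq_transitive[OF card_of_image])

lemma card_of_subset_le: "A \<subseteq> B \<Longrightarrow> |B| \<le>o r \<Longrightarrow> |A| \<le>o r"
  by (rule ordLeq_transitive[OF card_of_mono1])

lemma card_of_Sigma_le:
  "Cinfinite r \<Longrightarrow> |A| \<le>o r \<Longrightarrow> (\<And>a. a \<in> A \<Longrightarrow> |B a| \<le>o r) \<Longrightarrow> |Sigma A B| \<le>o r"
  using card_of_Sigma_ordLeq_infinite_Field[of r A B] by (auto simp: cinfinite_def)

lemma card_of_UN_le:
  "Cinfinite r \<Longrightarrow> |A| \<le>o r \<Longrightarrow> (\<And>a. a \<in> A \<Longrightarrow> |B a| \<le>o r) \<Longrightarrow> |\<Union>a\<in>A. B a| \<le>o r"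
  using card_of_UNION_ordLeq_infinite_Field[of r A B] by (auto simp: cinfinite_def)

lemma card_of_finite_le: "Cinfinite r \<Longrightarrow> finite A \<Longrightarrow> |A| \<le>o r"
  by (meson Cinfinite_card_of finite_iff_ordLess_natLeq natLeq_ordLeq_cinfinite
      ordLeq_transitive ordLess_imp_ordLeq)

lemma card_of_insert_le: "Cinfinite r \<Longrightarrow> |A| \<le>o r \<Longrightarrow> |insert a A| \<le>o r"
  using Un_Cinfinite_bound[of "{a}" r A] card_of_finite_le[of r "{a}"] by simp

lemma card_of_countable_le: "Cinfinite r \<Longrightarrow> countable A \<Longrightarrow> |A| \<le>o r"
proof -
  assume r: "Cinfinite r" and "countable A"
  then obtain f :: "_ \<Rightarrow> nat" where "inj_on f A" by (auto simp: countable_def)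
  then have "|A| \<le>o |UNIV :: nat set|" using card_of_ordLeq[of A UNIV] by blast
  also have "|UNIV :: nat set| \<le>o r"
    by (rule ordIso_ordLeq_trans[OF card_of_nat natLeq_ordLeq_cinfinite[OF r]])
  finally show ?thesis .
qed

lemma inj_into_of_le:
  "|A| \<le>o |B| \<Longrightarrow> \<exists>f. inj_on f A \<and> f ` A \<subseteq> B"
  using card_of_ordLeq[of A B] by blast

lemma surj_of_le: "A \<noteq> {} \<Longrightarrow> |A| \<le>o |B| \<Longrightarrow> \<exists>f. f ` B = A"
  using card_of_ordLeq2[of A B] by blast

lemma small_subset: "A \<subseteq> B \<Longrightarrow> small B \<Longrightarrow> small A"
  unfolding small_def by (rule ordLeq_ordLess_trans[OF card_of_mono1])

lemma small_image: "small A \<Longrightarrow> small (f ` A)" for f :: "'u \<Rightarrow> 'u"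
  unfolding small_def by (rule ordLeq_ordLess_trans[OF card_of_image])

lemma le_infinite_cardinal_small: "infinite_cardinal \<kappa> \<Longrightarrow> |X| \<le>o \<kappa> \<Longrightarrow> small X"
  for X :: "'u set" and \<kappa> :: "'u rel"
  unfolding infinite_cardinal_def small_def by (metis ordLeq_ordLess_trans)

context
  assumes universe: "universe TYPE('u)"
begin

lemma infinite_UNIV_universe: "infinite (UNIV :: 'u set)"
  using universe unfolding universe_def
  by (metis finite_iff_ordLess_natLeq not_ordLess_ordLeq ordLess_imp_ordLeq)

lemma small_Un: "small A \<Longrightarrow> small B \<Longrightarrow> small (A \<union> B)" for A B :: "'u set"
  unfolding small_def by (intro card_of_Un_ordLess_infinite infinite_UNIV_universe)

lemma small_finite: "finite A \<Longrightarrow> small A" for A :: "'u set"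
  unfolding small_def
  by (rule finite_ordLess_infinite[OF card_of_Well_order card_of_Well_order])
    (simp_all add: Field_card_of infinite_UNIV_universe)

lemma small_insert: "small A \<Longrightarrow> small (insert a A)" for A :: "'u set"
  using small_Un[of "{a}" A] small_finite[of "{a}"] by simp

lemma infinite_cardinal_nat: "\<exists>\<omega> :: 'u rel. infinite_cardinal \<omega> \<and> \<omega> =o natLeq"
proof -
  have "natLeq \<le>o |UNIV :: 'u set|"
    using universe universe_def ordLess_imp_ordLeq by blast
  then obtain B :: "'u set" where B: "|B| =o natLeq"
    using subset_of_card[OF natLeq_Card_order] by blast
  then have "infinite B" using infinite_iff_natLeq_ordLeq ordIso_iff_ordLeq by blast
  moreover have "small B"
    unfolding small_def by (rule ordIso_ordLess_trans[OF B conjunct1[OF universe[unfolded universe_def]]])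
  ultimately show ?thesis using infinite_cardinal_card_of B by blast
qed

lemma cardSuc_small: "infinite_cardinal \<kappa> \<Longrightarrow> cardSuc \<kappa> <o |UNIV :: 'u set|"
  for \<kappa> :: "'u rel"
  using universe universe_def by blast

text \<open>\<open>cardSuc \<kappa>\<close> is a relation on sets of points; the set
  \<open>I\<close> brings this cardinal back to the type of the points themselves.\<close>

lemma set_of_card_cardSuc:
  fixes \<kappa> :: "'u rel"
  assumes "infinite_cardinal \<kappa>"
  shows "\<exists>I :: 'u set. |I| =o cardSuc \<kappa> \<and> infinite_cardinal |I|"
proof -
  have *: "Cinfinite (cardSuc \<kappa>)"
    using assms Cinfinite_cardSuc Cinfinite_infinite_cardinal by blast
  obtain I :: "'u set" where I: "|I| =o cardSuc \<kappa>"
    using subset_of_card[OF conjunct2[OF *] ordLess_imp_ordLeq[OF cardSuc_small[OF assms]]] by auto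
  moreover have "infinite_cardinal |I|"
    unfolding infinite_cardinal_def
    by (intro conjI[OF Cinfinite_cong[OF ordIso_symmetric[OF I] *]]
        ordIso_ordLess_trans[OF I cardSuc_small[OF assms]])
  ultimately show ?thesis by blast
qed

text \<open>Removing a small set from the infinite universe does not lower its cardinality, so the
  complement still has room for a copy of \<open>A\<close>. Disjoint copies of models, rows, columns
  and holders are all taken from here.\<close>

lemma fresh_copy:
  fixes A :: "'b set" and B :: "'u set"
  assumes "|A| <o |UNIV :: 'u set|" "small B"
  shows "\<exists>f. inj_on f A \<and> f ` A \<inter> B = {}"
proof -
  have "\<not> |UNIV - B| <o |UNIV :: 'u set|"
  proof
    assume "|UNIV - B| <o |UNIV :: 'u set|"
    then have "|(UNIV - B) \<union> B| <o |UNIV :: 'u set|"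
      using assms(2) unfolding small_def
      by (intro card_of_Un_ordLess_infinite infinite_UNIV_universe)
    then show False using ordLess_irreflexive[of "|UNIV :: 'u set|"] by simp
  qed
  then have "|UNIV :: 'u set| \<le>o |UNIV - B|"
    by (simp add: not_ordLess_iff_ordLeq)
  then have "|A| \<le>o |UNIV - B|"
    by (rule ordLess_imp_ordLeq[OF ordLess_ordLeq_trans[OF assms(1)]])
  then obtain f where "inj_on f A" "f ` A \<subseteq> UNIV - B" using inj_into_of_le by blast
  then show ?thesis by blast
qed

lemma fresh_element: "small B \<Longrightarrow> \<exists>x. x \<notin> B" for B :: "'u set"
  unfolding small_def using ordLess_irreflexive by (metis UNIV_eq_I)

end


section \<open>Structures\<close>

lemma in_tuples: "xs \<in> tuples n A \<longleftrightarrow> length xs = n \<and> set xs \<subseteq> A"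
  by (simp add: tuples_def)

lemma is_struct_interp:
  "is_struct \<tau> M \<Longrightarrow> xs \<in> interp M s \<Longrightarrow> s \<in> \<tau> \<and> set xs \<subseteq> carrier M"
  by (cases s; cases "s \<in> \<tau>") (fastforce simp: is_struct_def tuples_def)+

lemma struct_eqI:
  "carrier M = carrier N \<Longrightarrow> (\<And>s. interp M s = interp N s) \<Longrightarrow> M = N"
  for M N :: "'u struct"
  by (cases M; cases N) (auto simp: fun_eq_iff)

lemma substruct_eqI:
  assumes "is_struct \<tau> N" "substruct M N" "carrier N \<subseteq> carrier M"
  shows "M = N"
proof (rule struct_eqI)
  show "carrier M = carrier N" using assms by (auto simp: substruct_def)
  then show "interp M s = interp N s" for s
    using assms is_struct_interp[OF assms(1)] by (fastforce simp: substruct_def lists_eq_set)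
qed

lemma substruct_refl: "is_struct \<tau> M \<Longrightarrow> substruct M M"
  using is_struct_interp by (fastforce simp: substruct_def lists_eq_set)

lemma substruct_trans: "substruct M N \<Longrightarrow> substruct N P \<Longrightarrow> substruct M P"
  by (fastforce simp: substruct_def lists_eq_set)

lemma substruct_carrier: "substruct M N \<Longrightarrow> carrier M \<subseteq> carrier N"
  by (simp add: substruct_def)

definition image_struct :: "('u \<Rightarrow> 'u) \<Rightarrow> 'u struct \<Rightarrow> 'u struct" where
  "image_struct f M = \<lparr>carrier = f ` carrier M, interp = (\<lambda>s. map f ` interp M s)\<rparr>"

lemma iso_image_struct: "inj_on f (carrier M) \<Longrightarrow> iso f M (image_struct f M)"
  by (simp add: iso_def image_struct_def bij_betw_def)

lemma iso_unique: "iso f M N \<Longrightarrow> iso f M N' \<Longrightarrow> N = N'"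
  by (rule struct_eqI) (auto simp: iso_def bij_betw_def)

lemma iso_id: "iso id M M"
  by (simp add: iso_def)

lemma iso_comp: "iso f M N \<Longrightarrow> iso g N P \<Longrightarrow> iso (g \<circ> f) M P"
  unfolding iso_def by (auto intro: bij_betw_trans simp: image_comp image_iff)

lemma iso_inv:
  assumes "iso f M N" "is_struct \<tau> M"
  shows "iso (inv_into (carrier M) f) N M"
proof -
  have f: "inj_on f (carrier M)" "bij_betw f (carrier M) (carrier N)"
    using assms(1) by (auto simp: iso_def bij_betw_def)
  have "map (inv_into (carrier M) f) ` map f ` interp M s = interp M s" for s
  proof -
    have "map (inv_into (carrier M) f) (map f xs) = xs" if "xs \<in> interp M s" for xs
      using is_struct_interp[OF assms(2) that] f(1) by (auto simp: map_idI inv_into_f_f subset_iff)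
    then show ?thesis by (force simp: image_iff)
  qed
  then show ?thesis
    using assms(1) bij_betw_inv_into[OF f(2)] by (simp add: iso_def)
qed

lemma iso_card: "iso f M N \<Longrightarrow> |carrier M| =o |carrier N|"
  using card_of_ordIsoI by (auto simp: iso_def)

lemma iso_cong: "(\<And>x. x \<in> carrier M \<Longrightarrow> f x = g x) \<Longrightarrow> is_struct \<tau> M \<Longrightarrow> iso f M N \<Longrightarrow> iso g M N"
proof -
  assume fg: "\<And>x. x \<in> carrier M \<Longrightarrow> f x = g x" and M: "is_struct \<tau> M" and f: "iso f M N"
  have "map f xs = map g xs" if "xs \<in> interp M s" for xs s
    using is_struct_interp[OF M that] fg by auto
  then have "map f ` interp M s = map g ` interp M s" for s by (rule image_cong[OF refl])
  moreover have "bij_betw g (carrier M) (carrier N) = bij_betw f (carrier M) (carrier N)"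
    by (rule bij_betw_cong) (simp add: fg)
  ultimately show "iso g M N" using f by (simp add: iso_def)
qed


section \<open>Abstract elementary classes\<close>

context AEC
begin

lemma strong_carrier: "strong K M N \<Longrightarrow> carrier M \<subseteq> carrier N"
  using strong_substruct substruct_carrier by blast

lemma strong_antisym: "strong K M N \<Longrightarrow> carrier N \<subseteq> carrier M \<Longrightarrow> M = N"
  using strong_substruct substruct_eqI models_struct strong_models by blast

lemma models_small: "M \<in> models K \<Longrightarrow> small (carrier M)"
  using models_struct by (auto simp: is_struct_def)

lemma models_nonempty: "M \<in> models K \<Longrightarrow> carrier M \<noteq> {}"
  using models_struct by (auto simp: is_struct_def)

end

lemma has_LS_property_mono:
  "has_LS_property K \<kappa> \<Longrightarrow> \<kappa> \<le>o \<mu> \<Longrightarrow> has_LS_property K \<mu>"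
proof (unfold has_LS_property_def, intro ballI allI impI)
  fix N X
  assume LS: "\<forall>N\<in>models K. \<forall>X\<subseteq>carrier N. \<exists>M. strong K M N \<and> X \<subseteq> carrier M \<and> |carrier M| \<le>o |X| +c \<kappa>"
    and le: "\<kappa> \<le>o \<mu>" and N: "N \<in> models K" "X \<subseteq> carrier N"
  obtain M where M: "strong K M N" "X \<subseteq> carrier M" "|carrier M| \<le>o |X| +c \<kappa>"
    using LS N by metis
  have "|carrier M| \<le>o |X| +c \<mu>" by (rule ordLeq_transitive[OF M(3) csum_mono2[OF le]])
  with M show "\<exists>M. strong K M N \<and> X \<subseteq> carrier M \<and> |carrier M| \<le>o |X| +c \<mu>" by metis
qed

lemma has_LS_propertyD:
  assumes "has_LS_property K \<kappa>" "N \<in> models K" "X \<subseteq> carrier N" "|X| \<le>o \<mu>" "\<kappa> \<le>o \<mu>" "Cinfinite \<mu>"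
    "Card_order \<kappa>"
  shows "\<exists>M. strong K M N \<and> X \<subseteq> carrier M \<and> |carrier M| \<le>o \<mu>"
proof -
  obtain M where "strong K M N" "X \<subseteq> carrier M" "|carrier M| \<le>o |X| +c \<kappa>"
    using assms(1-3) unfolding has_LS_property_def by blast
  moreover have "|X| +c \<kappa> \<le>o \<mu>" using assms by (intro csum_cinfinite_bound) auto
  ultimately show ?thesis by (metis ordLeq_transitive)
qed

lemma is_LS_unique: "is_LS K \<kappa> \<Longrightarrow> is_LS K \<mu> \<Longrightarrow> \<kappa> =o \<mu>"
  by (simp add: is_LS_def ordIso_iff_ordLeq)

lemma (in AEC) is_LS_LS: "is_LS K (LS K)"
proof -
  let ?R = "{\<kappa>. infinite_cardinal \<kappa> \<and> has_LS_property K \<kappa>}"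
  have "?R \<noteq> {}" using LS_exists by blast
  moreover have "\<forall>r\<in>?R. Card_order r" by (simp add: Card_order_infinite_cardinal)
  ultimately obtain \<kappa> where "\<kappa> \<in> ?R" "\<forall>\<mu>\<in>?R. \<kappa> \<le>o \<mu>"
    using exists_minim_Card_order[of ?R] by blast
  then have "is_LS K \<kappa>" by (auto simp: is_LS_def)
  then show ?thesis unfolding LS_def by (rule someI)
qed

subsection \<open>Unions of chains of order type omega\<close>

text \<open>The chain axioms speak of well-orders on the type of points, so the order of the natural
  numbers is transported along an injection \<open>f\<close>. The upper bound \<open>N\<close> keeps
  the union small.\<close>

lemma (in AEC) omega_chain:
  fixes A :: "nat \<Rightarrow> 'u struct"
  assumes "infinite (UNIV :: 'u set)" "\<And>n. strong K (A n) (A (Suc n))"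
    and "\<And>n. strong K (A n) N"
  shows "strong K (union_struct UNIV A) N"
proof -
  obtain f :: "nat \<Rightarrow> 'u" where f: "inj f" using infinite_iff_countable_subset[of "UNIV :: 'u set"] assms(1) by metis
  define r where "r = dir_image natLeq f"
  define B where "B = (\<lambda>x. A (inv f x))"
  have r: "Well_order r" "Field r = range f"
    unfolding r_def using Well_order_dir_image[OF natLeq_Well_order, of f] f
    by (auto simp: Field_natLeq dir_image_Field natLeq_Refl inj_on_def)
  have A: "strong K (A m) (A n)" if "m \<le> n" for m n
    using that
  proof (induction rule: dec_induct)
    case base
    then show ?case using assms(2) strong_models strong_refl by blast
  next
    case (step n)
    then show ?case using assms(2) strong_trans by blast
  qed
  have "union_struct (Field r) B = union_struct UNIV A"
    by (auto simp: union_struct_def r(2) B_def f inv_f_f)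
  moreover have "strong K (union_struct (Field r) B) N"
  proof (rule chain_least[OF r(1)])
    show "Field r \<noteq> {}" by (simp add: r)
    show "strong K (B i) (B j)" if "(i, j) \<in> r" for i j
      using that f A by (auto simp: r_def dir_image_def natLeq_def B_def inv_f_f)
    show "strong K (B i) N" for i using assms by (simp add: B_def)
    show "small (\<Union>i \<in> Field r. carrier (B i))"
      by (rule small_subset[OF _ models_small[of N]])
        (use assms(3) strong_models strong_carrier B_def in fastforce)+
  qed
  ultimately show ?thesis by simp
qed

subsection \<open>Maximal models\<close>

text \<open>If no strong extension of \<open>M\<close> were maximal, proper extensions could be
  iterated through all stages of an order of type \<theta>^+, with unions taken on the way. Every
  stage contributes a point that the earlier ones lack, so the final union would be a strong
  extension of \<open>M\<close> with more than \<theta> points, against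
  \<open>bound\<close>.\<close>

lemma (in AEC) maximal_extension_exists:
  fixes \<theta> :: "'u rel"
  assumes "universe TYPE('u)" "infinite_cardinal \<theta>" "M \<in> models K"
    and bound: "\<And>N. strong K M N \<Longrightarrow> |carrier N| \<le>o \<theta>"
  shows "\<exists>N. strong K M N \<and> maximal_model K N"
proof (rule ccontr)
  assume no: "\<not> ?thesis"
  obtain I :: "'u set" where I: "|I| =o cardSuc \<theta>" "infinite_cardinal |I|"
    using set_of_card_cardSuc[OF assms(1,2)] by metis
  define r where "r = |I|"
  have r: "Well_order r" "Field r = I" by (simp_all add: r_def)
  have wfr: "wf (r - Id)" using r(1) by (simp add: well_order_on_def)
  define ext where "ext N = (SOME N'. strong K N N' \<and> N' \<noteq> N)" for N
  have ext: "strong K N (ext N) \<and> ext N \<noteq> N" if "strong K M N" for N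
  proof -
    have "\<exists>N'. strong K N N' \<and> N' \<noteq> N"
      using no that strong_models unfolding maximal_model_def by blast
    then show ?thesis unfolding ext_def by (rule someI_ex)
  qed
  \<comment> \<open>The starting point of stage \<open>i\<close> is the union of all earlier stages.
    The first stage needs \<open>M\<close> itself, since an empty union has an empty carrier and is
    no model.\<close>
  define H where "H F i = (if underS r i = {} then M else union_struct (underS r i) F)" for F i
  define F where "F = wfrec (r - Id) (\<lambda>F i. ext (H F i))"
  have "adm_wf (r - Id) (\<lambda>F i. ext (H F i))"
  proof (unfold adm_wf_def, intro allI impI)
    fix f g i assume "\<forall>z. (z, i) \<in> r - Id \<longrightarrow> f z = (g z :: 'u struct)"
    then have "union_struct (underS r i) f = union_struct (underS r i) g"
      by (auto simp: union_struct_def underS_def)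
    then show "ext (H f i) = ext (H g i)" by (simp add: H_def)
  qed
  then have F: "F i = ext (H F i)" for i
    unfolding F_def by (rule wfrec_fixpoint[OF wfr, THEN fun_cong])
  have small_I: "|\<Union>i\<in>J. carrier (F i)| \<le>o |I|"
    if "J \<subseteq> I" "\<And>i. i \<in> J \<Longrightarrow> strong K M (F i)" for J
  proof (rule card_of_UN_le)
    show "Cinfinite |I|" using I(2) by (rule Cinfinite_infinite_cardinal)
    show "|J| \<le>o |I|" using that(1) by (rule card_of_mono1)
    have "\<theta> \<le>o |I|"
      by (rule ordLeq_ordIso_trans[OF cardSuc_ordLeq[OF Card_order_infinite_cardinal[OF assms(2)]]
            ordIso_symmetric[OF I(1)]])
    then show "|carrier (F i)| \<le>o |I|" if "i \<in> J" for i
      by (rule ordLeq_transitive[OF bound[OF \<open>\<And>i. i \<in> J \<Longrightarrow> strong K M (F i)\<close>[OF that]]])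
  qed
  have main: "strong K M (H F i) \<and> strong K (H F i) (F i) \<and> H F i \<noteq> F i \<and>
      (\<forall>j\<in>underS r i. strong K (F j) (H F i))" for i
  proof (induction i rule: wf_induct_rule[OF wfr])
    case (1 i)
    have IH: "strong K M (F j)" "\<And>k. k \<in> underS r j \<Longrightarrow> strong K (F k) (F j)"
      if "j \<in> underS r i" for j
      using 1[of j] that strong_trans unfolding underS_def by blast+
    have "strong K M (H F i) \<and> (\<forall>j\<in>underS r i. strong K (F j) (H F i))"
    proof (cases "underS r i = {}")
      case True
      then show ?thesis using assms(3) strong_refl by (simp add: H_def)
    next
      case False
      let ?r = "Restr r (underS r i)"
      have "underS r i \<subseteq> I" using r(2) by (auto simp: underS_def Field_def)
      have "wo_rel.ofilter r (underS r i)"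
        using r(1) by (simp add: wo_rel.underS_ofilter wo_rel_def)
      then have wr: "Well_order ?r" "Field ?r = underS r i"
        using r(1) Well_order_Restr Field_Restr_ofilter by blast+
      have ch: "strong K (F j) (F k)" if "(j, k) \<in> ?r" for j k
      proof (cases "j = k")
        case True
        then show ?thesis using IH(1)[of k] that strong_models strong_refl by blast
      next
        case False
        then show ?thesis using IH(2)[of k j] that by (auto simp: underS_def)
      qed
      have sm: "small (\<Union>j\<in>Field ?r. carrier (F j))"
        using small_I[OF \<open>underS r i \<subseteq> I\<close>] IH(1) le_infinite_cardinal_small[OF I(2)]
        unfolding wr(2) by blast
      have up: "strong K (F j) (union_struct (underS r i) F)" if "j \<in> underS r i" for j
        using chain_upper[OF wr(1) _ ch sm] wr(2) that by auto
      then have "strong K M (union_struct (underS r i) F)"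
        using False IH(1) strong_trans by blast
      then show ?thesis using up False by (simp add: H_def)
    qed
    then show ?case using ext F by metis
  qed
  \<comment> \<open>A point that is new at stage \<open>i\<close>. Such points are distinct for
    distinct stages and embed \<open>I\<close> into the final union.\<close>
  define x where "x i = (SOME x. x \<in> carrier (F i) - carrier (H F i))" for i
  have x: "x i \<in> carrier (F i)" "x i \<notin> carrier (H F i)" for i
  proof -
    have "\<exists>x. x \<in> carrier (F i) - carrier (H F i)"
      using main[of i] strong_antisym by blast
    then have "x i \<in> carrier (F i) - carrier (H F i)" unfolding x_def by (rule someI_ex)
    then show "x i \<in> carrier (F i)" "x i \<notin> carrier (H F i)" by blast+
  qed
  have "inj_on x I"
  proof -
    have ne: "x i \<noteq> x j" if "i \<in> underS r j" for i j
    proof -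
      have "strong K (F i) (H F j)" using main[of j] that by blast
      then show ?thesis using strong_carrier[of "F i" "H F j"] x(1)[of i] x(2)[of j] by auto
    qed
    have "i \<in> underS r j \<or> j \<in> underS r i" if "i \<in> I" "j \<in> I" "i \<noteq> j" for i j
      using that r by (auto simp: underS_def well_order_on_def linear_order_on_def total_on_def)
    then show ?thesis using ne unfolding inj_on_def by metis
  qed
  have all: "strong K M (F i)" for i using main[of i] strong_trans by blast
  let ?U = "union_struct (Field r) F"
  have ch: "strong K (F j) (F k)" if "(j, k) \<in> r" for j k
  proof (cases "j = k")
    case True
    then show ?thesis using all strong_models strong_refl by blast
  next
    case False
    then show ?thesis using main[of k] that strong_trans by (auto simp: underS_def)
  qed
  have ne: "Field r \<noteq> {}" using I(2) r(2) by (auto simp: infinite_cardinal_def cinfinite_def)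
  have sm: "small (\<Union>j\<in>Field r. carrier (F j))"
    using small_I[of I] all le_infinite_cardinal_small[OF I(2)] unfolding r(2) by blast
  have "strong K M ?U"
    using chain_upper[OF r(1) ne ch sm] ne all strong_trans by blast
  then have "|carrier ?U| \<le>o \<theta>" by (rule bound)
  moreover have "|I| \<le>o |carrier ?U|"
    using \<open>inj_on x I\<close> x(1) by (intro card_of_ordLeqI[of x]) (auto simp: union_struct_def r(2))
  ultimately have "cardSuc \<theta> \<le>o \<theta>"
    by (rule ordIso_ordLeq_trans[OF ordIso_symmetric[OF I(1)] ordLeq_transitive[rotated]])
  then show False
    using cardSuc_greater[OF Card_order_infinite_cardinal[OF assms(2)]] not_ordLess_ordLeq by blast
qed

section \<open>Raising the Loewenheim-Skolem number\<close>

text \<open>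
  Making all models of cardinality less than \<open>\<nu>\<close> incomparable forces the Loewenheim-Skolem number
  to be at least \<open>\<nu>\<close>, without changing the class of models or the strong submodel relation above.
\<close>

definition raise_LS :: "'u rel \<Rightarrow> 'u eclass \<Rightarrow> 'u eclass" where
  "raise_LS \<nu> K = K\<lparr>strong := (\<lambda>M N. strong K M N \<and> (M = N \<or> \<nu> \<le>o |carrier M| ))\<rparr>"

lemma raise_LS_simps [simp]:
  "vocab (raise_LS \<nu> K) = vocab K"
  "models (raise_LS \<nu> K) = models K"
  "strong (raise_LS \<nu> K) M N \<longleftrightarrow> strong K M N \<and> (M = N \<or> \<nu> \<le>o |carrier M| )"
  by (simp_all add: raise_LS_def)

text \<open>A model with at most \<nu> points serves as its own submodel. Otherwise \<nu> many
  points are added to \<open>X\<close>, so that the submodel found is large enough to stay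
  strong.\<close>

lemma raise_LS_has_LS:
  assumes "AEC K" "infinite_cardinal \<nu>" "has_LS_property K \<nu>"
  shows "has_LS_property (raise_LS \<nu> K) \<nu>"
proof (unfold has_LS_property_def, intro ballI allI impI)
  fix N X assume N: "N \<in> models (raise_LS \<nu> K)" "X \<subseteq> carrier N"
  interpret AEC K by fact
  have \<nu>: "Cinfinite \<nu>" "Card_order \<nu>"
    using assms(2) Cinfinite_infinite_cardinal Card_order_infinite_cardinal by auto
  have inf: "Cinfinite ( |X| +c \<nu>)" using Cinfinite_csum \<nu>(1) by metis
  have le: "\<nu> \<le>o |X| +c \<nu>" "|X| \<le>o |X| +c \<nu>"
    by (rule ordLeq_csum2[OF \<nu>(2)]) (rule ordLeq_csum1, simp)
  show "\<exists>M. strong (raise_LS \<nu> K) M N \<and> X \<subseteq> carrier M \<and> |carrier M| \<le>o |X| +c \<nu>"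
  proof (cases "|carrier N| \<le>o \<nu>")
    case True
    then have "|carrier N| \<le>o |X| +c \<nu>" by (rule ordLeq_transitive[OF _ le(1)])
    then show ?thesis using N strong_refl by auto
  next
    case False
    then have "\<nu> \<le>o |carrier N|"
      using \<nu>(2) by (metis card_of_Well_order card_order_on_def not_ordLess_iff_ordLeq ordLess_imp_ordLeq)
    then obtain Y where Y: "Y \<subseteq> carrier N" "|Y| =o \<nu>"
      using subset_of_card[OF \<nu>(2)] by metis
    have "|Y| \<le>o |X| +c \<nu>" by (rule ordIso_ordLeq_trans[OF Y(2) le(1)])
    then have "|X \<union> Y| \<le>o |X| +c \<nu>" by (rule Un_Cinfinite_bound[OF le(2) _ inf])
    then obtain M where M: "strong K M N" "X \<union> Y \<subseteq> carrier M" "|carrier M| \<le>o |X| +c \<nu>"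
      using has_LS_propertyD[OF assms(3) _ _ _ le(1) inf \<nu>(2), of N "X \<union> Y"] N Y(1) by auto
    have "\<nu> \<le>o |carrier M|"
      by (rule ordIso_ordLeq_trans[OF ordIso_symmetric[OF Y(2)] card_of_mono1]) (use M in auto)
    then show ?thesis using M by auto
  qed
qed

text \<open>A model with fewer than \<nu> points is comparable upwards only with itself. In a chain
  such a member equals all later members and hence the union, which is why the chain axioms survive.
  In the coherence axiom, \<open>M = P\<close> squeezes \<open>N\<close> between two equal
  carriers.\<close>

lemma raise_LS_AEC:
  assumes "AEC K" "infinite_cardinal \<nu>" "has_LS_property K \<nu>"
  shows "AEC (raise_LS \<nu> K)"
proof -
  interpret AEC K by fact
  have mono: "\<nu> \<le>o |carrier M| \<Longrightarrow> strong K M N \<Longrightarrow> \<nu> \<le>o |carrier N|" for M N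
    by (metis card_of_mono1 ordLeq_transitive strong_carrier)
  show ?thesis
  proof (unfold_locales, unfold raise_LS_simps)
    show "|vocab K| <o |UNIV :: 'a set|" by (rule vocab_small)
    show "M \<in> models K \<Longrightarrow> is_struct (vocab K) M" for M by (rule models_struct)
    show "M \<in> models K \<Longrightarrow> iso f M N \<Longrightarrow> N \<in> models K" for M f N by (rule models_iso)
    show "strong K M' N' \<and> (M' = N' \<or> \<nu> \<le>o |carrier M'| )"
      if "strong K M N \<and> (M = N \<or> \<nu> \<le>o |carrier M| )" "iso f N N'" "iso f M M'" for M N f N' M'
      using that strong_iso iso_unique ordLeq_ordIso_trans[OF _ iso_card] by metis
    show "strong K M N \<and> (M = N \<or> \<nu> \<le>o |carrier M| ) \<Longrightarrow> M \<in> models K \<and> N \<in> models K" for M N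
      using strong_models by metis
    show "strong K M N \<and> (M = N \<or> \<nu> \<le>o |carrier M| ) \<Longrightarrow> substruct M N" for M N
      using strong_substruct by metis
    show "M \<in> models K \<Longrightarrow> strong K M M \<and> (M = M \<or> \<nu> \<le>o |carrier M| )" for M
      using strong_refl by simp
    show "strong K M P \<and> (M = P \<or> \<nu> \<le>o |carrier M| )"
      if "strong K M N \<and> (M = N \<or> \<nu> \<le>o |carrier M| )"
        "strong K N P \<and> (N = P \<or> \<nu> \<le>o |carrier N| )" for M N P
      using that strong_trans by metis
    show "strong K M N \<and> (M = N \<or> \<nu> \<le>o |carrier M| )"
      if "strong K M P \<and> (M = P \<or> \<nu> \<le>o |carrier M| )"
        "strong K N P \<and> (N = P \<or> \<nu> \<le>o |carrier N| )" "substruct M N" for M P N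
    proof -
      have "M = N" if "M = P"
        using that strong_antisym strong_carrier \<open>substruct M N\<close> substruct_carrier
          \<open>strong K N P \<and> _\<close> by metis
      then show ?thesis using that coherence by metis
    qed
    show "\<exists>\<kappa>. infinite_cardinal \<kappa> \<and> has_LS_property (raise_LS \<nu> K) \<kappa>"
      using raise_LS_has_LS[OF assms] assms(2) by metis
  next
    fix r :: "'a rel" and Mi
    assume r: "Well_order r" "Field r \<noteq> {}"
      and ch: "\<And>i j. (i, j) \<in> r \<Longrightarrow> strong K (Mi i) (Mi j) \<and> (Mi i = Mi j \<or> \<nu> \<le>o |carrier (Mi i)| )"
      and sm: "small (\<Union>i \<in> Field r. carrier (Mi i))"
    have ch': "\<And>i j. (i, j) \<in> r \<Longrightarrow> strong K (Mi i) (Mi j)" using ch by metis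
    show "union_struct (Field r) Mi \<in> models K" by (rule chain_models[OF r ch' sm])
    show up: "strong K (Mi i) (union_struct (Field r) Mi) \<and>
        (Mi i = union_struct (Field r) Mi \<or> \<nu> \<le>o |carrier (Mi i)| )" if i: "i \<in> Field r" for i
    proof -
      have *: "strong K (Mi i) (union_struct (Field r) Mi)"
        by (rule chain_upper[OF r ch' sm i])
      have "Mi i = union_struct (Field r) Mi" if no: "\<not> \<nu> \<le>o |carrier (Mi i)|"
      proof (rule strong_antisym[OF *])
        have "carrier (Mi j) \<subseteq> carrier (Mi i)" if j: "j \<in> Field r" for j
        proof -
          have "(i, j) \<in> r \<or> (j, i) \<in> r"
            using i j r(1) by (metis wo_rel.TOTALS wo_rel.intro)
          then show ?thesis using ch no mono strong_carrier by (metis order_refl)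
        qed
        then show "carrier (union_struct (Field r) Mi) \<subseteq> carrier (Mi i)"
          by (auto simp: union_struct_def)
      qed
      then show ?thesis using * by metis
    qed
    show "strong K (union_struct (Field r) Mi) N \<and>
        (union_struct (Field r) Mi = N \<or> \<nu> \<le>o |carrier (union_struct (Field r) Mi)| )"
      if N: "\<And>i. i \<in> Field r \<Longrightarrow> strong K (Mi i) N \<and> (Mi i = N \<or> \<nu> \<le>o |carrier (Mi i)| )" for N
    proof -
      have *: "strong K (union_struct (Field r) Mi) N"
        by (rule chain_least[OF r ch' sm]) (use N in auto)
      obtain i where i: "i \<in> Field r" using r(2) by auto
      have "Mi i = N \<Longrightarrow> union_struct (Field r) Mi = N"
        using strong_antisym[OF *] strong_carrier[of "Mi i"] up[OF i] by metis
      then show ?thesis using * N[OF i] mono up[OF i] by metis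
    qed
  qed
qed

text \<open>Applied to \<open>N\<close> and the empty set, the property for \<mu> yields a strong
  submodel with at most \<mu> points. It is \<open>N\<close> itself or has at least \<nu> points by
  definition, so in both cases \<nu> is bounded by \<mu>.\<close>

lemma raise_LS_is_LS:
  assumes "AEC K" "infinite_cardinal \<nu>" "has_LS_property K \<nu>"
    and "N \<in> models K" "\<nu> \<le>o |carrier N|"
  shows "is_LS (raise_LS \<nu> K) \<nu>"
  unfolding is_LS_def
proof (intro conjI allI impI raise_LS_has_LS assms(1-3))
  fix \<mu> :: "'a rel" assume \<mu>: "infinite_cardinal \<mu> \<and> has_LS_property (raise_LS \<nu> K) \<mu>"
  have "Card_order \<mu>" "Cinfinite \<mu>"
    using \<mu> Cinfinite_infinite_cardinal Card_order_infinite_cardinal by auto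
  then obtain M where M: "strong (raise_LS \<nu> K) M N" "|carrier M| \<le>o \<mu>"
    using has_LS_propertyD[of "raise_LS \<nu> K" \<mu> N "{}" \<mu>] \<mu> assms(4) ordLeq_refl card_of_finite_le[of \<mu> "{}"]
    by auto
  then have "\<nu> \<le>o |carrier M|" using assms(5) by auto
  then show "\<nu> \<le>o \<mu>" by (rule ordLeq_transitive[OF _ M(2)])
qed

section \<open>The class with locks and tokens\<close>

text \<open>Intended reading: \<open>STyp t\<close> marks holders of type \<open>t\<close> and
  \<open>STok i\<close> tokens of type \<open>i\<close>. \<open>SMem h a\<close> says that
  \<open>a\<close> is a point of the model carried by \<open>h\<close>, and \<open>SCode t s\<close>
  records the symbol \<open>s\<close> of that model with \<open>h\<close> put in front.
  \<open>SKill x d\<close> says that \<open>d\<close> deactivates \<open>x\<close>.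
  \<open>SBel\<close> attaches holders to a token and columns to a lock, and also codes an order
  among holders; \<open>SRow\<close> attaches rows to a lock. \<open>SPick e a p\<close> says that
  \<open>e\<close> picks \<open>p\<close> by its point \<open>a\<close>, and
  \<open>SCol x d a\<close> that the cell in row \<open>x\<close> and column \<open>d\<close> has
  colour \<open>a\<close>. \<open>SRed\<close> is a mark for telling apart elements that otherwise
  look alike.\<close>

datatype ('i, 'u) sym =
    STyp 'i | STok 'i | SLock | SRed | SMem | SBel | SRow | SKill | SPick | SCol | SCode 'i "'u symb"

fun symb_length :: "'u symb \<Rightarrow> nat" where
  "symb_length (Rel n _) = n"
| "symb_length (Fun n _) = Suc n"

text \<open>The additional place of \<open>SCode\<close> is for the holder. As
  \<open>symb_length\<close> already counts the place of the value, the graph of a function symbol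
  is coded by a relation symbol like everything else.\<close>

fun sym_arity :: "('i, 'u) sym \<Rightarrow> nat" where
  "sym_arity (STyp _) = 1"
| "sym_arity (STok _) = 1"
| "sym_arity SLock = 1"
| "sym_arity SRed = 1"
| "sym_arity SMem = 2"
| "sym_arity SBel = 2"
| "sym_arity SRow = 2"
| "sym_arity SKill = 2"
| "sym_arity SPick = 3"
| "sym_arity SCol = 3"
| "sym_arity (SCode _ s) = Suc (symb_length s)"

definition restrict_struct :: "'u set \<Rightarrow> 'u struct \<Rightarrow> 'u struct" where
  "restrict_struct Z N = \<lparr>carrier = Z, interp = (\<lambda>s. interp N s \<inter> lists Z)\<rparr>"

lemma substruct_restrict: "Z \<subseteq> carrier N \<Longrightarrow> substruct (restrict_struct Z N) N"
  by (simp add: substruct_def restrict_struct_def)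

lemma substruct_restrict_eq: "substruct M N \<Longrightarrow> M = restrict_struct (carrier M) N"
  by (rule struct_eqI) (auto simp: substruct_def restrict_struct_def)

lemma substruct_common: "substruct A P \<Longrightarrow> substruct B P \<Longrightarrow> carrier A \<subseteq> carrier B \<Longrightarrow> substruct A B"
  by (fastforce simp: substruct_def lists_eq_set)

lemma substruct_common_eq: "substruct A P \<Longrightarrow> substruct B P \<Longrightarrow> carrier A = carrier B \<Longrightarrow> A = B"
  using substruct_restrict_eq by metis

text \<open>\<open>b\<close> is the index of the class whose models colour the locks.
  \<open>heavy\<close> and \<open>loose\<close> are kept abstract here: that the construction is an
  AEC with the property for \<nu> only depends on the invariance of \<open>heavy\<close> under
  strong extension and isomorphism, and \<open>loose\<close> is a switch in the colouring condition.
  \<open>name\<close> turns the abstract symbols into symbols named by points.\<close>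

locale lock_construction =
  fixes I :: "'i set" and b :: 'i and K :: "'i \<Rightarrow> 'u eclass" and \<nu> :: "'u rel"
    and heavy :: "'u struct \<Rightarrow> bool" and loose :: bool and name :: "('i, 'u) sym \<Rightarrow> 'u"
  fixes symbols :: "('i, 'u) sym set"
  defines "symbols \<equiv> STyp ` I \<union> STok ` I \<union> {SLock, SRed, SMem, SBel, SRow, SKill, SPick, SCol} \<union>
      {SCode t s | t s. t \<in> I \<and> s \<in> vocab (K t)}"
  assumes universe: "universe TYPE('u)"
    and aec: "i \<in> I \<Longrightarrow> AEC (K i)"
    and \<nu>: "infinite_cardinal \<nu>"
    and LS: "i \<in> I \<Longrightarrow> has_LS_property (K i) \<nu>"
    and b: "b \<in> I"
    and name_inj: "inj_on name symbols"
    and symbols_small: "|symbols| <o |UNIV :: 'u set|"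
    and heavy_strong: "strong (K b) A B \<Longrightarrow> heavy A \<longleftrightarrow> heavy B"
    and heavy_iso: "iso f A B \<Longrightarrow> heavy A \<longleftrightarrow> heavy B"
begin

definition code :: "('i, 'u) sym \<Rightarrow> 'u symb" where
  "code y = Rel (sym_arity y) (name y)"

definition voc :: "'u symb set" where
  "voc = code ` symbols"

definition rel :: "'u struct \<Rightarrow> ('i, 'u) sym \<Rightarrow> 'u list set" where
  "rel M y = (if y \<in> symbols then interp M (code y) else {})"

abbreviation "Typ M t h \<equiv> [h] \<in> rel M (STyp t)"
abbreviation "Tok M i c \<equiv> [c] \<in> rel M (STok i)"
abbreviation "Lock M l \<equiv> [l] \<in> rel M SLock"
abbreviation "Red M x \<equiv> [x] \<in> rel M SRed"
abbreviation "Mem M h a \<equiv> [h, a] \<in> rel M SMem"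
abbreviation "Bel M x y \<equiv> [x, y] \<in> rel M SBel"
abbreviation "Row M x l \<equiv> [x, l] \<in> rel M SRow"
abbreviation "Kill M x d \<equiv> [x, d] \<in> rel M SKill"
abbreviation "Pick M e a p \<equiv> [e, a, p] \<in> rel M SPick"
abbreviation "Col M x d a \<equiv> [x, d, a] \<in> rel M SCol"

definition part :: "'u struct \<Rightarrow> 'i \<Rightarrow> 'u \<Rightarrow> 'u struct" where
  "part M t h = \<lparr>carrier = {a. Mem M h a},
     interp = (\<lambda>s. {xs \<in> lists {a. Mem M h a}. h # xs \<in> rel M (SCode t s)})\<rparr>"

text \<open>Elements that are members of themselves are exempt; this makes the class pure.\<close>

definition holder :: "'u struct \<Rightarrow> 'i \<Rightarrow> 'u \<Rightarrow> bool" where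
  "holder M t h \<longleftrightarrow> Typ M t h \<and> \<not> Mem M h h"

definition dead :: "'u struct \<Rightarrow> 'u \<Rightarrow> bool" where
  "dead M x \<longleftrightarrow> (\<exists>d. Kill M x d)"

definition token :: "'u struct \<Rightarrow> 'i \<Rightarrow> 'u \<Rightarrow> bool" where
  "token M i c \<longleftrightarrow> Tok M i c \<and> \<not> dead M c"

definition lock :: "'u struct \<Rightarrow> 'u \<Rightarrow> bool" where
  "lock M l \<longleftrightarrow> Lock M l \<and> \<not> dead M l"

text \<open>
  An active token of type \<open>i\<close> bounds the model: its holders pick every point by an
  element of their parts, and any two of its holders pick one another in one direction.
\<close>

definition token_ok :: "'u struct \<Rightarrow> 'i \<Rightarrow> 'u \<Rightarrow> bool" where
  "token_ok M i c \<longleftrightarrow>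
     (\<forall>e. Bel M e c \<longrightarrow> holder M i e) \<and>
     (\<forall>e a p p'. Bel M e c \<longrightarrow> Mem M e a \<longrightarrow> Pick M e a p \<longrightarrow> Pick M e a p' \<longrightarrow> p = p') \<and>
     (\<forall>p \<in> carrier M. \<exists>e a. Bel M e c \<and> Mem M e a \<and> Pick M e a p) \<and>
     (\<forall>e f. Bel M e c \<longrightarrow> Bel M f c \<longrightarrow>
        (\<exists>a. Mem M e a \<and> Pick M e a f) \<or> (\<exists>a. Mem M f a \<and> Pick M f a e))"

text \<open>These are the only tuples that an active lock tolerates among itself and its points: the
  ones that record its model. If two models overlap in such a set, they agree on the overlap as soon
  as the recorded models do, which is what makes gluing possible.\<close>

definition lock_tuple :: "'u struct \<Rightarrow> 'u \<Rightarrow> ('i, 'u) sym \<Rightarrow> 'u list \<Rightarrow> bool" where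
  "lock_tuple M l y xs \<longleftrightarrow>
     (y = SLock \<or> y = STyp b) \<and> xs = [l] \<or> (\<exists>a. y = SMem \<and> xs = [l, a] \<and> Mem M l a) \<or>
     (\<exists>s zs. y = SCode b s \<and> xs = l # zs \<and> set zs \<subseteq> {a. Mem M l a})"

text \<open>
  The rows and columns of an active lock are coloured by its part, without monochromatic
  rectangles, where rectangles with a single row are included unless \<open>loose\<close> holds.
\<close>

definition lock_ok :: "'u struct \<Rightarrow> 'u \<Rightarrow> bool" where
  "lock_ok M l \<longleftrightarrow>
     holder M b l \<and>
     (\<forall>x d. Row M x l \<longrightarrow> Bel M d l \<longrightarrow> (\<exists>a. Mem M l a \<and> Col M x d a)) \<and>
     (\<forall>x x' d d' a. Row M x l \<longrightarrow> Row M x' l \<longrightarrow> Bel M d l \<longrightarrow> Bel M d' l \<longrightarrow> Mem M l a \<longrightarrow>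
        Col M x d a \<longrightarrow> Col M x d' a \<longrightarrow> Col M x' d a \<longrightarrow> Col M x' d' a \<longrightarrow>
        d = d' \<or> loose \<and> x = x') \<and>
     (\<forall>a d. Mem M l a \<longrightarrow> \<not> Kill M a d) \<and>
     (\<forall>y xs. xs \<in> rel M y \<longrightarrow> set xs \<subseteq> insert l {a. Mem M l a} \<longrightarrow> lock_tuple M l y xs)"

text \<open>Each clause concerns a single part or finitely many elements at a time, with finitely
  many witnesses; this is why it passes to unions of chains and to sets closed under witnesses. Dead
  tokens and dead locks are under no condition of their own, so a kill releases an extension from a
  condition. The uniqueness of killers is also what destroys amalgamation.\<close>

definition ok :: "'u struct \<Rightarrow> bool" where
  "ok M \<longleftrightarrow> is_struct voc M \<and>
     (\<forall>t h. holder M t h \<longrightarrow> part M t h \<in> models (K t)) \<and>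
     (\<forall>t t' h. holder M t h \<longrightarrow> holder M t' h \<longrightarrow> t = t') \<and>
     (\<forall>x d d'. Kill M x d \<longrightarrow> Kill M x d' \<longrightarrow> d = d') \<and>
     (\<forall>i c j c'. token M i c \<longrightarrow> token M j c' \<longrightarrow> i = j \<and> c = c') \<and>
     (\<forall>l l'. lock M l \<longrightarrow> lock M l' \<longrightarrow> l = l') \<and>
     (\<forall>i c. token M i c \<longrightarrow> token_ok M i c) \<and>
     (\<forall>l. lock M l \<longrightarrow> lock_ok M l)"

text \<open>
  While a heavy lock is active, it stays active, and active tokens are killed by its columns only.
\<close>

definition ext :: "'u struct \<Rightarrow> 'u struct \<Rightarrow> bool" where
  "ext M N \<longleftrightarrow> ok M \<and> ok N \<and> substruct M N \<and>
     (\<forall>t h. holder M t h \<longrightarrow> strong (K t) (part M t h) (part N t h)) \<and>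
     (\<forall>l. lock M l \<longrightarrow> heavy (part M b l) \<longrightarrow>
        lock N l \<and> (\<forall>i c d. token M i c \<longrightarrow> Kill N c d \<longrightarrow> Bel N d l))"

definition L :: "'u eclass" where
  "L = \<lparr>vocab = voc, models = {M. ok M}, strong = ext\<rparr>"

lemma L_simps [simp]: "vocab L = voc" "models L = {M. ok M}" "strong L = ext"
  by (simp_all add: L_def)

lemma voc_small: "|voc| <o |UNIV :: 'u set|"
  unfolding voc_def by (rule ordLeq_ordLess_trans[OF card_of_image symbols_small])

lemma code_inj: "y \<in> symbols \<Longrightarrow> y' \<in> symbols \<Longrightarrow> code y = code y' \<longleftrightarrow> y = y'"
  using name_inj by (auto simp: code_def inj_on_def)

lemma is_struct_voc:
  "is_struct voc M \<longleftrightarrow> carrier M \<noteq> {} \<and> small (carrier M) \<and>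
     (\<forall>y. rel M y \<subseteq> tuples (sym_arity y) (carrier M)) \<and> (\<forall>s. s \<notin> voc \<longrightarrow> interp M s = {})"
  by (auto simp: is_struct_def voc_def rel_def code_def)

lemma rel_tuple:
  assumes "is_struct voc M" "xs \<in> rel M y"
  shows "length xs = sym_arity y" "set xs \<subseteq> carrier M" "y \<in> symbols"
  using assms unfolding is_struct_voc by (auto simp: rel_def tuples_def split: if_splits)

lemma rel_carrier:
  assumes "is_struct voc M"
  shows "[x] \<in> rel M y \<Longrightarrow> x \<in> carrier M"
    and "[x, x'] \<in> rel M y \<Longrightarrow> x \<in> carrier M \<and> x' \<in> carrier M"
    and "[x, x', x''] \<in> rel M y \<Longrightarrow> x \<in> carrier M \<and> x' \<in> carrier M \<and> x'' \<in> carrier M"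
  using rel_tuple(2)[OF assms] by fastforce+

lemma struct_rel_eqI:
  assumes "is_struct voc M" "is_struct voc N" "carrier M = carrier N" "\<And>y. rel M y = rel N y"
  shows "M = N"
proof (rule struct_eqI)
  show "interp M s = interp N s" for s
  proof (cases "s \<in> voc")
    case True
    then obtain y where "y \<in> symbols" "s = code y" by (auto simp: voc_def)
    then show ?thesis using assms(4)[of y] by (simp add: rel_def)
  next
    case False
    then show ?thesis using assms(1,2) by (simp add: is_struct_def)
  qed
qed fact

text \<open>As \<open>code\<close> is injective on \<open>symbols\<close>, the union has at most one
  member; for a symbol outside the vocabulary it is empty, as required of a structure.\<close>

definition mk_struct :: "'u set \<Rightarrow> (('i, 'u) sym \<Rightarrow> 'u list set) \<Rightarrow> 'u struct" where
  "mk_struct C R = \<lparr>carrier = C, interp = (\<lambda>s. \<Union>y \<in> {y \<in> symbols. code y = s}. R y)\<rparr>"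

lemma carrier_mk [simp]: "carrier (mk_struct C R) = C"
  by (simp add: mk_struct_def)

lemma rel_mk: "rel (mk_struct C R) y = (if y \<in> symbols then R y else {})"
proof (cases "y \<in> symbols")
  case True
  then have "{y' \<in> symbols. code y' = code y} = {y}" using code_inj by auto
  then show ?thesis using True by (simp add: rel_def mk_struct_def)
qed (simp add: rel_def)

lemma is_struct_mk:
  "C \<noteq> {} \<Longrightarrow> small C \<Longrightarrow> (\<And>y. y \<in> symbols \<Longrightarrow> R y \<subseteq> tuples (sym_arity y) C) \<Longrightarrow>
     is_struct voc (mk_struct C R)"
  unfolding is_struct_voc rel_mk by (auto simp: mk_struct_def voc_def)

lemma substruct_rel:
  "substruct M N \<Longrightarrow> set xs \<subseteq> carrier M \<Longrightarrow> xs \<in> rel M y \<longleftrightarrow> xs \<in> rel N y"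
  by (auto simp: substruct_def rel_def lists_eq_set)

lemma substruct_relI:
  assumes "is_struct voc M" "is_struct voc N" "carrier M \<subseteq> carrier N"
    and "\<And>y xs. set xs \<subseteq> carrier M \<Longrightarrow> xs \<in> rel M y \<longleftrightarrow> xs \<in> rel N y"
  shows "substruct M N"
  unfolding substruct_def
proof (intro conjI allI assms(3))
  show "interp M s = interp N s \<inter> lists (carrier M)" for s
  proof (cases "s \<in> voc")
    case True
    then obtain y where y: "y \<in> symbols" "s = code y" by (auto simp: voc_def)
    then have "interp M s = rel M y" "interp N s = rel N y" by (simp_all add: rel_def)
    then show ?thesis
      using assms(4) rel_tuple(2)[OF assms(1), of _ y] unfolding lists_eq_set by blast
  next
    case False
    then show ?thesis using assms(1,2) by (simp add: is_struct_def)
  qed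
qed

lemma okD:
  assumes "ok M"
  shows "is_struct voc M"
    and "\<And>t h. holder M t h \<Longrightarrow> part M t h \<in> models (K t)"
    and "\<And>t t' h. holder M t h \<Longrightarrow> holder M t' h \<Longrightarrow> t = t'"
    and "\<And>x d d'. Kill M x d \<Longrightarrow> Kill M x d' \<Longrightarrow> d = d'"
    and "\<And>i c j c'. token M i c \<Longrightarrow> token M j c' \<Longrightarrow> i = j \<and> c = c'"
    and "\<And>l l'. lock M l \<Longrightarrow> lock M l' \<Longrightarrow> l = l'"
    and "\<And>i c. token M i c \<Longrightarrow> token_ok M i c"
    and "\<And>l. lock M l \<Longrightarrow> lock_ok M l"
  using assms unfolding ok_def by blast+

lemma holder_type: "holder M t h \<Longrightarrow> t \<in> I"
  by (auto simp: holder_def rel_def symbols_def split: if_splits)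

lemma token_type: "token M t h \<Longrightarrow> t \<in> I"
  by (auto simp: token_def rel_def symbols_def split: if_splits)

lemma holder_carrier: "is_struct voc M \<Longrightarrow> holder M t h \<Longrightarrow> h \<in> carrier M"
  using rel_carrier(1) by (auto simp: holder_def)

lemma token_carrier: "is_struct voc M \<Longrightarrow> token M t h \<Longrightarrow> h \<in> carrier M"
  using rel_carrier(1) by (auto simp: token_def)

lemma lock_carrier: "is_struct voc M \<Longrightarrow> lock M h \<Longrightarrow> h \<in> carrier M"
  using rel_carrier(1) by (auto simp: lock_def)

lemma carrier_part: "carrier (part M t h) = {a. Mem M h a}"
  by (simp add: part_def)

lemma carrier_part_subset: "is_struct voc M \<Longrightarrow> carrier (part M t h) \<subseteq> carrier M"
  using rel_carrier(2) by (auto simp: part_def)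

subsection \<open>Submodels\<close>

lemma substruct_holder: "substruct M N \<Longrightarrow> h \<in> carrier M \<Longrightarrow> holder M t h \<longleftrightarrow> holder N t h"
  by (simp add: holder_def substruct_rel)

text \<open>Being killed is witnessed by a tuple and persists upwards. Hence activity of locks and
  tokens is inherited downwards by every substructure that contains the element, but it may be lost
  in an extension.\<close>

lemma substruct_dead: "is_struct voc M \<Longrightarrow> substruct M N \<Longrightarrow> dead M x \<Longrightarrow> dead N x"
  unfolding dead_def using substruct_rel rel_tuple(2) by metis

lemma substruct_lock:
  "is_struct voc M \<Longrightarrow> substruct M N \<Longrightarrow> lock N l \<Longrightarrow> l \<in> carrier M \<Longrightarrow> lock M l"
  using substruct_dead by (auto simp: lock_def substruct_rel)

lemma substruct_token:
  "is_struct voc M \<Longrightarrow> substruct M N \<Longrightarrow> token N i c \<Longrightarrow> c \<in> carrier M \<Longrightarrow> token M i c"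
  using substruct_dead by (auto simp: token_def substruct_rel)

lemma substruct_part:
  assumes "is_struct voc M" "substruct M N" "h \<in> carrier M"
  shows "substruct (part M t h) (part N t h)"
proof -
  have C: "{a. Mem M h a} = {a \<in> carrier M. Mem N h a}"
  proof -
    have "Mem M h a \<longleftrightarrow> Mem N h a" if "a \<in> carrier M" for a
      using substruct_rel[OF assms(2), of "[h, a]"] that assms(3) by simp
    then show ?thesis using rel_carrier(2)[OF assms(1)] by blast
  qed
  have "h # xs \<in> rel M y \<longleftrightarrow> h # xs \<in> rel N y" if "set xs \<subseteq> carrier M" for xs y
    using substruct_rel[OF assms(2), of "h # xs"] that assms(3) by simp
  then show ?thesis unfolding substruct_def part_def C by (auto simp: lists_eq_set)
qed

subsection \<open>Isomorphic copies\<close>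

lemma iso_rel: "iso f M N \<Longrightarrow> rel N y = map f ` rel M y"
  by (simp add: iso_def rel_def)

lemma iso_rel_iff:
  assumes "is_struct voc M" "iso f M N" "set xs \<subseteq> carrier M"
  shows "map f xs \<in> rel N y \<longleftrightarrow> xs \<in> rel M y"
proof
  assume "map f xs \<in> rel N y"
  then obtain ys where ys: "ys \<in> rel M y" "map f xs = map f ys"
    using iso_rel[OF assms(2)] by auto
  have "inj_on f (carrier M)" using assms(2) by (simp add: iso_def bij_betw_def)
  then have "xs = ys" using ys(2) rel_tuple(2)[OF assms(1) ys(1)] assms(3)
    by (metis inj_on_map_eq_map inj_on_subset le_sup_iff)
  then show "xs \<in> rel M y" using ys by simp
next
  show "xs \<in> rel M y \<Longrightarrow> map f xs \<in> rel N y" using iso_rel[OF assms(2)] by auto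
qed

lemma iso_is_struct: "is_struct voc M \<Longrightarrow> iso f M N \<Longrightarrow> is_struct voc N"
  unfolding is_struct_voc
proof (intro conjI)
  assume M: "carrier M \<noteq> {} \<and> small (carrier M) \<and>
    (\<forall>y. rel M y \<subseteq> tuples (sym_arity y) (carrier M)) \<and> (\<forall>s. s \<notin> voc \<longrightarrow> interp M s = {})"
    and f: "iso f M N"
  have C: "carrier N = f ` carrier M" using f by (simp add: iso_def bij_betw_def)
  show "carrier N \<noteq> {}" "small (carrier N)" using M small_image unfolding C by auto
  show "\<forall>y. rel N y \<subseteq> tuples (sym_arity y) (carrier N)"
    using M unfolding iso_rel[OF f] C by (fastforce simp: tuples_def)
  show "\<forall>s. s \<notin> voc \<longrightarrow> interp N s = {}" using M f by (simp add: iso_def)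
qed

lemma iso_rel_subset_iff:
  assumes "is_struct voc M" "iso f M N"
  shows "[x'] \<in> rel N y \<longleftrightarrow> (\<exists>x. x' = f x \<and> [x] \<in> rel M y)"
    and "[x', z'] \<in> rel N y \<longleftrightarrow> (\<exists>x z. x' = f x \<and> z' = f z \<and> [x, z] \<in> rel M y)"
    and "[x', z', w'] \<in> rel N y \<longleftrightarrow> (\<exists>x z w. x' = f x \<and> z' = f z \<and> w' = f w \<and> [x, z, w] \<in> rel M y)"
  unfolding iso_rel[OF assms(2)] by (auto simp: image_iff Cons_eq_map_conv) metis+

context
  fixes f M N
  assumes M: "is_struct voc M" and f: "iso f M N"
begin

lemma iso_carrier: "carrier N = f ` carrier M"
  using f by (simp add: iso_def bij_betw_def)

lemma iso_inj: "x \<in> carrier M \<Longrightarrow> x' \<in> carrier M \<Longrightarrow> f x = f x' \<longleftrightarrow> x = x'"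
  using f by (auto simp: iso_def bij_betw_def inj_on_def)

lemma iso_rel123:
  "x \<in> carrier M \<Longrightarrow> [f x] \<in> rel N y \<longleftrightarrow> [x] \<in> rel M y"
  "x \<in> carrier M \<Longrightarrow> z \<in> carrier M \<Longrightarrow> [f x, f z] \<in> rel N y \<longleftrightarrow> [x, z] \<in> rel M y"
  "x \<in> carrier M \<Longrightarrow> z \<in> carrier M \<Longrightarrow> w \<in> carrier M \<Longrightarrow>
     [f x, f z, f w] \<in> rel N y \<longleftrightarrow> [x, z, w] \<in> rel M y"
  using iso_rel_iff[OF M f, of "[x]" y] iso_rel_iff[OF M f, of "[x, z]" y]
    iso_rel_iff[OF M f, of "[x, z, w]" y] by simp_all

lemma iso_rel_pair:
  assumes "x \<in> carrier M"
  shows "[f x, z'] \<in> rel N y \<longleftrightarrow> (\<exists>z. z' = f z \<and> z \<in> carrier M \<and> [x, z] \<in> rel M y)"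
    and "[z', f x] \<in> rel N y \<longleftrightarrow> (\<exists>z. z' = f z \<and> z \<in> carrier M \<and> [z, x] \<in> rel M y)"
proof -
  show "[f x, z'] \<in> rel N y \<longleftrightarrow> (\<exists>z. z' = f z \<and> z \<in> carrier M \<and> [x, z] \<in> rel M y)"
  proof
    assume "[f x, z'] \<in> rel N y"
    then obtain x0 z where "f x = f x0" "z' = f z" "[x0, z] \<in> rel M y"
      using iso_rel_subset_iff(2)[OF M f] by auto
    moreover from this have "x0 = x" "z \<in> carrier M"
      using iso_inj[OF _ assms, of x0] rel_carrier(2)[OF M, of x0 z y] by auto
    ultimately show "\<exists>z. z' = f z \<and> z \<in> carrier M \<and> [x, z] \<in> rel M y" by blast
  qed (use iso_rel_subset_iff(2)[OF M f] in auto)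
  show "[z', f x] \<in> rel N y \<longleftrightarrow> (\<exists>z. z' = f z \<and> z \<in> carrier M \<and> [z, x] \<in> rel M y)"
  proof
    assume "[z', f x] \<in> rel N y"
    then obtain x0 z where "f x = f x0" "z' = f z" "[z, x0] \<in> rel M y"
      using iso_rel_subset_iff(2)[OF M f] by auto
    moreover from this have "x0 = x" "z \<in> carrier M"
      using iso_inj[OF _ assms, of x0] rel_carrier(2)[OF M, of z x0 y] by auto
    ultimately show "\<exists>z. z' = f z \<and> z \<in> carrier M \<and> [z, x] \<in> rel M y" by blast
  qed (use iso_rel_subset_iff(2)[OF M f] in auto)
qed

lemma iso_holder: "x \<in> carrier M \<Longrightarrow> holder N t (f x) \<longleftrightarrow> holder M t x"
  by (simp add: holder_def iso_rel123)

lemma iso_dead: "x \<in> carrier M \<Longrightarrow> dead N (f x) \<longleftrightarrow> dead M x"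
  unfolding dead_def using iso_rel_pair(1) rel_carrier(2)[OF M] by metis

lemma iso_token: "x \<in> carrier M \<Longrightarrow> token N i (f x) \<longleftrightarrow> token M i x"
  by (simp add: token_def iso_rel123 iso_dead)

lemma iso_lock: "x \<in> carrier M \<Longrightarrow> lock N (f x) \<longleftrightarrow> lock M x"
  by (simp add: lock_def iso_rel123 iso_dead)

lemma iso_part:
  assumes h: "h \<in> carrier M"
  shows "iso f (part M t h) (part N t (f h))"
proof -
  have C: "{a. Mem N (f h) a} = f ` {a. Mem M h a}"
    using iso_rel_pair(1)[OF h] rel_carrier(2)[OF M] by auto
  have sub: "{a. Mem M h a} \<subseteq> carrier M" using rel_carrier(2)[OF M] by auto
  have "inj_on f {a. Mem M h a}"
    using sub f by (auto simp: iso_def bij_betw_def intro: inj_on_subset)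
  moreover have "{ys \<in> lists (f ` {a. Mem M h a}). f h # ys \<in> rel N y} =
      map f ` {xs \<in> lists {a. Mem M h a}. h # xs \<in> rel M y}" for y
  proof -
    have 1: "lists (f ` {a. Mem M h a}) = map f ` lists {a. Mem M h a}" by (simp add: lists_image)
    have "f h # map f xs \<in> rel N y \<longleftrightarrow> h # xs \<in> rel M y"
      if "xs \<in> lists {a. Mem M h a}" for xs
      using iso_rel_iff[OF M f, of "h # xs" y] that sub h by (auto simp: lists_eq_set)
    then show ?thesis unfolding 1 by blast
  qed
  ultimately show ?thesis by (simp add: iso_def part_def C bij_betw_def)
qed

lemma iso_token_ok:
  assumes c: "c \<in> carrier M" and "token_ok M i c"
  shows "token_ok N i (f c)"
proof -
  note R = iso_rel_subset_iff[OF M f] iso_carrier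
  have C: "Bel M e c \<Longrightarrow> e \<in> carrier M" "Mem M e a \<Longrightarrow> e \<in> carrier M \<and> a \<in> carrier M"
    "Pick M e a p \<Longrightarrow> e \<in> carrier M \<and> a \<in> carrier M \<and> p \<in> carrier M" for e a p
    using rel_carrier[OF M] by blast+
  have B: "Bel N e' (f c) \<longleftrightarrow> (\<exists>e. e' = f e \<and> Bel M e c)" for e'
    using iso_rel_pair(2)[OF c] C(1) by auto
  have MP: "e \<in> carrier M \<Longrightarrow> Mem N (f e) a' \<and> Pick N (f e) a' p' \<longleftrightarrow>
      (\<exists>a p. a' = f a \<and> p' = f p \<and> Mem M e a \<and> Pick M e a p)" for e a' p'
  proof
    assume e: "e \<in> carrier M" and *: "Mem N (f e) a' \<and> Pick N (f e) a' p'"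
    then obtain a where a: "a' = f a" "Mem M e a" using iso_rel_pair(1)[OF e, of a' SMem] by blast
    obtain e0 a0 p where 0: "f e = f e0" "a' = f a0" "p' = f p" "Pick M e0 a0 p"
      using * R(3)[of "f e" a' p'] by blast
    have "e0 = e" "a0 = a"
      using C(3)[OF 0(4)] C(2)[OF a(2)] e 0(1,2) a(1) iso_inj[of e0 e] iso_inj[of a0 a] by auto
    then show "\<exists>a p. a' = f a \<and> p' = f p \<and> Mem M e a \<and> Pick M e a p" using a 0 by blast
  next
    assume "\<exists>a p. a' = f a \<and> p' = f p \<and> Mem M e a \<and> Pick M e a p"
    then obtain a p where "a' = f a" "p' = f p" "Mem M e a" "Pick M e a p" by blast
    then show "Mem N (f e) a' \<and> Pick N (f e) a' p'"
      using R(2)[of "f e" a' SMem] R(3)[of "f e" a' p' SPick] by blast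
  qed
  show ?thesis
    unfolding token_ok_def
  proof (intro conjI allI impI ballI)
    show "holder N i e" if H: "Bel N e (f c)" for e
    proof -
      obtain e0 where e0: "e = f e0" "Bel M e0 c" using H B[of e] by blast
      then have "holder M i e0" using assms(2) unfolding token_ok_def by blast
      then show ?thesis using iso_holder[OF C(1)[OF e0(2)]] e0(1) by simp
    qed
    show "p = p'" if H: "Bel N e (f c)" "Mem N e a" "Pick N e a p" "Pick N e a p'" for e a p p'
    proof -
      obtain e0 where e0: "e = f e0" "Bel M e0 c" using H(1) B[of e] by blast
      obtain a0 p0 where 1: "a = f a0" "p = f p0" "Mem M e0 a0" "Pick M e0 a0 p0"
        using MP[OF C(1)[OF e0(2)], of a p] e0(1) H by blast
      obtain a1 p1 where 2: "a = f a1" "p' = f p1" "Mem M e0 a1" "Pick M e0 a1 p1"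
        using MP[OF C(1)[OF e0(2)], of a p'] e0(1) H by blast
      have "a0 = a1" using 1(1) 2(1) C(2)[OF 1(3)] C(2)[OF 2(3)] iso_inj[of a0 a1] by simp
      then have "p0 = p1" using 1 2 e0 assms(2) unfolding token_ok_def by blast
      then show ?thesis using 1 2 by simp
    qed
    show "\<exists>e a. Bel N e (f c) \<and> Mem N e a \<and> Pick N e a p" if H: "p \<in> carrier N" for p
    proof -
      obtain p0 where p0: "p = f p0" "p0 \<in> carrier M" using H iso_carrier by blast
      then obtain e a where e: "Bel M e c" "Mem M e a" "Pick M e a p0"
        using assms(2) unfolding token_ok_def by blast
      then have "Bel N (f e) (f c)" "Mem N (f e) (f a)" "Pick N (f e) (f a) p"
        unfolding R(2,3) p0(1) by blast+
      then show ?thesis by blast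
    qed
    show "(\<exists>a. Mem N e a \<and> Pick N e a g) \<or> (\<exists>a. Mem N g a \<and> Pick N g a e)"
      if H: "Bel N e (f c)" "Bel N g (f c)" for e g
    proof -
      obtain e0 g0 where 0: "e = f e0" "Bel M e0 c" "g = f g0" "Bel M g0 c"
        using H B[of e] B[of g] by blast
      then have "(\<exists>a. Mem M e0 a \<and> Pick M e0 a g0) \<or> (\<exists>a. Mem M g0 a \<and> Pick M g0 a e0)"
        using assms(2) unfolding token_ok_def by blast
      then show ?thesis unfolding R(2,3) 0 by blast
    qed
  qed
qed

lemma iso_lock_ok:
  assumes l: "l \<in> carrier M" and ok: "lock_ok M l"
  shows "lock_ok N (f l)"
proof -
  note R = iso_rel_subset_iff[OF M f] iso_carrier
  have B: "[x', f l] \<in> rel N y \<longleftrightarrow> (\<exists>x. x' = f x \<and> x \<in> carrier M \<and> [x, l] \<in> rel M y)" for x' y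
    using iso_rel_pair(2)[OF l] by simp
  have B': "[f l, x'] \<in> rel N y \<longleftrightarrow> (\<exists>x. x' = f x \<and> x \<in> carrier M \<and> [l, x] \<in> rel M y)" for x' y
    using iso_rel_pair(1)[OF l] by simp
  have ins: "insert (f l) {a. Mem N (f l) a} = f ` insert l {a. Mem M l a}"
    unfolding B' using rel_carrier(2)[OF M] by blast
  have sub: "insert l {a. Mem M l a} \<subseteq> carrier M" using rel_carrier(2)[OF M] l by auto
  note O = ok[unfolded lock_ok_def]
  show ?thesis
    unfolding lock_ok_def
  proof (intro conjI allI impI)
    show "holder N b (f l)" using O iso_holder l by blast
    show "\<exists>a. Mem N (f l) a \<and> Col N x d a" if H: "Row N x (f l)" "Bel N d (f l)" for x d
    proof -
      obtain x0 d0 where 0: "x = f x0" "Row M x0 l" "d = f d0" "Bel M d0 l"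
        using H B[of x] B[of d] by blast
      then obtain a where "Mem M l a" "Col M x0 d0 a" using O by blast
      then show ?thesis unfolding R(2,3) 0 by blast
    qed
    show "d = d' \<or> loose \<and> x = x'"
      if H: "Row N x (f l)" "Row N x' (f l)" "Bel N d (f l)" "Bel N d' (f l)" "Mem N (f l) a"
        "Col N x d a" "Col N x d' a" "Col N x' d a" "Col N x' d' a" for x x' d d' a
    proof -
      obtain x0 x1 d0 d1 a0 where 0: "x = f x0" "Row M x0 l" "x' = f x1" "Row M x1 l"
        "d = f d0" "Bel M d0 l" "d' = f d1" "Bel M d1 l" "a = f a0" "Mem M l a0"
        "x0 \<in> carrier M" "x1 \<in> carrier M" "d0 \<in> carrier M" "d1 \<in> carrier M" "a0 \<in> carrier M"
        using H(1-5) unfolding B B' by blast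
      then have "Col M x0 d0 a0" "Col M x0 d1 a0" "Col M x1 d0 a0" "Col M x1 d1 a0"
        using H iso_rel123(3) by auto
      then have "d0 = d1 \<or> loose \<and> x0 = x1" using O 0 by blast
      then show ?thesis using 0 by blast
    qed
    show "\<not> Kill N a d" if H: "Mem N (f l) a" for a d
    proof
      assume "Kill N a d"
      obtain a0 where a0: "a = f a0" "a0 \<in> carrier M" "Mem M l a0" using H B'[of a SMem] by blast
      then show False using \<open>Kill N a d\<close> iso_rel_pair(1)[OF a0(2), of d SKill] O by blast
    qed
    show "lock_tuple N (f l) y xs"
      if xs: "xs \<in> rel N y" "set xs \<subseteq> insert (f l) {a. Mem N (f l) a}" for y xs
    proof -
      obtain zs where zs: "xs = map f zs" "zs \<in> rel M y" using xs(1) iso_rel[OF f] by auto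
      have inj: "inj_on f (carrier M)" using f by (simp add: iso_def bij_betw_def)
      have "set zs \<subseteq> insert l {a. Mem M l a}"
      proof
        fix z assume z: "z \<in> set zs"
        then have "f z \<in> f ` insert l {a. Mem M l a}" using xs(2) ins zs(1) by auto
        then show "z \<in> insert l {a. Mem M l a}"
          using inj_on_image_mem_iff[OF inj _ sub] z rel_tuple(2)[OF M zs(2)] by blast
      qed
      then have "lock_tuple M l y zs" using O zs by blast
      moreover have "Mem N (f l) (f a)" if "Mem M l a" for a
        unfolding R(2) using that by blast
      ultimately show ?thesis
        unfolding lock_tuple_def zs(1) by (auto simp: subset_iff)
    qed
  qed
qed

lemma iso_ok:
  assumes ok: "ok M"
  shows "ok N"
proof -
  have N: "is_struct voc N" using iso_is_struct[OF M f] .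
  have pre: "\<exists>x \<in> carrier M. x' = f x" if H: "x' \<in> carrier N" for x' using H iso_carrier by blast
  show ?thesis
    unfolding ok_def
  proof (intro conjI allI impI N)
    show "part N t h \<in> models (K t)" if H: "holder N t h" for t h
    proof -
      have "h \<in> carrier N" by (rule holder_carrier[OF N H])
      then obtain h0 where h0: "h0 \<in> carrier M" "h = f h0" using pre by blast
      then have "part M t h0 \<in> models (K t)" using okD(2)[OF ok] iso_holder H by blast
      then show ?thesis
        using AEC.models_iso[OF aec[OF holder_type[OF H]]] iso_part[OF h0(1)] h0(2) by blast
    qed
    show "t = t'" if H: "holder N t h" "holder N t' h" for t t' h
      using H pre holder_carrier[OF N] iso_holder okD(3)[OF ok] by metis
    show "d = d'" if H: "Kill N x d" "Kill N x d'" for x d d'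
      using H iso_rel_subset_iff(2)[OF M f] iso_inj rel_carrier(2)[OF M] okD(4)[OF ok] by metis
    show "i = j" "c = c'" if H: "token N i c" "token N j c'" for i c j c'
      using H pre token_carrier[OF N] iso_token okD(5)[OF ok] by metis+
    show "l = l'" if H: "lock N l" "lock N l'" for l l'
      using H pre lock_carrier[OF N] iso_lock okD(6)[OF ok] by metis
    show "token_ok N i c" if H: "token N i c" for i c
      using H pre token_carrier[OF N] iso_token okD(7)[OF ok] iso_token_ok by metis
    show "lock_ok N l" if H: "lock N l" for l
      using H pre lock_carrier[OF N] iso_lock okD(8)[OF ok] iso_lock_ok by metis
  qed
qed

end

end

context lock_construction
begin

section \<open>Transitivity, coherence and isomorphism invariance of the extension relation\<close>

lemma extD:
  assumes "ext M N"
  shows "ok M" "ok N" "substruct M N"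
    and "\<And>t h. holder M t h \<Longrightarrow> strong (K t) (part M t h) (part N t h)"
    and "\<And>l. lock M l \<Longrightarrow> heavy (part M b l) \<Longrightarrow> lock N l"
    and "\<And>l i c d. lock M l \<Longrightarrow> heavy (part M b l) \<Longrightarrow> token M i c \<Longrightarrow> Kill N c d \<Longrightarrow> Bel N d l"
  using assms unfolding ext_def by blast+

lemma ext_refl: "ok M \<Longrightarrow> ext M M"
  unfolding ext_def
  using okD(1,2) substruct_refl AEC.strong_refl[OF aec] holder_type token_def dead_def by metis

lemma lock_holder: "ok M \<Longrightarrow> lock M l \<Longrightarrow> holder M b l"
  using okD(8) unfolding lock_ok_def by blast

lemma ext_heavy:
  assumes "ext M N" "lock M l"
  shows "heavy (part M b l) \<longleftrightarrow> heavy (part N b l)"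
  using heavy_strong extD(4)[OF assms(1)] lock_holder[OF extD(1)[OF assms(1)] assms(2)] by blast

lemma ext_trans:
  assumes MN: "ext M N" and NP: "ext N P"
  shows "ext M P"
  unfolding ext_def
proof (intro conjI allI impI)
  note M = extD[OF MN] and N = extD[OF NP]
  show "ok M" "ok P" "substruct M P" using M N substruct_trans by blast+
  show "strong (K t) (part M t h) (part P t h)" if "holder M t h" for t h
  proof -
    have "h \<in> carrier M" using holder_carrier[OF okD(1)[OF M(1)] that] .
    then have "holder N t h" using substruct_holder[OF M(3)] that by blast
    then show ?thesis using M(4)[OF that] N(4) AEC.strong_trans[OF aec[OF holder_type[OF that]]] by blast
  qed
  fix l assume l: "lock M l" "heavy (part M b l)"
  have lN: "lock N l" "heavy (part N b l)" using M(5)[OF l] ext_heavy[OF MN l(1)] l(2) by auto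
  show "lock P l" using N(5)[OF lN] .
  \<comment> \<open>If \<open>c\<close> is already dead in \<open>N\<close>, its killer there is a
    column of \<open>l\<close>, and \<open>d\<close> is the same element because killers are unique.
    If not, \<open>c\<close> is still a token of \<open>N\<close> and the condition of the second
    extension applies.\<close>
  show "Bel P d l" if c: "token M i c" and d: "Kill P c d" for i c d
  proof (cases "dead N c")
    case True
    then obtain d' where d': "Kill N c d'" by (auto simp: dead_def)
    have "Bel N d' l" using M(6)[OF l c d'] .
    then have "Bel P d' l" "Kill P c d'"
      using d' substruct_rel[OF N(3)] rel_tuple(2)[OF okD(1)[OF M(2)]] by blast+
    then show ?thesis using okD(4)[OF N(2) d] by blast
  next
    case False
    have "c \<in> carrier M" using token_carrier[OF okD(1)[OF M(1)] c] .
    then have "token N i c"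
      using c False substruct_rel[OF M(3), of "[c]"] by (simp add: token_def)
    then show ?thesis using N(6)[OF lN _ d] by blast
  qed
qed

text \<open>What is asked of \<open>N\<close> can be read off in \<open>P\<close>: an element that
  is dead in \<open>N\<close> is dead in \<open>P\<close>, and whether a point of \<open>N\<close>
  is a column of \<open>l\<close> does not change between \<open>N\<close> and
  \<open>P\<close>.\<close>

lemma ext_coherence:
  assumes MP: "ext M P" and NP: "ext N P" and MN: "substruct M N"
  shows "ext M N"
  unfolding ext_def
proof (intro conjI allI impI MN)
  note M = extD[OF MP] and N = extD[OF NP]
  note sM = okD(1)[OF M(1)] and sN = okD(1)[OF N(1)]
  show "ok M" "ok N" using M N by blast+
  show "strong (K t) (part M t h) (part N t h)" if "holder M t h" for t h
  proof -
    have h: "h \<in> carrier M" using holder_carrier[OF sM that] .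
    then have "holder N t h" using substruct_holder[OF MN] that by blast
    then show ?thesis
      using AEC.coherence[OF aec[OF holder_type[OF that]] M(4)[OF that] N(4)] substruct_part[OF sM MN h]
      by blast
  qed
  fix l assume l: "lock M l" "heavy (part M b l)"
  have "l \<in> carrier N" using lock_carrier[OF sM l(1)] substruct_carrier[OF MN] by blast
  then show "lock N l" using substruct_lock[OF sN N(3) M(5)[OF l]] by blast
  show "Bel N d l" if c: "token M i c" and d: "Kill N c d" for i c d
  proof -
    have "Kill P c d" "d \<in> carrier N"
      using d substruct_rel[OF N(3), of "[c, d]"] rel_carrier(2)[OF sN d] by auto
    then have "Bel P d l" using M(6)[OF l c] by blast
    then show ?thesis
      using substruct_rel[OF N(3), of "[d, l]"] \<open>d \<in> carrier N\<close> \<open>l \<in> carrier N\<close> by simp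
  qed
qed

lemma ext_iso:
  assumes MN: "ext M N" and fN: "iso f N N'" and fM: "iso f M M'"
  shows "ext M' N'"
  unfolding ext_def
proof (intro conjI allI impI)
  note M = extD[OF MN]
  note sM = okD(1)[OF M(1)] and sN = okD(1)[OF M(2)]
  have sM': "is_struct voc M'" and sN': "is_struct voc N'"
    using iso_is_struct[OF sM fM] iso_is_struct[OF sN fN] .
  have C: "carrier M' = f ` carrier M" "carrier N' = f ` carrier N" "carrier M \<subseteq> carrier N"
    using iso_carrier[OF sM fM] iso_carrier[OF sN fN] substruct_carrier[OF M(3)] .
  show "ok M'" "ok N'" using iso_ok[OF sM fM M(1)] iso_ok[OF sN fN M(2)] .
  show "substruct M' N'"
  proof (rule substruct_relI[OF sM' sN'])
    show "carrier M' \<subseteq> carrier N'" using C by blast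
    fix y xs assume "set xs \<subseteq> carrier M'"
    then have "xs \<in> lists (f ` carrier M)" using C(1) by (simp add: lists_eq_set)
    then obtain zs where "xs = map f zs" "zs \<in> lists (carrier M)" unfolding lists_image by blast
    then have zs: "xs = map f zs" "set zs \<subseteq> carrier M" by auto
    have "xs \<in> rel M' y \<longleftrightarrow> zs \<in> rel M y" using iso_rel_iff[OF sM fM zs(2)] zs(1) by simp
    also have "\<dots> \<longleftrightarrow> zs \<in> rel N y" using substruct_rel[OF M(3) zs(2)] .
    also have "\<dots> \<longleftrightarrow> xs \<in> rel N' y" using iso_rel_iff[OF sN fN, of zs] zs C(3) by simp
    finally show "xs \<in> rel M' y \<longleftrightarrow> xs \<in> rel N' y" .
  qed
  have pre: "\<exists>x \<in> carrier M. x' = f x" if "x' \<in> carrier M'" for x' using that C by blast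
  show "strong (K t) (part M' t h') (part N' t h')" if h': "holder M' t h'" for t h'
  proof -
    obtain h where h: "h \<in> carrier M" "h' = f h" using pre[OF holder_carrier[OF sM' h']] by blast
    then have "holder M t h" using iso_holder[OF sM fM] h' by blast
    then show ?thesis
      using AEC.strong_iso[OF aec[OF holder_type[OF h']] M(4) iso_part[OF sN fN] iso_part[OF sM fM]]
        h C(3) by blast
  qed
  fix l' assume l': "lock M' l'" "heavy (part M' b l')"
  obtain l where l: "l \<in> carrier M" "l' = f l" using pre[OF lock_carrier[OF sM' l'(1)]] by blast
  have lM: "lock M l" "heavy (part M b l)"
    using l' l iso_lock[OF sM fM] heavy_iso[OF iso_part[OF sM fM l(1)]] by auto
  have lN: "l \<in> carrier N" using l C(3) by blast
  show "lock N' l'" using M(5)[OF lM] iso_lock[OF sN fN lN] l(2) by blast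
  show "Bel N' d' l'" if c': "token M' i c'" and d': "Kill N' c' d'" for i c' d'
  proof -
    obtain c where c: "c \<in> carrier M" "c' = f c" using pre[OF token_carrier[OF sM' c']] by blast
    then have "token M i c" using iso_token[OF sM fM] c' by blast
    moreover have "c \<in> carrier N" using c C(3) by blast
    then obtain d where d: "d' = f d" "d \<in> carrier N" "Kill N c d"
      using iso_rel_pair(1)[OF sN fN, of c d' SKill] d' c(2) by blast
    ultimately have "Bel N d l" using M(6)[OF lM] by blast
    then show ?thesis using iso_rel123(2)[OF sN fN d(2) lN] d(1) l(2) by blast
  qed
qed

subsection \<open>Chains\<close>

lemma lock_tuple_mono: "lock_tuple M l y xs \<Longrightarrow> (\<And>a. Mem M l a \<Longrightarrow> Mem N l a) \<Longrightarrow> lock_tuple N l y xs"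
  unfolding lock_tuple_def by blast

context
  fixes r :: "'u rel" and Mi U
  assumes r: "Well_order r" "Field r \<noteq> {}"
    and ch: "\<And>i j. (i, j) \<in> r \<Longrightarrow> ext (Mi i) (Mi j)"
    and sm: "small (\<Union>i \<in> Field r. carrier (Mi i))"
  defines "U \<equiv> union_struct (Field r) Mi"
begin

lemma chain_total: "i \<in> Field r \<Longrightarrow> j \<in> Field r \<Longrightarrow> (i, j) \<in> r \<or> (j, i) \<in> r"
  using r(1) by (metis wo_rel.TOTALS wo_rel.intro)

lemma chain_ok: "i \<in> Field r \<Longrightarrow> ok (Mi i)"
  using chain_total[of i i] ch extD(1) by blast

lemma chain_carrier: "carrier U = (\<Union>i \<in> Field r. carrier (Mi i))"
  by (simp add: U_def union_struct_def)

lemma chain_rel: "rel U y = (\<Union>i \<in> Field r. rel (Mi i) y)"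
  by (simp add: U_def union_struct_def rel_def)

lemma chain_struct: "is_struct voc U"
  unfolding is_struct_voc
proof (intro conjI allI impI)
  obtain i where i: "i \<in> Field r" using r(2) by blast
  have s: "is_struct voc (Mi i)" if "i \<in> Field r" for i using okD(1)[OF chain_ok[OF that]] .
  show "carrier U \<noteq> {}" using s[OF i] i unfolding is_struct_voc chain_carrier by blast
  show "small (carrier U)" unfolding chain_carrier by (rule sm)
  show "rel U y \<subseteq> tuples (sym_arity y) (carrier U)" for y
  proof
    fix xs assume "xs \<in> rel U y"
    then obtain j where j: "j \<in> Field r" "xs \<in> rel (Mi j) y" unfolding chain_rel by blast
    then show "xs \<in> tuples (sym_arity y) (carrier U)"
      using rel_tuple(1,2)[OF s[OF j(1)] j(2)] unfolding chain_carrier by (auto simp: tuples_def)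
  qed
  show "interp U x = {}" if "x \<notin> voc" for x
    using s that by (auto simp: U_def union_struct_def is_struct_def)
qed

lemma chain_up: "xs \<in> rel (Mi i) y \<Longrightarrow> i \<in> Field r \<Longrightarrow> xs \<in> rel U y"
  unfolding chain_rel by blast

lemma chain_sub:
  assumes i: "i \<in> Field r"
  shows "substruct (Mi i) U"
proof (rule substruct_relI[OF okD(1)[OF chain_ok[OF i]] chain_struct])
  show "carrier (Mi i) \<subseteq> carrier U" using i unfolding chain_carrier by blast
  fix y xs assume xs: "set xs \<subseteq> carrier (Mi i)"
  show "xs \<in> rel (Mi i) y \<longleftrightarrow> xs \<in> rel U y"
  proof
    assume "xs \<in> rel U y"
    then obtain j where j: "j \<in> Field r" "xs \<in> rel (Mi j) y" unfolding chain_rel by blast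
    from chain_total[OF i j(1)] show "xs \<in> rel (Mi i) y"
    proof
      assume "(i, j) \<in> r"
      then show ?thesis using substruct_rel[OF extD(3)[OF ch] xs] j(2) by blast
    next
      assume "(j, i) \<in> r"
      then show ?thesis
        using substruct_rel[OF extD(3)[OF ch]] rel_tuple(2)[OF okD(1)[OF chain_ok[OF j(1)]] j(2)] j(2)
        by blast
    qed
  qed (use i chain_up in blast)
qed

lemma chain_locate:
  assumes "finite X" "X \<subseteq> carrier U"
  shows "\<exists>i \<in> Field r. X \<subseteq> carrier (Mi i)"
  using assms
proof (induction X rule: finite_induct)
  case empty
  then show ?case using r(2) by blast
next
  case (insert x X)
  then obtain i where i: "i \<in> Field r" "X \<subseteq> carrier (Mi i)" by blast
  obtain j where j: "j \<in> Field r" "x \<in> carrier (Mi j)" using insert.prems unfolding chain_carrier by blast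
  from chain_total[OF i(1) j(1)] show ?case
  proof
    assume "(i, j) \<in> r"
    then have "carrier (Mi i) \<subseteq> carrier (Mi j)" using substruct_carrier[OF extD(3)[OF ch]] by blast
    then show ?thesis using i j by blast
  next
    assume "(j, i) \<in> r"
    then have "carrier (Mi j) \<subseteq> carrier (Mi i)" using substruct_carrier[OF extD(3)[OF ch]] by blast
    then show ?thesis using i j by blast
  qed
qed

lemma chain_locate_tuples:
  assumes "finite T" "\<And>xs. xs \<in> T \<Longrightarrow> \<exists>y. xs \<in> rel U y" "finite X" "X \<subseteq> carrier U"
  shows "\<exists>i \<in> Field r. X \<subseteq> carrier (Mi i) \<and> (\<forall>xs \<in> T. set xs \<subseteq> carrier (Mi i))"
proof -
  have "\<Union>(set ` T) \<subseteq> carrier U" using assms(2) rel_tuple(2)[OF chain_struct] by blast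
  then obtain i where "i \<in> Field r" "X \<union> \<Union>(set ` T) \<subseteq> carrier (Mi i)"
    using chain_locate[of "X \<union> \<Union>(set ` T)"] assms by auto
  then show ?thesis by blast
qed

lemma chain_down: "i \<in> Field r \<Longrightarrow> set xs \<subseteq> carrier (Mi i) \<Longrightarrow> xs \<in> rel (Mi i) y \<longleftrightarrow> xs \<in> rel U y"
  using substruct_rel[OF chain_sub] .

lemma chain_token: "token U i c \<Longrightarrow> j \<in> Field r \<Longrightarrow> c \<in> carrier (Mi j) \<Longrightarrow> token (Mi j) i c"
  using substruct_token[OF okD(1)[OF chain_ok] chain_sub] by blast

lemma chain_lock: "lock U l \<Longrightarrow> j \<in> Field r \<Longrightarrow> l \<in> carrier (Mi j) \<Longrightarrow> lock (Mi j) l"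
  using substruct_lock[OF okD(1)[OF chain_ok] chain_sub] by blast

text \<open>The members of the chain that contain \<open>h\<close> have indices \<open>J\<close>,
  closed upwards in \<open>r\<close>. Along \<open>J\<close> the parts of \<open>h\<close> form a
  chain in \<open>K t\<close>, and its union is the part of \<open>h\<close> in \<open>U\<close>; so
  the chain axioms of \<open>K t\<close> carry over to parts.\<close>

lemma chain_part:
  assumes h: "holder U t h"
  shows "part U t h \<in> models (K t)"
    and "i \<in> Field r \<Longrightarrow> h \<in> carrier (Mi i) \<Longrightarrow> strong (K t) (part (Mi i) t h) (part U t h)"
    and "(\<And>i. i \<in> Field r \<Longrightarrow> h \<in> carrier (Mi i) \<Longrightarrow> strong (K t) (part (Mi i) t h) P) \<Longrightarrow>
      strong (K t) (part U t h) P"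
proof -
  define J where "J = {i \<in> Field r. h \<in> carrier (Mi i)}"
  define r' where "r' = Restr r J"
  interpret A: AEC "K t" using aec[OF holder_type[OF h]] .
  have "Refl r" using r(1) by (simp add: order_on_defs)
  then have F: "Field r' = J" unfolding r'_def by (intro Refl_Field_Restr2) (auto simp: J_def)
  have W: "Well_order r'" unfolding r'_def by (rule Well_order_Restr[OF r(1)])
  have hU: "h \<in> carrier U" using holder_carrier[OF chain_struct h] .
  then have ne: "Field r' \<noteq> {}" unfolding F J_def chain_carrier by blast
  have hi: "holder (Mi i) t h" if "i \<in> J" for i
    using substruct_holder[OF chain_sub] that h by (auto simp: J_def)
  have c: "strong (K t) (part (Mi i) t h) (part (Mi j) t h)" if "(i, j) \<in> r'" for i j
    using that extD(4)[OF ch hi] by (auto simp: r'_def)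
  have mem: "Mem U h a \<longleftrightarrow> (\<exists>i \<in> J. Mem (Mi i) h a)" for a
    unfolding chain_rel J_def using rel_carrier(2)[OF okD(1)[OF chain_ok]] by blast
  have u: "part U t h = union_struct (Field r') (\<lambda>i. part (Mi i) t h)"
  proof (rule struct_eqI)
    show "carrier (part U t h) = carrier (union_struct (Field r') (\<lambda>i. part (Mi i) t h))"
      using mem by (auto simp: F part_def union_struct_def)
    fix s
    show "interp (part U t h) s = interp (union_struct (Field r') (\<lambda>i. part (Mi i) t h)) s"
    proof (intro set_eqI iffI)
      fix xs assume xs: "xs \<in> interp (part U t h) s"
      then have 1: "h # xs \<in> rel U (SCode t s)" "set xs \<subseteq> {a. Mem U h a}"
        by (auto simp: part_def)
      have "\<exists>i \<in> Field r. insert h (set xs) \<subseteq> carrier (Mi i)"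
        by (rule chain_locate) (use rel_tuple(2)[OF chain_struct 1(1)] in auto)
      then obtain i where i: "i \<in> Field r" "insert h (set xs) \<subseteq> carrier (Mi i)" by blast
      have "Mem (Mi i) h a" if "a \<in> set xs" for a
        using chain_down[OF i(1), of "[h, a]" SMem] i 1 that by auto
      moreover have "h # xs \<in> rel (Mi i) (SCode t s)"
        using chain_down[OF i(1), of "h # xs"] i 1 by auto
      ultimately have "xs \<in> interp (part (Mi i) t h) s" by (auto simp: part_def)
      then show "xs \<in> interp (union_struct (Field r') (\<lambda>i. part (Mi i) t h)) s"
        using i by (auto simp: F J_def union_struct_def)
    next
      fix xs assume "xs \<in> interp (union_struct (Field r') (\<lambda>i. part (Mi i) t h)) s"
      then show "xs \<in> interp (part U t h) s"
        using mem by (auto simp: F J_def part_def union_struct_def intro: chain_up)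
    qed
  qed
  have s: "small (\<Union>i\<in>Field r'. carrier (part (Mi i) t h))"
  proof (rule small_subset[OF _ sm])
    show "(\<Union>i\<in>Field r'. carrier (part (Mi i) t h)) \<subseteq> (\<Union>i\<in>Field r. carrier (Mi i))"
      using carrier_part_subset[OF okD(1)[OF chain_ok]] unfolding F J_def by blast
  qed
  show "part U t h \<in> models (K t)" unfolding u by (rule A.chain_models[OF W ne c s])
  show "strong (K t) (part (Mi i) t h) (part U t h)" if "i \<in> Field r" "h \<in> carrier (Mi i)"
    unfolding u by (rule A.chain_upper[OF W ne c s]) (use that in \<open>simp_all add: F J_def\<close>)
  show "strong (K t) (part U t h) P"
    if "\<And>i. i \<in> Field r \<Longrightarrow> h \<in> carrier (Mi i) \<Longrightarrow> strong (K t) (part (Mi i) t h) P"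
    unfolding u by (rule A.chain_least[OF W ne c s]) (use that in \<open>simp_all add: F J_def\<close>)
qed

text \<open>A violation of a universal clause would involve finitely many elements, and these lie in
  one member of the chain. A token or lock active in \<open>U\<close> is active in every member that
  contains it, so that the existential clauses find their witnesses there and keep them.\<close>

lemma chain_union_ok: "ok U"
  unfolding ok_def
proof (intro conjI allI impI chain_struct)
  have loc: "\<exists>i \<in> Field r. set X \<subseteq> carrier (Mi i)" if "set X \<subseteq> carrier U" for X
    using chain_locate[of "set X"] that by blast
  have dn: "xs \<in> rel (Mi j) y" if "xs \<in> rel U y" "j \<in> Field r" "set xs \<subseteq> carrier (Mi j)" for xs y j
    using that chain_down by blast
  show "part U t h \<in> models (K t)" if "holder U t h" for t h using chain_part(1)[OF that] .
  show "t = t'" if 1: "holder U t h" "holder U t' h" for t t' h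
  proof -
    obtain i where i: "i \<in> Field r" "set [h] \<subseteq> carrier (Mi i)"
      using loc[of "[h]"] holder_carrier[OF chain_struct 1(1)] by auto
    then show ?thesis
      using substruct_holder[OF chain_sub[OF i(1)], of h] 1 okD(3)[OF chain_ok[OF i(1)], of t h t'] by auto
  qed
  show "d = d'" if 1: "Kill U x d" "Kill U x d'" for x d d'
  proof -
    obtain i where i: "i \<in> Field r" "set [x, d, d'] \<subseteq> carrier (Mi i)"
      using loc[of "[x, d, d']"] rel_carrier(2)[OF chain_struct 1(1)] rel_carrier(2)[OF chain_struct 1(2)]
      by auto
    then have "Kill (Mi i) x d" "Kill (Mi i) x d'" using dn 1 by auto
    then show ?thesis using okD(4)[OF chain_ok[OF i(1)]] by blast
  qed
  show "i = j" "c = c'" if 1: "token U i c" "token U j c'" for i c j c'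
  proof -
    obtain k where k: "k \<in> Field r" "set [c, c'] \<subseteq> carrier (Mi k)"
      using loc[of "[c, c']"] token_carrier[OF chain_struct 1(1)] token_carrier[OF chain_struct 1(2)] by auto
    then have "token (Mi k) i c" "token (Mi k) j c'"
      using chain_token[OF 1(1) k(1)] chain_token[OF 1(2) k(1)] by auto
    then show "i = j" "c = c'" using okD(5)[OF chain_ok[OF k(1)]] by blast+
  qed
  show "l = l'" if 1: "lock U l" "lock U l'" for l l'
  proof -
    obtain k where k: "k \<in> Field r" "set [l, l'] \<subseteq> carrier (Mi k)"
      using loc[of "[l, l']"] lock_carrier[OF chain_struct 1(1)] lock_carrier[OF chain_struct 1(2)] by auto
    then have "lock (Mi k) l" "lock (Mi k) l'"
      using chain_lock[OF 1(1) k(1)] chain_lock[OF 1(2) k(1)] by auto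
    then show "l = l'" using okD(6)[OF chain_ok[OF k(1)]] by blast
  qed
  note C1 = rel_carrier(1)[OF chain_struct] and C2 = rel_carrier(2)[OF chain_struct]
    and C3 = rel_carrier(3)[OF chain_struct]
  show "token_ok U i c" if c: "token U i c" for i c
    unfolding token_ok_def
  proof (intro conjI allI impI ballI)
    have cU: "c \<in> carrier U" using token_carrier[OF chain_struct c] .
    have loc_ok: "\<exists>j \<in> Field r. set X \<subseteq> carrier (Mi j) \<and> c \<in> carrier (Mi j) \<and> token_ok (Mi j) i c"
      if X: "set X \<subseteq> carrier U" for X
    proof -
      obtain j where j: "j \<in> Field r" "set (c # X) \<subseteq> carrier (Mi j)" using loc[of "c # X"] X cU by auto
      then have "token (Mi j) i c" using chain_token[OF c] by auto
      then show ?thesis using okD(7)[OF chain_ok[OF j(1)]] j by auto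
    qed
    show "holder U i e" if e: "Bel U e c" for e
    proof -
      obtain j where j: "j \<in> Field r" "set [e] \<subseteq> carrier (Mi j)" "c \<in> carrier (Mi j)" "token_ok (Mi j) i c"
        using loc_ok[of "[e]"] C2[OF e] by auto
      then have "Bel (Mi j) e c" using dn[OF e j(1)] by auto
      then have "holder (Mi j) i e" using j(4) unfolding token_ok_def by blast
      then show ?thesis using substruct_holder[OF chain_sub[OF j(1)]] j(2) by auto
    qed
    show "p = p'" if H: "Bel U e c" "Mem U e a" "Pick U e a p" "Pick U e a p'" for e a p p'
    proof -
      obtain j where j: "j \<in> Field r" "set [e, a, p, p'] \<subseteq> carrier (Mi j)" "c \<in> carrier (Mi j)"
        "token_ok (Mi j) i c"
        using loc_ok[of "[e, a, p, p']"] C3[OF H(3)] C3[OF H(4)] by auto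
      have "Bel (Mi j) e c" "Mem (Mi j) e a" "Pick (Mi j) e a p" "Pick (Mi j) e a p'"
        using dn[OF H(1) j(1)] dn[OF H(2) j(1)] dn[OF H(3) j(1)] dn[OF H(4) j(1)] j by auto
      then show ?thesis using j(4) unfolding token_ok_def by blast
    qed
    show "\<exists>e a. Bel U e c \<and> Mem U e a \<and> Pick U e a p" if p: "p \<in> carrier U" for p
    proof -
      obtain j where j: "j \<in> Field r" "set [p] \<subseteq> carrier (Mi j)" "token_ok (Mi j) i c"
        using loc_ok[of "[p]"] p by auto
      then obtain e a where "Bel (Mi j) e c" "Mem (Mi j) e a" "Pick (Mi j) e a p"
        unfolding token_ok_def by auto
      then show ?thesis using chain_up[OF _ j(1)] by blast
    qed
    show "(\<exists>a. Mem U e a \<and> Pick U e a f) \<or> (\<exists>a. Mem U f a \<and> Pick U f a e)"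
      if H: "Bel U e c" "Bel U f c" for e f
    proof -
      obtain j where j: "j \<in> Field r" "set [e, f] \<subseteq> carrier (Mi j)" "c \<in> carrier (Mi j)"
        "token_ok (Mi j) i c"
        using loc_ok[of "[e, f]"] C2[OF H(1)] C2[OF H(2)] by auto
      have "Bel (Mi j) e c" "Bel (Mi j) f c" using dn[OF H(1) j(1)] dn[OF H(2) j(1)] j by auto
      then have "(\<exists>a. Mem (Mi j) e a \<and> Pick (Mi j) e a f) \<or> (\<exists>a. Mem (Mi j) f a \<and> Pick (Mi j) f a e)"
        using j(4) unfolding token_ok_def by blast
      then show ?thesis using chain_up[OF _ j(1)] by blast
    qed
  qed
  show "lock_ok U l" if l: "lock U l" for l
    unfolding lock_ok_def
  proof (intro conjI allI impI)
    have lU: "l \<in> carrier U" using lock_carrier[OF chain_struct l] .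
    have loc_ok: "\<exists>j \<in> Field r. set X \<subseteq> carrier (Mi j) \<and> l \<in> carrier (Mi j) \<and> lock_ok (Mi j) l"
      if X: "set X \<subseteq> carrier U" for X
    proof -
      obtain j where j: "j \<in> Field r" "set (l # X) \<subseteq> carrier (Mi j)" using loc[of "l # X"] X lU by auto
      then have "lock (Mi j) l" using chain_lock[OF l] by auto
      then show ?thesis using okD(8)[OF chain_ok[OF j(1)]] j by auto
    qed
    show "holder U b l"
    proof -
      obtain j where j: "j \<in> Field r" "l \<in> carrier (Mi j)" "lock_ok (Mi j) l" using loc_ok[of "[]"] by auto
      then show ?thesis using substruct_holder[OF chain_sub[OF j(1)]] unfolding lock_ok_def by blast
    qed
    show "\<exists>a. Mem U l a \<and> Col U x d a" if H: "Row U x l" "Bel U d l" for x d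
    proof -
      obtain j where j: "j \<in> Field r" "set [x, d] \<subseteq> carrier (Mi j)" "l \<in> carrier (Mi j)" "lock_ok (Mi j) l"
        using loc_ok[of "[x, d]"] C2[OF H(1)] C2[OF H(2)] by auto
      have "Row (Mi j) x l" "Bel (Mi j) d l" using dn[OF H(1) j(1)] dn[OF H(2) j(1)] j by auto
      then have "\<exists>a. Mem (Mi j) l a \<and> Col (Mi j) x d a" using j(4) unfolding lock_ok_def by blast
      then show ?thesis using chain_up[OF _ j(1)] by blast
    qed
    show "d = d' \<or> loose \<and> x = x'"
      if H: "Row U x l" "Row U x' l" "Bel U d l" "Bel U d' l" "Mem U l a"
        "Col U x d a" "Col U x d' a" "Col U x' d a" "Col U x' d' a" for x x' d d' a
    proof -
      obtain j where j: "j \<in> Field r" "set [x, x', d, d', a] \<subseteq> carrier (Mi j)" "l \<in> carrier (Mi j)"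
        "lock_ok (Mi j) l"
        using loc_ok[of "[x, x', d, d', a]"] C3[OF H(6)] C3[OF H(9)] by auto
      have "Row (Mi j) x l" "Row (Mi j) x' l" "Bel (Mi j) d l" "Bel (Mi j) d' l" "Mem (Mi j) l a"
        "Col (Mi j) x d a" "Col (Mi j) x d' a" "Col (Mi j) x' d a" "Col (Mi j) x' d' a"
        using H[THEN dn, OF j(1)] j by auto
      then show ?thesis using j(4) unfolding lock_ok_def by blast
    qed
    show "\<not> Kill U a d" if H: "Mem U l a" for a d
    proof
      assume k: "Kill U a d"
      obtain j where j: "j \<in> Field r" "set [a, d] \<subseteq> carrier (Mi j)" "l \<in> carrier (Mi j)" "lock_ok (Mi j) l"
        using loc_ok[of "[a, d]"] C2[OF k] by auto
      then have "Kill (Mi j) a d" "Mem (Mi j) l a" using dn[OF k j(1)] dn[OF H j(1)] by auto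
      then show False using j(4) unfolding lock_ok_def by blast
    qed
    show "lock_tuple U l y xs" if H: "xs \<in> rel U y" "set xs \<subseteq> insert l {a. Mem U l a}" for y xs
    proof -
      obtain j where j: "j \<in> Field r" "set xs \<subseteq> carrier (Mi j)" "l \<in> carrier (Mi j)" "lock_ok (Mi j) l"
        using loc_ok[of xs] rel_tuple(2)[OF chain_struct H(1)] by auto
      have "xs \<in> rel (Mi j) y" using dn[OF H(1) j(1,2)] .
      moreover have "Mem (Mi j) l x" if "x \<in> set xs" "x \<noteq> l" for x
        using dn[of "[l, x]", OF _ j(1)] H(2) j(2,3) that by auto
      then have "set xs \<subseteq> insert l {a. Mem (Mi j) l a}" by blast
      ultimately have "lock_tuple (Mi j) l y xs" using j(4) unfolding lock_ok_def by blast
      then show ?thesis by (rule lock_tuple_mono) (rule chain_up[OF _ j(1)])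
    qed
  qed
qed

lemma chain_union_upper:
  assumes i: "i \<in> Field r"
  shows "ext (Mi i) U"
  unfolding ext_def
proof (intro conjI allI impI chain_ok[OF i] chain_union_ok chain_sub[OF i])
  note si = okD(1)[OF chain_ok[OF i]]
  show "strong (K t) (part (Mi i) t h) (part U t h)" if "holder (Mi i) t h" for t h
    using chain_part(2)[OF _ i] holder_carrier[OF si that] substruct_holder[OF chain_sub[OF i]] that by blast
  fix l assume l: "lock (Mi i) l" "heavy (part (Mi i) b l)"
  \<comment> \<open>The heavy lock of \<open>Mi i\<close> is only controlled in later members, so a
    member containing the given elements has to be found at or above \<open>i\<close>.\<close>
  have later: "\<exists>j. (i, j) \<in> r \<and> set xs \<subseteq> carrier (Mi j)" if X: "set xs \<subseteq> carrier U" for xs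
  proof -
    obtain j where j: "j \<in> Field r" "set xs \<subseteq> carrier (Mi j)" using chain_locate[of "set xs"] X by blast
    show ?thesis
    proof (cases "(i, j) \<in> r")
      case False
      then have "(j, i) \<in> r" "(i, i) \<in> r" using chain_total i j by blast+
      then show ?thesis using substruct_carrier[OF extD(3)[OF ch]] j(2) by blast
    qed (use j in blast)
  qed
  show "lock U l"
    unfolding lock_def
  proof
    show "Lock U l" using l(1) chain_up[OF _ i] by (simp add: lock_def)
    show "\<not> dead U l"
    proof
      assume "dead U l"
      then obtain d where d: "Kill U l d" by (auto simp: dead_def)
      obtain j where j: "(i, j) \<in> r" "set [l, d] \<subseteq> carrier (Mi j)"
        using later[of "[l, d]"] rel_carrier(2)[OF chain_struct d] by auto
      then have "Kill (Mi j) l d" using chain_down[of j "[l, d]" SKill] d FieldI2 by metis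
      moreover have "lock (Mi j) l" using extD(5)[OF ch[OF j(1)] l] .
      ultimately show False by (auto simp: lock_def dead_def)
    qed
  qed
  show "Bel U d l" if c: "token (Mi i) i' c" and d: "Kill U c d" for i' c d
  proof -
    obtain j where j: "(i, j) \<in> r" "set [c, d] \<subseteq> carrier (Mi j)"
      using later[of "[c, d]"] rel_carrier(2)[OF chain_struct d] by auto
    have jF: "j \<in> Field r" using j(1) FieldI2 by metis
    have "Kill (Mi j) c d" using chain_down[OF jF j(2)] d by blast
    then have "Bel (Mi j) d l" using extD(6)[OF ch[OF j(1)] l c] by blast
    then show ?thesis using chain_up[OF _ jF] by blast
  qed
qed

lemma chain_union_least:
  assumes N: "\<And>i. i \<in> Field r \<Longrightarrow> ext (Mi i) N"
  shows "ext U N"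
proof -
  obtain i0 where i0: "i0 \<in> Field r" using r(2) by blast
  have okN: "ok N" using extD(2)[OF N[OF i0]] .
  have sub: "substruct U N"
  proof (rule substruct_relI[OF chain_struct okD(1)[OF okN]])
    show "carrier U \<subseteq> carrier N" unfolding chain_carrier using substruct_carrier[OF extD(3)[OF N]] by blast
    fix y xs assume "set xs \<subseteq> carrier U"
    then obtain j where j: "j \<in> Field r" "set xs \<subseteq> carrier (Mi j)" using chain_locate[of "set xs"] by blast
    show "xs \<in> rel U y \<longleftrightarrow> xs \<in> rel N y"
      using chain_down[OF j] substruct_rel[OF extD(3)[OF N[OF j(1)]] j(2)] by blast
  qed
  show ?thesis
    unfolding ext_def
  proof (intro conjI allI impI chain_union_ok okN sub)
    show "strong (K t) (part U t h) (part N t h)" if h: "holder U t h" for t h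
      using chain_part(3)[OF h] extD(4)[OF N] substruct_holder[OF chain_sub] h by blast
    fix l assume l: "lock U l" "heavy (part U b l)"
    have act: "lock (Mi j) l \<and> heavy (part (Mi j) b l)" if "j \<in> Field r" "l \<in> carrier (Mi j)" for j
      using chain_lock[OF l(1) that] ext_heavy[OF chain_union_upper[OF that(1)]] l(2) by blast
    have lU: "l \<in> carrier U" using lock_carrier[OF chain_struct l(1)] .
    then obtain j where j: "j \<in> Field r" "l \<in> carrier (Mi j)" unfolding chain_carrier by blast
    then show "lock N l" using extD(5)[OF N[OF j(1)]] act by blast
    show "Bel N d l" if c: "token U i c" and d: "Kill N c d" for i c d
    proof -
      obtain k where k: "k \<in> Field r" "{c, l} \<subseteq> carrier (Mi k)"
        using chain_locate[of "{c, l}"] lU token_carrier[OF chain_struct c] by auto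
      then show ?thesis using extD(6)[OF N[OF k(1)] _ _ chain_token[OF c k(1)] d] act by blast
    qed
  qed
qed

end

end

context lock_construction
begin

subsection \<open>The downward Loewenheim-Skolem property\<close>

text \<open>One finite set serves all tokens and locks at once because at most one token and at most
  one lock are active. It is attached to a pair \<open>x\<close>, \<open>y\<close> since two
  clauses, mutual picking and cells, have two parameters.\<close>

lemma small_witnesses:
  assumes N: "ok N"
  shows "\<exists>W. finite W \<and> W \<subseteq> carrier N \<and>
    (dead N x \<longrightarrow> (\<exists>d \<in> W. Kill N x d)) \<and>
    (\<forall>i c. token N i c \<longrightarrow> x \<in> carrier N \<longrightarrow> (\<exists>e \<in> W. \<exists>a \<in> W. Bel N e c \<and> Mem N e a \<and> Pick N e a x)) \<and>
    (\<forall>i c. token N i c \<longrightarrow> Bel N x c \<longrightarrow> Bel N y c \<longrightarrow>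
      (\<exists>a \<in> W. Mem N x a \<and> Pick N x a y) \<or> (\<exists>a \<in> W. Mem N y a \<and> Pick N y a x)) \<and>
    (\<forall>l. lock N l \<longrightarrow> Row N x l \<longrightarrow> Bel N y l \<longrightarrow> (\<exists>a \<in> W. Mem N l a \<and> Col N x y a))"
proof -
  note C = rel_carrier[OF okD(1)[OF N]]
  have "\<exists>W. finite W \<and> W \<subseteq> carrier N \<and> (dead N x \<longrightarrow> (\<exists>d \<in> W. Kill N x d))"
  proof (cases "dead N x")
    case True
    then obtain d where "Kill N x d" by (auto simp: dead_def)
    then show ?thesis using C(2) by (intro exI[of _ "{d}"]) auto
  qed (rule exI[of _ "{}"], simp)
  then obtain W1 where W1: "finite W1" "W1 \<subseteq> carrier N" "dead N x \<longrightarrow> (\<exists>d \<in> W1. Kill N x d)"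
    by blast
  have "\<exists>W. finite W \<and> W \<subseteq> carrier N \<and>
    (\<forall>i c. token N i c \<longrightarrow> x \<in> carrier N \<longrightarrow> (\<exists>e \<in> W. \<exists>a \<in> W. Bel N e c \<and> Mem N e a \<and> Pick N e a x))"
  proof (cases "\<exists>i c. token N i c \<and> x \<in> carrier N")
    case True
    then obtain i c where ic: "token N i c" "x \<in> carrier N" by blast
    then obtain e a where e: "Bel N e c" "Mem N e a" "Pick N e a x"
      using okD(7)[OF N ic(1)] unfolding token_ok_def by blast
    have "i' = i \<and> c' = c" if "token N i' c'" for i' c' using okD(5)[OF N that ic(1)] .
    then show ?thesis using e C(2) by (intro exI[of _ "{e, a}"]) blast
  qed (rule exI[of _ "{}"], blast)
  then obtain W2 where W2: "finite W2" "W2 \<subseteq> carrier N"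
    "\<forall>i c. token N i c \<longrightarrow> x \<in> carrier N \<longrightarrow> (\<exists>e \<in> W2. \<exists>a \<in> W2. Bel N e c \<and> Mem N e a \<and> Pick N e a x)"
    by blast
  have "\<exists>W. finite W \<and> W \<subseteq> carrier N \<and>
    (\<forall>i c. token N i c \<longrightarrow> Bel N x c \<longrightarrow> Bel N y c \<longrightarrow>
      (\<exists>a \<in> W. Mem N x a \<and> Pick N x a y) \<or> (\<exists>a \<in> W. Mem N y a \<and> Pick N y a x))"
  proof (cases "\<exists>i c. token N i c \<and> Bel N x c \<and> Bel N y c")
    case True
    then obtain i c where ic: "token N i c" "Bel N x c" "Bel N y c" by blast
    then obtain a where a: "Mem N x a \<and> Pick N x a y \<or> Mem N y a \<and> Pick N y a x"
      using okD(7)[OF N ic(1)] unfolding token_ok_def by blast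
    then show ?thesis using C(2) by (intro exI[of _ "{a}"]) blast
  qed (rule exI[of _ "{}"], blast)
  then obtain W3 where W3: "finite W3" "W3 \<subseteq> carrier N"
    "\<forall>i c. token N i c \<longrightarrow> Bel N x c \<longrightarrow> Bel N y c \<longrightarrow>
      (\<exists>a \<in> W3. Mem N x a \<and> Pick N x a y) \<or> (\<exists>a \<in> W3. Mem N y a \<and> Pick N y a x)"
    by blast
  have "\<exists>W. finite W \<and> W \<subseteq> carrier N \<and>
    (\<forall>l. lock N l \<longrightarrow> Row N x l \<longrightarrow> Bel N y l \<longrightarrow> (\<exists>a \<in> W. Mem N l a \<and> Col N x y a))"
  proof (cases "\<exists>l. lock N l \<and> Row N x l \<and> Bel N y l")
    case True
    then obtain l where l: "lock N l" "Row N x l" "Bel N y l" by blast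
    then obtain a where a: "Mem N l a" "Col N x y a"
      using okD(8)[OF N l(1)] unfolding lock_ok_def by blast
    have "l' = l" if "lock N l'" for l' using okD(6)[OF N that l(1)] .
    then show ?thesis using a C(2) by (intro exI[of _ "{a}"]) blast
  qed (rule exI[of _ "{}"], blast)
  then obtain W4 where W4: "finite W4" "W4 \<subseteq> carrier N"
    "\<forall>l. lock N l \<longrightarrow> Row N x l \<longrightarrow> Bel N y l \<longrightarrow> (\<exists>a \<in> W4. Mem N l a \<and> Col N x y a)"
    by blast
  show ?thesis
  proof (intro exI[of _ "W1 \<union> W2 \<union> W3 \<union> W4"] conjI)
    show "finite (W1 \<union> W2 \<union> W3 \<union> W4)" using W1 W2 W3 W4 by blast
    show "W1 \<union> W2 \<union> W3 \<union> W4 \<subseteq> carrier N" using W1 W2 W3 W4 by blast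
    show "dead N x \<longrightarrow> (\<exists>d \<in> W1 \<union> W2 \<union> W3 \<union> W4. Kill N x d)" using W1(3) by blast
    show "\<forall>i c. token N i c \<longrightarrow> x \<in> carrier N \<longrightarrow>
      (\<exists>e \<in> W1 \<union> W2 \<union> W3 \<union> W4. \<exists>a \<in> W1 \<union> W2 \<union> W3 \<union> W4. Bel N e c \<and> Mem N e a \<and> Pick N e a x)"
      using W2(3) by blast
    show "\<forall>i c. token N i c \<longrightarrow> Bel N x c \<longrightarrow> Bel N y c \<longrightarrow>
      (\<exists>a \<in> W1 \<union> W2 \<union> W3 \<union> W4. Mem N x a \<and> Pick N x a y) \<or>
      (\<exists>a \<in> W1 \<union> W2 \<union> W3 \<union> W4. Mem N y a \<and> Pick N y a x)"
      using W3(3) by blast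
    show "\<forall>l. lock N l \<longrightarrow> Row N x l \<longrightarrow> Bel N y l \<longrightarrow>
      (\<exists>a \<in> W1 \<union> W2 \<union> W3 \<union> W4. Mem N l a \<and> Col N x y a)"
      using W4(3) by blast
  qed
qed

text \<open>Closure under the killers in \<open>W\<close> ensures that an element that is dead in
  \<open>N\<close> remains dead in the restriction; hence no token or lock becomes active again.
  Universal clauses are inherited and existential ones are witnessed inside \<open>Z\<close>. As
  nothing active in \<open>Z\<close> is killed in \<open>N\<close>, the lock conditions of
  \<open>ext\<close> hold trivially.\<close>

lemma restrict_ok:
  assumes N: "ok N" and Z: "Z \<subseteq> carrier N" "Z \<noteq> {}"
    and W: "\<And>x y. x \<in> Z \<Longrightarrow> y \<in> Z \<Longrightarrow> W x y \<subseteq> Z"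
      "\<And>x y. dead N x \<longrightarrow> (\<exists>d \<in> W x y. Kill N x d)"
      "\<And>x y i c. token N i c \<longrightarrow> x \<in> carrier N \<longrightarrow>
        (\<exists>e \<in> W x y. \<exists>a \<in> W x y. Bel N e c \<and> Mem N e a \<and> Pick N e a x)"
      "\<And>x y i c. token N i c \<longrightarrow> Bel N x c \<longrightarrow> Bel N y c \<longrightarrow>
        (\<exists>a \<in> W x y. Mem N x a \<and> Pick N x a y) \<or> (\<exists>a \<in> W x y. Mem N y a \<and> Pick N y a x)"
      "\<And>x y l. lock N l \<longrightarrow> Row N x l \<longrightarrow> Bel N y l \<longrightarrow> (\<exists>a \<in> W x y. Mem N l a \<and> Col N x y a)"
    and parts: "\<And>t h. holder N t h \<Longrightarrow> h \<in> Z \<Longrightarrow>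
      strong (K t) (part (restrict_struct Z N) t h) (part N t h)"
  shows "ext (restrict_struct Z N) N"
proof -
  let ?M = "restrict_struct Z N"
  have sN: "is_struct voc N" using okD(1)[OF N] .
  have sub: "substruct ?M N" by (rule substruct_restrict[OF Z(1)])
  have c: "carrier ?M = Z" by (simp add: restrict_struct_def)
  have rM: "rel ?M y = rel N y \<inter> lists Z" for y by (simp add: rel_def restrict_struct_def)
  have sM: "is_struct voc ?M"
    unfolding is_struct_voc c
  proof (intro conjI allI impI Z(2))
    show "small Z" using Z(1) sN small_subset unfolding is_struct_def by blast
    show "rel ?M y \<subseteq> tuples (sym_arity y) Z" for y
      unfolding rM using rel_tuple(1)[OF sN] by (auto simp: tuples_def)
    show "interp ?M s = {}" if "s \<notin> voc" for s
      using sN that by (simp add: restrict_struct_def is_struct_def)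
  qed
  have up: "xs \<in> rel ?M y \<Longrightarrow> xs \<in> rel N y \<and> set xs \<subseteq> Z" for xs y
    unfolding rM by (auto simp: lists_eq_set)
  have dn: "xs \<in> rel N y \<Longrightarrow> set xs \<subseteq> Z \<Longrightarrow> xs \<in> rel ?M y" for xs y
    unfolding rM by (auto simp: lists_eq_set)
  have WZ: "w \<in> Z" if "w \<in> W x y" "x \<in> Z" "y \<in> Z" for w x y using W(1)[OF that(2,3)] that(1) by blast
  have dead: "dead ?M x \<longleftrightarrow> dead N x" if x: "x \<in> Z" for x
  proof
    show "dead ?M x \<Longrightarrow> dead N x" by (rule substruct_dead[OF sM sub])
    assume "dead N x"
    then obtain d where "d \<in> W x x" "Kill N x d" using W(2)[of x x] by blast
    then have "Kill ?M x d" using dn[of "[x, d]"] WZ x by auto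
    then show "dead ?M x" by (auto simp: dead_def)
  qed
  have hold: "holder N t h \<and> h \<in> Z" if "holder ?M t h" for t h
    using that substruct_holder[OF sub, unfolded c] holder_carrier[OF sM that] c by blast
  have tok: "token N i x \<and> x \<in> Z" if "token ?M i x" for i x
    using that token_carrier[OF sM that] dead up unfolding token_def c by blast
  have lck: "lock N x \<and> x \<in> Z" if "lock ?M x" for x
    using that lock_carrier[OF sM that] dead up unfolding lock_def c by blast
  have okM: "ok ?M"
    unfolding ok_def
  proof (intro conjI allI impI sM)
    show "part ?M t h \<in> models (K t)" if "holder ?M t h" for t h
      using parts hold[OF that] AEC.strong_models[OF aec[OF holder_type[OF that]]] by blast
    show "t = t'" if "holder ?M t h" "holder ?M t' h" for t t' h
      using okD(3)[OF N] hold that by blast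
    show "d = d'" if "Kill ?M x d" "Kill ?M x d'" for x d d'
      using okD(4)[OF N] up that by blast
    show "i = j" "a = a'" if "token ?M i a" "token ?M j a'" for i a j a'
      using okD(5)[OF N] tok that by blast+
    show "l = l'" if "lock ?M l" "lock ?M l'" for l l'
      using okD(6)[OF N] lck that by blast
    show "token_ok ?M i k" if k: "token ?M i k" for i k
    proof -
      have kN: "token N i k" "k \<in> Z" using tok[OF k] by auto
      note T = okD(7)[OF N kN(1), unfolded token_ok_def]
      show ?thesis
        unfolding token_ok_def c
      proof (intro conjI allI impI ballI)
        show "holder ?M i e" if e: "Bel ?M e k" for e
          using T up[OF e] substruct_holder[OF sub, unfolded c] by auto
        show "p = p'" if "Bel ?M e k" "Mem ?M e a" "Pick ?M e a p" "Pick ?M e a p'" for e a p p'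
          using T that[THEN up] by blast
        show "\<exists>e a. Bel ?M e k \<and> Mem ?M e a \<and> Pick ?M e a p" if p: "p \<in> Z" for p
        proof -
          obtain e a where *: "e \<in> W p p" "a \<in> W p p" "Bel N e k" "Mem N e a" "Pick N e a p"
            using W(3) kN(1) p Z(1) by blast
          have "e \<in> Z" "a \<in> Z" using WZ * p by blast+
          then have "Bel ?M e k" "Mem ?M e a" "Pick ?M e a p" using *(3-5)[THEN dn] p kN by auto
          then show ?thesis by blast
        qed
        show "(\<exists>a. Mem ?M e a \<and> Pick ?M e a f) \<or> (\<exists>a. Mem ?M f a \<and> Pick ?M f a e)"
          if "Bel ?M e k" "Bel ?M f k" for e f
        proof -
          have ef: "Bel N e k" "Bel N f k" "e \<in> Z" "f \<in> Z" using that[THEN up] by auto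
          then obtain a where *: "a \<in> W e f" "Mem N e a \<and> Pick N e a f \<or> Mem N f a \<and> Pick N f a e"
            using W(4) kN(1) by blast
          have "a \<in> Z" using WZ * ef by blast
          have "set [e, a] \<subseteq> Z" "set [f, a] \<subseteq> Z" "set [e, a, f] \<subseteq> Z" "set [f, a, e] \<subseteq> Z"
            using \<open>a \<in> Z\<close> ef by auto
          then show ?thesis using *(2) dn by meson
        qed
      qed
    qed
    show "lock_ok ?M l" if l: "lock ?M l" for l
    proof -
      have lN: "lock N l" "l \<in> Z" using lck[OF l] by auto
      note T = okD(8)[OF N lN(1), unfolded lock_ok_def]
      show ?thesis
        unfolding lock_ok_def
      proof (intro conjI allI impI)
        show "holder ?M b l" using T lN(2) substruct_holder[OF sub, unfolded c] by blast
        show "\<exists>a. Mem ?M l a \<and> Col ?M x d a" if "Row ?M x l" "Bel ?M d l" for x d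
        proof -
          have xd: "Row N x l" "Bel N d l" "x \<in> Z" "d \<in> Z" using that[THEN up] by auto
          then obtain a where *: "a \<in> W x d" "Mem N l a" "Col N x d a" using W(5) lN(1) by blast
          have "a \<in> Z" using WZ * xd by blast
          then show ?thesis using *(2,3)[THEN dn] xd lN(2) by auto
        qed
        show "d = d' \<or> loose \<and> x = x'"
          if "Row ?M x l" "Row ?M x' l" "Bel ?M d l" "Bel ?M d' l" "Mem ?M l a"
            "Col ?M x d a" "Col ?M x d' a" "Col ?M x' d a" "Col ?M x' d' a" for x x' d d' a
          using T that[THEN up] by blast
        show "\<not> Kill ?M a d" if "Mem ?M l a" for a d using T up that by blast
        show "lock_tuple ?M l y xs" if xs: "xs \<in> rel ?M y" "set xs \<subseteq> insert l {a. Mem ?M l a}" for y xs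
        proof -
          have "lock_tuple N l y xs" using T xs up by blast
          moreover have "Mem ?M l a" if "Mem N l a" "a \<in> set xs" for a
            using dn[OF that(1)] up[OF xs(1)] lN(2) that(2) by auto
          ultimately show ?thesis unfolding lock_tuple_def by fastforce
        qed
      qed
    qed
  qed
  show ?thesis
    unfolding ext_def
  proof (intro conjI allI impI okM N sub)
    show "strong (K t) (part ?M t h) (part N t h)" if "holder ?M t h" for t h
      using parts hold[OF that] by blast
    show "lock N l" if "lock ?M l" for l using lck[OF that] by blast
    show "Bel N d l" if "token ?M i k" "Kill N k d" for l i k d
      using tok[OF that(1)] that(2) unfolding token_def dead_def by blast
  qed
qed

text \<open>Closing under witnesses and choosing strong submodels of the parts interfere with one
  another, so both are alternated through the natural numbers. In the limit the restricted part of
  each holder is the union of a chain of strong submodels of its full part, hence strong in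
  it.\<close>

lemma ext_LS:
  assumes N: "ok N" and X: "X \<subseteq> carrier N" "|X| \<le>o \<mu>" and \<mu>: "Cinfinite \<mu>" "\<nu> \<le>o \<mu>"
  shows "\<exists>M. ext M N \<and> X \<subseteq> carrier M \<and> |carrier M| \<le>o \<mu>"
proof -
  have sN: "is_struct voc N" using okD(1)[OF N] .
  have \<nu>c: "Card_order \<nu>" using \<nu> Card_order_infinite_cardinal by blast
  obtain x0 where x0: "x0 \<in> carrier N" using sN by (auto simp: is_struct_def)
  define P where "P x y W \<longleftrightarrow> finite W \<and> W \<subseteq> carrier N \<and>
    (dead N x \<longrightarrow> (\<exists>d \<in> W. Kill N x d)) \<and>
    (\<forall>i c. token N i c \<longrightarrow> x \<in> carrier N \<longrightarrow> (\<exists>e \<in> W. \<exists>a \<in> W. Bel N e c \<and> Mem N e a \<and> Pick N e a x)) \<and>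
    (\<forall>i c. token N i c \<longrightarrow> Bel N x c \<longrightarrow> Bel N y c \<longrightarrow>
      (\<exists>a \<in> W. Mem N x a \<and> Pick N x a y) \<or> (\<exists>a \<in> W. Mem N y a \<and> Pick N y a x)) \<and>
    (\<forall>l. lock N l \<longrightarrow> Row N x l \<longrightarrow> Bel N y l \<longrightarrow> (\<exists>a \<in> W. Mem N l a \<and> Col N x y a))" for x y W
  define W where "W x y = (SOME W. P x y W)" for x y
  have W: "P x y (W x y)" for x y
    unfolding W_def by (rule someI_ex) (unfold P_def, rule small_witnesses[OF N])
  \<comment> \<open>\<open>B\<close> is to be a strong submodel of the part of \<open>h\<close> that
    covers those points of the part that are already in \<open>Z\<close>. For an element that is no
    holder the condition is empty.\<close>
  define Q where "Q h Z B \<longleftrightarrow> (\<forall>t. holder N t h \<longrightarrow> strong (K t) B (part N t h) \<and>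
    Z \<inter> carrier (part N t h) \<subseteq> carrier B \<and> |carrier B| \<le>o \<mu>)" for h Z B
  define B where "B h Z = (SOME B. Q h Z B)" for h Z
  have B: "Q h Z (B h Z)" if Z: "|Z| \<le>o \<mu>" for h Z
  proof -
    have "\<exists>B. Q h Z B"
    proof (cases "\<exists>t. holder N t h")
      case True
      then obtain t where t: "holder N t h" by blast
      have "|Z \<inter> carrier (part N t h)| \<le>o \<mu>" by (rule card_of_subset_le[OF _ Z]) simp
      then obtain B where "strong (K t) B (part N t h)" "Z \<inter> carrier (part N t h) \<subseteq> carrier B"
        "|carrier B| \<le>o \<mu>"
        using has_LS_propertyD[OF LS[OF holder_type[OF t]] okD(2)[OF N t] _ _ \<mu>(2,1) \<nu>c,
            of "Z \<inter> carrier (part N t h)"] by auto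
      then have "Q h Z B" unfolding Q_def using okD(3)[OF N _ t] by blast
      then show ?thesis by blast
    qed (auto simp: Q_def)
    then show ?thesis unfolding B_def by (rule someI_ex)
  qed
  define H where "H h Z = (if \<exists>t. holder N t h then carrier (B h Z) else {})" for h Z
  \<comment> \<open>The start contains \<open>x0\<close> so that the closure is nonempty even if
    \<open>X\<close> is empty.\<close>
  define Z where "Z = rec_nat (insert x0 X)
    (\<lambda>_ Z. Z \<union> (\<Union>x\<in>Z. \<Union>y\<in>Z. W x y) \<union> (\<Union>h\<in>Z. H h Z))"
  have Z0: "Z 0 = insert x0 X"
    and ZS: "Z (Suc n) = Z n \<union> (\<Union>x\<in>Z n. \<Union>y\<in>Z n. W x y) \<union> (\<Union>h\<in>Z n. H h (Z n))" for n
    by (simp_all add: Z_def)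
  have Zle: "|Z n| \<le>o \<mu>" for n
  proof (induction n)
    case 0
    show ?case unfolding Z0 by (rule card_of_insert_le[OF \<mu>(1) X(2)])
  next
    case (Suc n)
    have "|\<Union>y\<in>Z n. W x y| \<le>o \<mu>" for x
      by (rule card_of_UN_le[OF \<mu>(1) Suc]) (use W card_of_finite_le[OF \<mu>(1)] P_def in blast)
    then have 1: "|\<Union>x\<in>Z n. \<Union>y\<in>Z n. W x y| \<le>o \<mu>" by (rule card_of_UN_le[OF \<mu>(1) Suc])
    have "|H h (Z n)| \<le>o \<mu>" for h
      using B[OF Suc, of h] card_of_finite_le[OF \<mu>(1), of "{}"] unfolding H_def Q_def by auto
    then have "|\<Union>h\<in>Z n. H h (Z n)| \<le>o \<mu>" by (rule card_of_UN_le[OF \<mu>(1) Suc])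
    then show ?case unfolding ZS by (intro Un_Cinfinite_bound Suc 1 \<mu>(1))
  qed
  have HN: "H h (Z n) \<subseteq> carrier N" for h n
  proof (cases "\<exists>t. holder N t h")
    case True
    then obtain t where t: "holder N t h" by blast
    then have "strong (K t) (B h (Z n)) (part N t h)" using B[OF Zle] unfolding Q_def by blast
    then have "carrier (B h (Z n)) \<subseteq> carrier (part N t h)"
      using AEC.strong_carrier[OF aec[OF holder_type[OF t]]] by blast
    then show ?thesis using carrier_part_subset[OF sN] True unfolding H_def by auto
  qed (simp add: H_def)
  have WN: "W x y \<subseteq> carrier N" for x y using W[of x y] unfolding P_def by blast
  have ZN: "Z n \<subseteq> carrier N" for n
  proof (induction n)
    case 0
    then show ?case using x0 X(1) by (simp add: Z0)
  next
    case (Suc n)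
    then show ?case unfolding ZS using HN WN by blast
  qed
  have Zmono: "Z m \<subseteq> Z n" if "m \<le> n" for m n
    by (rule lift_Suc_mono_le[of Z, OF _ that]) (auto simp: ZS)
  define Zo where "Zo = (\<Union>n. Z n)"
  have ZoN: "Zo \<subseteq> carrier N" using ZN by (auto simp: Zo_def)
  have sub: "substruct (restrict_struct Zo N) N" by (rule substruct_restrict[OF ZoN])
  have sM: "\<And>t h. h \<in> Zo \<Longrightarrow> substruct (part (restrict_struct Zo N) t h) (part N t h)"
  proof -
    have c: "carrier (restrict_struct Zo N) = Zo" by (simp add: restrict_struct_def)
    have rM: "rel (restrict_struct Zo N) y = rel N y \<inter> lists Zo" for y
      by (simp add: rel_def restrict_struct_def)
    have "is_struct voc (restrict_struct Zo N)"
      unfolding is_struct_voc c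
    proof (intro conjI allI impI)
      show "Zo \<noteq> {}" using Z0 by (auto simp: Zo_def)
      show "small Zo" using ZoN sN small_subset unfolding is_struct_def by blast
      show "rel (restrict_struct Zo N) y \<subseteq> tuples (sym_arity y) Zo" for y
        unfolding rM using rel_tuple(1)[OF sN] by (auto simp: tuples_def)
      show "interp (restrict_struct Zo N) s = {}" if "s \<notin> voc" for s
        using sN that by (simp add: restrict_struct_def is_struct_def)
    qed
    then show "\<And>t h. h \<in> Zo \<Longrightarrow> substruct (part (restrict_struct Zo N) t h) (part N t h)"
      using substruct_part[OF _ sub] c by blast
  qed
  have "ext (restrict_struct Zo N) N"
  proof (rule restrict_ok[where W = W, OF N ZoN])
    show "Zo \<noteq> {}" using Z0 by (auto simp: Zo_def)
    show "W x y \<subseteq> Zo" if xy: "x \<in> Zo" "y \<in> Zo" for x y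
    proof -
      obtain m n where mn: "x \<in> Z m" "y \<in> Z n" using xy by (auto simp: Zo_def)
      then have "x \<in> Z (max m n)" "y \<in> Z (max m n)"
        using Zmono[of m "max m n"] Zmono[of n "max m n"] by auto
      then have "W x y \<subseteq> Z (Suc (max m n))" unfolding ZS by blast
      then show ?thesis by (auto simp: Zo_def)
    qed
    show "strong (K t) (part (restrict_struct Zo N) t h) (part N t h)" if h: "holder N t h" "h \<in> Zo" for t h
    proof -
      interpret A: AEC "K t" using aec[OF holder_type[OF h(1)]] .
      obtain n0 where n0: "h \<in> Z n0" using h(2) by (auto simp: Zo_def)
      \<comment> \<open>The shift by \<open>n0\<close> matters: submodels of the part of
        \<open>h\<close> are only added to the closure after \<open>h\<close> itself has appeared,
        at stage \<open>n0\<close>.\<close>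
      define A where "A n = B h (Z (n0 + n))" for n
      have A: "strong (K t) (A n) (part N t h)" "Z (n0 + n) \<inter> carrier (part N t h) \<subseteq> carrier (A n)" for n
        using B[OF Zle, of h] h(1) unfolding A_def Q_def by blast+
      have AZ: "carrier (A n) \<subseteq> Z (Suc (n0 + n)) \<inter> carrier (part N t h)" for n
      proof -
        have "h \<in> Z (n0 + n)" using n0 Zmono[of n0 "n0 + n"] by auto
        then have "H h (Z (n0 + n)) \<subseteq> Z (Suc (n0 + n))" unfolding ZS by blast
        moreover have "H h (Z (n0 + n)) = carrier (A n)" using h(1) by (auto simp: H_def A_def)
        ultimately show ?thesis using A.strong_carrier[OF A(1)] by auto
      qed
      have st: "strong (K t) (A n) (A (Suc n))" for n
      proof (rule A.coherence[OF A(1) A(1)])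
        show "substruct (A n) (A (Suc n))"
          by (rule substruct_common[OF A.strong_substruct[OF A(1)] A.strong_substruct[OF A(1)]])
            (use AZ[of n] A(2)[of "Suc n"] in auto)
      qed
      have un: "strong (K t) (union_struct UNIV A) (part N t h)"
        by (rule A.omega_chain[where A = A, OF infinite_UNIV_universe[OF universe] st A(1)])
      have "part (restrict_struct Zo N) t h = union_struct UNIV A"
      proof (rule substruct_common_eq[OF sM[OF h(2)] A.strong_substruct[OF un]])
        have "carrier (part (restrict_struct Zo N) t h) = Zo \<inter> carrier (part N t h)"
          using h(2) by (auto simp: part_def rel_def restrict_struct_def)
        also have "\<dots> = (\<Union>n. carrier (A n))"
        proof
          show "(\<Union>n. carrier (A n)) \<subseteq> Zo \<inter> carrier (part N t h)" using AZ by (auto simp: Zo_def)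
          show "Zo \<inter> carrier (part N t h) \<subseteq> (\<Union>n. carrier (A n))"
          proof
            fix x assume x: "x \<in> Zo \<inter> carrier (part N t h)"
            then obtain n where "x \<in> Z n" by (auto simp: Zo_def)
            then have "x \<in> Z (n0 + n)" using Zmono[of n "n0 + n"] by auto
            then show "x \<in> (\<Union>n. carrier (A n))" using A(2)[of n] x by blast
          qed
        qed
        finally show "carrier (part (restrict_struct Zo N) t h) = carrier (union_struct UNIV A)"
          by (simp add: union_struct_def)
      qed
      then show ?thesis using un by simp
    qed
  qed (use W in \<open>unfold P_def, blast+\<close>)
  moreover have "X \<subseteq> carrier (restrict_struct Zo N)"
    using Z0 by (auto simp: restrict_struct_def Zo_def)
  moreover have "|carrier (restrict_struct Zo N)| \<le>o \<mu>"
    unfolding restrict_struct_def Zo_def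
    by simp (intro card_of_UN_le[OF \<mu>(1)] Zle card_of_countable_le[OF \<mu>(1)], simp)
  ultimately show ?thesis by blast
qed

lemma L_LS: "has_LS_property L \<nu>"
  unfolding has_LS_property_def L_simps
proof (intro ballI allI impI)
  fix N X assume N: "N \<in> {M. ok M}" "X \<subseteq> carrier N"
  have \<nu>c: "Cinfinite \<nu>" "Card_order \<nu>"
    using \<nu> Cinfinite_infinite_cardinal Card_order_infinite_cardinal by blast+
  show "\<exists>M. ext M N \<and> X \<subseteq> carrier M \<and> |carrier M| \<le>o |X| +c \<nu>"
  proof (rule ext_LS)
    show "ok N" "X \<subseteq> carrier N" using N by auto
    show "|X| \<le>o |X| +c \<nu>" by (rule ordLeq_csum1) simp
    show "Cinfinite ( |X| +c \<nu>)" by (rule Cinfinite_csum[OF disjI2[OF \<nu>c(1)]])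
    show "\<nu> \<le>o |X| +c \<nu>" by (rule ordLeq_csum2[OF \<nu>c(2)])
  qed
qed

lemma L_AEC: "AEC L"
proof (unfold_locales, unfold L_simps)
  show "|voc| <o |UNIV :: 'u set|" by (rule voc_small)
  show "M \<in> {M. ok M} \<Longrightarrow> is_struct voc M" for M using okD(1) by blast
  show "M \<in> {M. ok M} \<Longrightarrow> iso f M N \<Longrightarrow> N \<in> {M. ok M}" for M f N using iso_ok okD(1) by blast
  show "ext M N \<Longrightarrow> iso f N N' \<Longrightarrow> iso f M M' \<Longrightarrow> ext M' N'" for M N f N' M' by (rule ext_iso)
  show "ext M N \<Longrightarrow> M \<in> {M. ok M} \<and> N \<in> {M. ok M}" for M N using extD(1,2) by blast
  show "ext M N \<Longrightarrow> substruct M N" for M N using extD(3) by blast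
  show "M \<in> {M. ok M} \<Longrightarrow> ext M M" for M using ext_refl by blast
  show "ext M N \<Longrightarrow> ext N P \<Longrightarrow> ext M P" for M N P by (rule ext_trans)
  show "ext M P \<Longrightarrow> ext N P \<Longrightarrow> substruct M N \<Longrightarrow> ext M N" for M P N by (rule ext_coherence)
  show "\<exists>\<kappa>. infinite_cardinal \<kappa> \<and> has_LS_property L \<kappa>" using L_LS \<nu> by blast
qed (use chain_union_ok chain_union_upper chain_union_least in blast)+

end

context lock_construction
begin

subsection \<open>Extensions by fresh elements\<close>

text \<open>Every added tuple meets the new points, so the old model remains a substructure.
  Membership and code tuples must moreover begin with a new point; this freezes the parts of all old
  holders.\<close>

definition fresh :: "'u struct \<Rightarrow> 'u set \<Rightarrow> (('i, 'u) sym \<Rightarrow> 'u list set) \<Rightarrow> bool" where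
  "fresh M F X \<longleftrightarrow> ok M \<and> F \<inter> carrier M = {} \<and> small F \<and>
     (\<forall>y xs. xs \<in> X y \<longrightarrow> y \<in> symbols \<and> length xs = sym_arity y \<and> set xs \<subseteq> carrier M \<union> F \<and>
        \<not> set xs \<subseteq> carrier M) \<and>
     (\<forall>h xs. h # xs \<in> X SMem \<longrightarrow> h \<in> F) \<and> (\<forall>t s h xs. h # xs \<in> X (SCode t s) \<longrightarrow> h \<in> F)"

definition add :: "'u struct \<Rightarrow> 'u set \<Rightarrow> (('i, 'u) sym \<Rightarrow> 'u list set) \<Rightarrow> 'u struct" where
  "add M F X = mk_struct (carrier M \<union> F) (\<lambda>y. rel M y \<union> X y)"

lemma carrier_add [simp]: "carrier (add M F X) = carrier M \<union> F"
  by (simp add: add_def)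

lemma freshD:
  assumes "fresh M F X"
  shows "ok M" "F \<inter> carrier M = {}" "small F"
    and "\<And>y xs. xs \<in> X y \<Longrightarrow> y \<in> symbols \<and> length xs = sym_arity y \<and> set xs \<subseteq> carrier M \<union> F \<and>
        \<not> set xs \<subseteq> carrier M"
    and "\<And>h xs. h # xs \<in> X SMem \<Longrightarrow> h \<in> F" "\<And>t s h xs. h # xs \<in> X (SCode t s) \<Longrightarrow> h \<in> F"
  using assms unfolding fresh_def by blast+

lemma rel_add: "fresh M F X \<Longrightarrow> rel (add M F X) y = rel M y \<union> X y"
  unfolding add_def rel_mk using freshD(4) by (auto simp: rel_def)

lemma add_struct:
  assumes "fresh M F X"
  shows "is_struct voc (add M F X)"
  unfolding add_def
proof (rule is_struct_mk)
  have sM: "is_struct voc M" using okD(1)[OF freshD(1)[OF assms]] .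
  show "carrier M \<union> F \<noteq> {}" using sM by (auto simp: is_struct_def)
  show "small (carrier M \<union> F)"
    using sM freshD(3)[OF assms] small_Un[OF universe] by (auto simp: is_struct_def)
  show "rel M y \<union> X y \<subseteq> tuples (sym_arity y) (carrier M \<union> F)" for y
    using rel_tuple(1,2)[OF sM] freshD(4)[OF assms] by (fastforce simp: tuples_def)
qed

lemma add_old:
  assumes "fresh M F X" "set xs \<subseteq> carrier M"
  shows "xs \<in> rel (add M F X) y \<longleftrightarrow> xs \<in> rel M y"
  unfolding rel_add[OF assms(1)] using freshD(4)[OF assms(1)] assms(2) by blast

lemma add_sub:
  assumes "fresh M F X"
  shows "substruct M (add M F X)"
  by (rule substruct_relI[OF okD(1)[OF freshD(1)[OF assms]] add_struct[OF assms]])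
    (simp_all add: add_old[OF assms])

lemma add_dead: "fresh M F X \<Longrightarrow> dead (add M F X) x \<longleftrightarrow> dead M x \<or> (\<exists>d. [x, d] \<in> X SKill)"
  by (auto simp: dead_def rel_add)

lemma add_holder: "fresh M F X \<Longrightarrow> h \<in> carrier M \<Longrightarrow> holder (add M F X) t h \<longleftrightarrow> holder M t h"
  using substruct_holder[OF add_sub] by blast

lemma add_part:
  assumes "fresh M F X" "h \<in> carrier M"
  shows "part (add M F X) t h = part M t h"
proof -
  have "h \<notin> F" using assms freshD(2) by blast
  then have "h # xs \<notin> X SMem" "h # xs \<notin> X (SCode t s)" for xs s
    using freshD(5,6)[OF assms(1)] by blast+
  then show ?thesis by (simp add: part_def rel_add[OF assms(1)])
qed

lemma add_token:
  "fresh M F X \<Longrightarrow> token (add M F X) i c \<longleftrightarrow>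
     (Tok M i c \<or> [c] \<in> X (STok i)) \<and> \<not> dead M c \<and> (\<nexists>d. [c, d] \<in> X SKill)"
  by (auto simp: token_def add_dead rel_add)

lemma add_lock:
  "fresh M F X \<Longrightarrow> lock (add M F X) l \<longleftrightarrow>
     (Lock M l \<or> [l] \<in> X SLock) \<and> \<not> dead M l \<and> (\<nexists>d. [l, d] \<in> X SKill)"
  by (auto simp: lock_def add_dead rel_add)

lemma add_ok:
  assumes f: "fresh M F X"
    and "\<And>t h. h \<in> F \<Longrightarrow> holder (add M F X) t h \<Longrightarrow> part (add M F X) t h \<in> models (K t)"
    and "\<And>t t' h. h \<in> F \<Longrightarrow> holder (add M F X) t h \<Longrightarrow> holder (add M F X) t' h \<Longrightarrow> t = t'"
    and "\<And>x d. [x, d] \<in> X SKill \<Longrightarrow> \<not> dead M x"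
    and "\<And>x d d'. [x, d] \<in> X SKill \<Longrightarrow> [x, d'] \<in> X SKill \<Longrightarrow> d = d'"
    and "\<And>i c j c'. token (add M F X) i c \<Longrightarrow> token (add M F X) j c' \<Longrightarrow> i = j \<and> c = c'"
    and "\<And>l l'. lock (add M F X) l \<Longrightarrow> lock (add M F X) l' \<Longrightarrow> l = l'"
    and "\<And>i c. token (add M F X) i c \<Longrightarrow> token_ok (add M F X) i c"
    and "\<And>l. lock (add M F X) l \<Longrightarrow> lock_ok (add M F X) l"
  shows "ok (add M F X)"
  unfolding ok_def
proof (intro conjI allI impI add_struct[OF f])
  note M = freshD(1)[OF f]
  have h: "h \<in> carrier M \<or> h \<in> F" if "holder (add M F X) t h" for t h
    using holder_carrier[OF add_struct[OF f] that] by simp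
  show "part (add M F X) t h \<in> models (K t)" if "holder (add M F X) t h" for t h
    using h[OF that] assms(2) okD(2)[OF M] add_holder[OF f] add_part[OF f] that by metis
  show "t = t'" if "holder (add M F X) t h" "holder (add M F X) t' h" for t t' h
    using h[OF that(1)] assms(3) okD(3)[OF M] add_holder[OF f] that by metis
  show "d = d'" if "Kill (add M F X) x d" "Kill (add M F X) x d'" for x d d'
    using that okD(4)[OF M] assms(4,5) unfolding rel_add[OF f] dead_def by blast
qed (use assms in blast)+

text \<open>Old parts do not change, so only the lock condition is at stake. Under a heavy lock this
  lemma allows no kill at all; extensions that kill by a new column are built by gluing
  instead.\<close>

lemma add_ext:
  assumes f: "fresh M F X" and "ok (add M F X)"
    and "X SKill = {} \<or> (\<forall>l. lock M l \<longrightarrow> \<not> heavy (part M b l))"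
  shows "ext M (add M F X)"
  unfolding ext_def
proof (intro conjI allI impI freshD(1)[OF f] assms(2) add_sub[OF f])
  have sM: "is_struct voc M" using okD(1)[OF freshD(1)[OF f]] .
  show "strong (K t) (part M t h) (part (add M F X) t h)" if "holder M t h" for t h
    using add_part[OF f holder_carrier[OF sM that]] AEC.strong_refl[OF aec[OF holder_type[OF that]]]
      okD(2)[OF freshD(1)[OF f] that] by simp
  fix l assume l: "lock M l" "heavy (part M b l)"
  then have X: "X SKill = {}" using assms(3) by blast
  then show "lock (add M F X) l" using l(1) add_lock[OF f] by (simp add: lock_def)
  show "Bel (add M F X) d l" if "token M i c" "Kill (add M F X) c d" for i c d
    using that X unfolding rel_add[OF f] token_def dead_def by blast
qed

text \<open>The rows, columns and points of the lock are all old, hence so is every cell. The three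
  conditions on \<open>X\<close> say that nothing new is attached to the lock and none of its points
  gets killed.\<close>

lemma add_lock_ok:
  assumes f: "fresh M F X" and l: "lock_ok M l"
    and X: "\<And>x. [x, l] \<notin> X SRow" "\<And>x. [x, l] \<notin> X SBel" "\<And>a d. Mem M l a \<Longrightarrow> [a, d] \<notin> X SKill"
  shows "lock_ok (add M F X) l"
proof -
  note R = rel_add[OF f] and O = l[unfolded lock_ok_def]
  have sM: "is_struct voc M" using okD(1)[OF freshD(1)[OF f]] .
  have lM: "l \<in> carrier M" using O holder_carrier[OF sM] by blast
  have "l \<notin> F" using freshD(2)[OF f] lM by blast
  then have mem: "Mem (add M F X) l a \<longleftrightarrow> Mem M l a" for a
    unfolding R using freshD(5)[OF f, of l "[a]"] by blast
  have C: "Col (add M F X) x d a \<longleftrightarrow> Col M x d a" if "Row M x l" "Bel M d l" "Mem M l a" for x d a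
    using add_old[OF f, of "[x, d, a]"] rel_carrier(2)[OF sM] that by auto
  show ?thesis
    unfolding lock_ok_def
  proof (intro conjI allI impI)
    show "holder (add M F X) b l" using O add_holder[OF f lM] by blast
    show "\<exists>a. Mem (add M F X) l a \<and> Col (add M F X) x d a"
      if "Row (add M F X) x l" "Bel (add M F X) d l" for x d
    proof -
      have "Row M x l" "Bel M d l" using that X(1,2) by (simp_all add: R)
      then obtain a where "Mem M l a" "Col M x d a" using O by blast
      then show ?thesis unfolding mem R by blast
    qed
    show "d = d' \<or> loose \<and> x = x'"
      if "Row (add M F X) x l" "Row (add M F X) x' l" "Bel (add M F X) d l" "Bel (add M F X) d' l"
        "Mem (add M F X) l a" and c: "Col (add M F X) x d a" "Col (add M F X) x d' a"
        "Col (add M F X) x' d a" "Col (add M F X) x' d' a" for x x' d d' a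
    proof -
      have H: "Row M x l" "Row M x' l" "Bel M d l" "Bel M d' l" "Mem M l a"
        using that(1-5) X(1,2) unfolding mem by (simp_all add: R)
      show ?thesis using H c O unfolding C[OF H(1,3,5)] C[OF H(1,4,5)] C[OF H(2,3,5)] C[OF H(2,4,5)]
        by blast
    qed
    show "\<not> Kill (add M F X) a d" if "Mem (add M F X) l a" for a d
    proof -
      have "Mem M l a" using that unfolding mem .
      then have "\<not> Kill M a d" "[a, d] \<notin> X SKill" using O X(3) by blast+
      then show ?thesis by (simp add: R)
    qed
    show "lock_tuple (add M F X) l y xs"
      if xs: "xs \<in> rel (add M F X) y" "set xs \<subseteq> insert l {a. Mem (add M F X) l a}" for y xs
    proof -
      have "set xs \<subseteq> carrier M" using xs(2) lM rel_carrier(2)[OF sM] unfolding mem by blast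
      then have "lock_tuple M l y xs" using O xs add_old[OF f] unfolding mem by blast
      then show ?thesis by (rule lock_tuple_mono) (simp add: mem)
    qed
  qed
qed

section \<open>Building blocks: holders, unmarked points, killers, new locks and new holders of a
  token\<close>

definition holder_rel :: "'i \<Rightarrow> 'u \<Rightarrow> 'u struct \<Rightarrow> ('i, 'u) sym \<Rightarrow> 'u list set" where
  "holder_rel t h A y = (case y of STyp t' \<Rightarrow> if t' = t then {[h]} else {}
     | SMem \<Rightarrow> (\<lambda>a. [h, a]) ` carrier A
     | SCode t' s \<Rightarrow> if t' = t then (#) h ` interp A s else {} | _ \<Rightarrow> {})"

lemma part_eqI:
  assumes "A \<in> models (K t)" "t \<in> I" "\<And>a. Mem N h a \<longleftrightarrow> a \<in> carrier A"
    and "\<And>s xs. s \<in> vocab (K t) \<Longrightarrow> h # xs \<in> rel N (SCode t s) \<longleftrightarrow> xs \<in> interp A s"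
  shows "part N t h = A"
proof (rule struct_eqI)
  have A: "is_struct (vocab (K t)) A" using AEC.models_struct[OF aec[OF assms(2)] assms(1)] .
  show "carrier (part N t h) = carrier A" using assms(3) by (simp add: part_def)
  show "interp (part N t h) s = interp A s" for s
  proof (cases "s \<in> vocab (K t)")
    case True
    have "interp A s \<subseteq> {xs. set xs \<subseteq> carrier A}" using is_struct_interp[OF A, of _ s] by blast
    then show ?thesis using assms(3) assms(4)[OF True] by (auto simp: part_def lists_eq_set)
  next
    case False
    then have "SCode t s \<notin> symbols" by (auto simp: symbols_def)
    then show ?thesis using False A by (simp add: part_def rel_def is_struct_def)
  qed
qed

lemma holder_rel_tuple:
  assumes "A \<in> models (K t)" "t \<in> I" "xs \<in> holder_rel t h A y"
  shows "y \<in> symbols \<and> length xs = sym_arity y \<and> set xs \<subseteq> insert h (carrier A) \<and> hd xs = h \<and> xs \<noteq> []"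
proof -
  have A: "is_struct (vocab (K t)) A" using AEC.models_struct[OF aec[OF assms(2)] assms(1)] .
  show ?thesis
  proof (cases y)
    case (SCode t' s)
    then obtain zs where zs: "t' = t" "xs = h # zs" "zs \<in> interp A s"
      using assms(3) by (auto simp: holder_rel_def split: if_splits)
    have s: "s \<in> vocab (K t)" "set zs \<subseteq> carrier A" using is_struct_interp[OF A zs(3)] by auto
    moreover have "length zs = symb_length s"
      using A s zs(3) by (cases s) (fastforce simp: is_struct_def tuples_def)+
    ultimately show ?thesis using zs SCode assms(2) by (auto simp: symbols_def)
  qed (use assms in \<open>auto simp: holder_rel_def symbols_def split: if_splits\<close>)
qed

lemma symbolsI: "SLock \<in> symbols" "SRed \<in> symbols" "SMem \<in> symbols" "SBel \<in> symbols" "SRow \<in> symbols"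
  "SKill \<in> symbols" "SPick \<in> symbols" "SCol \<in> symbols" "t \<in> I \<Longrightarrow> STyp t \<in> symbols"
  "t \<in> I \<Longrightarrow> STok t \<in> symbols" "t \<in> I \<Longrightarrow> s \<in> vocab (K t) \<Longrightarrow> SCode t s \<in> symbols"
  by (auto simp: symbols_def)

lemma plain_ok:
  assumes "C \<noteq> {}" "small C"
  shows "ok (mk_struct C (\<lambda>_. {}))"
proof -
  have r: "rel (mk_struct C (\<lambda>_. {})) y = {}" for y by (simp add: rel_mk)
  have "is_struct voc (mk_struct C (\<lambda>_. {}))" by (rule is_struct_mk[OF assms]) simp
  then show ?thesis
    unfolding ok_def holder_def token_def lock_def r by blast
qed

lemma plain_rel: "rel (mk_struct C (\<lambda>_. {})) y = {}"
  by (simp add: rel_mk)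

text \<open>The only clause that an unmarked point can violate is that the active token picks every
  point. So without an active token no model is maximal.\<close>

lemma add_plain:
  assumes M: "ok M" "\<And>i c. \<not> token M i c" and p: "p \<notin> carrier M"
  shows "ext M (add M {p} (\<lambda>_. {}))"
proof -
  have f: "fresh M {p} (\<lambda>_. {})"
    using M(1) p small_finite[OF universe, of "{p}"] by (simp add: fresh_def)
  have "ok (add M {p} (\<lambda>_. {}))"
  proof (rule add_ok[OF f])
    show "lock_ok (add M {p} (\<lambda>_. {})) l" if "lock (add M {p} (\<lambda>_. {})) l" for l
      by (rule add_lock_ok[OF f okD(8)[OF M(1)]]) (use that add_lock[OF f] in \<open>simp_all add: lock_def\<close>)
    show "l = l'" if "lock (add M {p} (\<lambda>_. {})) l" "lock (add M {p} (\<lambda>_. {})) l'" for l l'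
      using okD(6)[OF M(1)] that add_lock[OF f] by (simp add: lock_def)
    show "i = j \<and> c = c'" if "token (add M {p} (\<lambda>_. {})) i c" for i c j c'
      using M(2)[of i c] that add_token[OF f] by (simp add: token_def)
    show "token_ok (add M {p} (\<lambda>_. {})) i c" if "token (add M {p} (\<lambda>_. {})) i c" for i c
      using M(2)[of i c] that add_token[OF f] by (simp add: token_def)
    have "\<not> holder (add M {p} (\<lambda>_. {})) t p" for t
      using rel_carrier(1)[OF okD(1)[OF M(1)]] p by (auto simp: holder_def rel_add[OF f])
    then show "part (add M {p} (\<lambda>_. {})) t h \<in> models (K t)"
      if "h \<in> {p}" "holder (add M {p} (\<lambda>_. {})) t h" for t h using that by blast
    show "t = t'" if "h \<in> {p}" "holder (add M {p} (\<lambda>_. {})) t h" for t t' h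
      using that \<open>\<And>t. \<not> holder (add M {p} (\<lambda>_. {})) t p\<close> by blast
  qed simp_all
  then show ?thesis by (rule add_ext[OF f]) simp
qed

text \<open>The choice of \<open>R\<close> decides whether the killer \<open>d\<close> is red. The
  two choices produce the extensions that cannot be amalgamated.\<close>

lemma add_killer:
  assumes M: "ok M" "\<And>i c. \<not> token M i c" "\<And>l. \<not> lock M l"
    and x: "x \<in> carrier M" "\<not> dead M x" and d: "d \<notin> carrier M" and R: "R \<subseteq> {[d]}"
  defines "X \<equiv> (\<lambda>y. if y = SKill then {[x, d]} else if y = SRed then R else {})"
  shows "ext M (add M {d} X)" "Kill (add M {d} X) x d" "Red (add M {d} X) d \<longleftrightarrow> [d] \<in> R"
proof -
  have f: "fresh M {d} X"
    unfolding fresh_def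
  proof (intro conjI allI impI M(1))
    show "{d} \<inter> carrier M = {}" "small {d}" using d small_finite[OF universe, of "{d}"] by auto
  qed (use x d R symbolsI in \<open>auto simp: X_def split: if_splits\<close>)
  show "Kill (add M {d} X) x d" unfolding rel_add[OF f] by (simp add: X_def)
  show "Red (add M {d} X) d \<longleftrightarrow> [d] \<in> R"
    using rel_carrier(1)[OF okD(1)[OF M(1)]] d unfolding rel_add[OF f] by (auto simp: X_def)
  have "ok (add M {d} X)"
  proof (rule add_ok[OF f])
    have "\<not> holder (add M {d} X) t d" for t
      using rel_carrier(1)[OF okD(1)[OF M(1)]] d unfolding holder_def rel_add[OF f] by (auto simp: X_def)
    then show "part (add M {d} X) t h \<in> models (K t)" "t = t'"
      if "h \<in> {d}" "holder (add M {d} X) t h" for t h t' using that by blast+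
    have nt: "\<not> token (add M {d} X) i c" for i c
      using M(2)[of i c] unfolding add_token[OF f] by (auto simp: token_def X_def)
    show "i = j \<and> c = c'" if "token (add M {d} X) i c" for i c j c' using nt that by blast
    show "token_ok (add M {d} X) i c" if "token (add M {d} X) i c" for i c using nt that by blast
    have nl: "\<not> lock (add M {d} X) l" for l
      using M(3)[of l] unfolding add_lock[OF f] by (auto simp: lock_def X_def)
    show "l = l'" if "lock (add M {d} X) l" for l l' using nl that by blast
    show "lock_ok (add M {d} X) l" if "lock (add M {d} X) l" for l using nl that by blast
    show "\<not> dead M x'" if "[x', d'] \<in> X SKill" for x' d' using that x(2) by (simp add: X_def)
    show "d' = d''" if "[x', d'] \<in> X SKill" "[x', d''] \<in> X SKill" for x' d' d''
      using that by (simp add: X_def)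
  qed
  then show "ext M (add M {d} X)" by (rule add_ext[OF f]) (use M(3) in blast)
qed

text \<open>
  A new lock may replace an active lock that is not heavy.  In the new lock, the colour of
  a cell determines and is determined by its column.
\<close>

lemma add_new_lock:
  assumes M: "ok M" "\<And>l. lock M l \<Longrightarrow> \<not> heavy (part M b l)"
    and A: "A \<in> models (K b)"
    and disj: "l \<notin> carrier A" "l \<notin> Rw" "l \<notin> D" "carrier A \<inter> Rw = {}" "carrier A \<inter> D = {}" "Rw \<inter> D = {}"
    and F: "insert l (carrier A \<union> Rw \<union> D) \<inter> carrier M = {}" "small Rw" "small D"
    and col: "inj_on col D" "col ` D \<subseteq> carrier A"
    and S: "S \<subseteq> D"
  defines "X \<equiv> (\<lambda>y. holder_rel b l A y \<union> (case y of SLock \<Rightarrow> {[l]} | SRow \<Rightarrow> (\<lambda>x. [x, l]) ` Rw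
      | SBel \<Rightarrow> (\<lambda>d. [d, l]) ` D | SCol \<Rightarrow> {[x, d, col d] | x d. x \<in> Rw \<and> d \<in> D}
      | SRed \<Rightarrow> (\<lambda>d. [d]) ` S | SKill \<Rightarrow> {[x, l] | x. lock M x \<or> (\<exists>i. token M i x)} | _ \<Rightarrow> {}))"
  defines "N \<equiv> add M (insert l (carrier A \<union> Rw \<union> D)) X"
  shows "ext M N" "lock N l" "part N b l = A" "\<And>i c. \<not> token N i c"
    and "\<And>x. Row N x l \<longleftrightarrow> x \<in> Rw" "\<And>d. Bel N d l \<longleftrightarrow> d \<in> D"
    and "\<And>x d a. x \<in> Rw \<Longrightarrow> Col N x d a \<longleftrightarrow> d \<in> D \<and> a = col d"
    and "\<And>d. d \<in> D \<Longrightarrow> Red N d \<longleftrightarrow> d \<in> S"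
proof -
  note sM = okD(1)[OF M(1)] and C = rel_carrier[OF okD(1)[OF M(1)]]
  let ?F = "insert l (carrier A \<union> Rw \<union> D)"
  have smallA: "small (carrier A)" using AEC.models_small[OF aec[OF b] A] .
  note HT = holder_rel_tuple[OF A b]
  have f: "fresh M ?F X"
    unfolding fresh_def
  proof (intro conjI allI impI M(1) F(1))
    show "small ?F" by (intro small_insert[OF universe] small_Un[OF universe] smallA F)
    have lM: "l \<notin> carrier M" using F(1) by blast
    fix y xs assume xs: "xs \<in> X y"
    show "y \<in> symbols" using xs HT symbolsI by (cases y) (auto simp: X_def)
    show "length xs = sym_arity y" using xs HT by (cases y) (auto simp: X_def)
    show "set xs \<subseteq> carrier M \<union> ?F"
      using xs HT[of xs] col(2) S lock_carrier[OF sM] token_carrier[OF sM] by (cases y) (auto simp: X_def)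
    have "\<not> set xs \<subseteq> carrier M" if "xs \<in> holder_rel b l A y"
      using HT[OF that] lM by (cases xs) auto
    then show "\<not> set xs \<subseteq> carrier M"
      using xs lM F(1) S by (cases y) (auto simp: X_def)
  next
    show "h \<in> ?F" if "h # xs \<in> X SMem" for h xs using that by (auto simp: X_def holder_rel_def)
    show "h \<in> ?F" if "h # xs \<in> X (SCode t s)" for h xs t s
      using that by (auto simp: X_def holder_rel_def split: if_splits)
  qed
  note R = rel_add[OF f, folded N_def]
  have nF: "x \<notin> carrier M" if "x \<in> ?F" for x using that F(1) by blast
  have lnF: "l \<notin> carrier M" by (rule nF) simp
  have hd: "h # xs \<notin> rel M y" if "h \<in> ?F" for h xs y
    using rel_tuple(2)[OF sM, of "h # xs" y] nF[OF that] by auto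
  have mem: "Mem N l a \<longleftrightarrow> a \<in> carrier A" for a
    unfolding R using hd[of l] by (auto simp: X_def holder_rel_def)
  show p: "part N b l = A"
  proof (rule part_eqI[OF A b mem])
    show "l # xs \<in> rel N (SCode b s) \<longleftrightarrow> xs \<in> interp A s" for s xs
      unfolding R using hd[of l] by (auto simp: X_def holder_rel_def)
  qed
  have hF: "t = b \<and> h = l" if "h \<in> ?F" "holder N t h" for t h
    using that hd[of h] unfolding holder_def R by (auto simp: X_def holder_rel_def split: if_splits)
  have nA: "l \<notin> carrier A" by fact
  have hl: "holder N b l" unfolding holder_def mem using nA by (simp add: R X_def holder_rel_def)
  \<comment> \<open>The lock \<open>l\<close> itself kills every active token and every active lock
    of \<open>M\<close>; the relation for tokens and locks adds no new token.\<close>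
  show nt: "\<not> token N i c" for i c
  proof
    assume "token N i c"
    then have "Tok M i c" "\<not> dead M c" "[c, l] \<notin> X SKill"
      unfolding N_def add_token[OF f] by (auto simp: X_def holder_rel_def)
    then show False by (auto simp: X_def token_def)
  qed
  have ll: "x = l" if "lock N x" for x
  proof -
    have "(Lock M x \<or> x = l) \<and> \<not> dead M x \<and> [x, l] \<notin> X SKill"
      using that unfolding N_def add_lock[OF f] by (auto simp: X_def holder_rel_def)
    then show ?thesis by (auto simp: X_def lock_def)
  qed
  have ndl: "[x, d] \<notin> rel N SKill" if "x \<in> ?F" for x d
    using hd[OF that] nF[OF that] lock_carrier[OF sM] token_carrier[OF sM]
    unfolding R by (auto simp: X_def holder_rel_def)
  show lN: "lock N l" using ndl[of l] unfolding lock_def dead_def by (auto simp: R X_def)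
  show row: "Row N x l \<longleftrightarrow> x \<in> Rw" for x
    using C(2) lnF unfolding R by (auto simp: X_def holder_rel_def)
  show bel: "Bel N d l \<longleftrightarrow> d \<in> D" for d
    using C(2) lnF unfolding R by (auto simp: X_def holder_rel_def)
  show coln: "Col N x d a \<longleftrightarrow> d \<in> D \<and> a = col d" if "x \<in> Rw" for x d a
    using C(3) nF[of x] that unfolding R by (auto simp: X_def holder_rel_def)
  show "Red N d \<longleftrightarrow> d \<in> S" if "d \<in> D" for d
    using C(1) nF[of d] that unfolding R by (auto simp: X_def holder_rel_def)
  have lok: "lock_ok N l"
    unfolding lock_ok_def
  proof (intro conjI allI impI hl)
    show "\<exists>a. Mem N l a \<and> Col N x d a" if "Row N x l" "Bel N d l" for x d
      using that col(2) unfolding row bel mem by (auto simp: coln)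
    \<comment> \<open>Within a row the colour determines the column because \<open>col\<close> is
      injective. So there is no monochromatic rectangle, not even one with a single row, and the new
      lock is correct for either value of \<open>loose\<close>.\<close>
    show "d = d' \<or> loose \<and> x = x'"
      if "Row N x l" "Row N x' l" "Bel N d l" "Bel N d' l" "Col N x d a" "Col N x d' a" for x x' d d' a
      using that col(1) unfolding row bel by (auto simp: coln inj_on_def)
    show "\<not> Kill N a d" if "Mem N l a" for a d using ndl[of a d] that unfolding mem by blast
    show "lock_tuple N l y xs" if xs: "xs \<in> rel N y" "set xs \<subseteq> insert l {a. Mem N l a}" for y xs
    proof -
      have xsA: "set xs \<subseteq> insert l (carrier A)" using xs(2) by (simp add: mem)
      have "xs \<noteq> []" using rel_tuple(1)[OF add_struct[OF f, folded N_def] xs(1)] by (cases y) auto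
      then have "xs \<notin> rel M y" using hd xsA by (cases xs) auto
      then have X: "xs \<in> X y" using xs(1) by (simp add: R)
      show ?thesis
      proof (cases "xs \<in> holder_rel b l A y")
        case True
        show ?thesis
        proof (cases y)
          case (SCode t s)
          then obtain zs where zs: "t = b" "xs = l # zs" "zs \<in> interp A s"
            using True by (auto simp: holder_rel_def split: if_splits)
          have "set zs \<subseteq> carrier A"
            using is_struct_interp[OF AEC.models_struct[OF aec[OF b] A] zs(3)] by blast
          then show ?thesis using zs SCode unfolding lock_tuple_def mem by blast
        qed (use True in \<open>auto simp: lock_tuple_def mem holder_rel_def split: if_splits\<close>)
      next
        case False
        have fM: "x \<notin> insert l (carrier A)" if "x \<in> carrier M" for x using that F(1) by blast
        have z1: "x \<in> Rw \<Longrightarrow> x \<in> carrier A \<Longrightarrow> False" "x \<in> D \<Longrightarrow> x \<in> carrier A \<Longrightarrow> False"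
          "x \<in> S \<Longrightarrow> x \<in> carrier A \<Longrightarrow> False" "lock M x \<Longrightarrow> x \<in> carrier A \<Longrightarrow> False"
          "token M i x \<Longrightarrow> x \<in> carrier A \<Longrightarrow> False" for x i
          using disj S fM lock_carrier[OF sM] token_carrier[OF sM] by blast+
        have z2: "l \<notin> S" "l \<notin> D" "l \<notin> Rw" "\<not> lock M l" "\<not> token M i l" for i
          using disj S fM[of l] lock_carrier[OF sM] token_carrier[OF sM] by blast+
        have "\<not> set xs \<subseteq> insert l (carrier A)" if "y \<noteq> SLock"
          using X False that by (cases y) (auto simp: X_def z2 dest: z1)
        then have "y = SLock" using xsA by blast
        then show ?thesis using X by (auto simp: X_def lock_tuple_def holder_rel_def)
      qed
    qed
  qed
  have okN: "ok N"
    unfolding N_def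
  proof (rule add_ok[OF f], fold N_def)
    show "part N t h \<in> models (K t)" if "h \<in> ?F" "holder N t h" for t h
      using hF[OF that] p A by simp
    show "t = t'" if "h \<in> ?F" "holder N t h" "holder N t' h" for t t' h using hF that by blast
    show "\<not> dead M x" if "[x, d] \<in> X SKill" for x d
      using that by (auto simp: X_def holder_rel_def lock_def token_def)
    show "d = d'" if "[x, d] \<in> X SKill" "[x, d'] \<in> X SKill" for x d d'
      using that by (auto simp: X_def holder_rel_def)
    show "i = j \<and> c = c'" if "token N i c" for i c j c' using nt that by blast
    show "token_ok N i c" if "token N i c" for i c using nt that by blast
    show "x = x'" if "lock N x" "lock N x'" for x x' using ll that by blast
    show "lock_ok N x" if "lock N x" for x using ll[OF that] lok by simp
  qed
  show "ext M N" unfolding N_def by (rule add_ext[OF f okN[unfolded N_def]]) (use M(2) in blast)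
qed

text \<open>
  New holders for the active token \<open>c\<close>, which is either an active token of \<open>M\<close> or itself new.
\<close>

lemma add_token_holders:
  assumes M: "ok M" and i: "i \<in> I"
    and c: "token M i c \<and> Cn = {} \<or> Cn = {c} \<and> c \<notin> carrier M \<and> (\<forall>j x. \<not> token M j x)"
    and A: "\<And>e. e \<in> E \<Longrightarrow> A e \<in> models (K i)"
    and disj: "c \<notin> E" "\<And>e. e \<in> E \<Longrightarrow> insert c E \<inter> carrier (A e) = {}"
    and F: "(Cn \<union> E \<union> (\<Union>e\<in>E. carrier (A e))) \<inter> carrier M = {}" "small (Cn \<union> E \<union> (\<Union>e\<in>E. carrier (A e)))"
    and g: "\<And>e a. e \<in> E \<Longrightarrow> a \<in> carrier (A e) \<Longrightarrow>
        g e a \<in> carrier M \<union> (Cn \<union> E \<union> (\<Union>e\<in>E. carrier (A e)))"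
      "\<And>p. p \<in> carrier M \<union> (Cn \<union> E \<union> (\<Union>e\<in>E. carrier (A e))) \<Longrightarrow> \<exists>e\<in>E. p \<in> g e ` carrier (A e)"
      "\<And>e f. e \<in> E \<Longrightarrow> f \<in> E \<Longrightarrow> f \<in> g e ` carrier (A e) \<or> e \<in> g f ` carrier (A f)"
      "\<And>e f. e \<in> E \<Longrightarrow> Bel M f c \<Longrightarrow> f \<in> g e ` carrier (A e)"
    and S: "S \<subseteq> E" "Ord \<subseteq> E \<times> E"
  defines "X \<equiv> (\<lambda>y. (\<Union>e\<in>E. holder_rel i e (A e) y) \<union> (case y of STok j \<Rightarrow> if j = i then (\<lambda>x. [x]) ` Cn else {}
      | SBel \<Rightarrow> (\<lambda>e. [e, c]) ` E \<union> (\<lambda>(e, f). [e, f]) ` Ord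
      | SPick \<Rightarrow> {[e, a, g e a] | e a. e \<in> E \<and> a \<in> carrier (A e)}
      | SRed \<Rightarrow> (\<lambda>e. [e]) ` S | _ \<Rightarrow> {}))"
  defines "N \<equiv> add M (Cn \<union> E \<union> (\<Union>e\<in>E. carrier (A e))) X"
  shows "ext M N" "token N i c" "\<And>e. e \<in> E \<Longrightarrow> part N i e = A e \<and> holder N i e"
    and "\<And>e. e \<in> E \<Longrightarrow> Bel N e c" "c \<notin> carrier M \<Longrightarrow> Bel N e c \<Longrightarrow> e \<in> E"
    and "\<And>e a. e \<in> E \<Longrightarrow> a \<in> carrier (A e) \<Longrightarrow> Pick N e a (g e a)"
    and "\<And>e. e \<in> E \<Longrightarrow> Red N e \<longleftrightarrow> e \<in> S"
    and "\<And>e f. e \<in> E \<Longrightarrow> f \<in> E \<Longrightarrow> Bel N e f \<longleftrightarrow> (e, f) \<in> Ord"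
    and "rel N SKill = rel M SKill" "rel N SLock = rel M SLock"
proof -
  note sM = okD(1)[OF M] and C = rel_carrier[OF okD(1)[OF M]]
  let ?F = "Cn \<union> E \<union> (\<Union>e\<in>E. carrier (A e))"
  note HT = holder_rel_tuple[OF A i]
  have cMF: "c \<in> carrier M \<union> ?F" using c token_carrier[OF sM] by auto
  have EM: "e \<notin> carrier M" if "e \<in> E" for e using F(1) that by blast
  have f: "fresh M ?F X"
    unfolding fresh_def
  proof (intro conjI allI impI M F)
    fix y xs assume xs: "xs \<in> X y"
    have H: "y \<in> symbols \<and> length xs = sym_arity y \<and> set xs \<subseteq> carrier M \<union> ?F \<and> \<not> set xs \<subseteq> carrier M"
      if "e \<in> E" "xs \<in> holder_rel i e (A e) y" for e
      using HT[OF that] that(1) EM[OF that(1)] by (cases xs) auto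
    have "y \<in> symbols \<and> length xs = sym_arity y \<and> set xs \<subseteq> carrier M \<union> ?F \<and> \<not> set xs \<subseteq> carrier M"
    proof (cases "\<exists>e \<in> E. xs \<in> holder_rel i e (A e) y")
      case True
      then show ?thesis using H by blast
    next
      case False
      then have *: "xs \<in> (case y of STok j \<Rightarrow> if j = i then (\<lambda>x. [x]) ` Cn else {}
      | SBel \<Rightarrow> (\<lambda>e. [e, c]) ` E \<union> (\<lambda>(e, f). [e, f]) ` Ord
      | SPick \<Rightarrow> {[e, a, g e a] | e a. e \<in> E \<and> a \<in> carrier (A e)}
      | SRed \<Rightarrow> (\<lambda>e. [e]) ` S | _ \<Rightarrow> {})" using xs by (auto simp: X_def)
      have 1: "y \<in> symbols" using * symbolsI i by (cases y) (auto split: if_splits)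
      have 2: "length xs = sym_arity y" using * by (cases y) (auto split: if_splits)
      have 3: "set xs \<subseteq> carrier M \<union> ?F"
      proof (cases "y = SPick")
        case True
        then obtain e a where "xs = [e, a, g e a]" "e \<in> E" "a \<in> carrier (A e)" using * by auto
        then show ?thesis using g(1)[of e a] by auto
      next
        case False
        then show ?thesis using * cMF S by (cases y) (auto split: if_splits)
      qed
      have "c \<notin> carrier M" if "Cn \<noteq> {}" using c that by blast
      then have 4: "\<not> set xs \<subseteq> carrier M" using * EM S c by (cases y) (auto split: if_splits)
      show ?thesis using 1 2 3 4 by blast
    qed
    then show "y \<in> symbols" "length xs = sym_arity y" "set xs \<subseteq> carrier M \<union> ?F" "\<not> set xs \<subseteq> carrier M"
      by blast+
  next
    show "h \<in> ?F" if "h # xs \<in> X SMem" for h xs using that by (auto simp: X_def holder_rel_def)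
    show "h \<in> ?F" if "h # xs \<in> X (SCode t s)" for h xs t s
      using that by (auto simp: X_def holder_rel_def split: if_splits)
  qed
  note R = rel_add[OF f, folded N_def]
  have nF: "x \<notin> carrier M" if "x \<in> ?F" for x using that F(1) by blast
  have hd: "h # xs \<notin> rel M y" if "h \<in> ?F" for h xs y
    using rel_tuple(2)[OF sM, of "h # xs" y] nF[OF that] by auto
  have mem: "Mem N e a \<longleftrightarrow> a \<in> carrier (A e)" if "e \<in> E" for e a
    unfolding R using hd[of e] that by (auto simp: X_def holder_rel_def)
  have p: "part N i e = A e" if e: "e \<in> E" for e
  proof (rule part_eqI[OF A[OF e] i mem[OF e]])
    show "e # xs \<in> rel N (SCode i s) \<longleftrightarrow> xs \<in> interp (A e) s" for s xs
      unfolding R using hd[of e] e by (auto simp: X_def holder_rel_def)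
  qed
  have hl: "holder N i e" if "e \<in> E" for e
    using disj(2)[OF that] that unfolding holder_def mem[OF that] by (auto simp: R X_def holder_rel_def)
  then show "\<And>e. e \<in> E \<Longrightarrow> part N i e = A e \<and> holder N i e" using p by blast
  have hF: "t = i \<and> h \<in> E" if "h \<in> ?F" "holder N t h" for t h
    using that hd[of h] unfolding holder_def R by (auto simp: X_def holder_rel_def split: if_splits)
  show kill: "rel N SKill = rel M SKill" by (simp add: R X_def holder_rel_def)
  show lk: "rel N SLock = rel M SLock" by (simp add: R X_def holder_rel_def)
  have lockN: "lock N l \<longleftrightarrow> lock M l" for l unfolding lock_def dead_def kill lk ..
  have tokN: "token N j x \<longleftrightarrow> token M j x \<or> j = i \<and> x \<in> Cn" for j x
  proof -
    have "\<not> dead M x" if "x \<in> Cn" using that c C(2) by (auto simp: dead_def)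
    then show ?thesis unfolding token_def dead_def kill by (auto simp: R X_def holder_rel_def)
  qed
  show tc: "token N i c" using tokN c by auto
  have tu: "j = i \<and> x = c" if "token N j x" for j x
    using that tokN c okD(5)[OF M] by blast
  show bel: "Bel N e c" if "e \<in> E" for e using that by (auto simp: R X_def)
  have belD: "e \<in> E \<or> Bel M e c" if "Bel N e c" for e
    using that S(2) disj(1) by (auto simp: R X_def holder_rel_def)
  show "e \<in> E" if "c \<notin> carrier M" "Bel N e c" for e using belD[OF that(2)] C(2) that(1) by blast
  have pickE: "Pick N e a q \<longleftrightarrow> a \<in> carrier (A e) \<and> q = g e a" if "e \<in> E" for e a q
    using hd[of e] that by (auto simp: R X_def holder_rel_def)
  then show "\<And>e a. e \<in> E \<Longrightarrow> a \<in> carrier (A e) \<Longrightarrow> Pick N e a (g e a)" by blast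
  show "Red N e \<longleftrightarrow> e \<in> S" if "e \<in> E" for e
    using hd[of e] that by (auto simp: R X_def holder_rel_def)
  show "Bel N e f \<longleftrightarrow> (e, f) \<in> Ord" if "e \<in> E" "f \<in> E" for e f
    using hd[of e] that disj(1) by (auto simp: R X_def holder_rel_def)
  have carN: "carrier N = carrier M \<union> ?F" by (simp add: N_def)
  have tok: "token_ok N i c"
    unfolding token_ok_def
  proof (intro conjI allI impI ballI)
    have old: "token_ok M i c" if "Bel M e c" for e
      using that c C(2) okD(7)[OF M] by blast
    have fM: "e \<in> carrier M" if "Bel M e c" for e using C(2) that by blast
    show "holder N i e" if "Bel N e c" for e
      using belD[OF that]
    proof
      assume e: "Bel M e c"
      then have "holder M i e" using old[OF e] unfolding token_ok_def by blast
      then show ?thesis using add_holder[OF f fM[OF e]] by (simp add: N_def)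
    qed (rule hl)
    show "q = q'" if "Bel N e c" "Mem N e a" "Pick N e a q" "Pick N e a q'" for e a q q'
      using belD[OF that(1)]
    proof
      assume e: "Bel M e c"
      have "e \<notin> E" using fM[OF e] EM by blast
      have "Mem M e a" "Pick M e a q" "Pick M e a q'"
        using that fM[OF e] \<open>e \<notin> E\<close> by (auto simp: R X_def holder_rel_def)
      then show ?thesis using old[OF e] e unfolding token_ok_def by blast
    next
      assume "e \<in> E"
      then show ?thesis using that(3,4) pickE[of e] by simp
    qed
    show "\<exists>e a. Bel N e c \<and> Mem N e a \<and> Pick N e a q" if q: "q \<in> carrier N" for q
    proof -
      obtain e a where "e \<in> E" "a \<in> carrier (A e)" "q = g e a" using g(2)[of q] q carN by auto
      then show ?thesis using bel mem pickE by blast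
    qed
    have gE: "\<exists>a. Mem N e a \<and> Pick N e a q" if "e \<in> E" "q \<in> g e ` carrier (A e)" for e q
      using that mem pickE by blast
    show "(\<exists>a. Mem N e a \<and> Pick N e a h) \<or> (\<exists>a. Mem N h a \<and> Pick N h a e)"
      if eh: "Bel N e c" "Bel N h c" for e h
    proof -
      consider "e \<in> E" "h \<in> E" | "e \<in> E" "Bel M h c" | "Bel M e c" "h \<in> E" | "Bel M e c" "Bel M h c"
        using belD[OF eh(1)] belD[OF eh(2)] by blast
      then show ?thesis
      proof cases
        case 1
        then show ?thesis using g(3)[OF 1] gE by blast
      next
        case 2
        then show ?thesis using g(4)[OF 2] gE by blast
      next
        case 3
        then show ?thesis using g(4)[OF 3(2,1)] gE by blast
      next
        case 4
        then have "(\<exists>a. Mem M e a \<and> Pick M e a h) \<or> (\<exists>a. Mem M h a \<and> Pick M h a e)"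
          using old[OF 4(1)] unfolding token_ok_def by blast
        then show ?thesis unfolding R by blast
      qed
    qed
  qed
  have okN: "ok N"
    unfolding N_def
  proof (rule add_ok[OF f], fold N_def)
    show "part N t h \<in> models (K t)" if "h \<in> ?F" "holder N t h" for t h
      using hF[OF that] p A by auto
    show "t = t'" if "h \<in> ?F" "holder N t h" "holder N t' h" for t t' h using hF that by blast
    show "\<not> dead M x" if "[x, d] \<in> X SKill" for x d using that by (simp add: X_def holder_rel_def)
    show "d = d'" if "[x, d] \<in> X SKill" "[x, d'] \<in> X SKill" for x d d'
      using that by (simp add: X_def holder_rel_def)
    show "j = j' \<and> x = x'" if "token N j x" "token N j' x'" for j x j' x' using tu that by blast
    show "token_ok N j x" if "token N j x" for j x using tu[OF that] tok by simp
    show "l = l'" if "lock N l" "lock N l'" for l l' using okD(6)[OF M] that lockN by blast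
    show "lock_ok N l" if l: "lock N l" for l
      unfolding N_def
    proof (rule add_lock_ok[OF f])
      have lM: "lock M l" using l lockN by blast
      show lo: "lock_ok M l" using okD(8)[OF M lM] .
      have lc: "l \<in> carrier M" using lock_carrier[OF sM lM] .
      show "[x, l] \<notin> X SRow" for x by (simp add: X_def holder_rel_def)
      show "[a, d] \<notin> X SKill" for a d by (simp add: X_def holder_rel_def)
      have "l \<noteq> c"
      proof
        assume lc': "l = c"
        then have tM: "token M i l" using c lc by auto
        have "[l] \<in> rel M (STok i)" using tM by (simp add: token_def)
        then have "lock_tuple M l (STok i) [l]" using lo unfolding lock_ok_def by auto
        then show False by (simp add: lock_tuple_def)
      qed
      then show "[x, l] \<notin> X SBel" for x using S(2) EM lc by (auto simp: X_def holder_rel_def)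
    qed
  qed
  show "ext M N" unfolding N_def
    by (rule add_ext[OF f okN[unfolded N_def]]) (simp add: X_def holder_rel_def)
qed

end

context lock_construction
begin

subsection \<open>Active tokens bound the cardinality\<close>

text \<open>Let \<open>S e\<close> be the set of points picked by \<open>e\<close>, which has at
  most \<kappa> elements. If there were more than \<kappa>^+ holders, take \<kappa>^+ of them;
  together they pick at most \<kappa>^+ points, so some holder \<open>e\<close> is picked by none of
  them. Then \<open>e\<close> has to pick all of them, which is too many. Thus there are at most
  \<kappa>^+ holders, and every point is picked by one of them.\<close>

lemma token_bound:
  assumes M: "ok M" "token M i c" and \<kappa>: "Cinfinite \<kappa>"
    and bound: "\<And>A. A \<in> models (K i) \<Longrightarrow> |carrier A| \<le>o \<kappa>"
  shows "|carrier M| \<le>o cardSuc \<kappa>"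
proof -
  note T = okD(7)[OF M, unfolded token_ok_def]
  note T5 = T[THEN conjunct2, THEN conjunct2, THEN conjunct2, rule_format]
  define E where "E = {e. Bel M e c}"
  define S where "S e = {p. \<exists>a. Mem M e a \<and> Pick M e a p}" for e
  have \<kappa>s: "Cinfinite (cardSuc \<kappa>)" "\<kappa> \<le>o cardSuc \<kappa>"
    using Cinfinite_cardSuc[OF \<kappa>] cardSuc_ordLeq \<kappa> by blast+
  have S: "|S e| \<le>o \<kappa>" if e: "e \<in> E" for e
  proof -
    have "holder M i e" using T e unfolding E_def by blast
    then have "|carrier (part M i e)| \<le>o \<kappa>" using bound okD(2)[OF M(1)] by blast
    moreover have "S e \<subseteq> (\<lambda>a. SOME p. Pick M e a p) ` carrier (part M i e)"
    proof
      fix p assume "p \<in> S e"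
      then obtain a where a: "Mem M e a" "Pick M e a p" by (auto simp: S_def)
      then have "Pick M e a (SOME p. Pick M e a p)" by (metis someI)
      then have "p = (SOME p. Pick M e a p)" using T a e unfolding E_def by blast
      then show "p \<in> (\<lambda>a. SOME p. Pick M e a p) ` carrier (part M i e)"
        using a(1) unfolding carrier_part by blast
    qed
    ultimately show ?thesis using card_of_subset_le card_of_image_le by metis
  qed
  have "|E| \<le>o cardSuc \<kappa>"
  proof (rule ccontr)
    assume no: "\<not> |E| \<le>o cardSuc \<kappa>"
    have wo: "Well_order |E|" "Well_order (cardSuc \<kappa>)"
      using cardSuc_Well_order \<kappa> by auto
    then have "cardSuc \<kappa> \<le>o |E|"
      using no not_ordLeq_iff_ordLess ordLess_imp_ordLeq by metis
    then obtain X where X: "X \<subseteq> E" "|X| =o cardSuc \<kappa>"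
      using subset_of_card[of "cardSuc \<kappa>" E] \<kappa>s(1) by metis
    have "|\<Union>x\<in>X. S x| \<le>o cardSuc \<kappa>"
    proof (rule card_of_UN_le[OF \<kappa>s(1)])
      show "|X| \<le>o cardSuc \<kappa>" using X(2) ordIso_iff_ordLeq by metis
      show "|S x| \<le>o cardSuc \<kappa>" if "x \<in> X" for x
        by (rule ordLeq_transitive[OF S \<kappa>s(2)]) (use that X in blast)
    qed
    then have "\<not> E \<subseteq> (\<Union>x\<in>X. S x)" using no card_of_subset_le by metis
    then obtain e where e: "e \<in> E" "e \<notin> (\<Union>x\<in>X. S x)" by blast
    have "X \<subseteq> S e"
    proof
      fix x assume x: "x \<in> X"
      then have "(\<exists>a. Mem M x a \<and> Pick M x a e) \<or> (\<exists>a. Mem M e a \<and> Pick M e a x)"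
        using T5[of x e] e(1) X(1) unfolding E_def by blast
      then show "x \<in> S e" using e(2) x unfolding S_def by blast
    qed
    then have "|X| \<le>o \<kappa>" by (rule card_of_subset_le[OF _ S[OF e(1)]])
    then have "cardSuc \<kappa> \<le>o \<kappa>" by (rule ordIso_ordLeq_trans[OF ordIso_symmetric[OF X(2)]])
    then show False using cardSuc_greater \<kappa> not_ordLess_ordLeq by metis
  qed
  moreover have "carrier M \<subseteq> (\<Union>e\<in>E. S e)" using T unfolding E_def S_def by blast
  moreover have "|S e| \<le>o cardSuc \<kappa>" if "e \<in> E" for e
    by (rule ordLeq_transitive[OF S[OF that] \<kappa>s(2)])
  ultimately show ?thesis using card_of_UN_le[OF \<kappa>s(1)] card_of_subset_le by metis
qed

subsection \<open>Gluing along a lock\<close>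

text \<open>In the glued grid the cells over the rows and columns of \<open>M\<close> and those over
  the rows and columns of \<open>N\<close> form two diagonal blocks that are already coloured. What
  remains are the mixed cells and all cells of the new column \<open>d\<close>.\<close>

definition glue_cells :: "'u struct \<Rightarrow> 'u struct \<Rightarrow> 'u \<Rightarrow> 'u \<Rightarrow> ('u \<times> 'u) set" where
  "glue_cells M N l d = {(x, y). (Row M x l \<or> Row N x l) \<and> (Bel M y l \<or> Bel N y l \<or> y = d) \<and>
     \<not> (Row M x l \<and> Bel M y l) \<and> \<not> (Row N x l \<and> Bel N y l)}"

text \<open>The tokens of both sides cannot both stay active and need not be compatible. All are
  killed by the new column \<open>d\<close>, which is the kind of kill that \<open>ext\<close>
  permits under a heavy lock.\<close>

definition glue_new :: "'u struct \<Rightarrow> 'u struct \<Rightarrow> 'u \<Rightarrow> 'u \<Rightarrow> ('u \<times> 'u \<Rightarrow> 'u) \<Rightarrow>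
    ('i, 'u) sym \<Rightarrow> 'u list set" where
  "glue_new M N l d col y = (case y of SBel \<Rightarrow> {[d, l]}
     | SKill \<Rightarrow> {[c, d] | c. \<exists>i. token M i c \<or> token N i c}
     | SCol \<Rightarrow> {[x, y, col (x, y)] | x y. (x, y) \<in> glue_cells M N l d} | _ \<Rightarrow> {})"

definition glue :: "'u struct \<Rightarrow> 'u struct \<Rightarrow> 'u struct \<Rightarrow> 'u \<Rightarrow> 'u \<Rightarrow> ('u \<times> 'u \<Rightarrow> 'u) \<Rightarrow> 'u struct" where
  "glue M N B l d col = mk_struct (insert d (carrier M \<union> carrier N \<union> carrier B))
     (\<lambda>y. rel M y \<union> rel N y \<union> holder_rel b l B y \<union> glue_new M N l d col y)"

text \<open>Specializations of the tuple clause of \<open>lock_ok\<close>, together with the ban on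
  killing its points: inside an active lock and its points, no element is a row, column, token or
  killed, and the only type or lock mark is on \<open>l\<close>.\<close>

lemma lock_facts:
  assumes M: "ok M" and l: "lock M l"
  shows "Mem M l l \<Longrightarrow> False"
    and "x \<in> insert l {a. Mem M l a} \<Longrightarrow> Row M x l \<Longrightarrow> False"
    and "x \<in> insert l {a. Mem M l a} \<Longrightarrow> Bel M x l \<Longrightarrow> False"
    and "x \<in> insert l {a. Mem M l a} \<Longrightarrow> Tok M i x \<Longrightarrow> False"
    and "x \<in> insert l {a. Mem M l a} \<Longrightarrow> Kill M x d \<Longrightarrow> False"
    and "x \<in> insert l {a. Mem M l a} \<Longrightarrow> Typ M t x \<Longrightarrow> x = l"
    and "x \<in> insert l {a. Mem M l a} \<Longrightarrow> Lock M x \<Longrightarrow> x = l"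
proof -
  note O = okD(8)[OF M l, unfolded lock_ok_def]
  have T: "lock_tuple M l y xs" if "xs \<in> rel M y" "set xs \<subseteq> insert l {a. Mem M l a}" for xs y
    using O that by blast
  show "Mem M l l \<Longrightarrow> False" using O unfolding holder_def by blast
  show "x \<in> insert l {a. Mem M l a} \<Longrightarrow> Row M x l \<Longrightarrow> False" using T[of "[x, l]" SRow] by (auto simp: lock_tuple_def)
  show "x \<in> insert l {a. Mem M l a} \<Longrightarrow> Bel M x l \<Longrightarrow> False" using T[of "[x, l]" SBel] by (auto simp: lock_tuple_def)
  show "x \<in> insert l {a. Mem M l a} \<Longrightarrow> Tok M i x \<Longrightarrow> False" using T[of "[x]" "STok i"] by (auto simp: lock_tuple_def)
  show "x \<in> insert l {a. Mem M l a} \<Longrightarrow> Kill M x d \<Longrightarrow> False" using O l by (auto simp: lock_def dead_def)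
  show "x \<in> insert l {a. Mem M l a} \<Longrightarrow> Typ M t x \<Longrightarrow> x = l" using T[of "[x]" "STyp t"] by (auto simp: lock_tuple_def)
  show "x \<in> insert l {a. Mem M l a} \<Longrightarrow> Lock M x \<Longrightarrow> x = l" using T[of "[x]" SLock] by (auto simp: lock_tuple_def)
qed

text \<open>The overlap of \<open>M\<close> and \<open>N\<close> is as small as possible: the common
  lock and those points that their two models share in the common extension \<open>B\<close>. The
  last clause serves the strict condition on colours: without \<open>loose\<close>, a new colour
  must not have been in use in the same row before.\<close>

definition glueable :: "'u struct \<Rightarrow> 'u struct \<Rightarrow> 'u struct \<Rightarrow> 'u \<Rightarrow> 'u \<Rightarrow> ('u \<times> 'u \<Rightarrow> 'u) \<Rightarrow> bool" where
  "glueable M N B l d col \<longleftrightarrow> ok M \<and> ok N \<and> lock M l \<and> lock N l \<and>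
     strong (K b) (part M b l) B \<and> strong (K b) (part N b l) B \<and>
     carrier M \<inter> carrier N = insert l (carrier (part M b l) \<inter> carrier (part N b l)) \<and>
     carrier M \<inter> carrier B = carrier (part M b l) \<and> carrier N \<inter> carrier B = carrier (part N b l) \<and>
     l \<notin> carrier B \<and> d \<notin> insert l (carrier M \<union> carrier N \<union> carrier B) \<and>
     inj_on col (glue_cells M N l d) \<and> col ` glue_cells M N l d \<subseteq> carrier B \<and>
     (\<not> loose \<longrightarrow> col ` glue_cells M N l d \<inter> (carrier M \<union> carrier N) = {})"

lemma glue_cells_sym: "glue_cells N M l d = glue_cells M N l d"
  unfolding glue_cells_def by blast

lemma glueable_sym: "glueable M N B l d col \<Longrightarrow> glueable N M B l d col"
  unfolding glueable_def glue_cells_sym[of N M] by (auto simp: Int_commute Un_commute)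

lemma glue_sym: "glue N M B l d col = glue M N B l d col"
proof -
  have "glue_new N M l d col = glue_new M N l d col"
    unfolding glue_new_def glue_cells_sym[of N M] by (auto simp: fun_eq_iff split: sym.split)
  then show ?thesis unfolding glue_def by (simp add: Un_commute Un_left_commute)
qed

context
  fixes M N B l d col P
  assumes gl: "glueable M N B l d col"
  defines "P \<equiv> glue M N B l d col"
begin

lemma gD:
  shows "ok M" "ok N" "lock M l" "lock N l" "strong (K b) (part M b l) B" "strong (K b) (part N b l) B"
    "carrier M \<inter> carrier N = insert l (carrier (part M b l) \<inter> carrier (part N b l))"
    "carrier M \<inter> carrier B = carrier (part M b l)" "carrier N \<inter> carrier B = carrier (part N b l)"
    "l \<notin> carrier B" "d \<notin> insert l (carrier M \<union> carrier N \<union> carrier B)"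
    "inj_on col (glue_cells M N l d)" "col ` glue_cells M N l d \<subseteq> carrier B"
    "\<not> loose \<Longrightarrow> col ` glue_cells M N l d \<inter> (carrier M \<union> carrier N) = {}"
  using gl unfolding glueable_def by blast+

lemma g_B: "B \<in> models (K b)"
  using AEC.strong_models[OF aec[OF b] gD(5)] by blast

lemma g_Bstruct: "is_struct (vocab (K b)) B"
  using AEC.models_struct[OF aec[OF b] g_B] .

lemma g_struct: "is_struct voc M" "is_struct voc N"
  using okD(1)[OF gD(1)] okD(1)[OF gD(2)] .

lemma g_l: "l \<in> carrier M" "l \<in> carrier N"
  using lock_carrier[OF g_struct(1) gD(3)] lock_carrier[OF g_struct(2) gD(4)] .

lemma g_rel_subset: "rel M y \<union> rel N y \<union> holder_rel b l B y \<union> glue_new M N l d col y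
    \<subseteq> tuples (sym_arity y) (insert d (carrier M \<union> carrier N \<union> carrier B))
    \<and> (rel M y \<union> rel N y \<union> holder_rel b l B y \<union> glue_new M N l d col y \<noteq> {} \<longrightarrow> y \<in> symbols)"
proof -
  have 1: "y \<in> symbols \<and> length xs = sym_arity y \<and> set xs \<subseteq> carrier M" if "xs \<in> rel M y" for xs
    using rel_tuple[OF g_struct(1) that] by blast
  have 2: "y \<in> symbols \<and> length xs = sym_arity y \<and> set xs \<subseteq> carrier N" if "xs \<in> rel N y" for xs
    using rel_tuple[OF g_struct(2) that] by blast
  have 3: "y \<in> symbols \<and> length xs = sym_arity y \<and> set xs \<subseteq> insert l (carrier B)"
    if "xs \<in> holder_rel b l B y" for xs
    using holder_rel_tuple[OF g_B b that] by blast
  have cc: "x \<in> carrier M \<union> carrier N" "y' = d \<or> y' \<in> carrier M \<union> carrier N" "col (x, y') \<in> carrier B"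
    if "(x, y') \<in> glue_cells M N l d" for x y'
    using that rel_carrier(2)[OF g_struct(1)] rel_carrier(2)[OF g_struct(2)] gD(13)
    by (auto simp: glue_cells_def)
  have 4: "y \<in> symbols \<and> length xs = sym_arity y \<and> set xs \<subseteq> insert d (carrier M \<union> carrier N \<union> carrier B)"
    if "xs \<in> glue_new M N l d col y" for xs
    using that symbolsI g_l token_carrier[OF g_struct(1)] token_carrier[OF g_struct(2)]
    by (cases y) (auto simp: glue_new_def dest: cc)
  show ?thesis
    using 1 2 3 4 g_l by (fastforce simp: tuples_def)
qed

lemma g_carrier: "carrier P = insert d (carrier M \<union> carrier N \<union> carrier B)"
  by (simp add: P_def glue_def)

lemma g_rel: "rel P y = rel M y \<union> rel N y \<union> holder_rel b l B y \<union> glue_new M N l d col y"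
  unfolding P_def glue_def rel_mk using g_rel_subset[of y] by auto

lemma g_Pstruct: "is_struct voc P"
  unfolding P_def glue_def
proof (rule is_struct_mk)
  show "small (insert d (carrier M \<union> carrier N \<union> carrier B))"
    using g_struct g_Bstruct by (intro small_insert[OF universe] small_Un[OF universe]) (auto simp: is_struct_def)
qed (use g_rel_subset in auto)

text \<open>By \<open>lock_facts\<close> no marked element of \<open>M\<close> except
  \<open>l\<close> lies in the overlap with \<open>N\<close> or in \<open>B\<close>. Hence every
  row, column, token or killed element of one side belongs to that side alone.\<close>

lemma g_rows_private:
  "Row M x l \<Longrightarrow> x \<notin> carrier N" "Bel M x l \<Longrightarrow> x \<notin> carrier N" "Tok M i x \<Longrightarrow> x \<notin> carrier N"
  "Row M x l \<Longrightarrow> x \<notin> insert l (carrier B)" "Bel M x l \<Longrightarrow> x \<notin> insert l (carrier B)"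
  "Tok M i x \<Longrightarrow> x \<notin> insert l (carrier B)"
  "Kill M x d' \<Longrightarrow> x \<notin> insert l (carrier N \<union> carrier B)"
  "Typ M t x \<Longrightarrow> x \<in> carrier N \<union> carrier B \<Longrightarrow> x = l"
  "Lock M x \<Longrightarrow> x \<in> carrier N \<union> carrier B \<Longrightarrow> x = l"
proof -
  note lf = lock_facts[OF gD(1,3)]
  have *: "x \<in> insert l {a. Mem M l a}" if "x \<in> carrier M" "x \<in> insert l (carrier N \<union> carrier B)" for x
    using that gD(7,8) unfolding carrier_part by blast
  have C: "x \<in> carrier M" if "Row M x l \<or> Bel M x l \<or> Kill M x d' \<or> Tok M i x \<or> Typ M t x \<or> Lock M x"
    using that rel_carrier[OF g_struct(1)] by blast
  show "Row M x l \<Longrightarrow> x \<notin> carrier N" "Row M x l \<Longrightarrow> x \<notin> insert l (carrier B)" using lf(2)[of x] *[of x] C by blast+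
  show "Bel M x l \<Longrightarrow> x \<notin> carrier N" "Bel M x l \<Longrightarrow> x \<notin> insert l (carrier B)" using lf(3)[of x] *[of x] C by blast+
  show "Tok M i x \<Longrightarrow> x \<notin> carrier N" "Tok M i x \<Longrightarrow> x \<notin> insert l (carrier B)" using lf(4)[of x] *[of x] C by blast+
  show "Kill M x d' \<Longrightarrow> x \<notin> insert l (carrier N \<union> carrier B)" using lf(5)[of x] *[of x] C by blast
  show "Typ M t x \<Longrightarrow> x \<in> carrier N \<union> carrier B \<Longrightarrow> x = l" using lf(6)[of x] *[of x] C by blast
  show "Lock M x \<Longrightarrow> x \<in> carrier N \<union> carrier B \<Longrightarrow> x = l" using lf(7)[of x] *[of x] C by blast
qed

lemma g_part_interp:
  "set zs \<subseteq> carrier (part M b l) \<Longrightarrow> l # zs \<in> rel M (SCode b s) \<longleftrightarrow> zs \<in> interp B s"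
proof -
  assume zs: "set zs \<subseteq> carrier (part M b l)"
  have "interp (part M b l) s = interp B s \<inter> lists (carrier (part M b l))"
    using AEC.strong_substruct[OF aec[OF b] gD(5)] by (simp add: substruct_def)
  moreover have "l # zs \<in> rel M (SCode b s) \<longleftrightarrow> zs \<in> interp (part M b l) s"
    using zs by (simp add: part_def lists_eq_set)
  ultimately show ?thesis using zs by (simp add: lists_eq_set)
qed

end

text \<open>A tuple of \<open>N\<close> inside \<open>M\<close> lies in the lock and its shared
  points, so it is a \<open>lock_tuple\<close> and its truth is decided by \<open>B\<close>. Since
  the model of the lock in \<open>M\<close> is a strong submodel of \<open>B\<close>,
  \<open>M\<close> decides it in the same way. Tuples that come from \<open>B\<close> itself are
  treated alike.\<close>

lemma g_old:
  assumes gl: "glueable M N B l d col" and xs: "set xs \<subseteq> carrier M"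
  shows "xs \<in> rel (glue M N B l d col) y \<longleftrightarrow> xs \<in> rel M y"
proof
  assume "xs \<in> rel (glue M N B l d col) y"
  then consider "xs \<in> rel M y" | "xs \<in> rel N y" | "xs \<in> holder_rel b l B y" | "xs \<in> glue_new M N l d col y"
    unfolding g_rel[OF gl] by blast
  then show "xs \<in> rel M y"
  proof cases
    note D = gD[OF gl]
    have hM: "Typ M b l" "Lock M l" using lock_holder[OF D(1,3)] D(3) by (auto simp: holder_def lock_def)
    {
      case 2
      have sub: "set xs \<subseteq> insert l (carrier (part M b l) \<inter> carrier (part N b l))"
        using xs rel_tuple(2)[OF g_struct(2)[OF gl] 2] D(7) by blast
      then have "lock_tuple N l y xs"
        using okD(8)[OF D(2,4)] 2 unfolding lock_ok_def carrier_part by blast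
      then consider "y = SLock \<or> y = STyp b" "xs = [l]" | a where "y = SMem" "xs = [l, a]" "Mem N l a"
        | s zs where "y = SCode b s" "xs = l # zs" "set zs \<subseteq> {a. Mem N l a}"
        unfolding lock_tuple_def by blast
      then show ?thesis
      proof cases
        case 1
        then show ?thesis using hM by auto
      next
        case (2 a)
        then have "a \<noteq> l" using lock_facts(1)[OF D(2,4)] by blast
        then show ?thesis using 2 sub by (auto simp: carrier_part)
      next
        case (3 s zs)
        have "l \<notin> set zs" using 3(3) lock_facts(1)[OF D(2,4)] by blast
        then have "set zs \<subseteq> carrier (part M b l)" using sub 3(2) by auto
        moreover have "zs \<in> interp B s"
          using g_part_interp[OF glueable_sym[OF gl], of zs s] 3 2 by (simp add: carrier_part)
        ultimately show ?thesis using g_part_interp[OF gl, of zs s] 3 by simp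
      qed
    next
      case 3
      then show ?thesis
      proof (cases y)
        case (STyp t)
        then show ?thesis using 3 hM by (auto simp: holder_rel_def split: if_splits)
      next
        case SMem
        then obtain a where a: "xs = [l, a]" "a \<in> carrier B" using 3 by (auto simp: holder_rel_def)
        then have "a \<in> carrier (part M b l)" using xs D(8) by auto
        then show ?thesis using a SMem by (simp add: carrier_part)
      next
        case (SCode t s)
        then obtain zs where zs: "t = b" "xs = l # zs" "zs \<in> interp B s"
          using 3 by (auto simp: holder_rel_def split: if_splits)
        then have "set zs \<subseteq> carrier (part M b l)"
          using is_struct_interp[OF g_Bstruct[OF gl] zs(3)] xs D(8) by auto
        then show ?thesis using g_part_interp[OF gl, of zs s] zs SCode by simp
      qed (auto simp: holder_rel_def)
    next
      case 4
      have dM: "d \<notin> carrier M" using D(11) by blast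
      \<comment> \<open>A row and a column that both belong to \<open>M\<close> form a cell of the
        block of \<open>M\<close>, which was excluded from \<open>glue_cells\<close>; and
        \<open>d\<close> is not in \<open>M\<close>.\<close>
      have F: "False" if "(x, y') \<in> glue_cells M N l d" "x \<in> carrier M" "y' \<in> carrier M" for x y'
        using that g_rows_private[OF glueable_sym[OF gl]] dM unfolding glue_cells_def by blast
      show ?thesis using 4 xs dM by (cases y) (auto simp: glue_new_def dest: F)
    }
  qed
qed (use g_rel[OF gl] in blast)

lemma g_sub: "glueable M N B l d col \<Longrightarrow> substruct M (glue M N B l d col)"
  by (rule substruct_relI[OF g_struct(1) g_Pstruct]) (auto simp: g_carrier g_old)

lemma g_mem:
  assumes gl: "glueable M N B l d col"
  shows "Mem (glue M N B l d col) l a \<longleftrightarrow> a \<in> carrier B"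
proof -
  note D = gD[OF gl]
  have "Mem M l a \<Longrightarrow> a \<in> carrier B" "Mem N l a \<Longrightarrow> a \<in> carrier B"
    using AEC.strong_carrier[OF aec[OF b] D(5)] AEC.strong_carrier[OF aec[OF b] D(6)]
    unfolding carrier_part by blast+
  then show ?thesis unfolding g_rel[OF gl] by (auto simp: holder_rel_def glue_new_def)
qed

lemma g_part_l:
  assumes gl: "glueable M N B l d col"
  shows "part (glue M N B l d col) b l = B"
proof (rule struct_eqI)
  note D = gD[OF gl] and B = g_Bstruct[OF gl]
  show "carrier (part (glue M N B l d col) b l) = carrier B" using g_mem[OF gl] by (simp add: carrier_part)
  fix s
  have "l # xs \<in> rel (glue M N B l d col) (SCode b s) \<longleftrightarrow> xs \<in> interp B s"
    if xs: "set xs \<subseteq> carrier B" for xs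
  proof -
    have "xs \<in> interp B s" if "l # xs \<in> rel M (SCode b s)"
    proof -
      have "set xs \<subseteq> carrier (part M b l)" using rel_tuple(2)[OF g_struct(1)[OF gl] that] xs D(8) by auto
      then show ?thesis using g_part_interp[OF gl] that by blast
    qed
    moreover have "xs \<in> interp B s" if "l # xs \<in> rel N (SCode b s)"
    proof -
      have "set xs \<subseteq> carrier (part N b l)" using rel_tuple(2)[OF g_struct(2)[OF gl] that] xs D(9) by auto
      then show ?thesis using g_part_interp[OF glueable_sym[OF gl]] that by blast
    qed
    ultimately show ?thesis unfolding g_rel[OF gl] by (auto simp: holder_rel_def glue_new_def)
  qed
  then have "interp (part (glue M N B l d col) b l) s = {xs \<in> lists (carrier B). xs \<in> interp B s}"
    unfolding part_def g_mem[OF gl] by (auto simp: lists_eq_set)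
  also have "\<dots> = interp B s"
    using is_struct_interp[OF B, of _ s] unfolding lists_eq_set by blast
  finally show "interp (part (glue M N B l d col) b l) s = interp B s" .
qed

lemma g_part:
  assumes gl: "glueable M N B l d col" and h: "Typ M t h" "h \<noteq> l"
  shows "part (glue M N B l d col) t' h = part M t' h"
proof -
  have "h \<notin> carrier N" using g_rows_private(8)[OF gl h(1)] h(2) by blast
  then have "h # xs \<notin> rel N y" for xs y using rel_tuple(2)[OF g_struct(2)[OF gl], of "h # xs" y] by auto
  then have "h # xs \<in> rel (glue M N B l d col) y \<longleftrightarrow> h # xs \<in> rel M y"
    if "y = SMem \<or> y = SCode t' s" for xs y s
    using that h(2) unfolding g_rel[OF gl] by (auto simp: holder_rel_def glue_new_def split: if_splits)
  then show ?thesis unfolding part_def by simp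
qed

lemma g_cells_disjoint:
  assumes gl: "glueable M N B l d col"
  shows "Row M x l \<Longrightarrow> Row N x l \<Longrightarrow> False" "Bel M x l \<Longrightarrow> Bel N x l \<Longrightarrow> False"
    "Bel M d l \<Longrightarrow> False" "Bel N d l \<Longrightarrow> False"
  using g_rows_private(1,2)[OF gl] rel_carrier(2)[OF g_struct(2)[OF gl]]
    rel_carrier(2)[OF g_struct(1)[OF gl]] gD(11)[OF gl] by blast+

lemma g_col:
  assumes gl: "glueable M N B l d col"
  shows "Row M x l \<Longrightarrow> Bel M y l \<Longrightarrow> Col (glue M N B l d col) x y a \<longleftrightarrow> Col M x y a"
    and "(x, y) \<in> glue_cells M N l d \<Longrightarrow> Col (glue M N B l d col) x y a \<longleftrightarrow> a = col (x, y)"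
proof -
  note p = g_rows_private[OF gl] and p' = g_rows_private[OF glueable_sym[OF gl]]
  note C = rel_carrier[OF g_struct(1)[OF gl]] and C' = rel_carrier[OF g_struct(2)[OF gl]]
  show "Col (glue M N B l d col) x y a \<longleftrightarrow> Col M x y a" if "Row M x l" "Bel M y l"
  proof -
    have "\<not> Col N x y a" using p(1)[OF that(1)] C'(3) by blast
    moreover have "(x, y) \<notin> glue_cells M N l d" using that by (simp add: glue_cells_def)
    ultimately show ?thesis unfolding g_rel[OF gl] by (auto simp: holder_rel_def glue_new_def)
  qed
  show "Col (glue M N B l d col) x y a \<longleftrightarrow> a = col (x, y)" if cell: "(x, y) \<in> glue_cells M N l d"
  proof -
    have d: "d \<notin> carrier M" "d \<notin> carrier N" using gD(11)[OF gl] by blast+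
    have "\<not> Col M x y a" "\<not> Col N x y a"
      using cell d p(1,2) p'(1,2) C(3)[of x y a] C'(3)[of x y a] C(2) C'(2)
      unfolding glue_cells_def by blast+
    then show ?thesis using cell unfolding g_rel[OF gl] by (auto simp: holder_rel_def glue_new_def)
  qed
qed

lemma g_colN:
  assumes gl: "glueable M N B l d col"
  shows "Row N x l \<Longrightarrow> Bel N y l \<Longrightarrow> Col (glue M N B l d col) x y a \<longleftrightarrow> Col N x y a"
  using g_col(1)[OF glueable_sym[OF gl]] unfolding glue_sym[of N M] .

lemma g_row: "glueable M N B l d col \<Longrightarrow> Row (glue M N B l d col) x l \<longleftrightarrow> Row M x l \<or> Row N x l"
  unfolding g_rel by (auto simp: holder_rel_def glue_new_def)

lemma g_bel: "glueable M N B l d col \<Longrightarrow> Bel (glue M N B l d col) x l \<longleftrightarrow> Bel M x l \<or> Bel N x l \<or> x = d"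
  unfolding g_rel by (auto simp: holder_rel_def glue_new_def)

lemma g_kill: "glueable M N B l d col \<Longrightarrow> Kill (glue M N B l d col) x y \<longleftrightarrow>
    Kill M x y \<or> Kill N x y \<or> y = d \<and> (\<exists>i. token M i x \<or> token N i x)"
  unfolding g_rel by (auto simp: holder_rel_def glue_new_def)

lemma g_tok: "glueable M N B l d col \<Longrightarrow> Tok (glue M N B l d col) i x \<longleftrightarrow> Tok M i x \<or> Tok N i x"
  unfolding g_rel by (auto simp: holder_rel_def glue_new_def)

text \<open>Every token of the glued structure comes from one side and was active or dead there; the
  active ones are killed by \<open>d\<close>. So the glued model is not bounded, and the picking
  clauses need not be checked.\<close>

lemma g_token:
  assumes gl: "glueable M N B l d col"
  shows "\<not> token (glue M N B l d col) i c"
  unfolding token_def dead_def g_tok[OF gl] g_kill[OF gl] by blast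

lemma g_Lock: "glueable M N B l d col \<Longrightarrow> Lock (glue M N B l d col) x \<longleftrightarrow> Lock M x \<or> Lock N x"
  unfolding g_rel by (auto simp: holder_rel_def glue_new_def)

lemma g_lock:
  assumes gl: "glueable M N B l d col"
  shows "lock (glue M N B l d col) x \<longleftrightarrow> x = l"
proof
  note D = gD[OF gl]
  assume "lock (glue M N B l d col) x"
  then have "lock M x \<or> lock N x" unfolding lock_def dead_def g_Lock[OF gl] g_kill[OF gl] by blast
  then show "x = l" using okD(6)[OF D(1) _ D(3)] okD(6)[OF D(2) _ D(4)] by blast
next
  note D = gD[OF gl]
  assume x: "x = l"
  have "\<not> token M i l" "\<not> token N i l" for i
    using lock_facts(4)[OF D(1,3)] lock_facts(4)[OF D(2,4)] unfolding token_def by blast+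
  then show "lock (glue M N B l d col) x"
    using D(3,4) unfolding x lock_def dead_def g_Lock[OF gl] g_kill[OF gl] by blast
qed

text \<open>In the strict case a repeated colour in one row must involve two old cells of one block,
  two new cells, or an old and a new one. The first is excluded in \<open>M\<close> or
  \<open>N\<close>, the second by injectivity of \<open>col\<close>, the third because new colours
  lie outside \<open>M\<close> and \<open>N\<close>. In the loose case new colours may be old ones;
  there the shape of the grid helps: a rectangle that contains a new cell contains at least two,
  which cannot share a colour unless they coincide.\<close>

lemma g_lock_ok:
  assumes gl: "glueable M N B l d col"
  shows "lock_ok (glue M N B l d col) l"
proof -
  let ?P = "glue M N B l d col"
  note D = gD[OF gl] and gl' = glueable_sym[OF gl]
  note OM = okD(8)[OF D(1,3), unfolded lock_ok_def] and ON = okD(8)[OF D(2,4), unfolded lock_ok_def]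
  have AM: "Mem M l a \<longleftrightarrow> a \<in> carrier M \<and> a \<in> carrier B" for a
    using D(8) unfolding carrier_part by blast
  have AN: "Mem N l a \<longleftrightarrow> a \<in> carrier N \<and> a \<in> carrier B" for a
    using D(9) unfolding carrier_part by blast
  have cell: "Row M x l \<and> Bel M y l \<or> Row N x l \<and> Bel N y l \<or> (x, y) \<in> glue_cells M N l d"
    if "Row ?P x l" "Bel ?P y l" for x y
    using that unfolding g_row[OF gl] g_bel[OF gl] glue_cells_def by blast
  have eq: "x = x' \<and> y = y'"
    if "(x, y) \<in> glue_cells M N l d" "(x', y') \<in> glue_cells M N l d" "Col ?P x y a" "Col ?P x' y' a" for x x' y y' a
    using that(3,4) D(12) that(1,2) unfolding g_col(2)[OF gl that(1)] g_col(2)[OF gl that(2)] inj_on_def by blast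
  have fresh_col: "a \<notin> carrier M \<union> carrier N" if "(x, y) \<in> glue_cells M N l d" "Col ?P x y a" "\<not> loose" for x y a
    using D(14)[OF that(3)] that(1,2) unfolding g_col(2)[OF gl that(1)] by blast
  have oldM: "a \<in> carrier M" if "Row M x l" "Bel M y l" "Col ?P x y a" for x y a
    using that(3) rel_carrier(3)[OF g_struct(1)[OF gl]] unfolding g_col(1)[OF gl that(1,2)] by blast
  have oldN: "a \<in> carrier N" if "Row N x l" "Bel N y l" "Col ?P x y a" for x y a
    using that(3) rel_carrier(3)[OF g_struct(2)[OF gl]] unfolding g_colN[OF gl that(1,2)] by blast
  note dis = g_cells_disjoint[OF gl]
  show ?thesis
    unfolding lock_ok_def g_mem[OF gl]
  proof (intro conjI allI impI)
    show "holder ?P b l"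
      using lock_holder[OF D(1,3)] substruct_holder[OF g_sub[OF gl] g_l(1)[OF gl]] by blast
    show "\<exists>a. a \<in> carrier B \<and> Col ?P x y a" if xy: "Row ?P x l" "Bel ?P y l" for x y
      using cell[OF xy]
    proof (elim disjE conjE)
      assume 1: "Row M x l" "Bel M y l"
      then obtain a where "Mem M l a" "Col M x y a" using OM by blast
      then show ?thesis unfolding g_col(1)[OF gl 1] AM by blast
    next
      assume 1: "Row N x l" "Bel N y l"
      then obtain a where "Mem N l a" "Col N x y a" using ON by blast
      then show ?thesis unfolding g_colN[OF gl 1] AN by blast
    next
      assume 1: "(x, y) \<in> glue_cells M N l d"
      then show ?thesis using D(13) unfolding g_col(2)[OF gl 1] by blast
    qed
    show "y = y' \<or> loose \<and> x = x'"
      if R: "Row ?P x l" "Row ?P x' l" "Bel ?P y l" "Bel ?P y' l" and a: "a \<in> carrier B"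
        and c: "Col ?P x y a" "Col ?P x y' a" "Col ?P x' y a" "Col ?P x' y' a" for x x' y y' a
    proof (cases loose)
      case False
      consider "Row M x l" "Bel M y l" "Bel M y' l" | "Row N x l" "Bel N y l" "Bel N y' l"
        | "(x, y) \<in> glue_cells M N l d" "(x, y') \<in> glue_cells M N l d"
        | "(x, y) \<in> glue_cells M N l d" "Row M x l \<and> Bel M y' l \<or> Row N x l \<and> Bel N y' l"
        | "(x, y') \<in> glue_cells M N l d" "Row M x l \<and> Bel M y l \<or> Row N x l \<and> Bel N y l"
        using cell[OF R(1,3)] cell[OF R(1,4)] dis(1)[of x] by blast
      then show ?thesis
      proof cases
        case 1
        have "Mem M l a" using oldM[OF 1(1,2) c(1)] a AM by blast
        moreover have "Col M x y a" "Col M x y' a"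
          using c(1,2) unfolding g_col(1)[OF gl 1(1,2)] g_col(1)[OF gl 1(1,3)] .
        ultimately show ?thesis using OM 1 False by blast
      next
        case 2
        have "Mem N l a" using oldN[OF 2(1,2) c(1)] a AN by blast
        moreover have "Col N x y a" "Col N x y' a"
          using c(1,2) unfolding g_colN[OF gl 2(1,2)] g_colN[OF gl 2(1,3)] .
        ultimately show ?thesis using ON 2 False by blast
      next
        case 3
        then show ?thesis using eq c(1,2) by blast
      next
        case 4
        then show ?thesis using fresh_col[OF 4(1) c(1) False] oldM oldN c(2) by blast
      next
        case 5
        then show ?thesis using fresh_col[OF 5(1) c(2) False] oldM oldN c(1) by blast
      qed
    next
      case True
      have "y = y' \<or> x = x'"
      proof (cases "(x, y) \<in> glue_cells M N l d \<or> (x, y') \<in> glue_cells M N l d \<or>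
          (x', y) \<in> glue_cells M N l d \<or> (x', y') \<in> glue_cells M N l d")
        case True
        \<comment> \<open>The old cells form two diagonal blocks with disjoint rows and disjoint
          columns. If three corners of a rectangle are old, they lie in the same block, and then so
          does the fourth. Hence a new corner never occurs alone.\<close>
        have two: "(x, y) \<in> glue_cells M N l d \<and> (x, y') \<in> glue_cells M N l d \<or>
          (x', y) \<in> glue_cells M N l d \<and> (x', y') \<in> glue_cells M N l d \<or>
          (x, y) \<in> glue_cells M N l d \<and> (x', y) \<in> glue_cells M N l d \<or>
          (x, y') \<in> glue_cells M N l d \<and> (x', y') \<in> glue_cells M N l d \<or>
          (x, y) \<in> glue_cells M N l d \<and> (x', y') \<in> glue_cells M N l d \<or>
          (x, y') \<in> glue_cells M N l d \<and> (x', y) \<in> glue_cells M N l d"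
        proof -
          have G: "(u, v) \<in> glue_cells M N l d \<longleftrightarrow>
              \<not> (Row M u l \<and> Bel M v l) \<and> \<not> (Row N u l \<and> Bel N v l)"
            if "Row ?P u l" "Bel ?P v l" for u v
            using that unfolding g_row[OF gl] g_bel[OF gl] glue_cells_def by auto
          have r: "Row M x l \<or> Row N x l" "Row M x' l \<or> Row N x' l"
            "\<not> (Row M x l \<and> Row N x l)" "\<not> (Row M x' l \<and> Row N x' l)"
            "\<not> (Bel M y l \<and> Bel N y l)" "\<not> (Bel M y' l \<and> Bel N y' l)"
            using R(1,2) dis(1)[of x] dis(1)[of x'] dis(2)[of y] dis(2)[of y'] unfolding g_row[OF gl] by auto
          show ?thesis
            using True r unfolding G[OF R(1,3)] G[OF R(1,4)] G[OF R(2,3)] G[OF R(2,4)] by argo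
        qed
        show ?thesis
          using two eq[OF _ _ c(1,2)] eq[OF _ _ c(3,4)] eq[OF _ _ c(1,3)] eq[OF _ _ c(2,4)]
            eq[OF _ _ c(1,4)] eq[OF _ _ c(2,3)] by blast
      next
        case False
        then consider "Row M x l" "Row M x' l" "Bel M y l" "Bel M y' l"
          | "Row N x l" "Row N x' l" "Bel N y l" "Bel N y' l"
          using cell[OF R(1,3)] cell[OF R(1,4)] cell[OF R(2,3)] cell[OF R(2,4)]
            dis(1)[of x] dis(1)[of x'] dis(2)[of y] dis(2)[of y'] by auto
        then show ?thesis
        proof cases
          case 1
          have "Mem M l a" using oldM[OF 1(1,3) c(1)] a AM by blast
          moreover have "Col M x y a" "Col M x y' a" "Col M x' y a" "Col M x' y' a"
            using c unfolding g_col(1)[OF gl 1(1,3)] g_col(1)[OF gl 1(1,4)]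
              g_col(1)[OF gl 1(2,3)] g_col(1)[OF gl 1(2,4)] .
          ultimately show ?thesis using OM 1 by blast
        next
          case 2
          have "Mem N l a" using oldN[OF 2(1,3) c(1)] a AN by blast
          moreover have "Col N x y a" "Col N x y' a" "Col N x' y a" "Col N x' y' a"
            using c unfolding g_colN[OF gl 2(1,3)] g_colN[OF gl 2(1,4)]
              g_colN[OF gl 2(2,3)] g_colN[OF gl 2(2,4)] .
          ultimately show ?thesis using ON 2 by blast
        qed
      qed
      then show ?thesis using True by blast
    qed
    show "\<not> Kill ?P a y" if a: "a \<in> carrier B" for a y
    proof -
      have "\<not> Kill M a y" "\<not> Kill N a y"
        using a g_rows_private(7)[OF gl, of a y] g_rows_private(7)[OF gl', of a y] by blast+
      moreover have "\<not> token M i a" "\<not> token N i a" for i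
        using a g_rows_private(6)[OF gl, where x = a and i = i] g_rows_private(6)[OF gl', where x = a and i = i]
        unfolding token_def by blast+
      ultimately show ?thesis unfolding g_kill[OF gl] by blast
    qed
    show "lock_tuple ?P l y xs" if xs: "xs \<in> rel ?P y" "set xs \<subseteq> insert l {a. a \<in> carrier B}" for y xs
    proof -
      have lM: "l \<notin> carrier B" using D(10) .
      consider "xs \<in> rel M y" | "xs \<in> rel N y" | "xs \<in> holder_rel b l B y" | "xs \<in> glue_new M N l d col y"
        using xs(1) unfolding g_rel[OF gl] by blast
      then show ?thesis
      proof cases
        case 1
        then have "set xs \<subseteq> insert l {a. Mem M l a}"
          using xs(2) rel_tuple(2)[OF g_struct(1)[OF gl] 1] AM by blast
        then have "lock_tuple M l y xs" using OM 1 by blast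
        then show ?thesis by (rule lock_tuple_mono) (simp add: g_mem[OF gl] AM)
      next
        case 2
        then have "set xs \<subseteq> insert l {a. Mem N l a}"
          using xs(2) rel_tuple(2)[OF g_struct(2)[OF gl] 2] AN by blast
        then have "lock_tuple N l y xs" using ON 2 by blast
        then show ?thesis by (rule lock_tuple_mono) (simp add: g_mem[OF gl] AN)
      next
        case 3
        then show ?thesis
        proof (cases y)
          case (SCode t s)
          then obtain zs where zs: "t = b" "xs = l # zs" "zs \<in> interp B s"
            using 3 by (auto simp: holder_rel_def split: if_splits)
          have "set zs \<subseteq> carrier B" using is_struct_interp[OF g_Bstruct[OF gl] zs(3)] by blast
          then show ?thesis using zs SCode unfolding lock_tuple_def g_mem[OF gl] by blast
        qed (auto simp: lock_tuple_def g_mem[OF gl] holder_rel_def split: if_splits)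
      next
        case 4
        have "d \<notin> insert l (carrier B)" using D(11) by blast
        moreover have "x \<notin> insert l (carrier B)" if "(x, y') \<in> glue_cells M N l d" for x y'
          using that g_rows_private(4)[OF gl] g_rows_private(4)[OF gl'] unfolding glue_cells_def by blast
        ultimately have False using 4 xs(2) by (cases y) (auto simp: glue_new_def)
        then show ?thesis ..
      qed
    qed
  qed
qed

lemma g_holder_cases:
  assumes gl: "glueable M N B l d col" and h: "holder (glue M N B l d col) t h"
  shows "holder M t h \<or> holder N t h"
proof -
  note D = gD[OF gl]
  have "Typ (glue M N B l d col) t h" using h by (simp add: holder_def)
  then have "[h] \<in> rel M (STyp t) \<or> [h] \<in> rel N (STyp t) \<or> h = l"
    unfolding g_rel[OF gl] by (auto simp: holder_rel_def glue_new_def split: if_splits)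
  then have "h \<in> carrier M \<or> h \<in> carrier N"
    using rel_carrier(1)[OF g_struct(1)[OF gl]] rel_carrier(1)[OF g_struct(2)[OF gl]] g_l[OF gl] by blast
  then show ?thesis
    using substruct_holder[OF g_sub[OF gl]] substruct_holder[OF g_sub[OF glueable_sym[OF gl]]] h
    unfolding glue_sym[of N M] by blast
qed

lemma g_part_models:
  assumes gl: "glueable M N B l d col" and h: "holder M t h"
  shows "strong (K t) (part M t h) (part (glue M N B l d col) t h)"
proof (cases "h = l")
  case True
  have "t = b"
    using okD(3)[OF gD(1)[OF gl] h, of b] lock_holder[OF gD(1)[OF gl] gD(3)[OF gl]] True by simp
  then show ?thesis using g_part_l[OF gl] gD(5)[OF gl] True by simp
next
  case False
  have "part (glue M N B l d col) t h = part M t h"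
    by (rule g_part[OF gl _ False]) (use h in \<open>auto simp: holder_def\<close>)
  then show ?thesis
    using AEC.strong_refl[OF aec[OF holder_type[OF h]] okD(2)[OF gD(1)[OF gl] h]] by simp
qed

lemma g_ok:
  assumes gl: "glueable M N B l d col"
  shows "ok (glue M N B l d col)"
  unfolding ok_def
proof (intro conjI allI impI g_Pstruct[OF gl])
  let ?P = "glue M N B l d col"
  note D = gD[OF gl] and gl' = glueable_sym[OF gl]
  show "part ?P t h \<in> models (K t)" if "holder ?P t h" for t h
    using g_holder_cases[OF gl that]
  proof
    assume "holder M t h"
    then show ?thesis
      using AEC.strong_models[OF aec[OF holder_type[OF that]] g_part_models[OF gl]] by blast
  next
    assume "holder N t h"
    then show ?thesis
      using AEC.strong_models[OF aec[OF holder_type[OF that]] g_part_models[OF gl']]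
      unfolding glue_sym[of N M] by blast
  qed
  show "t = t'" if h: "holder ?P t h" "holder ?P t' h" for t t' h
  proof -
    have "h \<in> carrier M \<or> h \<in> carrier N"
      using g_holder_cases[OF gl h(1)] holder_carrier[OF g_struct(1)[OF gl]]
        holder_carrier[OF g_struct(2)[OF gl]] by blast
    then show ?thesis
    proof
      assume "h \<in> carrier M"
      then have "holder M t h" "holder M t' h" using substruct_holder[OF g_sub[OF gl]] h by simp_all
      then show ?thesis by (rule okD(3)[OF D(1)])
    next
      assume "h \<in> carrier N"
      then have "holder N t h" "holder N t' h"
        using substruct_holder[OF g_sub[OF gl'], unfolded glue_sym[of N M]] h by simp_all
      then show ?thesis by (rule okD(3)[OF D(2)])
    qed
  qed
  show "y = y'" if k: "Kill ?P x y" "Kill ?P x y'" for x y y'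
  proof -
    have 1: "x \<notin> carrier N" if "Kill M x z" for z using g_rows_private(7)[OF gl that] by blast
    have 2: "x \<notin> carrier N" if "token M i x" for i
      using g_rows_private(3)[OF gl, where x = x and i = i] that unfolding token_def by blast
    have 3: "x \<in> carrier N" if "Kill N x z" for z using rel_carrier(2)[OF g_struct(2)[OF gl] that] by blast
    have 4: "x \<in> carrier N" if "token N i x" for i using token_carrier[OF g_struct(2)[OF gl] that] .
    have 5: "token M i x \<Longrightarrow> Kill M x z \<Longrightarrow> False" "token N i x \<Longrightarrow> Kill N x z \<Longrightarrow> False" for i z
      by (auto simp: token_def dead_def)
    show ?thesis
      using k okD(4)[OF D(1), of x y y'] okD(4)[OF D(2), of x y y'] unfolding g_kill[OF gl]
      by (elim disjE) (auto dest: 1 2 3 4 5)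
  qed
  show "i = j" if "token ?P i c" for i j c using g_token[OF gl] that by blast
  show "c = c'" if "token ?P i c" for i c c' using g_token[OF gl] that by blast
  show "x = x'" if "lock ?P x" "lock ?P x'" for x x' using that unfolding g_lock[OF gl] by simp
  show "token_ok ?P i c" if "token ?P i c" for i c using g_token[OF gl] that by blast
  show "lock_ok ?P x" if "lock ?P x" for x using that g_lock_ok[OF gl] unfolding g_lock[OF gl] by simp
qed

text \<open>The only part that grows is that of the lock, from its model in \<open>M\<close> to the
  strong extension \<open>B\<close>. A token active in \<open>M\<close> can only be killed by
  \<open>d\<close>, which is a column of \<open>l\<close>.\<close>

lemma g_ext:
  assumes gl: "glueable M N B l d col"
  shows "ext M (glue M N B l d col)"
  unfolding ext_def
proof (intro conjI allI impI g_ok[OF gl] g_sub[OF gl] gD(1)[OF gl] g_part_models[OF gl])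
  let ?P = "glue M N B l d col"
  note D = gD[OF gl]
  fix x assume x: "lock M x" "heavy (part M b x)"
  have [simp]: "x = l" using okD(6)[OF D(1) x(1) D(3)] .
  show "lock ?P x" using g_lock[OF gl] by simp
  show "Bel ?P y x" if c: "token M i c" and y: "Kill ?P c y" for i c y
  proof -
    have "\<not> Kill M c y" using c by (auto simp: token_def dead_def)
    moreover have "\<not> Kill N c y"
      using g_rows_private(3)[OF gl, where x = c and i = i] c rel_carrier(2)[OF g_struct(2)[OF gl]]
      unfolding token_def by blast
    ultimately have "y = d" using y unfolding g_kill[OF gl] by blast
    then show ?thesis using g_bel[OF gl] by simp
  qed
qed

subsection \<open>Joint embeddings\<close>

lemma relocate:
  assumes M: "ok M" "lock M m" and f: "iso f (part M b m) A" and V: "small V" "carrier A \<subseteq> V" "l \<in> V"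
    and l: "l \<notin> carrier A"
  shows "\<exists>M' \<phi>. iso \<phi> M M' \<and> lock M' l \<and> part M' b l = A \<and> carrier M' \<inter> V = insert l (carrier A)"
proof -
  have sM: "is_struct voc M" using okD(1)[OF M(1)] .
  have mM: "m \<in> carrier M" using lock_carrier[OF sM M(2)] .
  let ?A = "carrier (part M b m)"
  have "|carrier M - insert m ?A| <o |UNIV :: 'u set|"
    using sM small_subset[of "carrier M - insert m ?A" "carrier M"] by (auto simp: is_struct_def small_def)
  then obtain g where g: "inj_on g (carrier M - insert m ?A)" "g ` (carrier M - insert m ?A) \<inter> V = {}"
    using fresh_copy[OF universe _ V(1)] by blast
  define \<phi> where "\<phi> x = (if x = m then l else if x \<in> ?A then f x else g x)" for x
  have fA: "inj_on f ?A" "f ` ?A = carrier A" using f by (auto simp: iso_def bij_betw_def)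
  have mA: "m \<notin> ?A" using lock_facts(1)[OF M] by (auto simp: carrier_part)
  have AM: "?A \<subseteq> carrier M" using carrier_part_subset[OF sM] .
  have fV: "f x \<in> carrier A \<and> f x \<in> V" if "x \<in> ?A" for x using fA that V by blast
  have gV: "g x \<notin> V" if "x \<in> carrier M" "x \<noteq> m" "x \<notin> ?A" for x using g(2) that by blast
  have inj: "inj_on \<phi> (carrier M)"
  proof (rule inj_onI)
    fix x y assume xy: "x \<in> carrier M" "y \<in> carrier M" "\<phi> x = \<phi> y"
    show "x = y"
      using xy fV[of x] fV[of y] gV[of x] gV[of y] l V(3) inj_onD[OF fA(1), of x y] inj_onD[OF g(1), of x y]
      by (auto simp: \<phi>_def split: if_splits)
  qed
  define M' where "M' = image_struct \<phi> M"
  have iso: "iso \<phi> M M'" unfolding M'_def by (rule iso_image_struct[OF inj])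
  have \<phi>m: "\<phi> m = l" by (simp add: \<phi>_def)
  have "iso \<phi> (part M b m) (part M' b l)" using iso_part[OF sM iso mM] \<phi>m by simp
  moreover have "iso \<phi> (part M b m) A"
  proof (rule iso_cong[OF _ _ f])
    show "f x = \<phi> x" if "x \<in> carrier (part M b m)" for x using that mA by (auto simp: \<phi>_def)
    show "is_struct (vocab (K b)) (part M b m)"
      using AEC.models_struct[OF aec[OF b] okD(2)[OF M(1) lock_holder[OF M]]] .
  qed
  ultimately have "part M' b l = A" by (rule iso_unique)
  moreover have "lock M' l" using iso_lock[OF sM iso mM] M(2) \<phi>m by simp
  moreover have "carrier M' \<inter> V = insert l (carrier A)"
  proof -
    have 1: "carrier M' = \<phi> ` carrier M" using iso_carrier[OF sM iso] .
    have 2: "insert l (carrier A) \<subseteq> \<phi> ` carrier M"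
    proof -
      have "f x \<in> \<phi> ` carrier M" if "x \<in> ?A" for x
        by (rule image_eqI[of _ _ x]) (use that mA AM in \<open>auto simp: \<phi>_def\<close>)
      then have "f ` ?A \<subseteq> \<phi> ` carrier M" by blast
      then show ?thesis using mM \<phi>m unfolding fA(2) by auto
    qed
    have 3: "\<phi> x \<in> insert l (carrier A)" if "x \<in> carrier M" "\<phi> x \<in> V" for x
      using that fV[of x] gV[of x] by (auto simp: \<phi>_def split: if_splits)
    show ?thesis
    proof (rule equalityI)
      show "carrier M' \<inter> V \<subseteq> insert l (carrier A)" unfolding 1 using 3 by auto
      show "insert l (carrier A) \<subseteq> carrier M' \<inter> V" unfolding 1 using 2 V(2,3) by auto
    qed
  qed
  ultimately show ?thesis using iso by blast
qed

text \<open>\<open>D\<close> is the reservoir of colours. The number of uncoloured cells is bounded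
  by the square of an infinite cardinal that bounds both models, hence by the size of
  \<open>D\<close>, so all of them can receive different colours. Both models are first moved so
  that their locks coincide, their lock models become submodels of \<open>B\<close>, and nothing
  else overlaps.\<close>

lemma joint_embedding_locks:
  assumes M: "ok M" "lock M m" and N: "ok N" "lock N n"
    and A: "iso f (part M b m) A" "strong (K b) A B" and A': "iso g (part N b n) A'" "strong (K b) A' B"
    and D: "D \<subseteq> carrier B" "infinite D" "|carrier M| \<le>o |D|" "|carrier N| \<le>o |D|"
      "\<not> loose \<Longrightarrow> D \<inter> (carrier A \<union> carrier A') = {}"
  shows "\<exists>P. ok P \<and> (\<exists>\<phi> M'. iso \<phi> M M' \<and> ext M' P) \<and> (\<exists>\<psi> N'. iso \<psi> N N' \<and> ext N' P)"
proof -
  interpret A: AEC "K b" by (rule aec[OF b])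
  have sB: "small (carrier B)" using A.models_small A.strong_models[OF A(2)] by blast
  obtain l where l: "l \<notin> carrier B" using fresh_element[OF universe sB] by blast
  obtain d where d: "d \<notin> insert l (carrier B)"
    using fresh_element[OF universe small_insert[OF universe sB, of l]] by blast
  let ?V = "insert d (insert l (carrier B))"
  have sV: "small ?V" by (intro small_insert[OF universe] sB)
  have AB: "carrier A \<subseteq> carrier B" "carrier A' \<subseteq> carrier B" using A.strong_carrier A(2) A'(2) by blast+
  have "\<exists>M' \<phi>. iso \<phi> M M' \<and> lock M' l \<and> part M' b l = A \<and> carrier M' \<inter> ?V = insert l (carrier A)"
    by (rule relocate[OF M A(1) sV]) (use AB l in auto)
  then obtain M' \<phi> where M': "iso \<phi> M M'" "lock M' l" "part M' b l = A" "carrier M' \<inter> ?V = insert l (carrier A)"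
    by blast
  have okM': "ok M'" using iso_ok[OF okD(1)[OF M(1)] M'(1) M(1)] .
  have sV': "small (?V \<union> carrier M')"
    using small_Un[OF universe sV] okD(1)[OF okM'] by (auto simp: is_struct_def)
  have "\<exists>N' \<psi>. iso \<psi> N N' \<and> lock N' l \<and> part N' b l = A' \<and>
      carrier N' \<inter> (?V \<union> carrier M') = insert l (carrier A')"
    by (rule relocate[OF N A'(1) sV']) (use AB l in auto)
  then obtain N' \<psi> where N': "iso \<psi> N N'" "lock N' l" "part N' b l = A'"
    "carrier N' \<inter> (?V \<union> carrier M') = insert l (carrier A')" by blast
  have okN': "ok N'" using iso_ok[OF okD(1)[OF N(1)] N'(1) N(1)] .
  let ?cells = "glue_cells M' N' l d"
  have "|?cells| \<le>o |D|"
  proof -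
    have iD: "Cinfinite |D|" using D(2) by (rule Cinfinite_card_of)
    have m: "|carrier M'| \<le>o |D|" by (rule ordIso_ordLeq_trans[OF ordIso_symmetric[OF iso_card[OF M'(1)]] D(3)])
    have n: "|carrier N'| \<le>o |D|" by (rule ordIso_ordLeq_trans[OF ordIso_symmetric[OF iso_card[OF N'(1)]] D(4)])
    have u: "|insert d (carrier M' \<union> carrier N')| \<le>o |D|"
      by (intro card_of_insert_le[OF iD] Un_Cinfinite_bound[OF m n iD])
    have "?cells \<subseteq> insert d (carrier M' \<union> carrier N') \<times> insert d (carrier M' \<union> carrier N')"
      using rel_carrier(2)[OF okD(1)[OF okM']] rel_carrier(2)[OF okD(1)[OF okN']]
      unfolding glue_cells_def by blast
    then show ?thesis by (rule card_of_subset_le) (intro card_of_Sigma_le[OF iD] u)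
  qed
  \<comment> \<open>Injectivity of the colouring on all new cells at once, not just within rows, is
    what the rectangle argument of the gluing uses.\<close>
  then obtain col where col: "inj_on col ?cells" "col ` ?cells \<subseteq> D" using inj_into_of_le by metis
  have gl: "glueable M' N' B l d col"
    unfolding glueable_def M'(3) N'(3)
  proof (intro conjI impI okM' okN' M'(2) N'(2) A(2) A'(2) l col(1))
    have xM: "x \<in> carrier M' \<longleftrightarrow> x = l \<or> x \<in> carrier A" if "x \<in> ?V" for x
    proof -
      have "x \<in> carrier M' \<longleftrightarrow> x \<in> carrier M' \<inter> ?V" using that by simp
      then show ?thesis unfolding M'(4) by simp
    qed
    have xN: "x \<in> carrier N' \<longleftrightarrow> x = l \<or> x \<in> carrier A'" if "x \<in> ?V \<union> carrier M'" for x
    proof -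
      have "x \<in> carrier N' \<longleftrightarrow> x \<in> carrier N' \<inter> (?V \<union> carrier M')" using that by simp
      then show ?thesis unfolding N'(4) by simp
    qed
    have AB': "x \<in> carrier A \<Longrightarrow> x \<in> carrier B" "x \<in> carrier A' \<Longrightarrow> x \<in> carrier B" for x using AB by auto
    show 1: "carrier M' \<inter> carrier B = carrier A" using xM AB' l by auto
    show 2: "carrier N' \<inter> carrier B = carrier A'" using xN AB' l by auto
    show "carrier M' \<inter> carrier N' = insert l (carrier A \<inter> carrier A')"
    proof (intro set_eqI)
      fix x
      show "x \<in> carrier M' \<inter> carrier N' \<longleftrightarrow> x \<in> insert l (carrier A \<inter> carrier A')"
        using xM[of x] xN[of x] AB'[of x] by auto
    qed
    show "d \<notin> insert l (carrier M' \<union> carrier N' \<union> carrier B)"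
      using xM[of d] xN[of d] d AB'[of d] by auto
    show "col ` ?cells \<subseteq> carrier B" using col(2) D(1) by blast
    show "col ` ?cells \<inter> (carrier M' \<union> carrier N') = {}" if "\<not> loose"
      using D(5)[OF that] col(2) D(1) 1 2 by blast
  qed
  have "ext M' (glue M' N' B l d col)" "ext N' (glue M' N' B l d col)"
    using g_ext[OF gl] g_ext[OF glueable_sym[OF gl]] unfolding glue_sym[of N' M'] .
  then show ?thesis using M'(1) N'(1) g_ok[OF gl] by blast
qed

end

context lock_construction
begin

section \<open>Fresh locks over a given model, and the failure of amalgamation\<close>

lemma fresh_lock:
  fixes R0 :: "'u set"
  assumes M: "ok M" "\<And>l. lock M l \<Longrightarrow> \<not> heavy (part M b l)"
    and A: "A \<in> models (K b)" and R0: "small R0" and D0: "D0 \<subseteq> carrier A"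
  shows "\<exists>N l A' f Rw D col. ext M N \<and> lock N l \<and> iso f A A' \<and> A' \<in> models (K b) \<and> part N b l = A' \<and>
    carrier N = insert l (carrier M \<union> carrier A' \<union> Rw \<union> D) \<and> l \<notin> carrier M \<and> |Rw| =o |R0| \<and> |D| \<le>o |carrier A'| \<and>
    (\<forall>i c. \<not> token N i c) \<and> (\<forall>x. Row N x l \<longleftrightarrow> x \<in> Rw) \<and> (\<forall>d. Bel N d l \<longleftrightarrow> d \<in> D) \<and>
    bij_betw col D (f ` D0) \<and> (\<forall>x \<in> Rw. \<forall>d a. Col N x d a \<longleftrightarrow> d \<in> D \<and> a = col d) \<and>
    (\<forall>d \<in> D. Red N d \<longleftrightarrow> red)"
proof -
  interpret A: AEC "K b" by (rule aec[OF b])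
  have sM: "small (carrier M)" using okD(1)[OF M(1)] by (simp add: is_struct_def)
  have sA: "small (carrier A)" using A.models_small[OF A] .
  obtain l where l: "l \<notin> carrier M" using fresh_element[OF universe sM] by blast
  have s1: "small (insert l (carrier M))" by (rule small_insert[OF universe sM])
  obtain f where f: "inj_on f (carrier A)" "f ` carrier A \<inter> insert l (carrier M) = {}"
    using fresh_copy[OF universe sA[unfolded small_def] s1] by blast
  define A' where "A' = image_struct f A"
  have iso: "iso f A A'" unfolding A'_def by (rule iso_image_struct[OF f(1)])
  have A': "A' \<in> models (K b)" "carrier A' = f ` carrier A"
    using A.models_iso[OF A iso] by (simp_all add: A'_def image_struct_def)
  have sA': "small (carrier A')" using A.models_small[OF A'(1)] .
  have s2: "small (insert l (carrier M) \<union> carrier A')" by (rule small_Un[OF universe s1 sA'])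
  obtain g where g: "inj_on g R0" "g ` R0 \<inter> (insert l (carrier M) \<union> carrier A') = {}"
    using fresh_copy[OF universe R0[unfolded small_def] s2] by blast
  have sR: "small (g ` R0)" by (rule small_image[OF R0])
  have s3: "small (insert l (carrier M) \<union> carrier A' \<union> g ` R0)" by (rule small_Un[OF universe s2 sR])
  have fD: "f ` D0 \<subseteq> carrier A'" using D0 A'(2) by blast
  have sfD: "small (f ` D0)" by (rule small_subset[OF fD sA'])
  obtain h where h: "inj_on h (f ` D0)" "h ` (f ` D0) \<inter> (insert l (carrier M) \<union> carrier A' \<union> g ` R0) = {}"
    using fresh_copy[OF universe sfD[unfolded small_def] s3] by blast
  define D where "D = h ` (f ` D0)"
  \<comment> \<open>The columns are a copy of the chosen points of the lock model, and
    \<open>col\<close> undoes the copying. So each chosen point is the colour of exactly one column,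
    constantly in all rows.\<close>
  define col where "col = inv_into (f ` D0) h"
  have col: "bij_betw col D (f ` D0)"
    unfolding col_def D_def by (rule bij_betw_inv_into) (use h(1) in \<open>simp add: bij_betw_def\<close>)
  define Rw where "Rw = g ` R0"
  have Rc: "|Rw| =o |R0|"
    unfolding Rw_def using card_of_ordIsoI[of g R0 "g ` R0"] g(1) ordIso_symmetric by (auto simp: bij_betw_def)
  have Dc: "|D| \<le>o |carrier A'|"
    unfolding D_def by (rule ordLeq_transitive[OF card_of_image card_of_mono1[OF fD]])
  have sD: "small D" unfolding D_def by (rule small_image[OF sfD])
  define S where "S = (if red then D else {})"
  note L = add_new_lock[OF M A'(1), of l Rw D col S]
  have pre: "l \<notin> carrier A'" "l \<notin> Rw" "l \<notin> D" "carrier A' \<inter> Rw = {}" "carrier A' \<inter> D = {}" "Rw \<inter> D = {}"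
    "insert l (carrier A' \<union> Rw \<union> D) \<inter> carrier M = {}" "small Rw" "small D" "inj_on col D"
    "col ` D \<subseteq> carrier A'" "S \<subseteq> D"
    using l f(2) g(2) h(2) sR sD col fD
    unfolding A'(2) Rw_def D_def[symmetric] S_def bij_betw_def by auto
  note L = L[OF _ pre]
  define N where "N = add M (insert l (carrier A' \<union> Rw \<union> D))
      (\<lambda>y. holder_rel b l A' y \<union> (case y of SLock \<Rightarrow> {[l]} | SRow \<Rightarrow> (\<lambda>x. [x, l]) ` Rw
      | SBel \<Rightarrow> (\<lambda>d. [d, l]) ` D | SCol \<Rightarrow> {[x, d, col d] | x d. x \<in> Rw \<and> d \<in> D}
      | SRed \<Rightarrow> (\<lambda>d. [d]) ` S | SKill \<Rightarrow> {[x, l] | x. lock M x \<or> (\<exists>i. token M i x)} | _ \<Rightarrow> {}))"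
  note L = L[folded N_def]
  have "carrier N = insert l (carrier M \<union> carrier A' \<union> Rw \<union> D)" by (auto simp: N_def)
  moreover have "\<forall>d \<in> D. Red N d \<longleftrightarrow> red" using L(8) by (simp add: S_def)
  ultimately show ?thesis
    using L(1-7) iso A'(1) l Rc Dc col
    by (intro exI[of _ N] exI[of _ l] exI[of _ A'] exI[of _ f] exI[of _ Rw] exI[of _ D] exI[of _ col]) simp
qed

lemma plain_no_lock: "\<not> lock (mk_struct C (\<lambda>_. {})) l" "\<not> token (mk_struct C (\<lambda>_. {})) i c"
  by (simp_all add: lock_def token_def plain_rel)

text \<open>Over a set without any marks, \<open>M1\<close> lets a red element kill \<open>x\<close>
  and \<open>M2\<close> one that is not red. In an amalgam over that set \<open>x\<close> keeps a
  single image, whose killer is unique and would have to be red and not red. As no token or lock is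
  involved, this works in every infinite cardinality.\<close>

lemma L_amalgamation_fails:
  assumes \<mu>: "infinite_cardinal (\<mu> :: 'u rel)"
  shows "\<exists>M0 M1 M2. |carrier M0| =o \<mu> \<and> |carrier M1| =o \<mu> \<and> |carrier M2| =o \<mu> \<and> ext M0 M1 \<and> ext M0 M2 \<and>
    \<not> (\<exists>f g M1' M2' P. iso f M1 M1' \<and> ext M1' P \<and> iso g M2 M2' \<and> ext M2' P \<and> (\<forall>x \<in> carrier M0. f x = g x))"
proof -
  have \<mu>c: "Card_order \<mu>" "Cinfinite \<mu>" using \<mu> by (simp_all add: infinite_cardinal_def)
  define C where "C = Field \<mu>"
  have C: "|C| =o \<mu>" unfolding C_def by (rule card_of_Field_ordIso[OF \<mu>c(1)])
  have sC: "small C" unfolding small_def by (rule ordIso_ordLess_trans[OF C infinite_cardinal_small[OF \<mu>]])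
  have iC: "infinite C" using \<mu>c(2) by (simp add: C_def cinfinite_def)
  then obtain x where x: "x \<in> C" by (metis finite.emptyI ex_in_conv)
  obtain d where d: "d \<notin> C" using fresh_element[OF universe sC] by blast
  let ?M0 = "mk_struct C (\<lambda>_. {})"
  have ok0: "ok ?M0" by (rule plain_ok) (use x sC in auto)
  have nd: "\<not> dead ?M0 x" by (simp add: dead_def plain_rel)
  note k = add_killer[OF ok0 plain_no_lock(2) plain_no_lock(1), of x d, simplified, OF x nd d]
  define M1 where "M1 = add ?M0 {d} (\<lambda>y. if y = SKill then {[x, d]} else if y = SRed then {[d]} else {})"
  define M2 where "M2 = add ?M0 {d} (\<lambda>y. if y = SKill then {[x, d]} else if y = SRed then {} else {})"
  have M1: "ext ?M0 M1" "Kill M1 x d" "Red M1 d"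
    unfolding M1_def using k[of "{[d]}"] by auto
  have M2: "ext ?M0 M2" "Kill M2 x d" "\<not> Red M2 d"
    unfolding M2_def using k[of "{}"] by auto
  have "|insert d C| =o \<mu>"
  proof -
    have "|C| \<le>o \<mu>" using C ordIso_iff_ordLeq by metis
    then have "|insert d C| \<le>o \<mu>" by (rule card_of_insert_le[OF \<mu>c(2)])
    moreover have "\<mu> \<le>o |insert d C|"
      by (rule ordIso_ordLeq_trans[OF ordIso_symmetric[OF C] card_of_mono1]) blast
    ultimately show ?thesis by (simp add: ordIso_iff_ordLeq)
  qed
  then have c: "|carrier M1| =o \<mu>" "|carrier M2| =o \<mu>" by (simp_all add: M1_def M2_def)
  have "False" if P: "iso f M1 M1'" "ext M1' P" "iso g M2 M2'" "ext M2' P" "f x = g x" for f g M1' M2' P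
  proof -
    note s1 = okD(1)[OF extD(2)[OF M1(1)]] and s2 = okD(1)[OF extD(2)[OF M2(1)]]
    have dM: "d \<in> carrier M1" "d \<in> carrier M2" "x \<in> carrier M1" "x \<in> carrier M2"
      using x by (simp_all add: M1_def M2_def)
    have cc: "f d \<in> carrier M1'" "g d \<in> carrier M2'" "f x \<in> carrier M1'" "g x \<in> carrier M2'"
      using iso_carrier[OF s1 P(1)] iso_carrier[OF s2 P(3)] dM by auto
    have "Kill M1' (f x) (f d)" "Kill M2' (g x) (g d)" "Red M1' (f d)" "\<not> Red M2' (g d)"
      using iso_rel123[OF s1 P(1)] iso_rel123[OF s2 P(3)] dM M1 M2 by auto
    then have "Kill P (f x) (f d)" "Kill P (f x) (g d)" "Red P (f d)" "\<not> Red P (g d)"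
      using substruct_rel[OF extD(3)[OF P(2)], of "[f x, f d]"] substruct_rel[OF extD(3)[OF P(2)], of "[f d]"]
        substruct_rel[OF extD(3)[OF P(4)], of "[g x, g d]"] substruct_rel[OF extD(3)[OF P(4)], of "[g d]"] cc P(5)
      by auto
    then show False using okD(4)[OF extD(2)[OF P(2)], of "f x" "f d" "g d"] by metis
  qed
  then have "\<not> (\<exists>P f g M1' M2'. iso f M1 M1' \<and> ext M1' P \<and> iso g M2 M2' \<and> ext M2' P \<and>
    (\<forall>x \<in> C. f x = g x))" using x by blast
  then show ?thesis using c C M1(1) M2(1)
    by (intro exI[of _ ?M0] exI[of _ M1] exI[of _ M2] conjI) simp_all
qed

section \<open>Purity\<close>

definition full_struct :: "'u \<Rightarrow> 'u struct" where
  "full_struct p = mk_struct {p} (\<lambda>y. tuples (sym_arity y) {p})"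

text \<open>In the one-point structure with all relations full, the point is a member of itself and
  hence no holder, and it kills itself and hence is neither an active token nor an active lock. So
  all conditions on holders, tokens and locks are empty.\<close>

lemma full_ok: "ok (full_struct p)"
proof -
  have s: "is_struct voc (full_struct p)"
    unfolding full_struct_def
    by (rule is_struct_mk) (use small_finite[OF universe, of "{p}"] in auto)
  have r: "xs \<in> rel (full_struct p) y \<longleftrightarrow> y \<in> symbols \<and> length xs = sym_arity y \<and> set xs \<subseteq> {p}" for xs y
    by (simp add: full_struct_def rel_mk tuples_def)
  have p: "x = p" if "xs \<in> rel (full_struct p) y" "x \<in> set xs" for xs y x using that r by blast
  have "\<not> holder (full_struct p) t h" for t h
    using p[of "[h]"] symbolsI(3) by (auto simp: holder_def r)
  moreover have dead: "dead (full_struct p) p" using symbolsI(6) by (auto simp: dead_def r)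
  then have "\<not> token (full_struct p) i c" "\<not> lock (full_struct p) c" for i c
    using p[of "[c]"] by (auto simp: token_def lock_def)
  moreover have "d = d'" if "Kill (full_struct p) x d" "Kill (full_struct p) x d'" for x d d'
    using p[OF that(1), of d] p[OF that(2), of d'] by simp
  ultimately show ?thesis using s unfolding ok_def by blast
qed

text \<open>A single model that interprets every symbol by a nonempty relation lies in no subclass
  given by a proper subvocabulary, so two such subclasses cannot cover the class.\<close>

lemma L_pure: "pure L"
proof -
  fix p :: 'u
  have ne: "interp (full_struct p) s \<noteq> {}" if s: "s \<in> voc" for s
  proof -
    obtain y where y: "y \<in> symbols" "s = code y" using s by (auto simp: voc_def)
    have "replicate (sym_arity y) p \<in> rel (full_struct p) y"
      using y by (auto simp: full_struct_def rel_mk tuples_def)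
    then show ?thesis using y by (auto simp: rel_def)
  qed
  have "full_struct p \<notin> models_in L \<tau>" if "\<tau> \<noteq> voc" "\<tau> \<subseteq> voc" for \<tau>
    using ne that unfolding models_in_def L_simps by blast
  moreover have "full_struct p \<in> models L" using full_ok by simp
  ultimately show ?thesis unfolding pure_def hybrid_def L_simps by blast
qed

subsection \<open>Maximal models\<close>

text \<open>The lock model cannot grow, every colour already has a column that is constant on
  \<open>Rw\<close>, and \<open>Rw\<close> outnumbers the colours; so the lock gets no new column
  and the token cannot be killed. As the models of the holders are maximal and fully used for
  picking, old holders pick no new point. A new holder would then have to pick all old ones, of
  which there are more than \<kappa>.\<close>

lemma maximal_criterion:
  assumes N: "ok N" and l: "lock N l" "heavy (part N b l)"
    and lmax: "\<And>B. strong (K b) (part N b l) B \<Longrightarrow> B = part N b l"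
    and Rw: "\<And>x. x \<in> Rw \<Longrightarrow> Row N x l" "\<not> |Rw| \<le>o |carrier (part N b l)|"
    and cols: "\<And>a. Mem N l a \<Longrightarrow> \<exists>d. Bel N d l \<and> (\<forall>x \<in> Rw. Col N x d a)"
    and c: "token N i c"
    and emax: "\<And>e B. Bel N e c \<Longrightarrow> strong (K i) (part N i e) B \<Longrightarrow> B = part N i e"
    and pick: "\<And>e a. Bel N e c \<Longrightarrow> Mem N e a \<Longrightarrow> \<exists>p. Pick N e a p"
    and big: "\<not> |{e. Bel N e c}| \<le>o \<kappa>" and bound: "\<And>A. A \<in> models (K i) \<Longrightarrow> |carrier A| \<le>o \<kappa>"
    and P: "ext N P"
  shows "P = N"
proof -
  note E = extD[OF P]
  note sN = okD(1)[OF E(1)] and sP = okD(1)[OF E(2)]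
  have up: "xs \<in> rel P y" if "xs \<in> rel N y" for xs y
    using substruct_rel[OF E(3)] rel_tuple(2)[OF sN that] that by blast
  have dn: "xs \<in> rel N y" if "xs \<in> rel P y" "set xs \<subseteq> carrier N" for xs y
    using substruct_rel[OF E(3) that(2)] that(1) by blast
  have lP: "lock P l" using E(5)[OF l] .
  have pl: "part P b l = part N b l" using lmax[OF E(4)[OF lock_holder[OF N l(1)]]] .
  have memP: "Mem P l a \<longleftrightarrow> Mem N l a" for a
    using arg_cong[OF pl, of carrier] unfolding carrier_part by blast
  note OP = okD(8)[OF E(2) lP, unfolded lock_ok_def]
  \<comment> \<open>If a new column gave two rows of \<open>Rw\<close> the same colour, these rows
    would form a monochromatic rectangle with the old column that carries this colour throughout
    \<open>Rw\<close>. So the colours of a new column are different in different rows of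
    \<open>Rw\<close>, and there are not enough of them.\<close>
  have nocol: "d \<in> carrier N" if d: "Bel P d l" for d
  proof (rule ccontr)
    assume dN: "d \<notin> carrier N"
    have "\<forall>x\<in>Rw. \<exists>a. Mem P l a \<and> Col P x d a" using OP d up[OF Rw(1)] by blast
    then obtain a where a: "\<And>x. x \<in> Rw \<Longrightarrow> Mem P l (a x) \<and> Col P x d (a x)" by metis
    have "inj_on a Rw"
    proof (rule inj_onI)
      fix x x' assume x: "x \<in> Rw" "x' \<in> Rw" "a x = a x'"
      obtain d'' where d'': "Bel N d'' l" "\<forall>z \<in> Rw. Col N z d'' (a x)"
        using cols[of "a x"] a[OF x(1)] memP by blast
      have "d'' \<noteq> d" using d''(1) rel_carrier(2)[OF sN] dN by blast
      have 1: "Row P x l" "Row P x' l" "Bel P d'' l" "Mem P l (a x)" "Col P x d'' (a x)" "Col P x' d'' (a x)"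
        "Col P x d (a x)" "Col P x' d (a x)"
        using up[OF Rw(1)[OF x(1)]] up[OF Rw(1)[OF x(2)]] up[OF d''(1)] a[OF x(1)] a[OF x(2)] x
          up[OF bspec[OF d''(2) x(1)]] up[OF bspec[OF d''(2) x(2)]] by simp_all
      have "d = d'' \<or> loose \<and> x = x'"
        using OP 1 d by blast
      then show "x = x'" using \<open>d'' \<noteq> d\<close> by blast
    qed
    then have "|Rw| \<le>o |carrier (part N b l)|"
      by (rule card_of_ordLeqI) (use a memP in \<open>auto simp: carrier_part\<close>)
    then show False using Rw(2) by blast
  qed
  have cN: "c \<in> carrier N" using token_carrier[OF sN c] .
  have "\<not> dead P c"
  proof
    assume "dead P c"
    then obtain d where d: "Kill P c d" by (auto simp: dead_def)
    then have "d \<in> carrier N" using nocol[OF E(6)[OF l c d]] by blast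
    then have "Kill N c d" using dn[OF d] cN by simp
    then show False using c by (auto simp: token_def dead_def)
  qed
  then have cP: "token P i c" using c up by (auto simp: token_def)
  note T = okD(7)[OF E(2) cP, unfolded token_ok_def]
  note T3 = T[THEN conjunct2, THEN conjunct1, rule_format]
    and T4 = T[THEN conjunct2, THEN conjunct2, THEN conjunct1, rule_format]
    and T5 = T[THEN conjunct2, THEN conjunct2, THEN conjunct2, rule_format]
  \<comment> \<open>The part of an old holder is unchanged, and each of its points already picks
    something in \<open>N\<close>; since a point picks only one element, it picks nothing new in
    \<open>P\<close>.\<close>
  have old: "p \<in> carrier N" if H: "Bel P e c" "Mem P e a" "Pick P e a p" "e \<in> carrier N" for e a p
  proof -
    have e: "Bel N e c" using dn[OF H(1)] H(4) cN by simp
    have "holder N i e" using okD(7)[OF N c] e unfolding token_ok_def by blast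
    then have pe: "part P i e = part N i e" using emax[OF e E(4)] by blast
    have "{a. Mem P e a} = {a. Mem N e a}" using arg_cong[OF pe, of carrier] by (simp only: carrier_part)
    then have "Mem N e a" using H(2) by blast
    then obtain q where q: "Pick N e a q" using pick[OF e] by blast
    have "p = q" using T3[OF H(1,2,3) up[OF q]] .
    then show ?thesis using rel_carrier(3)[OF sN q] by simp
  qed
  have "carrier P \<subseteq> carrier N"
  proof
    fix p assume "p \<in> carrier P"
    then obtain e a where e: "Bel P e c" "Mem P e a" "Pick P e a p" using T4 by blast
    have "e \<in> carrier N"
    proof (rule ccontr)
      \<comment> \<open>No old holder picks \<open>e\<close>, so \<open>e\<close> picks every old
        holder. It does so by different points of its part, whose number is at most
        \<kappa>.\<close>
      assume eN: "e \<notin> carrier N"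
      have "\<exists>a. Mem P e a \<and> Pick P e a f" if f: "Bel N f c" for f
      proof -
        have "f \<in> carrier N" using rel_carrier(2)[OF sN f] by blast
        then have "\<not> (\<exists>a. Mem P f a \<and> Pick P f a e)" using old[OF up[OF f]] eN by blast
        then show ?thesis using T5[OF e(1) up[OF f]] by blast
      qed
      then obtain k where k: "\<And>f. Bel N f c \<Longrightarrow> Mem P e (k f) \<and> Pick P e (k f) f" by metis
      have "inj_on k {f. Bel N f c}"
      proof (rule inj_onI)
        fix f f' assume f: "f \<in> {f. Bel N f c}" "f' \<in> {f. Bel N f c}" "k f = k f'"
        have "Pick P e (k f) f'" using k[of f'] f by simp
        then show "f = f'" using T3[OF e(1), of "k f" f f'] k[of f] f(1) by simp
      qed
      then have "|{f. Bel N f c}| \<le>o |carrier (part P i e)|"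
        by (rule card_of_ordLeqI) (use k in \<open>auto simp: carrier_part\<close>)
      moreover have "holder P i e" using T e(1) by blast
      then have "|carrier (part P i e)| \<le>o \<kappa>" using bound okD(2)[OF E(2)] by blast
      ultimately show False using big ordLeq_transitive[of "|{f. Bel N f c}|"] by blast
    qed
    then show "p \<in> carrier N" using old[OF e] by blast
  qed
  then show ?thesis using substruct_eqI[OF sP E(3)] by simp
qed

text \<open>One new holder with a model of cardinality \<kappa> suffices: its points can pick all of
  \<open>M\<close>, the new holder and its whole part, as these together number at most \<kappa>.
  Picking is arranged to be surjective, so no other clause about the token needs care.\<close>

lemma strict_extension:
  assumes M: "ok M" and i: "i \<in> I" "infinite_cardinal \<kappa>" "token M i c"
    and A: "A \<in> models (K i)" "|carrier A| =o \<kappa>" and le: "|carrier M| \<le>o \<kappa>"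
  shows "\<exists>N. ext M N \<and> N \<noteq> M"
proof -
  interpret A: AEC "K i" by (rule aec[OF i(1)])
  have \<kappa>c: "Cinfinite \<kappa>" using i(2) by (simp add: infinite_cardinal_def)
  have sM: "small (carrier M)" using okD(1)[OF M] by (simp add: is_struct_def)
  obtain e where e: "e \<notin> carrier M" using fresh_element[OF universe sM] by blast
  have s1: "small (insert e (carrier M))" by (rule small_insert[OF universe sM])
  obtain f where f: "inj_on f (carrier A)" "f ` carrier A \<inter> insert e (carrier M) = {}"
    using fresh_copy[OF universe A.models_small[OF A(1), unfolded small_def] s1] by blast
  define A' where "A' = image_struct f A"
  have iso: "iso f A A'" unfolding A'_def by (rule iso_image_struct[OF f(1)])
  have A': "A' \<in> models (K i)" "carrier A' = f ` carrier A"
    using A.models_iso[OF A(1) iso] by (simp_all add: A'_def image_struct_def)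
  have cA': "|carrier A'| =o \<kappa>" by (rule ordIso_transitive[OF ordIso_symmetric[OF iso_card[OF iso]] A(2)])
  let ?T = "carrier M \<union> ({} \<union> {e} \<union> (\<Union>e\<in>{e}. carrier A'))"
  have "|carrier A'| \<le>o \<kappa>" using cA' ordIso_iff_ordLeq by metis
  then have "|carrier M \<union> insert e (carrier A')| \<le>o \<kappa>"
    by (intro Un_Cinfinite_bound card_of_insert_le \<kappa>c le)
  then have "|?T| \<le>o |carrier A'|" using ordLeq_ordIso_trans[OF _ ordIso_symmetric[OF cA']] by simp
  then obtain g where g: "g ` carrier A' = ?T" using surj_of_le[of ?T] by blast
  have cM: "c \<in> carrier M" using token_carrier[OF okD(1)[OF M] i(3)] .
  have ext: "ext M (add M ({} \<union> {e} \<union> (\<Union>e\<in>{e}. carrier A'))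
      (\<lambda>y. (\<Union>e\<in>{e}. holder_rel i e A' y) \<union> (case y of STok j \<Rightarrow> if j = i then (\<lambda>x. [x]) ` {} else {}
      | SBel \<Rightarrow> (\<lambda>e. [e, c]) ` {e} \<union> (\<lambda>(e, f). [e, f]) ` {}
      | SPick \<Rightarrow> {[e', a, g a] | e' a. e' \<in> {e} \<and> a \<in> carrier A'}
      | SRed \<Rightarrow> (\<lambda>e. [e]) ` {} | _ \<Rightarrow> {})))"
  proof (rule add_token_holders(1)[OF M i(1), where A = "\<lambda>_. A'" and g = "\<lambda>_. g"])
    show "token M i c \<and> {} = {} \<or> {} = {c} \<and> c \<notin> carrier M \<and> (\<forall>j x. \<not> token M j x)" using i(3) by simp
    show "A' \<in> models (K i)" by fact
    show "c \<notin> {e}" using cM e by blast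
    show "insert c {e} \<inter> carrier A' = {}" using f(2) cM unfolding A'(2) by blast
    show "({} \<union> {e} \<union> (\<Union>e\<in>{e}. carrier A')) \<inter> carrier M = {}" using f(2) e unfolding A'(2) by blast
    show "small ({} \<union> {e} \<union> (\<Union>e\<in>{e}. carrier A'))"
      using small_insert[OF universe A.models_small[OF A'(1)], of e] by simp
    show "g a \<in> ?T" if "a \<in> carrier A'" for a using g that by blast
    show "\<exists>e\<in>{e}. p \<in> g ` carrier A'" if "p \<in> ?T" for p using g that by blast
    show "f' \<in> g ` carrier A' \<or> e' \<in> g ` carrier A'" if "e' \<in> {e}" for e' f' using g that by blast
    show "f' \<in> g ` carrier A'" if "Bel M f' c" for f'
      using g rel_carrier(2)[OF okD(1)[OF M] that] by blast
  qed simp_all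
  moreover have "add M ({} \<union> {e} \<union> (\<Union>e\<in>{e}. carrier A')) X \<noteq> M" for X
  proof
    assume "add M ({} \<union> {e} \<union> (\<Union>e\<in>{e}. carrier A')) X = M"
    then have "e \<in> carrier M" using carrier_add[of M "{} \<union> {e} \<union> (\<Union>e\<in>{e}. carrier A')" X] by auto
    then show False using e by blast
  qed
  ultimately show ?thesis by blast
qed

end

text \<open>A strong extension \<open>B\<close> of the copy \<open>Q'\<close> is carried back to a
  strong extension of \<open>Q\<close> by extending the inverse of \<open>f\<close> to the remaining
  points of \<open>B\<close> with fresh values.\<close>

lemma (in AEC) maximal_model_iso:
  assumes universe: "universe TYPE('u)" and Q: "maximal_model K Q" and f: "iso f Q Q'"
  shows "maximal_model K Q'"
  unfolding maximal_model_def
proof (intro conjI allI impI)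
  have sQ: "is_struct (vocab K) Q" and mQ: "Q \<in> models K"
    using Q models_struct by (auto simp: maximal_model_def)
  show "Q' \<in> models K" using models_iso[OF mQ f] .
  then have sQ': "is_struct (vocab K) Q'" by (rule models_struct)
  fix B assume B: "strong K Q' B"
  have smB: "small (carrier B)" "small (carrier Q)"
    using models_small strong_models[OF B] mQ by blast+
  define g where "g = inv_into (carrier Q) f"
  have g: "iso g Q' Q" unfolding g_def by (rule iso_inv[OF f sQ])
  have gb: "bij_betw g (carrier Q') (carrier Q)" using g by (simp add: iso_def)
  obtain h where h: "inj_on h (carrier B)" "h ` carrier B \<inter> carrier Q = {}"
    using fresh_copy[OF universe smB(1)[unfolded small_def] smB(2)] by blast
  define \<phi> where "\<phi> x = (if x \<in> carrier Q' then g x else h x)" for x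
  have inj: "inj_on \<phi> (carrier B)"
  proof (rule inj_onI)
    fix x y assume xy: "x \<in> carrier B" "y \<in> carrier B" "\<phi> x = \<phi> y"
    have 1: "g z \<in> carrier Q" if "z \<in> carrier Q'" for z using bij_betwE[OF gb] that by blast
    have 2: "h z \<notin> carrier Q" if "z \<in> carrier B" for z using h(2) that by blast
    show "x = y"
      using xy 1[of x] 1[of y] 2[of x] 2[of y] inj_onD[OF h(1), of x y]
        inj_onD[OF bij_betw_imp_inj_on[OF gb], of x y]
      by (auto simp: \<phi>_def split: if_splits)
  qed
  have iB: "iso \<phi> B (image_struct \<phi> B)" by (rule iso_image_struct[OF inj])
  have "iso \<phi> Q' Q" by (rule iso_cong[OF _ sQ' g]) (simp add: \<phi>_def)
  then have "strong K Q (image_struct \<phi> B)" using strong_iso[OF B iB] by blast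
  then have "image_struct \<phi> B = Q" using Q by (simp add: maximal_model_def)
  then have "\<phi> ` carrier B = carrier Q" by (auto simp: image_struct_def)
  then have "x \<in> carrier Q'" if "x \<in> carrier B" for x
    using h(2) that by (auto simp: \<phi>_def split: if_splits)
  then show "B = Q'" using strong_antisym[OF B] by blast
qed

context lock_construction
begin

section \<open>Joint embeddings through heavy locks\<close>

lemma common_lock:
  assumes N: "ok N" "lock N l" "heavy (part N b l)" and f: "iso f N M'" and P: "ext M' P"
  shows "lock P (f l)" "iso f (part N b l) (part M' b (f l))"
    "strong (K b) (part M' b (f l)) (part P b (f l))"
proof -
  note sN = okD(1)[OF N(1)]
  have l: "l \<in> carrier N" using lock_carrier[OF sN N(2)] .
  show i: "iso f (part N b l) (part M' b (f l))" by (rule iso_part[OF sN f l])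
  have l': "lock M' (f l)" using iso_lock[OF sN f l] N(2) by blast
  have "heavy (part M' b (f l))" using heavy_iso[OF i] N(3) by blast
  then show "lock P (f l)" using extD(5)[OF P l'] by blast
  show "strong (K b) (part M' b (f l)) (part P b (f l))"
    using extD(4)[OF P lock_holder[OF extD(1)[OF P] l']] .
qed

text \<open>An active lock that is not heavy does not stand in the way, because a new lock may kill
  it. The new lock is given neither rows nor columns, so the cardinality only grows by that of
  \<open>A\<close>.\<close>

lemma add_heavy_lock:
  assumes M: "ok M" and A: "A \<in> models (K b)" "heavy A"
    and \<mu>: "Cinfinite \<mu>" "|carrier M| \<le>o \<mu>" "|carrier A| \<le>o \<mu>"
  shows "\<exists>N l. ext M N \<and> lock N l \<and> heavy (part N b l) \<and> |carrier N| \<le>o \<mu>"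
proof (cases "\<exists>l. lock M l \<and> heavy (part M b l)")
  case True
  then show ?thesis using ext_refl[OF M] \<mu>(2) by blast
next
  case False
  then have no: "\<not> heavy (part M b l)" if "lock M l" for l using that by blast
  have s: "small ({} :: 'u set)" by (rule small_finite[OF universe]) simp
  obtain N l A' f Rw D col where N: "ext M N" "lock N l" "iso f A A'" "part N b l = A'"
    "carrier N = insert l (carrier M \<union> carrier A' \<union> Rw \<union> D)" "|Rw| =o |{} :: 'u set|" "bij_betw col D (f ` {})"
    using fresh_lock[OF M no A(1) s empty_subsetI, of False] by blast
  have "Rw = {}" using N(6) card_of_empty2 by blast
  moreover have "D = {}" using N(7) by (simp add: bij_betw_def)
  moreover have "|carrier A'| \<le>o \<mu>"
    by (rule ordIso_ordLeq_trans[OF ordIso_symmetric[OF iso_card[OF N(3)]] \<mu>(3)])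
  ultimately have "|carrier N| \<le>o \<mu>"
    unfolding N(5) using \<mu> by (auto intro!: card_of_insert_le Un_Cinfinite_bound)
  moreover have "heavy (part N b l)" using heavy_iso[OF N(3)] A(2) N(4) by simp
  ultimately show ?thesis using N by blast
qed

text \<open>Both models first receive a heavy lock if they lack one; then gluing applies. The
  hypothesis \<open>J\<close> asks for more than a joint embedding of the lock models: it also asks
  for at least \<theta> many colours, and without \<open>loose\<close> these must be outside the two
  images.\<close>

lemma joint_embedding:
  assumes M: "ok M" and N: "ok N" and A0: "A0 \<in> models (K b)" "heavy A0"
    and \<theta>: "Cinfinite \<theta>" "|carrier M| \<le>o \<theta>" "|carrier N| \<le>o \<theta>" "|carrier A0| \<le>o \<theta>"
    and J: "\<And>A A'. A \<in> models (K b) \<Longrightarrow> A' \<in> models (K b) \<Longrightarrow> heavy A \<Longrightarrow> heavy A' \<Longrightarrow>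
      |carrier A| \<le>o \<theta> \<Longrightarrow> |carrier A'| \<le>o \<theta> \<Longrightarrow>
      \<exists>f g A1 A1' B D. iso f A A1 \<and> strong (K b) A1 B \<and> iso g A' A1' \<and> strong (K b) A1' B \<and>
        D \<subseteq> carrier B \<and> \<theta> \<le>o |D| \<and> (loose \<or> D \<inter> (carrier A1 \<union> carrier A1') = {})"
  shows "jointly_embeddable L M N"
proof -
  obtain M1 m where M1: "ext M M1" "lock M1 m" "heavy (part M1 b m)" "|carrier M1| \<le>o \<theta>"
    using add_heavy_lock[OF M A0 \<theta>(1,2,4)] by blast
  obtain N1 n where N1: "ext N N1" "lock N1 n" "heavy (part N1 b n)" "|carrier N1| \<le>o \<theta>"
    using add_heavy_lock[OF N A0 \<theta>(1,3,4)] by blast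
  note o = extD(2)[OF M1(1)] extD(2)[OF N1(1)]
  have pm: "part M1 b m \<in> models (K b)" "part N1 b n \<in> models (K b)"
    using okD(2)[OF o(1) lock_holder[OF o(1) M1(2)]] okD(2)[OF o(2) lock_holder[OF o(2) N1(2)]] .
  have sz: "|carrier (part M1 b m)| \<le>o \<theta>" "|carrier (part N1 b n)| \<le>o \<theta>"
    using card_of_subset_le[OF carrier_part_subset[OF okD(1)[OF o(1)]] M1(4)]
      card_of_subset_le[OF carrier_part_subset[OF okD(1)[OF o(2)]] N1(4)] .
  obtain f g A1 A1' B D where J: "iso f (part M1 b m) A1" "strong (K b) A1 B" "iso g (part N1 b n) A1'"
    "strong (K b) A1' B" "D \<subseteq> carrier B" "\<theta> \<le>o |D|" "loose \<or> D \<inter> (carrier A1 \<union> carrier A1') = {}"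
    using J[OF pm M1(3) N1(3) sz] by blast
  have "infinite D" using J(6) \<theta>(1) cinfinite_mono[of \<theta> "|D|"] by (simp add: cinfinite_def)
  then obtain P \<phi> M' \<psi> N' where P: "ok P" "iso \<phi> M1 M'" "ext M' P" "iso \<psi> N1 N'" "ext N' P"
    using joint_embedding_locks[OF o(1) M1(2) o(2) N1(2) J(1-5) _ ordLeq_transitive[OF M1(4) J(6)]
        ordLeq_transitive[OF N1(4) J(6)]] J(7) by blast
  have *: "\<exists>f M''. iso f X M'' \<and> ext M'' P" if X: "ext X Y" "iso h Y Y'" "ext Y' P" for X Y h Y'
  proof -
    have "inj_on h (carrier X)"
      using X(2) substruct_carrier[OF extD(3)[OF X(1)]] by (auto simp: iso_def bij_betw_def intro: inj_on_subset)
    then have i: "iso h X (image_struct h X)" by (rule iso_image_struct)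
    show ?thesis using i ext_trans[OF ext_iso[OF X(1) X(2) i] X(3)] by blast
  qed
  show ?thesis
    unfolding jointly_embeddable_def embedding_def L_simps
    using P(1) *[OF M1(1) P(2,3)] *[OF N1(1) P(4,5)] by blast
qed

end

text \<open>Here the cardinalities enter. \<open>heavy_large\<close> makes a maximal model of
  cardinality \<kappa> \<open>b\<close> eligible for a permanent lock, and the last assumption
  supplies the incompatible pair that a loose lock needs for the failure of joint embedding.\<close>

locale sized_lock_construction = lock_construction I b K \<nu> heavy loose name
  for I :: "'i set" and b K and \<nu> :: "'u rel" and heavy loose name +
  fixes \<kappa> :: "'i \<Rightarrow> 'u rel"
  assumes \<kappa>: "i \<in> I \<Longrightarrow> infinite_cardinal (\<kappa> i)"
    and \<kappa>_least: "i \<in> I \<Longrightarrow> \<kappa> b \<le>o \<kappa> i"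
    and bounded: "i \<in> I \<Longrightarrow> A \<in> models (K i) \<Longrightarrow> |carrier A| \<le>o \<kappa> i"
    and attained: "i \<in> I \<Longrightarrow> \<exists>A \<in> models (K i). |carrier A| =o \<kappa> i"
    and heavy_large: "A \<in> models (K b) \<Longrightarrow> \<kappa> b \<le>o |carrier A| \<Longrightarrow> heavy A"
    and loose: "loose \<Longrightarrow> \<exists>A \<in> models (K b). \<exists>A' \<in> models (K b).
      heavy A \<and> heavy A' \<and> \<not> jointly_embeddable (K b) A A'"
begin

lemma maximal_exists:
  assumes i: "i \<in> I"
  shows "\<exists>Q. maximal_model (K i) Q \<and> |carrier Q| =o \<kappa> i"
proof -
  interpret A: AEC "K i" by (rule aec[OF i])
  obtain A where A: "A \<in> models (K i)" "|carrier A| =o \<kappa> i" using attained[OF i] by blast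
  obtain Q where Q: "strong (K i) A Q" "maximal_model (K i) Q"
    using A.maximal_extension_exists[OF universe \<kappa>[OF i] A(1) bounded[OF i]] A.strong_models by metis
  have "|carrier A| \<le>o |carrier Q|" by (rule card_of_mono1[OF A.strong_carrier[OF Q(1)]])
  then have "\<kappa> i \<le>o |carrier Q|" by (rule ordIso_ordLeq_trans[OF ordIso_symmetric[OF A(2)]])
  moreover have "|carrier Q| \<le>o \<kappa> i" using Q(2) bounded[OF i] by (simp add: maximal_model_def)
  ultimately show ?thesis using Q(2) ordIso_iff_ordLeq by metis
qed

text \<open>An unmarked set of \<mu> points provides the cardinality and a fresh lock is put on top
  of it; neither the lock model nor the rows and columns exceed \<mu>.\<close>

lemma plain_lock:
  fixes R0 :: "'u set"
  assumes \<mu>: "infinite_cardinal (\<mu> :: 'u rel)" "\<kappa> b \<le>o \<mu>" and A: "A \<in> models (K b)"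
    and R0: "|R0| \<le>o \<mu>" and D0: "D0 \<subseteq> carrier A"
  shows "\<exists>N l A' f Rw D col. ok N \<and> |carrier N| =o \<mu> \<and> lock N l \<and> iso f A A' \<and> A' \<in> models (K b) \<and>
    part N b l = A' \<and> |Rw| =o |R0| \<and> (\<forall>i c. \<not> token N i c) \<and> (\<forall>x. Row N x l \<longleftrightarrow> x \<in> Rw) \<and>
    (\<forall>d. Bel N d l \<longleftrightarrow> d \<in> D) \<and> bij_betw col D (f ` D0) \<and>
    (\<forall>x \<in> Rw. \<forall>d a. Col N x d a \<longleftrightarrow> d \<in> D \<and> a = col d) \<and> (\<forall>d \<in> D. Red N d \<longleftrightarrow> red)"
proof -
  have \<mu>c: "Card_order \<mu>" "Cinfinite \<mu>" using \<mu>(1) by (simp_all add: infinite_cardinal_def)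
  define C where "C = Field \<mu>"
  have C: "|C| =o \<mu>" unfolding C_def by (rule card_of_Field_ordIso[OF \<mu>c(1)])
  then have C': "|C| \<le>o \<mu>" using ordIso_iff_ordLeq by metis
  have sC: "small C" unfolding small_def by (rule ordIso_ordLess_trans[OF C infinite_cardinal_small[OF \<mu>(1)]])
  have "infinite C" using \<mu>c(2) by (simp add: C_def cinfinite_def)
  then have "C \<noteq> {}" by auto
  then have ok0: "ok (mk_struct C (\<lambda>_. {}))" by (rule plain_ok[OF _ sC])
  have sR: "small R0" by (rule le_infinite_cardinal_small[OF \<mu>(1) R0])
  obtain N l A' f Rw D col where N: "ext (mk_struct C (\<lambda>_. {})) N" "lock N l" "iso f A A'" "A' \<in> models (K b)"
    "part N b l = A'" "carrier N = insert l (C \<union> carrier A' \<union> Rw \<union> D)" "|Rw| =o |R0|" "|D| \<le>o |carrier A'|"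
    "\<forall>i c. \<not> token N i c" "\<forall>x. Row N x l \<longleftrightarrow> x \<in> Rw" "\<forall>d. Bel N d l \<longleftrightarrow> d \<in> D"
    "bij_betw col D (f ` D0)" "\<forall>x \<in> Rw. \<forall>d a. Col N x d a \<longleftrightarrow> d \<in> D \<and> a = col d"
    "\<forall>d \<in> D. Red N d \<longleftrightarrow> red"
    using fresh_lock[OF ok0 _ A sR D0, of red] plain_no_lock(1)[of C] by auto
  have A': "|carrier A'| \<le>o \<mu>" by (rule ordLeq_transitive[OF bounded[OF b N(4)] \<mu>(2)])
  have "|carrier N| \<le>o \<mu>"
    unfolding N(6)
    using C' A' ordLeq_transitive[OF N(8) A'] ordIso_ordLeq_trans[OF N(7) R0] \<mu>c(2)
    by (intro card_of_insert_le Un_Cinfinite_bound)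
  moreover have "\<mu> \<le>o |carrier N|"
    unfolding N(6) by (rule ordIso_ordLeq_trans[OF ordIso_symmetric[OF C] card_of_mono1]) blast
  ultimately have "|carrier N| =o \<mu>" by (simp add: ordIso_iff_ordLeq)
  then show ?thesis using N extD(2)[OF N(1)]
    by (intro exI[of _ N] exI[of _ l] exI[of _ A'] exI[of _ f] exI[of _ Rw] exI[of _ D] exI[of _ col]) simp
qed

text \<open>Heavy locks stay active, so a joint embedding must identify the two locks, and their
  models are then jointly embedded in the model of the common lock. In the loose case these were
  chosen incompatible. In the strict case both carry the same maximal model, and the contradiction
  comes from the columns: in a row of \<open>N\<close>, every colour is occupied by a column that is
  not red, and a red column of \<open>M\<close> also needs a colour there.\<close>

lemma joint_embedding_fails:
  assumes \<mu>: "infinite_cardinal (\<mu> :: 'u rel)" "\<kappa> b \<le>o \<mu>"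
  shows "\<exists>M N. ok M \<and> ok N \<and> |carrier M| =o \<mu> \<and> |carrier N| =o \<mu> \<and> \<not> jointly_embeddable L M N"
proof (cases loose)
  case True
  interpret A: AEC "K b" by (rule aec[OF b])
  obtain A1 A2 where A: "A1 \<in> models (K b)" "A2 \<in> models (K b)" "heavy A1" "heavy A2"
    "\<not> jointly_embeddable (K b) A1 A2" using loose[OF True] by blast
  have e: "|{} :: 'u set| \<le>o \<mu>" by (rule card_of_finite_le) (use \<mu>(1) in \<open>auto simp: infinite_cardinal_def\<close>)
  obtain M m f1 B1 where M: "ok M" "|carrier M| =o \<mu>" "lock M m" "iso f1 A1 B1" "part M b m = B1"
    using plain_lock[OF \<mu> A(1) e empty_subsetI] by blast
  obtain N n f2 B2 where N: "ok N" "|carrier N| =o \<mu>" "lock N n" "iso f2 A2 B2" "part N b n = B2"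
    using plain_lock[OF \<mu> A(2) e empty_subsetI] by blast
  have "\<not> jointly_embeddable L M N"
  proof
    assume "jointly_embeddable L M N"
    then obtain P f g M' N' where P: "ok P" "iso f M M'" "ext M' P" "iso g N N'" "ext N' P"
      unfolding jointly_embeddable_def embedding_def L_simps by blast
    have h: "heavy (part M b m)" "heavy (part N b n)"
      using heavy_iso[OF M(4)] heavy_iso[OF N(4)] A(3,4) M(5) N(5) by simp_all
    note c = common_lock[OF M(1,3) h(1) P(2,3)] and d = common_lock[OF N(1,3) h(2) P(4,5)]
    have eq: "g n = f m" using okD(6)[OF P(1) d(1) c(1)] .
    note d = d(2-3)[unfolded eq]
    have "\<exists>f'. embedding (K b) f' A1 (part P b (f m))" "\<exists>g'. embedding (K b) g' A2 (part P b (f m))"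
      unfolding embedding_def
      using iso_comp[OF M(4)] c(2,3) iso_comp[OF N(4)] d M(5) N(5) by blast+
    moreover have "part P b (f m) \<in> models (K b)" using A.strong_models[OF c(3)] by blast
    ultimately show False using A(5) unfolding jointly_embeddable_def by blast
  qed
  then show ?thesis using M N by blast
next
  case False
  interpret A: AEC "K b" by (rule aec[OF b])
  obtain Q where Q: "maximal_model (K b) Q" "|carrier Q| =o \<kappa> b" using maximal_exists[OF b] by blast
  have mQ: "Q \<in> models (K b)" using Q(1) by (simp add: maximal_model_def)
  have hQ: "heavy Q" using heavy_large[OF mQ] Q(2) ordIso_iff_ordLeq by metis
  \<comment> \<open>One row is enough, since without \<open>loose\<close> no colour occurs twice in
    a row.\<close>
  fix z :: 'u
  have e: "|{z}| \<le>o \<mu>" by (rule card_of_finite_le) (use \<mu>(1) in \<open>auto simp: infinite_cardinal_def\<close>)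
  obtain M m B1 f1 Rw D col where M: "ok M" "|carrier M| =o \<mu>" "lock M m" "iso f1 Q B1" "part M b m = B1"
    "\<forall>d. Bel M d m \<longleftrightarrow> d \<in> D" "bij_betw col D (f1 ` carrier Q)" "\<forall>x \<in> Rw. \<forall>d a. Col M x d a \<longleftrightarrow> d \<in> D \<and> a = col d"
    "\<forall>d\<in>D. Red M d \<longleftrightarrow> True" "|Rw| =o |{z}|" "\<forall>x. Row M x m \<longleftrightarrow> x \<in> Rw"
    using plain_lock[OF \<mu> mQ e subset_refl, of True] by blast
  obtain N n B2 f2 Rw' D' col' where N: "ok N" "|carrier N| =o \<mu>" "lock N n" "iso f2 Q B2" "part N b n = B2"
    "\<forall>d. Bel N d n \<longleftrightarrow> d \<in> D'" "bij_betw col' D' (f2 ` carrier Q)" "\<forall>x \<in> Rw'. \<forall>d a. Col N x d a \<longleftrightarrow> d \<in> D' \<and> a = col' d"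
    "\<forall>d\<in>D'. Red N d \<longleftrightarrow> False" "|Rw'| =o |{z}|" "\<forall>x. Row N x n \<longleftrightarrow> x \<in> Rw'"
    using plain_lock[OF \<mu> mQ e subset_refl, of False] by blast
  have "\<not> jointly_embeddable L M N"
  proof
    assume "jointly_embeddable L M N"
    then obtain P f g M' N' where P: "ok P" "iso f M M'" "ext M' P" "iso g N N'" "ext N' P"
      unfolding jointly_embeddable_def embedding_def L_simps by blast
    have h: "heavy (part M b m)" "heavy (part N b n)"
      using heavy_iso[OF M(4)] heavy_iso[OF N(4)] hQ M(5) N(5) by simp_all
    note c = common_lock[OF M(1,3) h(1) P(2,3)] and d = common_lock[OF N(1,3) h(2) P(4,5)]
    have eq: "g n = f m" using okD(6)[OF P(1) d(1) c(1)] .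
    have "maximal_model (K b) (part N' b (g n))"
      using A.maximal_model_iso[OF universe Q(1) iso_comp[OF N(4)]] d(2) N(5) by blast
    \<comment> \<open>By maximality the common lock of \<open>P\<close> has no colours beyond those
      coming from \<open>N\<close>.\<close>
    then have pe: "part P b (g n) = part N' b (g n)" using d(3) by (simp add: maximal_model_def)
    note sM = okD(1)[OF M(1)] and sN = okD(1)[OF N(1)]
    have nN: "n \<in> carrier N" "m \<in> carrier M" using lock_carrier[OF sN N(3)] lock_carrier[OF sM M(3)] .
    have B2: "carrier B2 = f2 ` carrier Q" using N(4) by (simp add: iso_def bij_betw_def)
    have memP: "\<exists>q. a = g q \<and> q \<in> carrier B2" if "Mem P (g n) a" for a
    proof -
      have "a \<in> carrier (part N' b (g n))" unfolding pe[symmetric] using that by (simp add: carrier_part)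
      then show ?thesis using d(2) N(5) by (auto simp: iso_def bij_betw_def)
    qed
    have "Rw' \<noteq> {}" using N(10) card_of_empty3 ordIso_symmetric[OF N(10)] ordIso_iff_ordLeq by blast
    then obtain x where x: "x \<in> Rw'" by blast
    have "D \<noteq> {}" using M(7) A.models_nonempty[OF mQ] by (auto simp: bij_betw_def)
    then obtain d1 where d1: "d1 \<in> D" by blast
    have xN: "Row N x n" "x \<in> carrier N" using N(11) x rel_carrier(2)[OF sN] by blast+
    have dM: "Bel M d1 m" "d1 \<in> carrier M" using M(6) d1 rel_carrier(2)[OF sM] by blast+
    have liftN: "map g xs \<in> rel P y" if "xs \<in> rel N y" for xs y
      using iso_rel[OF P(4)] that rel_tuple(2)[OF okD(1)[OF extD(1)[OF P(5)]]] substruct_rel[OF extD(3)[OF P(5)]] by blast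
    have liftM: "map f xs \<in> rel P y" if "xs \<in> rel M y" for xs y
      using iso_rel[OF P(2)] that rel_tuple(2)[OF okD(1)[OF extD(1)[OF P(3)]]] substruct_rel[OF extD(3)[OF P(3)]] by blast
    have 1: "Row P (g x) (g n)" "Bel P (f d1) (g n)" "Red P (f d1)"
      using liftN[OF xN(1)] liftM[OF dM(1)] liftM[of "[d1]" SRed] M(9) d1 eq by simp_all
    note OP = okD(8)[OF P(1) d(1), unfolded lock_ok_def]
    note O2 = OP[THEN conjunct2, THEN conjunct1, rule_format]
      and O3 = OP[THEN conjunct2, THEN conjunct2, THEN conjunct1, rule_format]
    obtain a where a: "Mem P (g n) a" "Col P (g x) (f d1) a" using O2[OF 1(1,2)] by blast
    obtain q where q: "a = g q" "q \<in> carrier B2" using memP[OF a(1)] by blast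
    \<comment> \<open>The columns of \<open>N\<close> use up all points of the lock model, so some
      column \<open>d2\<close> of \<open>N\<close> already has the colour \<open>q\<close> in this
      row.\<close>
    then have "q \<in> col' ` D'" using bij_betw_imp_surj_on[OF N(7)] B2 by simp
    then obtain d2 where d2: "d2 \<in> D'" "col' d2 = q" by blast
    have dN: "Bel N d2 n" "d2 \<in> carrier N" "Col N x d2 q"
      using N(6)[rule_format, of d2] N(8)[rule_format, OF x, of d2 q] d2 rel_carrier(2)[OF sN, of d2 n] by auto
    have 2: "Bel P (g d2) (g n)" "Col P (g x) (g d2) a" using liftN[OF dN(1)] liftN[OF dN(3)] q(1) by simp_all
    have "f d1 = g d2" using O3[OF 1(1) 1(1) 1(2) 2(1) a(1) a(2) 2(2) a(2) 2(2)] False by blast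
    moreover have "\<not> Red P (g d2)"
    proof -
      have "\<not> Red N d2" using N(9) d2(1) by blast
      then have "\<not> Red N' (g d2)" using iso_rel123(1)[OF sN P(4) dN(2)] by simp
      then show ?thesis
        using substruct_rel[OF extD(3)[OF P(5)], of "[g d2]"] iso_carrier[OF sN P(4)] dN(2) by auto
    qed
    ultimately show False using 1(3) by simp
  qed
  then show ?thesis using M(1,2) N(1,2) by blast
qed

text \<open>A maximal model has an active token, since otherwise an unmarked point could be added.
  The token bounds its size by \<kappa> \<open>i\<close>^+ from above, and by
  \<open>strict_extension\<close> the model cannot have \<kappa> \<open>i\<close> points or
  fewer.\<close>

lemma maximal_size:
  assumes M: "ok M" and max: "\<And>N. ext M N \<Longrightarrow> N = M"
  shows "\<exists>i \<in> I. |carrier M| =o cardSuc (\<kappa> i)"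
proof (cases "\<exists>i c. token M i c")
  case True
  then obtain i c where c: "token M i c" by blast
  have i: "i \<in> I" using token_type[OF c] .
  note \<kappa>i = Cinfinite_infinite_cardinal[OF \<kappa>[OF i]]
  have "|carrier M| \<le>o cardSuc (\<kappa> i)" by (rule token_bound[OF M c \<kappa>i bounded[OF i]])
  moreover have "\<not> |carrier M| \<le>o \<kappa> i"
    using strict_extension[OF M i \<kappa>[OF i] c] attained[OF i] max by metis
  then have "\<kappa> i <o |carrier M|" using not_ordLeq_iff_ordLess[of "\<kappa> i" "|carrier M|"] card_order_on_well_order_on[OF conjunct2[OF \<kappa>i]] by simp
  then have "cardSuc (\<kappa> i) \<le>o |carrier M|" using cardSuc_ordLess_ordLeq[of "\<kappa> i" "|carrier M|"] \<kappa>i by simp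
  ultimately show ?thesis using i ordIso_iff_ordLeq by blast
next
  case False
  have sM: "small (carrier M)" using okD(1)[OF M] by (simp add: is_struct_def)
  obtain p where p: "p \<notin> carrier M" using fresh_element[OF universe sM] by blast
  have "ext M (add M {p} (\<lambda>_. {}))" by (rule add_plain[OF M _ p]) (use False in blast)
  then have "carrier M = carrier M \<union> {p}" using max carrier_add by metis
  then show ?thesis using p by blast
qed

text \<open>The base model \<open>M\<close> carries a lock with a maximal model, \<kappa>
  \<open>bot\<close>^+ rows and one column for each point, where \<open>bot\<close> stands for the
  index \<open>b\<close>. Over it a token of type \<open>i\<close> gets \<kappa> \<open>i\<close>^+
  holders with maximal models. Every model obtained is maximal by \<open>maximal_criterion\<close>;
  the red holders are arbitrary, which gives one model for every subset of the set of
  holders.\<close>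

lemma maximal_family:
  assumes i: "i \<in> I"
  shows "\<exists>F. (\<forall>M \<in> F. ok M \<and> (\<forall>P. ext M P \<longrightarrow> P = M) \<and> |carrier M| =o cardSuc (\<kappa> i)) \<and>
    |F| =o ctwo ^c cardSuc (\<kappa> i) \<and> (\<forall>M \<in> F. \<forall>N \<in> F. M \<noteq> N \<longrightarrow> \<not> isomorphic M N)"
proof -
  interpret B: AEC "K b" by (rule aec[OF b])
  interpret A: AEC "K i" by (rule aec[OF i])
  note \<kappa>i = Cinfinite_infinite_cardinal[OF \<kappa>[OF i]] and \<kappa>b = Cinfinite_infinite_cardinal[OF \<kappa>[OF b]]
  have \<theta>: "Cinfinite (cardSuc (\<kappa> i))" using Cinfinite_cardSuc[OF \<kappa>i] .
  have le_\<theta>: "cardSuc (\<kappa> b) \<le>o cardSuc (\<kappa> i)"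
    using cardSuc_mono_ordLeq[of "\<kappa> b" "\<kappa> i"] \<kappa>i \<kappa>b \<kappa>_least[OF i] by blast
  obtain Q where Q: "maximal_model (K b) Q" "|carrier Q| =o \<kappa> b" using maximal_exists[OF b] by blast
  have mQ: "Q \<in> models (K b)" using Q(1) by (simp add: maximal_model_def)
  have hQ: "heavy Q" using heavy_large[OF mQ] Q(2) ordIso_iff_ordLeq by metis
  \<comment> \<open>The successor of \<kappa> \<open>b\<close> is the least number of rows that
    exceeds the number of colours.\<close>
  obtain R0 :: "'u set" where R0: "|R0| =o cardSuc (\<kappa> b)" "infinite_cardinal |R0|"
    using set_of_card_cardSuc[OF universe \<kappa>[OF b]] by blast
  have "\<kappa> b \<le>o |R0|" using cardSuc_ordLeq \<kappa>b ordLeq_ordIso_trans[OF _ ordIso_symmetric[OF R0(1)]] by blast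
  then obtain M l Qb f Rw D col where M: "ok M" "|carrier M| =o |R0|" "lock M l" "iso f Q Qb" "part M b l = Qb"
    "|Rw| =o |R0|" "\<forall>i c. \<not> token M i c" "\<forall>x. Row M x l \<longleftrightarrow> x \<in> Rw" "\<forall>d. Bel M d l \<longleftrightarrow> d \<in> D"
    "bij_betw col D (f ` carrier Q)" "\<forall>x \<in> Rw. \<forall>d a. Col M x d a \<longleftrightarrow> d \<in> D \<and> a = col d"
    using plain_lock[OF R0(2) _ mQ card_of_mono1[OF subset_refl] subset_refl, of False] by blast
  note sM = okD(1)[OF M(1)]
  have smM: "small (carrier M)" using sM by (simp add: is_struct_def)
  have Qb: "maximal_model (K b) Qb" using B.maximal_model_iso[OF universe Q(1) M(4)] .
  have hM: "heavy (part M b l)" using heavy_iso[OF M(4)] hQ M(5) by simp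
  have cM: "|carrier M| \<le>o cardSuc (\<kappa> i)"
    by (rule ordIso_ordLeq_trans[OF ordIso_transitive[OF M(2) R0(1)] le_\<theta>])
  obtain c where c: "c \<notin> carrier M" using fresh_element[OF universe smM] by blast
  have s1: "small (insert c (carrier M))" by (rule small_insert[OF universe smM])
  obtain E0 :: "'u set" where E0: "|E0| =o cardSuc (\<kappa> i)" "infinite_cardinal |E0|"
    using set_of_card_cardSuc[OF universe \<kappa>[OF i]] by blast
  obtain h where h: "inj_on h E0" "h ` E0 \<inter> insert c (carrier M) = {}"
    using fresh_copy[OF universe infinite_cardinal_small[OF E0(2)] s1] by blast
  define E where "E = h ` E0"
  have "|E0| =o |E|" unfolding E_def using card_of_ordIsoI[of h E0] h(1) by (auto simp: bij_betw_def)
  then have E: "|E| =o cardSuc (\<kappa> i)" by (rule ordIso_transitive[OF ordIso_symmetric E0(1)])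
  have sE: "small E" unfolding E_def
    by (rule small_image) (use infinite_cardinal_small[OF E0(2)] in \<open>simp add: small_def\<close>)
  have s2: "small (insert c (carrier M) \<union> E)" by (rule small_Un[OF universe s1 sE])
  obtain Q1 where Q1: "maximal_model (K i) Q1" "|carrier Q1| =o \<kappa> i" using maximal_exists[OF i] by blast
  have mQ1: "Q1 \<in> models (K i)" using Q1(1) by (simp add: maximal_model_def)
  obtain k where k: "inj_on k (carrier Q1)" "k ` carrier Q1 \<inter> (insert c (carrier M) \<union> E) = {}"
    using fresh_copy[OF universe A.models_small[OF mQ1, unfolded small_def] s2] by blast
  define A where "A = image_struct k Q1"
  have iA: "iso k Q1 A" unfolding A_def by (rule iso_image_struct[OF k(1)])
  have A: "maximal_model (K i) A" "A \<in> models (K i)" "carrier A = k ` carrier Q1"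
    using A.maximal_model_iso[OF universe Q1(1) iA] by (simp_all add: maximal_model_def A_def image_struct_def)
  have Ac: "|carrier A| =o \<kappa> i" by (rule ordIso_transitive[OF ordIso_symmetric[OF iso_card[OF iA]] Q1(2)])
  define F where "F = {c} \<union> E \<union> (\<Union>e\<in>E. carrier A)"
  \<comment> \<open>\<open>T\<close> is the carrier of all the models \<open>N S\<close>. Its
    cardinal order \<open>|T|\<close> has type \<kappa> \<open>i\<close>^+, so every proper initial
    segment has at most \<kappa> \<open>i\<close> points and can be enumerated by the model of a
    single holder.\<close>
  define T where "T = carrier M \<union> F"
  have E_le: "|E| \<le>o cardSuc (\<kappa> i)" using E ordIso_iff_ordLeq by metis
  have "|carrier A| \<le>o cardSuc (\<kappa> i)"
    by (rule ordIso_ordLeq_trans[OF Ac cardSuc_ordLeq]) (use \<kappa>i in blast)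
  then have "|carrier M \<union> insert c (E \<union> carrier A)| \<le>o cardSuc (\<kappa> i)"
    by (intro Un_Cinfinite_bound card_of_insert_le \<theta> cM E_le)
  then have "|T| \<le>o cardSuc (\<kappa> i)" by (rule card_of_subset_le[rotated]) (auto simp: T_def F_def)
  moreover have "cardSuc (\<kappa> i) \<le>o |T|"
    by (rule ordIso_ordLeq_trans[OF ordIso_symmetric[OF E] card_of_mono1]) (auto simp: T_def F_def)
  ultimately have T: "|T| =o cardSuc (\<kappa> i)" by (simp add: ordIso_iff_ordLeq)
  have ET: "E \<subseteq> T" by (auto simp: T_def F_def)
  have woT: "Well_order |T|" by simp
  have refT: "(x, x) \<in> |T|" if "x \<in> T" for x
    using woT that by (auto simp: order_on_defs refl_on_def)
  have small_seg: "|underS |T| x| \<le>o \<kappa> i" if "x \<in> T" for x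
  proof -
    have "|underS |T| x| <o |T|" by (rule card_of_underS) (use that in simp_all)
    then have "|underS |T| x| <o cardSuc (\<kappa> i)" by (rule ordLess_ordIso_trans[OF _ T])
    then show ?thesis using cardSuc_ordLeq_ordLess[of "\<kappa> i" "|underS |T| x|"] \<kappa>i by simp
  qed
  \<comment> \<open>Each holder is to pick exactly the points up to and including itself in
    \<open>|T|\<close>. Linearity then makes one of any two holders pick the other. Including
    \<open>e\<close> also makes the segment nonempty, as a surjection onto it requires.\<close>
  have "\<exists>g. g ` carrier A = under |T| e" if e: "e \<in> E" for e
  proof -
    have eT: "e \<in> T" using ET e by blast
    have "under |T| e \<subseteq> insert e (underS |T| e)" by (auto simp: under_def underS_def)
    then have "|under |T| e| \<le>o \<kappa> i"
      by (rule card_of_subset_le[OF _ card_of_insert_le[OF \<kappa>i small_seg[OF eT]]])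
    then have "|under |T| e| \<le>o |carrier A|" by (rule ordLeq_ordIso_trans[OF _ ordIso_symmetric[OF Ac]])
    moreover have "under |T| e \<noteq> {}" using refT[OF eT] by (auto simp: under_def)
    ultimately show ?thesis by (rule surj_of_le[rotated])
  qed
  then obtain g where g: "\<And>e. e \<in> E \<Longrightarrow> g e ` carrier A = under |T| e" by metis
  have underT: "under |T| e \<subseteq> T" for e using woT by (auto simp: under_def dest: FieldI1)
  \<comment> \<open>All holders carry the same model \<open>A\<close>; only the red set depends on
    \<open>S\<close>. Among the holders, \<open>SBel\<close> codes the well-order
    \<open>|E|\<close>, which does not interfere with their attachment to the token because
    \<open>c\<close> is no holder.\<close>
  define N where "N S = add M F (\<lambda>y. (\<Union>e\<in>E. holder_rel i e A y) \<union>
      (case y of STok j \<Rightarrow> if j = i then (\<lambda>x. [x]) ` {c} else {}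
      | SBel \<Rightarrow> (\<lambda>e. [e, c]) ` E \<union> (\<lambda>(e, f). [e, f]) ` |E|
      | SPick \<Rightarrow> {[e, a, g e a] | e a. e \<in> E \<and> a \<in> carrier A}
      | SRed \<Rightarrow> (\<lambda>e. [e]) ` S | _ \<Rightarrow> {}))" for S
  have NS: "ext M (N S)" "token (N S) i c" "\<And>e. e \<in> E \<Longrightarrow> part (N S) i e = A \<and> holder (N S) i e"
    "\<And>e. e \<in> E \<Longrightarrow> Bel (N S) e c" "c \<notin> carrier M \<Longrightarrow> Bel (N S) e c \<Longrightarrow> e \<in> E"
    "\<And>e a. e \<in> E \<Longrightarrow> a \<in> carrier A \<Longrightarrow> Pick (N S) e a (g e a)"
    "\<And>e. e \<in> E \<Longrightarrow> Red (N S) e \<longleftrightarrow> e \<in> S"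
    "\<And>e f. e \<in> E \<Longrightarrow> f \<in> E \<Longrightarrow> Bel (N S) e f \<longleftrightarrow> (e, f) \<in> |E|"
    if S: "S \<subseteq> E" for S e
  proof -
    have hyps: "token M i c \<and> {c} = {} \<or> {c} = {c} \<and> c \<notin> carrier M \<and> (\<forall>j x. \<not> token M j x)"
      "\<And>e. e \<in> E \<Longrightarrow> A \<in> models (K i)" "c \<notin> E" "\<And>e. e \<in> E \<Longrightarrow> insert c E \<inter> carrier A = {}"
      "({c} \<union> E \<union> (\<Union>e\<in>E. carrier A)) \<inter> carrier M = {}" "small ({c} \<union> E \<union> (\<Union>e\<in>E. carrier A))"
      "\<And>e a. e \<in> E \<Longrightarrow> a \<in> carrier A \<Longrightarrow> g e a \<in> carrier M \<union> ({c} \<union> E \<union> (\<Union>e\<in>E. carrier A))"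
      "\<And>p. p \<in> carrier M \<union> ({c} \<union> E \<union> (\<Union>e\<in>E. carrier A)) \<Longrightarrow> \<exists>e\<in>E. p \<in> g e ` carrier A"
      "\<And>e f. e \<in> E \<Longrightarrow> f \<in> E \<Longrightarrow> f \<in> g e ` carrier A \<or> e \<in> g f ` carrier A"
      "\<And>e f. e \<in> E \<Longrightarrow> Bel M f c \<Longrightarrow> f \<in> g e ` carrier A" "S \<subseteq> E" "|E| \<subseteq> E \<times> E"
    proof -
      show "token M i c \<and> {c} = {} \<or> {c} = {c} \<and> c \<notin> carrier M \<and> (\<forall>j x. \<not> token M j x)" using c M(7) by blast
      show "A \<in> models (K i)" by fact
      show "c \<notin> E" using h(2) by (auto simp: E_def)
      show "insert c E \<inter> carrier A = {}" using k(2) by (auto simp: A(3))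
      show "({c} \<union> E \<union> (\<Union>e\<in>E. carrier A)) \<inter> carrier M = {}"
        using c h(2) k(2) by (auto simp: A(3) E_def)
      have "small (insert c E \<union> carrier A)"
        by (intro small_Un[OF universe] small_insert[OF universe] sE A.models_small A(2))
      then show "small ({c} \<union> E \<union> (\<Union>e\<in>E. carrier A))" by (rule small_subset[rotated]) auto
      show "g e a \<in> carrier M \<union> ({c} \<union> E \<union> (\<Union>e\<in>E. carrier A))" if H: "e \<in> E" "a \<in> carrier A" for e a
        using g[OF H(1)] H(2) underT[of e] unfolding T_def F_def by blast
      show "\<exists>e\<in>E. p \<in> g e ` carrier A" if H: "p \<in> carrier M \<union> ({c} \<union> E \<union> (\<Union>e\<in>E. carrier A))" for p
      proof (rule ccontr)
        assume no: "\<not> (\<exists>e\<in>E. p \<in> g e ` carrier A)"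
        have pT: "p \<in> T" using H by (simp add: T_def F_def)
        \<comment> \<open>A point that no holder picks would lie strictly above all holders, but
          there are more of these than points in a proper initial segment of
          \<open>|T|\<close>.\<close>
        have "E \<subseteq> underS |T| p"
        proof
          fix e assume e: "e \<in> E"
          then have "(p, e) \<notin> |T|" using no g[OF e] by (auto simp: under_def)
          then have "(e, p) \<in> |T|" "e \<noteq> p"
            using woT pT ET e refT[OF pT] unfolding order_on_defs total_on_def by auto
          then show "e \<in> underS |T| p" by (simp add: underS_def)
        qed
        then have "|E| \<le>o \<kappa> i" using small_seg[OF pT] by (rule card_of_subset_le)
        then have "cardSuc (\<kappa> i) \<le>o \<kappa> i" by (rule ordIso_ordLeq_trans[OF ordIso_symmetric[OF E]])
        then show False using cardSuc_greater[of "\<kappa> i"] \<kappa>i not_ordLess_ordLeq by blast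
      qed
      show "f \<in> g e ` carrier A \<or> e \<in> g f ` carrier A" if H: "e \<in> E" "f \<in> E" for e f
      proof -
        have "(e, f) \<in> |T| \<or> (f, e) \<in> |T|"
          using woT subsetD[OF ET H(1)] subsetD[OF ET H(2)] refT
          unfolding order_on_defs total_on_def by (cases "e = f") auto
        then show ?thesis unfolding g[OF H(1)] g[OF H(2)] by (auto simp: under_def)
      qed
      show "f \<in> g e ` carrier A" if "Bel M f c" for e f using rel_carrier(2)[OF sM that] c by blast
      show "S \<subseteq> E" by fact
      show "|E| \<subseteq> E \<times> E" using FieldI1 FieldI2 by fastforce
    qed
    note H = add_token_holders[of M i c "{c}" E "\<lambda>_. A" g S "|E|", OF M(1) i hyps]
    show "ext M (N S)"
      unfolding N_def F_def by (rule H(1))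
    show "token (N S) i c"
      unfolding N_def F_def by (rule H(2))
    show "part (N S) i e = A \<and> holder (N S) i e" if "e \<in> E" for e
      unfolding N_def F_def by (rule H(3)) (use that in auto)
    show "Bel (N S) e c" if "e \<in> E" for e
      unfolding N_def F_def by (rule H(4)) (use that in auto)
    show "e \<in> E" if "c \<notin> carrier M" "Bel (N S) e c" for e
      by (rule H(5)) (use that[unfolded N_def F_def] in auto)
    show "Pick (N S) e a (g e a)" if "e \<in> E" "a \<in> carrier A" for e a
      unfolding N_def F_def by (rule H(6)) (use that in auto)
    show "Red (N S) e \<longleftrightarrow> e \<in> S" if "e \<in> E" for e
      unfolding N_def F_def by (rule H(7)) (use that in auto)
    show "Bel (N S) e f \<longleftrightarrow> (e, f) \<in> |E|" if "e \<in> E" "f \<in> E" for e f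
      unfolding N_def F_def by (rule H(8)) (use that in auto)
  qed
  have cN: "carrier (N S) = T" for S by (simp add: N_def T_def)
  have okN: "ok (N S)" if "S \<subseteq> E" for S using extD(2)[OF NS(1)[OF that]] .
  have maxN: "P = N S" if S: "S \<subseteq> E" and P: "ext (N S) P" for S P
  proof (rule maximal_criterion[OF okN[OF S] _ _ _ _ _ _ NS(2)[OF S] _ _ _ bounded[OF i] P, where Rw = Rw])
    note X = extD[OF NS(1)[OF S]]
    have up: "xs \<in> rel (N S) y" if "xs \<in> rel M y" for xs y
      using substruct_rel[OF X(3)] rel_tuple(2)[OF sM that] that by blast
    show lN: "lock (N S) l" using X(5)[OF M(3) hM] .
    have "strong (K b) Qb (part (N S) b l)" using X(4)[OF lock_holder[OF M(1,3)]] M(5) by simp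
    then have pl: "part (N S) b l = Qb" using Qb by (simp add: maximal_model_def)
    then show "heavy (part (N S) b l)" using hM M(5) by simp
    show "B = part (N S) b l" if "strong (K b) (part (N S) b l) B" for B
      using Qb that unfolding pl by (simp add: maximal_model_def)
    show "Row (N S) x l" if "x \<in> Rw" for x using up[of "[x, l]"] M(8) that by blast
    show "\<not> |Rw| \<le>o |carrier (part (N S) b l)|"
    proof
      assume "|Rw| \<le>o |carrier (part (N S) b l)|"
      then have "|Rw| \<le>o \<kappa> b" unfolding pl
        by (rule ordLeq_transitive) (use Qb bounded[OF b] in \<open>simp add: maximal_model_def\<close>)
      then have "cardSuc (\<kappa> b) \<le>o \<kappa> b"
        by (rule ordIso_ordLeq_trans[OF ordIso_symmetric[OF ordIso_transitive[OF M(6) R0(1)]]])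
      then show False using cardSuc_greater[of "\<kappa> b"] \<kappa>b not_ordLess_ordLeq by blast
    qed
    show "\<exists>d. Bel (N S) d l \<and> (\<forall>x \<in> Rw. Col (N S) x d a)" if H: "Mem (N S) l a" for a
    proof -
      have "a \<in> carrier (part (N S) b l)" using H by (simp add: carrier_part)
      then have "a \<in> f ` carrier Q" unfolding pl using M(4) by (simp add: iso_def bij_betw_def)
      then have "a \<in> col ` D" using bij_betw_imp_surj_on[OF M(10)] by simp
      then obtain d where d: "d \<in> D" "a = col d" by blast
      then have "Bel M d l" "\<forall>x \<in> Rw. Col M x d a" using M(9,11) by simp_all
      then show ?thesis using up by blast
    qed
    show "B = part (N S) i e" if H: "Bel (N S) e c" "strong (K i) (part (N S) i e) B" for e B
    proof -
      have "part (N S) i e = A" using NS(3)[OF S NS(5)[OF S c H(1)]] by blast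
      then show ?thesis using A(1) H(2) by (simp add: maximal_model_def)
    qed
    show "\<exists>p. Pick (N S) e a p" if H: "Bel (N S) e c" "Mem (N S) e a" for e a
    proof -
      have e: "e \<in> E" by (rule NS(5)[OF S c H(1)])
      have "a \<in> carrier (part (N S) i e)" using H(2) by (simp add: carrier_part)
      then have "a \<in> carrier A" using NS(3)[OF S e] by simp
      then show ?thesis using NS(6)[OF S e] by blast
    qed
    show "\<not> |{e. Bel (N S) e c}| \<le>o \<kappa> i"
    proof
      assume H: "|{e. Bel (N S) e c}| \<le>o \<kappa> i"
      have "E \<subseteq> {e. Bel (N S) e c}" using NS(4)[OF S] by blast
      then have "|E| \<le>o \<kappa> i" by (rule card_of_subset_le[OF _ H])
      then have "cardSuc (\<kappa> i) \<le>o \<kappa> i" by (rule ordIso_ordLeq_trans[OF ordIso_symmetric[OF E]])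
      then show False using cardSuc_greater[of "\<kappa> i"] \<kappa>i not_ordLess_ordLeq by blast
    qed
  qed
  \<comment> \<open>An isomorphism fixes the unique active token, hence maps the set of its holders
    onto itself, and it preserves the coded well-order. A well-order has no nontrivial automorphism,
    so every holder is fixed and the red sets agree.\<close>
  have S_eq: "S = S'" if S: "S \<subseteq> E" "S' \<subseteq> E" and \<phi>: "iso \<phi> (N S) (N S')" for S S' \<phi>
  proof -
    note sN = okD(1)[OF okN[OF S(1)]] and sN' = okD(1)[OF okN[OF S(2)]]
    have cT: "c \<in> T" by (simp add: T_def F_def)
    have "token (N S') i (\<phi> c)" using iso_token[OF sN \<phi>, of c i] NS(2)[OF S(1)] cT cN by simp
    then have \<phi>c: "\<phi> c = c" using okD(5)[OF okN[OF S(2)] _ NS(2)[OF S(2)]] by blast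
    have inj: "inj_on \<phi> T" using \<phi> cN by (simp add: iso_def bij_betw_def)
    have EE: "\<phi> ` E = E"
    proof
      show "\<phi> ` E \<subseteq> E"
      proof
        fix x assume "x \<in> \<phi> ` E"
        then obtain e where e: "e \<in> E" "x = \<phi> e" by blast
        have "Bel (N S') (\<phi> e) (\<phi> c)"
          using iso_rel123(2)[OF sN \<phi>, of e c] NS(4)[OF S(1) e(1)] ET e(1) cT cN by auto
        then show "x \<in> E" using NS(5)[OF S(2) c] \<phi>c e(2) by simp
      qed
      show "E \<subseteq> \<phi> ` E"
      proof
        fix x assume x: "x \<in> E"
        have "Bel (N S') x (\<phi> c)" using NS(4)[OF S(2) x] \<phi>c by simp
        then obtain e where "x = \<phi> e" "Bel (N S) e c"
          using iso_rel_pair(2)[OF sN \<phi>, of c x SBel] cT cN by auto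
        then show "x \<in> \<phi> ` E" using NS(5)[OF S(1) c] by blast
      qed
    qed
    have ord: "(e, f) \<in> |E| \<longleftrightarrow> (\<phi> e, \<phi> f) \<in> |E|" if H: "e \<in> E" "f \<in> E" for e f
    proof -
      have "\<phi> e \<in> E" "\<phi> f \<in> E" using EE H by blast+
      then show ?thesis
        using NS(8)[OF S(1) H] NS(8)[OF S(2)] iso_rel123(2)[OF sN \<phi>, of e f SBel] ET H cN by auto
    qed
    have "BNF_Wellorder_Embedding.iso |E| |E| \<phi>"
      by (subst iso_iff2) (use ord EE inj_on_subset[OF inj ET] in \<open>auto simp: bij_betw_def\<close>)
    then have "embed |E| |E| \<phi>" by (simp add: BNF_Wellorder_Embedding.iso_def)
    moreover have "embed |E| |E| id" using id_embed by blast
    ultimately have fixed: "\<phi> e = e" if "e \<in> E" for e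
      using embed_unique[of "|E|" "|E|" \<phi> id] that by simp
    have "e \<in> S \<longleftrightarrow> e \<in> S'" if e: "e \<in> E" for e
      using NS(7)[OF S(1) e] NS(7)[OF S(2) e] iso_rel123(1)[OF sN \<phi>, of e SRed] fixed[OF e] ET e cN by auto
    then show ?thesis using S by blast
  qed
  have injN: "inj_on N (Pow E)"
  proof (rule inj_onI)
    fix S S' assume S: "S \<in> Pow E" "S' \<in> Pow E" "N S = N S'"
    then have "iso id (N S) (N S')" using iso_id[of "N S"] by simp
    then show "S = S'" using S_eq S by blast
  qed
  have "|N ` Pow E| =o |Pow E|"
    using card_of_ordIsoI[of N "Pow E" "N ` Pow E"] injN ordIso_symmetric by (auto simp: bij_betw_def)
  moreover have "|Pow E| =o ctwo ^c |E|" by (simp add: cexp_def ctwo_def card_of_Pow_Func)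
  moreover have "ctwo ^c |E| =o ctwo ^c cardSuc (\<kappa> i)"
    by (rule cexp_cong2[OF E Card_order_ctwo]) simp
  ultimately have "|N ` Pow E| =o ctwo ^c cardSuc (\<kappa> i)" using ordIso_transitive by metis
  moreover have "\<forall>M\<in>N ` Pow E. ok M \<and> (\<forall>P. ext M P \<longrightarrow> P = M) \<and> |carrier M| =o cardSuc (\<kappa> i)"
    using okN maxN cN T by auto
  moreover have "\<forall>M\<in>N ` Pow E. \<forall>M'\<in>N ` Pow E. M \<noteq> M' \<longrightarrow> \<not> isomorphic M M'"
  proof (intro ballI impI notI)
    fix M M' assume H: "M \<in> N ` Pow E" "M' \<in> N ` Pow E" "M \<noteq> M'" "isomorphic M M'"
    then obtain S S' \<phi> where S: "S \<subseteq> E" "S' \<subseteq> E" "M = N S" "M' = N S'" "iso \<phi> M M'"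
      unfolding isomorphic_def by blast
    then show False using S_eq[OF S(1,2), of \<phi>] H(3) by simp
  qed
  ultimately show ?thesis by blast
qed

end

section \<open>Axiomatizability\<close>

definition Falsum :: "'u fm" where "Falsum = Ex 0 (Neg (Eq (Var 0) (Var 0)))"
definition And :: "'u fm \<Rightarrow> 'u fm \<Rightarrow> 'u fm" where "And \<phi> \<psi> = Conj (\<lambda>n. if n = 0 then \<phi> else \<psi>)"
definition Imp :: "'u fm \<Rightarrow> 'u fm \<Rightarrow> 'u fm" where "Imp \<phi> \<psi> = Neg (And \<phi> (Neg \<psi>))"
definition All :: "nat \<Rightarrow> 'u fm \<Rightarrow> 'u fm" where "All x \<phi> = Neg (Ex x (Neg \<phi>))"
text \<open>An infinitary conjunction is indexed by all natural numbers, so the index set is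
  enumerated with repetitions; an empty one has no enumeration and gets a valid formula.\<close>

definition Conjs :: "'a set \<Rightarrow> ('a \<Rightarrow> 'u fm) \<Rightarrow> 'u fm" where
  "Conjs A \<Phi> = (if A = {} then Neg Falsum else Conj (\<lambda>n. \<Phi> (from_nat_into A n)))"

text \<open>The variables 1 to \<open>n\<close> are quantified, in this order from the outside.
  Variable 0 is left free for the holder or lock in question.\<close>

primrec Alls :: "nat \<Rightarrow> 'u fm \<Rightarrow> 'u fm" where
  "Alls 0 \<phi> = \<phi>"
| "Alls (Suc n) \<phi> = Alls n (All (Suc n) \<phi>)"

lemma sat_connectives [simp]:
  "\<not> sat M Falsum e"
  "sat M (And \<phi> \<psi>) e \<longleftrightarrow> sat M \<phi> e \<and> sat M \<psi> e"
  "sat M (Imp \<phi> \<psi>) e \<longleftrightarrow> (sat M \<phi> e \<longrightarrow> sat M \<psi> e)"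
  "sat M (All x \<phi>) e \<longleftrightarrow> (\<forall>a \<in> carrier M. sat M \<phi> (e(x := a)))"
  by (auto simp: Falsum_def And_def Imp_def All_def)

lemma Conjs_range: "countable A \<Longrightarrow> A \<noteq> {} \<Longrightarrow> (\<forall>n. P (from_nat_into A n)) \<longleftrightarrow> (\<forall>a \<in> A. P a)"
  using range_from_nat_into[of A] by (metis rangeE rangeI)

lemma sat_Conjs [simp]: "countable A \<Longrightarrow> sat M (Conjs A \<Phi>) e \<longleftrightarrow> (\<forall>a \<in> A. sat M (\<Phi> a) e)"
  using Conjs_range[of A "\<lambda>a. sat M (\<Phi> a) e"] by (simp add: Conjs_def)

lemma fv_And [simp]: "fv (And \<phi> \<psi>) = fv \<phi> \<union> fv \<psi>"
  by (auto simp: And_def split: if_splits)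

lemma fv_connectives [simp]:
  "fv Falsum = {}" "fv (Imp \<phi> \<psi>) = fv \<phi> \<union> fv \<psi>" "fv (All x \<phi>) = fv \<phi> - {x}"
  by (auto simp: Falsum_def All_def Imp_def)

lemma fv_Alls [simp]: "fv (Alls n \<phi>) = fv \<phi> - {1..n}"
  by (induction n arbitrary: \<phi>) (auto simp: le_Suc_eq)

lemma fv_Conjs:
  assumes "\<And>a. a \<in> A \<Longrightarrow> fv (\<Phi> a) \<subseteq> V"
  shows "fv (Conjs A \<Phi>) \<subseteq> V"
proof -
  have "fv (\<Phi> (from_nat_into A n)) \<subseteq> V" if "A \<noteq> {}" for n by (rule assms[OF from_nat_into[OF that]])
  then show ?thesis by (simp add: Conjs_def UN_subset_iff)
qed

lemma wf_And [simp]: "wf_fm \<tau> (And \<phi> \<psi>) \<longleftrightarrow> wf_fm \<tau> \<phi> \<and> wf_fm \<tau> \<psi>"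
  by (auto simp: And_def)

lemma wf_connectives [simp]:
  "wf_fm \<tau> Falsum" "wf_fm \<tau> (Imp \<phi> \<psi>) \<longleftrightarrow> wf_fm \<tau> \<phi> \<and> wf_fm \<tau> \<psi>" "wf_fm \<tau> (All x \<phi>) \<longleftrightarrow> wf_fm \<tau> \<phi>"
  by (auto simp: Falsum_def All_def Imp_def)

lemma wf_Alls [simp]: "wf_fm \<tau> (Alls n \<phi>) \<longleftrightarrow> wf_fm \<tau> \<phi>"
  by (induction n arbitrary: \<phi>) auto

lemma wf_Conjs: "(\<And>a. a \<in> A \<Longrightarrow> wf_fm \<tau> (\<Phi> a)) \<Longrightarrow> wf_fm \<tau> (Conjs A \<Phi>)"
  using from_nat_into[of A] by (auto simp: Conjs_def)

lemma sat_Alls: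
  fixes e :: "nat \<Rightarrow> 'u"
  assumes "\<And>e :: nat \<Rightarrow> 'u. e 0 = h \<Longrightarrow> sat M \<phi> e \<longleftrightarrow> Q (map e [1..<Suc n])" and "e 0 = h"
  shows "sat M (Alls n \<phi>) e \<longleftrightarrow> (\<forall>xs. length xs = n \<longrightarrow> set xs \<subseteq> carrier M \<longrightarrow> Q xs)"
  using assms
proof (induction n arbitrary: \<phi> Q)
  case (Suc n)
  have "sat M (Alls n (All (Suc n) \<phi>)) e \<longleftrightarrow>
      (\<forall>xs. length xs = n \<longrightarrow> set xs \<subseteq> carrier M \<longrightarrow> (\<forall>a \<in> carrier M. Q (xs @ [a])))"
  proof (rule Suc.IH[OF _ Suc.prems(2)])
    fix e :: "nat \<Rightarrow> 'u" assume e: "e 0 = h"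
    have "map (e(Suc n := a)) [1..<Suc (Suc n)] = map e [1..<Suc n] @ [a]" for a by simp
    moreover have "sat M \<phi> (e(Suc n := a)) \<longleftrightarrow> Q (map (e(Suc n := a)) [1..<Suc (Suc n)])" for a
      by (rule Suc.prems(1)) (use e in simp)
    ultimately show "sat M (All (Suc n) \<phi>) e \<longleftrightarrow> (\<forall>a\<in>carrier M. Q (map e [1..<Suc n] @ [a]))"
      by (simp del: upt_Suc)
  qed
  also have "\<dots> \<longleftrightarrow> (\<forall>xs. length xs = Suc n \<longrightarrow> set xs \<subseteq> carrier M \<longrightarrow> Q xs)"
  proof (intro iffI allI impI)
    fix xs assume H: "\<forall>xs. length xs = n \<longrightarrow> set xs \<subseteq> carrier M \<longrightarrow> (\<forall>a \<in> carrier M. Q (xs @ [a]))"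
      and xs: "length xs = Suc n" "set xs \<subseteq> carrier M"
    then show "Q xs" by (cases xs rule: rev_cases) auto
  qed auto
  finally show ?case by simp
qed simp

lemma val_cong: "(\<And>x. x \<in> fv_trm t \<Longrightarrow> e x = e' x) \<Longrightarrow> val M e t = val M e' t"
proof (induction t)
  case (App f ts)
  then have "map (val M e) ts = map (val M e') ts" by auto
  then show ?case by (simp only: val.simps)
qed simp

lemma sat_cong: "(\<And>x. x \<in> fv \<phi> \<Longrightarrow> e x = e' x) \<Longrightarrow> sat M \<phi> e \<longleftrightarrow> sat M \<phi> e'"
proof (induction \<phi> arbitrary: e e')
  case (Eq s t)
  then have "val M e s = val M e' s" "val M e t = val M e' t" by (auto intro!: val_cong)
  then show ?case by simp
next
  case (Atom R ts)
  then have "map (val M e) ts = map (val M e') ts" by (auto intro!: val_cong)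
  then show ?case by (simp only: sat.simps)
next
  case (Conj \<Phi>)
  have "sat M (\<Phi> n) e \<longleftrightarrow> sat M (\<Phi> n) e'" for n by (rule Conj.IH) (use Conj.prems in auto)
  then show ?case by simp
next
  case (Ex x \<phi>)
  have "sat M \<phi> (e(x := a)) \<longleftrightarrow> sat M \<phi> (e'(x := a))" for a by (rule Ex.IH) (use Ex.prems in auto)
  then show ?case by simp
next
  case (Neg \<phi>)
  have "sat M \<phi> e \<longleftrightarrow> sat M \<phi> e'" by (rule Neg.IH) (use Neg.prems in auto)
  then show ?case by simp
qed

lemma finite_fv_trm: "finite (fv_trm t)"
  by (induction t) auto

lemma val_App_iff:
  assumes A: "is_struct \<tau> A" and "f = Fun (length ts) c" "f \<in> \<tau>" and ts: "\<And>t. t \<in> set ts \<Longrightarrow> val A e t \<in> carrier A"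
  shows "val A e (App f ts) \<in> carrier A"
    and "val A e (App f ts) = y \<longleftrightarrow> map (val A e) ts @ [y] \<in> interp A f"
proof -
  have wf: "wf_interp (carrier A) f (interp A f)" using assms(1,3) by (simp add: is_struct_def)
  have w: "interp A f \<subseteq> tuples (Suc (length ts)) (carrier A)"
    "\<forall>xs \<in> tuples (length ts) (carrier A). \<exists>!y. y \<in> carrier A \<and> xs @ [y] \<in> interp A f"
    using wf by (auto simp: assms(2))
  have "map (val A e) ts \<in> tuples (length ts) (carrier A)" using ts by (auto simp: tuples_def)
  then obtain z where z: "z \<in> carrier A" "map (val A e) ts @ [z] \<in> interp A f"
    and u: "\<And>y. y \<in> carrier A \<Longrightarrow> map (val A e) ts @ [y] \<in> interp A f \<Longrightarrow> y = z"
    using w(2) by metis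
  have c: "y \<in> carrier A" if "map (val A e) ts @ [y] \<in> interp A f" for y
    using w(1) that by (auto simp: tuples_def)
  have v: "val A e (App f ts) = z"
    unfolding val.simps by (rule the_equality[where P = "\<lambda>y. map (val A e) ts @ [y] \<in> interp A f"])
      (use z(2) u c in blast)+
  show "val A e (App f ts) \<in> carrier A" using z(1) unfolding v .
  show "val A e (App f ts) = y \<longleftrightarrow> map (val A e) ts @ [y] \<in> interp A f"
    unfolding v using z(2) u[OF c, of y] by metis
qed

lemma val_carrier:
  assumes "is_struct \<tau> A"
  shows "wf_trm \<tau> t \<Longrightarrow> (\<And>x. x \<in> fv_trm t \<Longrightarrow> e x \<in> carrier A) \<Longrightarrow> val A e t \<in> carrier A"
proof (induction t)
  case (App f ts)
  then obtain c where "f = Fun (length ts) c" "f \<in> \<tau>" by auto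
  then show ?case by (rule val_App_iff(1)[OF assms]) (use App in auto)
qed simp

context lock_construction
begin

definition at :: "('i, 'u) sym \<Rightarrow> nat list \<Rightarrow> 'u fm" where
  "at y xs = Atom (code y) (map Var xs)"

lemma at_simps [simp]:
  "y \<in> symbols \<Longrightarrow> sat M (at y xs) e \<longleftrightarrow> map e xs \<in> rel M y"
  "fv (at y xs) = set xs"
  "wf_fm voc (at y xs) \<longleftrightarrow> code y \<in> voc \<and> length xs = sym_arity y"
  by (auto simp: at_def rel_def comp_def code_def)

lemma code_voc: "y \<in> symbols \<Longrightarrow> code y \<in> voc"
  by (simp add: voc_def)

subsection \<open>Relativization to the part of a holder\<close>

text \<open>
  In the relativized formulas, the variable 0 stands for the holder and \<open>Suc x\<close> for \<open>x\<close>.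
  The formula \<open>eval_term t s k n\<close> says that \<open>k\<close> is the value of the term \<open>s\<close>; the number \<open>n\<close>
  is an upper bound for its free variables.
\<close>

primrec eval_list :: "(nat \<Rightarrow> nat \<Rightarrow> 'u fm) list \<Rightarrow> (nat list \<Rightarrow> 'u fm) \<Rightarrow> nat list \<Rightarrow> nat \<Rightarrow> 'u fm" where
  "eval_list [] C acc n = C acc"
| "eval_list (g # gs) C acc n =
     Ex n (And (at SMem [0, n]) (And (g n (Suc n)) (eval_list gs C (acc @ [n]) (Suc n))))"

primrec eval_term :: "'i \<Rightarrow> 'u trm \<Rightarrow> nat \<Rightarrow> nat \<Rightarrow> 'u fm" where
  "eval_term t (Var x) = (\<lambda>k n. Eq (Var (Suc x)) (Var k))"
| "eval_term t (App f ts) =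
     (\<lambda>k n. eval_list (map (eval_term t) ts) (\<lambda>acc. at (SCode t f) (0 # acc @ [k])) [] n)"

text \<open>One successor accounts for the shift of variables by the relativization, the other makes
  the bound strict; 0 is inserted so that the maximum exists.\<close>

definition above :: "nat set \<Rightarrow> nat" where
  "above X = Suc (Suc (Max (insert 0 X)))"

lemma above: "finite X \<Longrightarrow> x \<in> X \<Longrightarrow> Suc x < above X" "0 < above X"
  by (auto simp: above_def less_Suc_eq_le)

text \<open>The new vocabulary has only relation symbols, so terms of the given vocabulary cannot be
  written in it and are unnested. An equation becomes the existence of a common value in the part;
  an atom becomes a statement about the values of its arguments.\<close>

primrec relativize :: "'i \<Rightarrow> 'u fm \<Rightarrow> 'u fm" where
  "relativize t (Eq s s') = (let n = above (fv_trm s \<union> fv_trm s') in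
     Ex n (And (at SMem [0, n]) (And (eval_term t s n (Suc n)) (eval_term t s' n (Suc n)))))"
| "relativize t (Atom R ts) =
     eval_list (map (eval_term t) ts) (\<lambda>acc. at (SCode t R) (0 # acc)) [] (above (\<Union>s \<in> set ts. fv_trm s))"
| "relativize t (Neg \<phi>) = Neg (relativize t \<phi>)"
| "relativize t (Conj \<Phi>) = Conj (\<lambda>n. relativize t (\<Phi> n))"
| "relativize t (Ex x \<phi>) = Ex (Suc x) (And (at SMem [0, Suc x]) (relativize t \<phi>))"

lemma eval_list_wf:
  assumes "\<And>g k n. g \<in> set gs \<Longrightarrow> wf_fm voc (g k n)"
    and "\<And>acc'. length acc' = length gs \<Longrightarrow> wf_fm voc (C (acc @ acc'))"
  shows "wf_fm voc (eval_list gs C acc n)"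
  using assms
proof (induction gs arbitrary: acc n)
  case (Cons g gs)
  have "wf_fm voc (eval_list gs C (acc @ [n]) (Suc n))"
    by (rule Cons.IH) (use Cons.prems in auto)
  then show ?case using Cons.prems(1) by (simp add: code_voc symbolsI)
qed (use assms(2)[of "[]"] in simp)

lemma eval_list_fv:
  assumes "\<And>g k n. g \<in> set gs \<Longrightarrow> fv (g k n) \<subseteq> insert 0 (insert k V)"
    and "\<And>acc. fv (C acc) \<subseteq> set acc \<union> insert 0 V"
  shows "fv (eval_list gs C acc n) \<subseteq> set acc \<union> insert 0 V"
  using assms(1)
proof (induction gs arbitrary: acc n)
  case Nil
  then show ?case using assms(2) by simp
next
  case (Cons g gs)
  have "fv (eval_list gs C (acc @ [n]) (Suc n)) \<subseteq> set (acc @ [n]) \<union> insert 0 V"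
    by (rule Cons.IH) (use Cons.prems in auto)
  then show ?case using Cons.prems[of g n "Suc n"] by auto
qed

context
  fixes t :: 'i
  assumes t: "t \<in> I"
begin

lemma eval_term_wf: "wf_trm (vocab (K t)) s \<Longrightarrow> wf_fm voc (eval_term t s k n)"
proof (induction s arbitrary: k n)
  case (App f ts)
  then show ?case by (auto intro!: eval_list_wf code_voc symbolsI t)
qed simp

lemma eval_term_fv: "fv (eval_term t s k n) \<subseteq> insert 0 (insert k (Suc ` fv_trm s))"
proof (induction s arbitrary: k n)
  case (App f ts)
  have "fv (eval_list (map (eval_term t) ts) (\<lambda>acc. at (SCode t f) (0 # acc @ [k])) [] n)
    \<subseteq> set [] \<union> insert 0 (insert k (Suc ` fv_trm (App f ts)))"
    by (rule eval_list_fv) (use App in fastforce)+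
  then show ?case by simp
qed auto

lemma relativize_wf: "wf_fm (vocab (K t)) \<phi> \<Longrightarrow> wf_fm voc (relativize t \<phi>)"
proof (induction \<phi>)
  case (Atom R ts)
  then show ?case by (auto intro!: eval_list_wf eval_term_wf code_voc symbolsI t)
qed (auto simp: Let_def code_voc symbolsI eval_term_wf)

lemma relativize_fv: "fv (relativize t \<phi>) \<subseteq> insert 0 (Suc ` fv \<phi>)"
proof (induction \<phi>)
  case (Eq s s')
  then show ?case
    using eval_term_fv[of s "above (fv_trm s \<union> fv_trm s')"] eval_term_fv[of s' "above (fv_trm s \<union> fv_trm s')"]
    by (fastforce simp: Let_def)
next
  case (Atom R ts)
  have "fv (eval_list (map (eval_term t) ts) (\<lambda>acc. at (SCode t R) (0 # acc)) [] (above (\<Union>s \<in> set ts. fv_trm s)))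
    \<subseteq> set [] \<union> insert 0 (Suc ` fv (Atom R ts))"
    by (rule eval_list_fv) (use eval_term_fv in fastforce)+
  then show ?case by simp
qed (auto; blast)+

context
  fixes M h A
  assumes M: "is_struct voc M" and A: "A = part M t h" "is_struct (vocab (K t)) A"
begin

lemma code_interp:
  assumes "f \<in> vocab (K t)" "set xs \<subseteq> carrier A" "e 0 = h"
  shows "e 0 # xs \<in> rel M (SCode t f) \<longleftrightarrow> xs \<in> interp A f"
  using assms by (auto simp: A(1) part_def)

lemma mem_iff: "Mem M h a \<longleftrightarrow> a \<in> carrier A"
  by (simp add: A(1) carrier_part)

lemma part_carrier: "a \<in> carrier A \<Longrightarrow> a \<in> carrier M"
  using carrier_part_subset[OF M] by (auto simp: A(1))

text \<open>The fresh variables from \<open>n\<close> on receive the values of the terms one after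
  another, and \<open>acc\<close> remembers them for the continuation \<open>C\<close>. The set
  \<open>X\<close> protects variables that \<open>C\<close> uses besides, such as the one for the
  value of an application. A general \<open>G\<close> in place of \<open>eval_term\<close> allows
  the use inside the induction on terms.\<close>

lemma sat_eval_list:
  assumes g: "\<And>s k n e. s \<in> set ss \<Longrightarrow> e 0 = h \<Longrightarrow> (\<And>x. x \<in> fv_trm s \<Longrightarrow> e (Suc x) \<in> carrier A \<and> Suc x < n) \<Longrightarrow>
      k < n \<Longrightarrow> 0 < n \<Longrightarrow> e k \<in> carrier A \<Longrightarrow> sat M (G s k n) e \<longleftrightarrow> val A (e \<circ> Suc) s = e k"
    and wf: "\<And>s. s \<in> set ss \<Longrightarrow> wf_trm (vocab (K t)) s"
    and C: "\<And>acc e'. set acc \<subseteq> {m. e' m \<in> carrier A} \<Longrightarrow> length acc = l + length ss \<Longrightarrow> e' 0 = h \<Longrightarrow>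
      (\<And>x. x \<in> X \<Longrightarrow> e' x = e x) \<Longrightarrow> sat M (C acc) e' \<longleftrightarrow> Q (map e' acc)"
    and e: "e 0 = h" "\<And>s x. s \<in> set ss \<Longrightarrow> x \<in> fv_trm s \<Longrightarrow> e (Suc x) \<in> carrier A \<and> Suc x < n" "0 < n"
    and acc: "\<And>m. m \<in> set acc \<Longrightarrow> e m \<in> carrier A \<and> m < n" "length acc = l" and X: "\<And>x. x \<in> X \<Longrightarrow> x < n"
  shows "sat M (eval_list (map G ss) C acc n) e \<longleftrightarrow> Q (map e acc @ map (val A (e \<circ> Suc)) ss)"
  using assms
proof (induction ss arbitrary: acc n e l)
  case Nil
  have "sat M (C acc) e \<longleftrightarrow> Q (map e acc)"
    by (rule Nil.prems(3)) (use Nil.prems in auto)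
  then show ?case by simp
next
  case (Cons s ss)
  note e = Cons.prems(4) and e2 = Cons.prems(5)
  define v where "v = val A (e \<circ> Suc) s"
  have v: "v \<in> carrier A"
    unfolding v_def by (rule val_carrier[OF A(2) Cons.prems(2)]) (use e2[of s] in auto)
  have e0: "(e(n := a)) 0 = h" for a using e Cons.prems(6) by simp
  have G: "sat M (G s n (Suc n)) (e(n := a)) \<longleftrightarrow> v = a" if a: "a \<in> carrier A" for a
  proof -
    have "sat M (G s n (Suc n)) (e(n := a)) \<longleftrightarrow> val A (e(n := a) \<circ> Suc) s = (e(n := a)) n"
    proof (rule Cons.prems(1))
      show "(e(n := a)) (Suc x) \<in> carrier A \<and> Suc x < Suc n" if x: "x \<in> fv_trm s" for x
        using e2[of s x] x a by auto
    qed (use a e0 in auto)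
    moreover have "val A (e(n := a) \<circ> Suc) s = v"
      unfolding v_def by (rule val_cong) (use e2[of s] in auto)
    ultimately show ?thesis by simp
  qed
  have R: "sat M (eval_list (map G ss) C (acc @ [n]) (Suc n)) (e(n := a)) \<longleftrightarrow>
      Q (map e acc @ [a] @ map (val A (e \<circ> Suc)) ss)" if a: "a \<in> carrier A" for a
  proof -
    have "sat M (eval_list (map G ss) C (acc @ [n]) (Suc n)) (e(n := a)) \<longleftrightarrow>
      Q (map (e(n := a)) (acc @ [n]) @ map (val A (e(n := a) \<circ> Suc)) ss)"
    proof (rule Cons.IH[where l = "Suc l"])
      show "sat M (G s' k n') e' \<longleftrightarrow> val A (e' \<circ> Suc) s' = e' k"
        if "s' \<in> set ss" "e' 0 = h" "\<And>x. x \<in> fv_trm s' \<Longrightarrow> e' (Suc x) \<in> carrier A \<and> Suc x < n'" "k < n'" "0 < n'"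
          "e' k \<in> carrier A" for s' k n' e'
        by (rule Cons.prems(1)) (use that in auto)
      show "wf_trm (vocab (K t)) s'" if "s' \<in> set ss" for s' using Cons.prems(2) that by simp
      show "sat M (C acc') e' \<longleftrightarrow> Q (map e' acc')"
        if "set acc' \<subseteq> {m. e' m \<in> carrier A}" "length acc' = Suc l + length ss" "e' 0 = h"
          "\<And>x. x \<in> X \<Longrightarrow> e' x = (e(n := a)) x" for acc' e'
      proof (rule Cons.prems(3))
        show "e' x = e x" if "x \<in> X" for x using \<open>\<And>x. x \<in> X \<Longrightarrow> e' x = (e(n := a)) x\<close>[OF that] Cons.prems(9)[OF that] by simp
      qed (use that in auto)
      show "(e(n := a)) 0 = h" by (rule e0)
      show "(e(n := a)) (Suc x) \<in> carrier A \<and> Suc x < Suc n" if "s' \<in> set ss" "x \<in> fv_trm s'" for s' x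
        using e2[of s' x] that a by auto
      show "(e(n := a)) m \<in> carrier A \<and> m < Suc n" if "m \<in> set (acc @ [n])" for m
        using Cons.prems(7)[of m] that a by auto
      show "x < Suc n" if "x \<in> X" for x using Cons.prems(9)[OF that] by simp
    qed (use Cons.prems(8) in simp_all)
    moreover have "map (e(n := a)) (acc @ [n]) = map e acc @ [a]" using Cons.prems(7) by fastforce
    moreover have "val A (e(n := a) \<circ> Suc) s' = val A (e \<circ> Suc) s'" if "s' \<in> set ss" for s'
      by (rule val_cong) (use e2[of s'] that in auto)
    then have "map (val A (e(n := a) \<circ> Suc)) ss = map (val A (e \<circ> Suc)) ss" by (rule map_cong[OF refl])
    ultimately show ?thesis by (simp only: append_assoc)
  qed
  have "sat M (eval_list (map G (s # ss)) C acc n) e \<longleftrightarrow>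
      (\<exists>a \<in> carrier M. a \<in> carrier A \<and> v = a \<and> Q (map e acc @ [a] @ map (val A (e \<circ> Suc)) ss))"
    using G R mem_iff e Cons.prems(6) by (simp add: symbolsI) blast
  also have "\<dots> \<longleftrightarrow> Q (map e acc @ [v] @ map (val A (e \<circ> Suc)) ss)" using v part_carrier by blast
  finally show ?case by (simp only: v_def list.map append.simps)
qed

lemma sat_eval_term:
  "wf_trm (vocab (K t)) s \<Longrightarrow> e 0 = h \<Longrightarrow> (\<And>x. x \<in> fv_trm s \<Longrightarrow> e (Suc x) \<in> carrier A \<and> Suc x < n) \<Longrightarrow>
     k < n \<Longrightarrow> 0 < n \<Longrightarrow> e k \<in> carrier A \<Longrightarrow> sat M (eval_term t s k n) e \<longleftrightarrow> val A (e \<circ> Suc) s = e k"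
proof (induction s arbitrary: k n e)
  case (App f ts)
  obtain c where f: "f = Fun (length ts) c" "f \<in> vocab (K t)" using App.prems(1) by auto
  have "sat M (eval_list (map (eval_term t) ts) (\<lambda>acc. at (SCode t f) (0 # acc @ [k])) [] n) e \<longleftrightarrow>
      map e [] @ map (val A (e \<circ> Suc)) ts @ [e k] \<in> interp A f"
  proof (rule sat_eval_list[where Q = "\<lambda>xs. xs @ [e k] \<in> interp A f" and X = "{k}" and l = 0, unfolded append_assoc])
    show "sat M (eval_term t s k n) e \<longleftrightarrow> val A (e \<circ> Suc) s = e k"
      if "s \<in> set ts" "e 0 = h" "\<And>x. x \<in> fv_trm s \<Longrightarrow> e (Suc x) \<in> carrier A \<and> Suc x < n"
        "k < n" "0 < n" "e k \<in> carrier A" for s k n e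
      by (rule App.IH) (use that App.prems(1) in auto)
    show "sat M (at (SCode t f) (0 # acc @ [k])) e' \<longleftrightarrow> map e' acc @ [e k] \<in> interp A f"
      if "set acc \<subseteq> {m. e' m \<in> carrier A}" "e' 0 = h" "\<And>x. x \<in> {k} \<Longrightarrow> e' x = e x" for acc e'
      using code_interp[OF f(2), of "map e' (acc @ [k])" e'] that App.prems(6) f(2)
      by (auto simp: symbolsI t)
  qed (use App.prems in auto)
  also have "\<dots> \<longleftrightarrow> val A (e \<circ> Suc) (App f ts) = e k"
  proof -
    have "val A (e \<circ> Suc) s \<in> carrier A" if "s \<in> set ts" for s
      by (rule val_carrier[OF A(2)]) (use App.prems that in auto)
    then show ?thesis using val_App_iff(2)[OF A(2) f] by simp
  qed
  finally show ?case unfolding eval_term.simps .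
qed simp

text \<open>The part only needs to be a structure of the given vocabulary here, which makes the
  evaluation of terms total; that it is a structure is expressed separately by
  \<open>struct_fm\<close>.\<close>

lemma sat_relativize:
  "wf_fm (vocab (K t)) \<phi> \<Longrightarrow> e 0 = h \<Longrightarrow> (\<And>x. x \<in> fv \<phi> \<Longrightarrow> e (Suc x) \<in> carrier A) \<Longrightarrow>
     sat M (relativize t \<phi>) e \<longleftrightarrow> sat A \<phi> (e \<circ> Suc)"
proof (induction \<phi> arbitrary: e)
  case (Eq s s')
  define n where "n = above (fv_trm s \<union> fv_trm s')"
  have n: "Suc x < n" if "x \<in> fv_trm s \<union> fv_trm s'" for x
    unfolding n_def by (rule above(1)[OF _ that]) (simp add: finite_fv_trm)
  have n0: "0 < n" by (simp add: n_def above)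
  have v: "val A (e \<circ> Suc) r \<in> carrier A" if "r = s \<or> r = s'" for r
    by (rule val_carrier[OF A(2)]) (use that Eq.prems in auto)
  have T: "sat M (eval_term t r n (Suc n)) (e(n := a)) \<longleftrightarrow> val A (e \<circ> Suc) r = a"
    if r: "r = s \<or> r = s'" and a: "a \<in> carrier A" for r a
  proof -
    have "sat M (eval_term t r n (Suc n)) (e(n := a)) \<longleftrightarrow> val A (e(n := a) \<circ> Suc) r = (e(n := a)) n"
    proof (rule sat_eval_term)
      show "(e(n := a)) (Suc x) \<in> carrier A \<and> Suc x < Suc n" if "x \<in> fv_trm r" for x
        using Eq.prems(3)[of x] n[of x] that r a by auto
    qed (use Eq.prems r a n0 in auto)
    moreover have "val A (e(n := a) \<circ> Suc) r = val A (e \<circ> Suc) r"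
      by (rule val_cong) (use n r in auto)
    ultimately show ?thesis by simp
  qed
  have "sat M (relativize t (Eq s s')) e \<longleftrightarrow> (\<exists>a \<in> carrier M. a \<in> carrier A \<and>
      sat M (eval_term t s n (Suc n)) (e(n := a)) \<and> sat M (eval_term t s' n (Suc n)) (e(n := a)))"
    using mem_iff Eq.prems(2) n0 by (simp add: Let_def n_def[symmetric] symbolsI)
  also have "\<dots> \<longleftrightarrow>
      (\<exists>a \<in> carrier M. a \<in> carrier A \<and> val A (e \<circ> Suc) s = a \<and> val A (e \<circ> Suc) s' = a)"
    by (intro bex_cong refl conj_cong T) simp_all
  also have "\<dots> \<longleftrightarrow> val A (e \<circ> Suc) s = val A (e \<circ> Suc) s'"
  proof -
    have "val A (e \<circ> Suc) s \<in> carrier A" using v by simp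
    moreover from this have "val A (e \<circ> Suc) s \<in> carrier M" by (rule part_carrier)
    ultimately show ?thesis by metis
  qed
  finally show ?case by (simp only: sat.simps)
next
  case (Atom R ts)
  obtain c where R: "R = Rel (length ts) c" "R \<in> vocab (K t)" using Atom.prems(1) by auto
  let ?n = "above (\<Union>s \<in> set ts. fv_trm s)"
  have n: "Suc x < ?n" if "s \<in> set ts" "x \<in> fv_trm s" for s x
    by (rule above(1)) (use that finite_fv_trm in auto)
  have "sat M (eval_list (map (eval_term t) ts) (\<lambda>acc. at (SCode t R) (0 # acc)) [] ?n) e \<longleftrightarrow>
      map e [] @ map (val A (e \<circ> Suc)) ts \<in> interp A R"
  proof (rule sat_eval_list[where Q = "\<lambda>xs. xs \<in> interp A R" and X = "{}" and l = 0])
    show "sat M (eval_term t s k n) e \<longleftrightarrow> val A (e \<circ> Suc) s = e k"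
      if "s \<in> set ts" "e 0 = h" "\<And>x. x \<in> fv_trm s \<Longrightarrow> e (Suc x) \<in> carrier A \<and> Suc x < n"
        "k < n" "0 < n" "e k \<in> carrier A" for s k n e
      by (rule sat_eval_term) (use that Atom.prems(1) in auto)
    show "sat M (at (SCode t R) (0 # acc)) e' \<longleftrightarrow> map e' acc \<in> interp A R"
      if "set acc \<subseteq> {m. e' m \<in> carrier A}" "e' 0 = h" for acc e'
      using code_interp[OF R(2), of "map e' acc" e'] that R(2) by (auto simp: symbolsI t)
    show "0 < ?n" by (rule above(2))
    show "e (Suc x) \<in> carrier A \<and> Suc x < ?n" if "s \<in> set ts" "x \<in> fv_trm s" for s x
      using n[OF that] Atom.prems(3)[of x] that by auto
  qed (use Atom.prems in auto)
  then show ?case by (simp only: relativize.simps sat.simps list.map append.simps)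
next
  case (Conj \<Phi>)
  have "sat M (relativize t (\<Phi> n)) e \<longleftrightarrow> sat A (\<Phi> n) (e \<circ> Suc)" for n
    by (rule Conj.IH) (use Conj.prems in auto)
  then show ?case by (simp only: relativize.simps sat.simps)
next
  case (Neg \<phi>)
  have "sat M (relativize t \<phi>) e \<longleftrightarrow> sat A \<phi> (e \<circ> Suc)" by (rule Neg.IH) (use Neg.prems in auto)
  then show ?case by (simp only: relativize.simps sat.simps)
next
  case (Ex x \<phi>)
  have 1: "sat M (relativize t \<phi>) (e(Suc x := a)) \<longleftrightarrow> sat A \<phi> ((e \<circ> Suc)(x := a))" if a: "a \<in> carrier A" for a
  proof -
    have "sat M (relativize t \<phi>) (e(Suc x := a)) \<longleftrightarrow> sat A \<phi> (e(Suc x := a) \<circ> Suc)"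
      by (rule Ex.IH) (use Ex.prems a in auto)
    moreover have "e(Suc x := a) \<circ> Suc = (e \<circ> Suc)(x := a)" by auto
    ultimately show ?thesis by (simp only:)
  qed
  have "sat M (relativize t (Ex x \<phi>)) e \<longleftrightarrow>
      (\<exists>a \<in> carrier M. a \<in> carrier A \<and> sat M (relativize t \<phi>) (e(Suc x := a)))"
    using mem_iff Ex.prems(2) by (simp add: symbolsI)
  also have "\<dots> \<longleftrightarrow> (\<exists>a \<in> carrier M. a \<in> carrier A \<and> sat A \<phi> ((e \<circ> Suc)(x := a)))"
    by (intro bex_cong refl conj_cong 1)
  also have "\<dots> \<longleftrightarrow> (\<exists>a \<in> carrier A. sat A \<phi> ((e \<circ> Suc)(x := a)))" using part_carrier by metis
  finally show ?case by (simp only: sat.simps)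
qed

end

end

subsection \<open>The sentence\<close>

definition holder_fm :: "'i \<Rightarrow> nat \<Rightarrow> 'u fm" where
  "holder_fm t x = And (at (STyp t) [x]) (Neg (at SMem [x, x]))"

definition alive_fm :: "('i, 'u) sym \<Rightarrow> nat \<Rightarrow> 'u fm" where
  "alive_fm y x = And (at y [x]) (Neg (Ex (Suc x) (at SKill [x, Suc x])))"

text \<open>For the new vocabulary the code of a function symbol is an arbitrary relation, so
  totality and uniqueness of values inside the part have to be demanded. Variable 0 is the holder, 1
  to \<open>n\<close> are the arguments, and the next two are candidates for the value.\<close>

definition function_fm :: "'i \<Rightarrow> 'u symb \<Rightarrow> nat \<Rightarrow> 'u fm" where
  "function_fm t s n = (let F = \<lambda>k. And (at SMem [0, k]) (at (SCode t s) (0 # [1..<Suc n] @ [k])) in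
     Alls n (Imp (Conjs {1..n} (\<lambda>x. at SMem [0, x]))
       (And (Ex (Suc n) (F (Suc n)))
         (All (Suc n) (All (Suc (Suc n)) (Imp (F (Suc n)) (Imp (F (Suc (Suc n))) (Eq (Var (Suc n)) (Var (Suc (Suc n)))))))))))"

text \<open>Relation symbols need no condition: arity and range of their interpretations in a part
  are right by the definition of \<open>part\<close> and the arity of the codes.\<close>

definition struct_fm :: "'i \<Rightarrow> 'u fm" where
  "struct_fm t = And (Ex 1 (at SMem [0, 1])) (Conjs (vocab (K t))
     (\<lambda>s. case s of Rel n c \<Rightarrow> Neg Falsum | Fun n c \<Rightarrow> function_fm t s n))"

definition token_fm :: "'i \<Rightarrow> 'u fm" where
  "token_fm i =
     And (All 1 (Imp (at SBel [1, 0]) (holder_fm i 1)))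
    (And (All 1 (All 2 (All 3 (All 4 (Imp (at SBel [1, 0]) (Imp (at SMem [1, 2])
       (Imp (at SPick [1, 2, 3]) (Imp (at SPick [1, 2, 4]) (Eq (Var 3) (Var 4))))))))))
    (And (All 3 (Ex 1 (Ex 2 (And (at SBel [1, 0]) (And (at SMem [1, 2]) (at SPick [1, 2, 3]))))))
      (All 1 (All 2 (Imp (at SBel [1, 0]) (Imp (at SBel [2, 0])
        (Imp (Neg (Ex 3 (And (at SMem [1, 3]) (at SPick [1, 3, 2]))))
          (Ex 3 (And (at SMem [2, 3]) (at SPick [2, 3, 1]))))))))))"

text \<open>The disjunction in \<open>lock_tuple\<close> has a uniform shape: the symbol is one of
  the listed ones, the first entry is the lock, and all later entries are its points. For
  \<open>SLock\<close> and \<open>STyp b\<close> there are no later entries. The symbol is fixed, so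
  its membership is decided when the formula is formed.\<close>

definition lock_tuple_fm :: "('i, 'u) sym \<Rightarrow> 'u fm" where
  "lock_tuple_fm y = Alls (sym_arity y) (Imp (at y [1..<Suc (sym_arity y)])
     (Imp (Conjs {1..sym_arity y} (\<lambda>x. Imp (Neg (Eq (Var x) (Var 0))) (at SMem [0, x])))
       (if y \<in> {SLock, STyp b, SMem} \<union> range (SCode b)
        then And (Eq (Var 1) (Var 0)) (Conjs {2..sym_arity y} (\<lambda>x. at SMem [0, x])) else Falsum)))"

definition lock_fm :: "'u fm" where
  "lock_fm =
     And (holder_fm b 0)
    (And (All 1 (All 2 (foldr Imp [at SRow [1, 0], at SBel [2, 0]] (Ex 3 (And (at SMem [0, 3]) (at SCol [1, 2, 3]))))))
    (And (All 1 (All 2 (All 3 (All 4 (All 5 (foldr Imp [at SRow [1, 0], at SRow [2, 0], at SBel [3, 0],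
        at SBel [4, 0], at SMem [0, 5], at SCol [1, 3, 5], at SCol [1, 4, 5], at SCol [2, 3, 5], at SCol [2, 4, 5],
        Neg (Eq (Var 3) (Var 4))] (if loose then Eq (Var 1) (Var 2) else Falsum)))))))
    (And (All 1 (All 2 (Imp (at SMem [0, 1]) (Neg (at SKill [1, 2])))))
      (Conjs symbols lock_tuple_fm))))"

definition ok_fm :: "('i \<Rightarrow> 'u fm) \<Rightarrow> 'u fm" where
  "ok_fm \<phi> =
     And (Conjs I (\<lambda>t. All 0 (Imp (holder_fm t 0) (And (struct_fm t) (relativize t (\<phi> t))))))
    (And (Conjs I (\<lambda>t. Conjs (I - {t}) (\<lambda>t'. All 0 (Imp (holder_fm t 0) (Neg (holder_fm t' 0))))))
    (And (All 0 (All 1 (All 2 (Imp (at SKill [0, 1]) (Imp (at SKill [0, 2]) (Eq (Var 1) (Var 2)))))))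
    (And (Conjs I (\<lambda>i. Conjs I (\<lambda>j. All 0 (All 1 (Imp (alive_fm (STok i) 0) (Imp (alive_fm (STok j) 1)
       (if i = j then Eq (Var 0) (Var 1) else Falsum)))))))
    (And (All 0 (All 1 (Imp (alive_fm SLock 0) (Imp (alive_fm SLock 1) (Eq (Var 0) (Var 1))))))
    (And (Conjs I (\<lambda>i. All 0 (Imp (alive_fm (STok i) 0) (token_fm i))))
      (All 0 (Imp (alive_fm SLock 0) lock_fm)))))))"

context
  assumes countable: "countable I" "\<And>i. i \<in> I \<Longrightarrow> countable (vocab (K i))"
begin

lemma countable_symbols: "countable symbols"
proof -
  have "{SCode t s | t s. t \<in> I \<and> s \<in> vocab (K t)} = (\<Union>t \<in> I. SCode t ` vocab (K t))" by auto
  then show ?thesis unfolding symbols_def using countable by auto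
qed

lemma ok_fm_sentence:
  assumes "\<And>t. t \<in> I \<Longrightarrow> sentence (vocab (K t)) (\<phi> t)"
  shows "sentence voc (ok_fm \<phi>)"
proof -
  have code: "code y \<in> voc" if "y \<in> symbols" for y using that by (rule code_voc)
  note C = code symbolsI
  have h: "wf_fm voc (holder_fm t x)" "fv (holder_fm t x) = {x}" if "t \<in> I" for t x
    using that by (auto simp: holder_fm_def C)
  have a: "wf_fm voc (alive_fm y x)" "fv (alive_fm y x) = {x}" if "y \<in> symbols" "sym_arity y = 1" for y x
    using that by (auto simp: alive_fm_def C)
  have fn: "wf_fm voc (function_fm t s n)" "fv (function_fm t s n) \<subseteq> {0}"
    if t: "t \<in> I" and s: "s \<in> vocab (K t)" "s = Fun n c" for t s n c
  proof -
    show "wf_fm voc (function_fm t s n)"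
      using t s by (auto simp: function_fm_def Let_def C intro!: wf_Conjs)
    have 1: "fv (Conjs {1..n} (\<lambda>x. at SMem [0, x])) \<subseteq> {0..n}" by (rule fv_Conjs) auto
    show "fv (function_fm t s n) \<subseteq> {0}"
      unfolding function_fm_def Let_def using 1 by (auto simp: subset_iff)
  qed
  have s: "wf_fm voc (struct_fm t)" "fv (struct_fm t) \<subseteq> {0}" if t: "t \<in> I" for t
  proof -
    show "wf_fm voc (struct_fm t)"
      using fn(1)[OF t] by (auto simp: struct_fm_def C intro!: wf_Conjs split: symb.split)
    have "fv (Conjs (vocab (K t)) (\<lambda>s. case s of Rel n c \<Rightarrow> Neg Falsum | Fun n c \<Rightarrow> function_fm t s n)) \<subseteq> {0}"
    proof (rule fv_Conjs)
      fix s assume "s \<in> vocab (K t)"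
      then show "fv (case s of Rel n c \<Rightarrow> Neg Falsum | Fun n c \<Rightarrow> function_fm t s n) \<subseteq> {0}"
        using fn(2)[OF t, of s] by (cases s) auto
    qed
    then show "fv (struct_fm t) \<subseteq> {0}" by (auto simp: struct_fm_def)
  qed
  have k: "wf_fm voc (token_fm i)" "fv (token_fm i) \<subseteq> {0}" if "i \<in> I" for i
    using that by (auto simp: token_fm_def C h)
  have lt: "wf_fm voc (lock_tuple_fm y)" "fv (lock_tuple_fm y) \<subseteq> {0}" if y: "y \<in> symbols" for y
  proof -
    show "wf_fm voc (lock_tuple_fm y)"
      using y by (auto simp: lock_tuple_fm_def C intro!: wf_Conjs)
    have 1: "fv (Conjs {1..sym_arity y} (\<lambda>x. Imp (Neg (Eq (Var x) (Var 0))) (at SMem [0, x]))) \<subseteq> {0..sym_arity y}"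
      by (rule fv_Conjs) auto
    have 2: "fv (Conjs {2..sym_arity y} (\<lambda>x. at SMem [0, x])) \<subseteq> {0..sym_arity y}" by (rule fv_Conjs) auto
    have "1 \<le> sym_arity y" by (cases y) simp_all
    then have 3: "set [1..<Suc (sym_arity y)] \<subseteq> {0..sym_arity y}" "fv (Eq (Var 1) (Var 0)) \<subseteq> {0..sym_arity y}"
      by (simp_all del: upt_Suc) auto
    have 4: "{0..sym_arity y} - {1..sym_arity y} \<subseteq> {0}" by auto
    show "fv (lock_tuple_fm y) \<subseteq> {0}"
      unfolding lock_tuple_fm_def fv_Alls fv_connectives at_simps(2)
      by (rule subset_trans[OF Diff_mono[OF _ subset_refl] 4])
        (use 1 2 3 in \<open>simp only: fv_And fv_connectives if_distrib[of fv] Un_subset_iff empty_subsetI split: if_split, blast\<close>)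
  qed
  have l: "wf_fm voc lock_fm" "fv lock_fm \<subseteq> {0}"
  proof -
    show "wf_fm voc lock_fm" by (auto simp: lock_fm_def C h b lt intro!: wf_Conjs)
    have "fv (Conjs symbols lock_tuple_fm) \<subseteq> {0}" by (rule fv_Conjs) (rule lt)
    then show "fv lock_fm \<subseteq> {0}" by (auto simp: lock_fm_def h b)
  qed
  have r: "wf_fm voc (relativize t (\<phi> t))" "fv (relativize t (\<phi> t)) \<subseteq> {0}" if "t \<in> I" for t
    using assms[OF that] relativize_wf[OF that] relativize_fv[OF that, of "\<phi> t"] by (auto simp: sentence_def)
  have "wf_fm voc (ok_fm \<phi>)"
    by (auto simp: ok_fm_def C h a s k l r intro!: wf_Conjs)
  moreover have "fv (ok_fm \<phi>) \<subseteq> {}"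
  proof -
    have 1: "fv (Conjs I (\<lambda>t. All 0 (Imp (holder_fm t 0) (And (struct_fm t) (relativize t (\<phi> t)))))) \<subseteq> {}"
      by (rule fv_Conjs) (use h s r in auto)
    have 2: "fv (Conjs I (\<lambda>t. Conjs (I - {t}) (\<lambda>t'. All 0 (Imp (holder_fm t 0) (Neg (holder_fm t' 0)))))) \<subseteq> {}"
      by (intro fv_Conjs) (use h in auto)
    have 3: "fv (Conjs I (\<lambda>i. Conjs I (\<lambda>j. All 0 (All 1 (Imp (alive_fm (STok i) 0) (Imp (alive_fm (STok j) 1)
       (if i = j then Eq (Var 0) (Var 1) else Falsum))))))) \<subseteq> {}"
      by (intro fv_Conjs) (use a[OF symbolsI(10)] in auto)
    have 4: "fv (Conjs I (\<lambda>i. All 0 (Imp (alive_fm (STok i) 0) (token_fm i)))) \<subseteq> {}"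
      by (intro fv_Conjs) (use a[OF symbolsI(10)] k in auto)
    show ?thesis
      unfolding ok_fm_def fv_And fv_connectives using 1 2 3 4 l a[OF symbolsI(1)] by auto
  qed
  ultimately show ?thesis by (simp add: sentence_def)
qed

context
  fixes M
  assumes M: "is_struct voc M"
begin

section \<open>Correctness of the sentence\<close>

lemma sat_holder_fm: "t \<in> I \<Longrightarrow> sat M (holder_fm t x) e \<longleftrightarrow> holder M t (e x)"
  by (simp add: holder_fm_def holder_def symbolsI)

lemma sat_alive_fm: "y \<in> symbols \<Longrightarrow> sat M (alive_fm y x) e \<longleftrightarrow> [e x] \<in> rel M y \<and> \<not> dead M (e x)"
  using rel_carrier(2)[OF M] by (auto simp: alive_fm_def dead_def symbolsI)

lemma sat_token_fm:
  assumes "i \<in> I"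
  shows "sat M (token_fm i) e \<longleftrightarrow> token_ok M i (e 0)"
proof -
  note C = rel_carrier[OF M]
  have "sat M (token_fm i) e \<longleftrightarrow>
     (\<forall>x \<in> carrier M. Bel M x (e 0) \<longrightarrow> holder M i x) \<and>
     (\<forall>x \<in> carrier M. \<forall>a \<in> carrier M. \<forall>p \<in> carrier M. \<forall>p' \<in> carrier M.
        Bel M x (e 0) \<longrightarrow> Mem M x a \<longrightarrow> Pick M x a p \<longrightarrow> Pick M x a p' \<longrightarrow> p = p') \<and>
     (\<forall>p \<in> carrier M. \<exists>x \<in> carrier M. \<exists>a \<in> carrier M. Bel M x (e 0) \<and> Mem M x a \<and> Pick M x a p) \<and>
     (\<forall>x \<in> carrier M. \<forall>f \<in> carrier M. Bel M x (e 0) \<longrightarrow> Bel M f (e 0) \<longrightarrow>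
        \<not> (\<exists>a \<in> carrier M. Mem M x a \<and> Pick M x a f) \<longrightarrow> (\<exists>a \<in> carrier M. Mem M f a \<and> Pick M f a x))"
    using assms by (simp add: token_fm_def sat_holder_fm symbolsI)
  also have "\<dots> \<longleftrightarrow> token_ok M i (e 0)"
    unfolding token_ok_def
  proof (intro arg_cong2[of _ _ _ _ "(\<and>)"])
    show "(\<forall>x \<in> carrier M. Bel M x (e 0) \<longrightarrow> holder M i x) \<longleftrightarrow> (\<forall>x. Bel M x (e 0) \<longrightarrow> holder M i x)"
      using C(2) by blast
    show "(\<forall>x \<in> carrier M. \<forall>a \<in> carrier M. \<forall>p \<in> carrier M. \<forall>p' \<in> carrier M.
        Bel M x (e 0) \<longrightarrow> Mem M x a \<longrightarrow> Pick M x a p \<longrightarrow> Pick M x a p' \<longrightarrow> p = p') \<longleftrightarrow>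
      (\<forall>x a p p'. Bel M x (e 0) \<longrightarrow> Mem M x a \<longrightarrow> Pick M x a p \<longrightarrow> Pick M x a p' \<longrightarrow> p = p')"
      using C(3) by blast
    show "(\<forall>p \<in> carrier M. \<exists>x \<in> carrier M. \<exists>a \<in> carrier M. Bel M x (e 0) \<and> Mem M x a \<and> Pick M x a p) \<longleftrightarrow>
      (\<forall>p \<in> carrier M. \<exists>x a. Bel M x (e 0) \<and> Mem M x a \<and> Pick M x a p)"
      using C(2) by blast
    show "(\<forall>x \<in> carrier M. \<forall>f \<in> carrier M. Bel M x (e 0) \<longrightarrow> Bel M f (e 0) \<longrightarrow>
        \<not> (\<exists>a \<in> carrier M. Mem M x a \<and> Pick M x a f) \<longrightarrow> (\<exists>a \<in> carrier M. Mem M f a \<and> Pick M f a x)) \<longleftrightarrow>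
      (\<forall>x f. Bel M x (e 0) \<longrightarrow> Bel M f (e 0) \<longrightarrow>
        (\<exists>a. Mem M x a \<and> Pick M x a f) \<or> (\<exists>a. Mem M f a \<and> Pick M f a x))"
      using C(2) by meson
  qed
  finally show ?thesis .
qed

lemma sat_lock_tuple_fm:
  assumes y: "y \<in> symbols"
  shows "sat M (lock_tuple_fm y) e \<longleftrightarrow>
    (\<forall>xs. xs \<in> rel M y \<longrightarrow> set xs \<subseteq> insert (e 0) {a. Mem M (e 0) a} \<longrightarrow> lock_tuple M (e 0) y xs)"
proof -
  define h where "h = e 0"
  define Y :: "('i, 'u) sym set" where "Y = {SLock, STyp b, SMem} \<union> range (SCode b)"
  have n: "1 \<le> sym_arity y" by (cases y) auto
  define Q where "Q xs \<longleftrightarrow> (xs \<in> rel M y \<longrightarrow> (\<forall>x \<in> set xs. x \<noteq> h \<longrightarrow> Mem M h x) \<longrightarrow>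
      y \<in> Y \<and> hd xs = h \<and> (\<forall>x \<in> set (tl xs). Mem M h x))" for xs
  have "sat M (lock_tuple_fm y) e \<longleftrightarrow> (\<forall>xs. length xs = sym_arity y \<longrightarrow> set xs \<subseteq> carrier M \<longrightarrow> Q xs)"
    unfolding lock_tuple_fm_def
  proof (rule sat_Alls[where h = h])
    fix e :: "nat \<Rightarrow> 'u" assume e: "e 0 = h"
    have u: "set [1..<Suc (sym_arity y)] = {1..sym_arity y}" "hd (map e [1..<Suc (sym_arity y)]) = e 1"
      "set (tl (map e [1..<Suc (sym_arity y)])) = e ` {2..sym_arity y}"
    proof -
      show "set [1..<Suc (sym_arity y)] = {1..sym_arity y}" by (auto simp del: upt_Suc)
      have *: "[1..<Suc (sym_arity y)] = 1 # [2..<Suc (sym_arity y)]"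
        using n by (simp add: upt_conv_Cons numeral_2_eq_2 del: upt_Suc)
      show "hd (map e [1..<Suc (sym_arity y)]) = e 1" unfolding * by simp
      have "{2..<Suc (sym_arity y)} = {2..sym_arity y}" by auto
      then show "set (tl (map e [1..<Suc (sym_arity y)])) = e ` {2..sym_arity y}"
        unfolding * by (simp del: upt_Suc)
    qed
    show "sat M (Imp (at y [1..<Suc (sym_arity y)])
     (Imp (Conjs {1..sym_arity y} (\<lambda>x. Imp (Neg (Eq (Var x) (Var 0))) (at SMem [0, x])))
       (if y \<in> {SLock, STyp b, SMem} \<union> range (SCode b)
        then And (Eq (Var 1) (Var 0)) (Conjs {2..sym_arity y} (\<lambda>x. at SMem [0, x])) else Falsum))) e \<longleftrightarrow>
      Q (map e [1..<Suc (sym_arity y)])"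
      unfolding Y_def[symmetric] Q_def u(2,3) set_map u(1)
      using y by (simp add: symbolsI e del: upt_Suc)
  qed (simp add: h_def)
  also have "\<dots> \<longleftrightarrow> (\<forall>xs. xs \<in> rel M y \<longrightarrow> set xs \<subseteq> insert h {a. Mem M h a} \<longrightarrow> lock_tuple M h y xs)"
  proof -
    have q: "Q xs \<longleftrightarrow> (set xs \<subseteq> insert h {a. Mem M h a} \<longrightarrow> lock_tuple M h y xs)" if xs: "xs \<in> rel M y" for xs
    proof -
      have "lock_tuple M h y xs \<longleftrightarrow> y \<in> Y \<and> hd xs = h \<and> (\<forall>x \<in> set (tl xs). Mem M h x)"
        using rel_tuple(1)[OF M xs] by (cases y) (auto simp: lock_tuple_def Y_def length_Suc_conv numeral_2_eq_2)
      then show ?thesis using xs unfolding Q_def by auto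
    qed
    have nq: "Q xs" if "xs \<notin> rel M y" for xs using that by (simp add: Q_def)
    show ?thesis
    proof (intro iffI allI impI)
      fix xs assume H: "\<forall>xs. length xs = sym_arity y \<longrightarrow> set xs \<subseteq> carrier M \<longrightarrow> Q xs" "xs \<in> rel M y"
        "set xs \<subseteq> insert h {a. Mem M h a}"
      then have "Q xs" using rel_tuple(1,2)[OF M H(2)] by simp
      then show "lock_tuple M h y xs" using q[OF H(2)] H(3) by simp
    next
      fix xs assume "\<forall>xs. xs \<in> rel M y \<longrightarrow> set xs \<subseteq> insert h {a. Mem M h a} \<longrightarrow> lock_tuple M h y xs"
      then show "Q xs" using q[of xs] nq[of xs] by (cases "xs \<in> rel M y") simp_all
    qed
  qed
  finally show ?thesis by (simp add: h_def)
qed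

lemma sat_lock_fm: "sat M lock_fm e \<longleftrightarrow> lock_ok M (e 0)"
proof -
  note C = rel_carrier[OF M]
  define l where "l = e 0"
  have sat: "sat M lock_fm e \<longleftrightarrow> holder M b l \<and>
     (\<forall>x \<in> carrier M. \<forall>d \<in> carrier M. Row M x l \<longrightarrow> Bel M d l \<longrightarrow> (\<exists>a \<in> carrier M. Mem M l a \<and> Col M x d a)) \<and>
     (\<forall>x \<in> carrier M. \<forall>x' \<in> carrier M. \<forall>d \<in> carrier M. \<forall>d' \<in> carrier M. \<forall>a \<in> carrier M.
        Row M x l \<longrightarrow> Row M x' l \<longrightarrow> Bel M d l \<longrightarrow> Bel M d' l \<longrightarrow> Mem M l a \<longrightarrow>
        Col M x d a \<longrightarrow> Col M x d' a \<longrightarrow> Col M x' d a \<longrightarrow> Col M x' d' a \<longrightarrow> d \<noteq> d' \<longrightarrow> loose \<and> x = x') \<and>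
     (\<forall>a \<in> carrier M. \<forall>d \<in> carrier M. Mem M l a \<longrightarrow> \<not> Kill M a d) \<and>
     (\<forall>y \<in> symbols. \<forall>xs. xs \<in> rel M y \<longrightarrow> set xs \<subseteq> insert l {a. Mem M l a} \<longrightarrow> lock_tuple M l y xs)"
    by (simp add: lock_fm_def sat_holder_fm symbolsI b countable_symbols sat_lock_tuple_fm l_def)
  show ?thesis
    unfolding sat lock_ok_def l_def[symmetric]
  proof (intro arg_cong2[of _ _ _ _ "(\<and>)"] refl)
    show "(\<forall>x \<in> carrier M. \<forall>d \<in> carrier M. Row M x l \<longrightarrow> Bel M d l \<longrightarrow> (\<exists>a \<in> carrier M. Mem M l a \<and> Col M x d a)) \<longleftrightarrow>
      (\<forall>x d. Row M x l \<longrightarrow> Bel M d l \<longrightarrow> (\<exists>a. Mem M l a \<and> Col M x d a))"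
      using C(2) by meson
    show "(\<forall>x \<in> carrier M. \<forall>x' \<in> carrier M. \<forall>d \<in> carrier M. \<forall>d' \<in> carrier M. \<forall>a \<in> carrier M.
        Row M x l \<longrightarrow> Row M x' l \<longrightarrow> Bel M d l \<longrightarrow> Bel M d' l \<longrightarrow> Mem M l a \<longrightarrow>
        Col M x d a \<longrightarrow> Col M x d' a \<longrightarrow> Col M x' d a \<longrightarrow> Col M x' d' a \<longrightarrow> d \<noteq> d' \<longrightarrow> loose \<and> x = x') \<longleftrightarrow>
      (\<forall>x x' d d' a. Row M x l \<longrightarrow> Row M x' l \<longrightarrow> Bel M d l \<longrightarrow> Bel M d' l \<longrightarrow> Mem M l a \<longrightarrow>
        Col M x d a \<longrightarrow> Col M x d' a \<longrightarrow> Col M x' d a \<longrightarrow> Col M x' d' a \<longrightarrow> d = d' \<or> loose \<and> x = x')"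
      (is "?L \<longleftrightarrow> ?R")
    proof
      assume H: ?L
      show ?R
      proof (intro allI impI)
        fix x x' d d' a
        assume R: "Row M x l" "Row M x' l" "Bel M d l" "Bel M d' l" "Mem M l a"
          "Col M x d a" "Col M x d' a" "Col M x' d a" "Col M x' d' a"
        have "x \<in> carrier M" "x' \<in> carrier M" "d \<in> carrier M" "d' \<in> carrier M" "a \<in> carrier M"
          using C(2)[OF R(1)] C(2)[OF R(2)] C(2)[OF R(3)] C(2)[OF R(4)] C(2)[OF R(5)] by auto
        then show "d = d' \<or> loose \<and> x = x'" using H[rule_format, of x x' d d' a] R by blast
      qed
    next
      assume H: ?R
      show ?L
      proof (intro ballI impI)
        fix x x' d d' a
        assume "Row M x l" "Row M x' l" "Bel M d l" "Bel M d' l" "Mem M l a"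
          "Col M x d a" "Col M x d' a" "Col M x' d a" "Col M x' d' a" "d \<noteq> d'"
        then show "loose \<and> x = x'" using H[rule_format, of x x' d d' a] by blast
      qed
    qed
    show "(\<forall>a \<in> carrier M. \<forall>d \<in> carrier M. Mem M l a \<longrightarrow> \<not> Kill M a d) \<longleftrightarrow> (\<forall>a d. Mem M l a \<longrightarrow> \<not> Kill M a d)"
      using C(2) by blast
    show "(\<forall>y \<in> symbols. \<forall>xs. xs \<in> rel M y \<longrightarrow> set xs \<subseteq> insert l {a. Mem M l a} \<longrightarrow> lock_tuple M l y xs) \<longleftrightarrow>
      (\<forall>y xs. xs \<in> rel M y \<longrightarrow> set xs \<subseteq> insert l {a. Mem M l a} \<longrightarrow> lock_tuple M l y xs)"
      using rel_tuple(3)[OF M] by blast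
  qed
qed

lemma sat_struct_fm:
  assumes t: "t \<in> I"
  shows "sat M (struct_fm t) e \<longleftrightarrow> is_struct (vocab (K t)) (part M t (e 0))"
proof -
  define A where "A = part M t (e 0)"
  have mem: "Mem M (e 0) a \<longleftrightarrow> a \<in> carrier A" for a by (simp add: A_def carrier_part)
  have AM: "carrier A \<subseteq> carrier M" unfolding A_def by (rule carrier_part_subset[OF M])
  have code: "e 0 # xs \<in> rel M (SCode t s) \<longleftrightarrow> xs \<in> interp A s" if "set xs \<subseteq> carrier A" for xs s
    using that by (auto simp: A_def part_def)
  have len: "length xs = symb_length s \<and> set xs \<subseteq> carrier A \<and> s \<in> vocab (K t)" if "xs \<in> interp A s" for xs s
  proof -
    have "set xs \<subseteq> carrier A" "e 0 # xs \<in> rel M (SCode t s)" using that by (auto simp: A_def part_def)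
    then show ?thesis using rel_tuple(1,3)[OF M, of "e 0 # xs" "SCode t s"] by (auto simp: symbols_def)
  qed
  have fn: "sat M (function_fm t s n) e \<longleftrightarrow> wf_interp (carrier A) s (interp A s)"
    if s: "s = Fun n c" "s \<in> vocab (K t)" for s n c
  proof -
    define Q where "Q xs \<longleftrightarrow> (set xs \<subseteq> carrier A \<longrightarrow> (\<exists>y \<in> carrier M. y \<in> carrier A \<and> xs @ [y] \<in> interp A s) \<and>
       (\<forall>y \<in> carrier M. \<forall>z \<in> carrier M. y \<in> carrier A \<and> xs @ [y] \<in> interp A s \<longrightarrow>
          z \<in> carrier A \<and> xs @ [z] \<in> interp A s \<longrightarrow> y = z))" for xs
    have "sat M (function_fm t s n) e \<longleftrightarrow> (\<forall>xs. length xs = n \<longrightarrow> set xs \<subseteq> carrier M \<longrightarrow> Q xs)"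
      unfolding function_fm_def Let_def
    proof (rule sat_Alls[where h = "e 0"])
      fix e' :: "nat \<Rightarrow> 'u" assume e': "e' 0 = e 0"
      let ?xs = "map e' [1..<Suc n]"
      let ?F = "\<lambda>k. And (at SMem [0, k]) (at (SCode t s) (0 # [1..<Suc n] @ [k]))"
      have u: "set [1..<Suc n] = {1..n}" by (auto simp del: upt_Suc)
      have F: "sat M (?F k) e'' \<longleftrightarrow> e'' k \<in> carrier A \<and> ?xs @ [e'' k] \<in> interp A s"
        if H: "set ?xs \<subseteq> carrier A" "\<And>j. j \<le> n \<Longrightarrow> e'' j = e' j" for e'' k
      proof -
        have m: "map e'' [1..<Suc n] = ?xs" using H(2) by auto
        have 0: "e'' 0 = e 0" using H(2) e' by simp
        have mm: "map e'' (0 # [1..<Suc n] @ [k]) = e 0 # ?xs @ [e'' k]" by (simp only: list.map map_append m 0)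
        have "sat M (?F k) e'' \<longleftrightarrow> map e'' [0, k] \<in> rel M SMem \<and> map e'' (0 # [1..<Suc n] @ [k]) \<in> rel M (SCode t s)"
          by (simp only: sat_connectives(2) at_simps(1)[OF symbolsI(3)] at_simps(1)[OF symbolsI(11)[OF t s(2)]])
        also have "\<dots> \<longleftrightarrow> e'' k \<in> carrier A \<and> e 0 # ?xs @ [e'' k] \<in> rel M (SCode t s)"
          unfolding mm using mem 0 by simp
        also have "\<dots> \<longleftrightarrow> e'' k \<in> carrier A \<and> ?xs @ [e'' k] \<in> interp A s"
        proof (cases "e'' k \<in> carrier A")
          case True
          then have "set (?xs @ [e'' k]) \<subseteq> carrier A" using H(1) by (simp only: set_append) simp
          then show ?thesis using code by blast
        qed simp
        finally show ?thesis .
      qed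
      have c: "sat M (Conjs {1..n} (\<lambda>x. at SMem [0, x])) e' \<longleftrightarrow> set ?xs \<subseteq> carrier A"
        unfolding set_map u using mem e' by (auto simp: symbolsI)
      show "sat M (Imp (Conjs {1..n} (\<lambda>x. at SMem [0, x])) (And (Ex (Suc n) (?F (Suc n)))
         (All (Suc n) (All (Suc (Suc n)) (Imp (?F (Suc n)) (Imp (?F (Suc (Suc n)))
           (Eq (Var (Suc n)) (Var (Suc (Suc n)))))))))) e' \<longleftrightarrow> Q ?xs"
      proof (cases "set ?xs \<subseteq> carrier A")
        case True
        have F1: "sat M (?F (Suc n)) (e'(Suc n := y)) \<longleftrightarrow> y \<in> carrier A \<and> ?xs @ [y] \<in> interp A s" for y
          using F[OF True, of "e'(Suc n := y)" "Suc n"] by simp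
        have F2: "sat M (?F (Suc n)) (e'(Suc n := y, Suc (Suc n) := z)) \<longleftrightarrow> y \<in> carrier A \<and> ?xs @ [y] \<in> interp A s" for y z
          using F[OF True, of "e'(Suc n := y, Suc (Suc n) := z)" "Suc n"] by simp
        have F3: "sat M (?F (Suc (Suc n))) (e'(Suc n := y, Suc (Suc n) := z)) \<longleftrightarrow> z \<in> carrier A \<and> ?xs @ [z] \<in> interp A s" for y z
          using F[OF True, of "e'(Suc n := y, Suc (Suc n) := z)" "Suc (Suc n)"] by simp
        have F4: "sat M (Eq (Var (Suc n)) (Var (Suc (Suc n)))) (e'(Suc n := y, Suc (Suc n) := z)) \<longleftrightarrow> y = z" for y z
          by simp
        show ?thesis
          unfolding sat_connectives(2-4) sat.simps(5) c F4 Q_def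
            F1[unfolded sat_connectives(2)] F2[unfolded sat_connectives(2)] F3[unfolded sat_connectives(2)] by blast
      next
        case False
        then show ?thesis unfolding sat_connectives(3) c Q_def by blast
      qed
    qed simp
    also have "\<dots> \<longleftrightarrow> (\<forall>xs \<in> tuples n (carrier A). \<exists>!y. y \<in> carrier A \<and> xs @ [y] \<in> interp A s)"
    proof -
      have 1: "Q xs \<longleftrightarrow> (\<exists>!y. y \<in> carrier A \<and> xs @ [y] \<in> interp A s)" if "set xs \<subseteq> carrier A" for xs
        using that AM unfolding Q_def by blast
      have 2: "Q xs" if "\<not> set xs \<subseteq> carrier A" for xs using that by (simp add: Q_def)
      show ?thesis
      proof (intro iffI ballI allI impI)
        fix xs :: "'u list" assume "\<forall>xs. length xs = n \<longrightarrow> set xs \<subseteq> carrier M \<longrightarrow> Q xs" "xs \<in> tuples n (carrier A)"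
        then show "\<exists>!y. y \<in> carrier A \<and> xs @ [y] \<in> interp A s" using 1[of xs] AM by (auto simp: tuples_def)
      next
        fix xs :: "'u list" assume "\<forall>xs \<in> tuples n (carrier A). \<exists>!y. y \<in> carrier A \<and> xs @ [y] \<in> interp A s" "length xs = n"
        then show "Q xs" using 1[of xs] 2[of xs] by (cases "set xs \<subseteq> carrier A") (simp_all add: tuples_def)
      qed
    qed
    also have "\<dots> \<longleftrightarrow> wf_interp (carrier A) s (interp A s)"
    proof -
      have "interp A s \<subseteq> tuples (Suc n) (carrier A)" using len[of _ s] s(1) by (auto simp: tuples_def)
      then show ?thesis by (simp add: s(1))
    qed
    finally show ?thesis .
  qed
  have "sat M (struct_fm t) e \<longleftrightarrow> (\<exists>a \<in> carrier M. a \<in> carrier A) \<and>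
      (\<forall>s \<in> vocab (K t). sat M (case s of Rel n c \<Rightarrow> Neg Falsum | Fun n c \<Rightarrow> function_fm t s n) e)"
    by (simp add: struct_fm_def symbolsI countable(2)[OF t] mem)
  also have "\<dots> \<longleftrightarrow> carrier A \<noteq> {} \<and> (\<forall>s \<in> vocab (K t). wf_interp (carrier A) s (interp A s))"
  proof (intro arg_cong2[of _ _ _ _ "(\<and>)"] ball_cong refl)
    show "(\<exists>a \<in> carrier M. a \<in> carrier A) \<longleftrightarrow> carrier A \<noteq> {}" using AM by auto
    show "sat M (case s of Rel n c \<Rightarrow> Neg Falsum | Fun n c \<Rightarrow> function_fm t s n) e \<longleftrightarrow> wf_interp (carrier A) s (interp A s)"
      if s: "s \<in> vocab (K t)" for s
    proof (cases s)
      case (Rel n c)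
      have "interp A s \<subseteq> tuples n (carrier A)" using len[of _ s] Rel by (auto simp: tuples_def)
      then show ?thesis by (simp add: Rel)
    next
      case (Fun n c)
      then show ?thesis using fn[OF Fun s] by simp
    qed
  qed
  also have "\<dots> \<longleftrightarrow> is_struct (vocab (K t)) A"
  proof -
    have "small (carrier A)" using small_subset[OF AM] M by (simp add: is_struct_def)
    moreover have "interp A s = {}" if "s \<notin> vocab (K t)" for s using len[of _ s] that by blast
    ultimately show ?thesis by (auto simp: is_struct_def)
  qed
  finally show ?thesis by (simp add: A_def)
qed

lemma sat_ok_fm:
  assumes \<phi>: "\<And>t. t \<in> I \<Longrightarrow> sentence (vocab (K t)) (\<phi> t)" "\<And>t. t \<in> I \<Longrightarrow> models (K t) = Mod (vocab (K t)) (\<phi> t)"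
  shows "sat M (ok_fm \<phi>) e \<longleftrightarrow> ok M"
proof -
  note C = rel_carrier[OF M]
  have tok: "[x] \<in> rel M (STok i) \<and> \<not> dead M x \<longleftrightarrow> token M i x" for i x by (simp add: token_def)
  have lk: "[x] \<in> rel M SLock \<and> \<not> dead M x \<longleftrightarrow> lock M x" for x by (simp add: lock_def)
  have model: "sat M (And (struct_fm t) (relativize t (\<phi> t))) e \<longleftrightarrow> part M t (e 0) \<in> models (K t)"
    if t: "t \<in> I" for t e
  proof (cases "is_struct (vocab (K t)) (part M t (e 0))")
    case True
    note s = \<phi>(1)[OF t, unfolded sentence_def]
    have r1: "sat M (relativize t (\<phi> t)) e \<longleftrightarrow> sat (part M t (e 0)) (\<phi> t) (e \<circ> Suc)"
      by (rule sat_relativize[OF t M refl True]) (use s in auto)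
    \<comment> \<open>\<open>Mod\<close> asks for all assignments into the part, while the
      relativized formula tests only the one given by \<open>e\<close>. For a sentence the
      assignment does not matter.\<close>
    have r2: "sat (part M t (e 0)) (\<phi> t) (e \<circ> Suc) \<longleftrightarrow> sat (part M t (e 0)) (\<phi> t) e'" for e'
      by (rule sat_cong) (use s in auto)
    obtain a where a: "a \<in> carrier (part M t (e 0))" using True by (auto simp: is_struct_def)
    then have ran: "range (\<lambda>_ :: nat. a) \<subseteq> carrier (part M t (e 0))" by auto
    have "sat M (relativize t (\<phi> t)) e \<longleftrightarrow>
        (\<forall>e'. range e' \<subseteq> carrier (part M t (e 0)) \<longrightarrow> sat (part M t (e 0)) (\<phi> t) e')"
    proof (intro iffI allI impI)
      fix e' :: "nat \<Rightarrow> 'u" assume "sat M (relativize t (\<phi> t)) e"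
      then show "sat (part M t (e 0)) (\<phi> t) e'" using r1 r2[of e'] by simp
    next
      assume "\<forall>e'. range e' \<subseteq> carrier (part M t (e 0)) \<longrightarrow> sat (part M t (e 0)) (\<phi> t) e'"
      then have "sat (part M t (e 0)) (\<phi> t) (\<lambda>_. a)" using ran by blast
      then show "sat M (relativize t (\<phi> t)) e" using r1 r2[of "\<lambda>_. a"] by simp
    qed
    then show ?thesis using True \<phi>(2)[OF t] by (simp add: sat_struct_fm[OF t] Mod_def)
  next
    case False
    then show ?thesis using \<phi>(2)[OF t] by (simp add: sat_struct_fm[OF t] Mod_def)
  qed
  have "sat M (ok_fm \<phi>) e \<longleftrightarrow>
     (\<forall>t \<in> I. \<forall>h \<in> carrier M. holder M t h \<longrightarrow> part M t h \<in> models (K t)) \<and>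
     (\<forall>t \<in> I. \<forall>t' \<in> I - {t}. \<forall>h \<in> carrier M. holder M t h \<longrightarrow> \<not> holder M t' h) \<and>
     (\<forall>x \<in> carrier M. \<forall>d \<in> carrier M. \<forall>d' \<in> carrier M. Kill M x d \<longrightarrow> Kill M x d' \<longrightarrow> d = d') \<and>
     (\<forall>i \<in> I. \<forall>j \<in> I. \<forall>c \<in> carrier M. \<forall>c' \<in> carrier M. token M i c \<longrightarrow> token M j c' \<longrightarrow> i = j \<and> c = c') \<and>
     (\<forall>l \<in> carrier M. \<forall>l' \<in> carrier M. lock M l \<longrightarrow> lock M l' \<longrightarrow> l = l') \<and>
     (\<forall>i \<in> I. \<forall>c \<in> carrier M. token M i c \<longrightarrow> token_ok M i c) \<and>
     (\<forall>l \<in> carrier M. lock M l \<longrightarrow> lock_ok M l)"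
    unfolding ok_fm_def sat_connectives(2)
  proof (intro arg_cong2[of _ _ _ _ "(\<and>)"])
    show "sat M (Conjs I (\<lambda>t. All 0 (Imp (holder_fm t 0) (And (struct_fm t) (relativize t (\<phi> t)))))) e \<longleftrightarrow>
      (\<forall>t \<in> I. \<forall>h \<in> carrier M. holder M t h \<longrightarrow> part M t h \<in> models (K t))"
      unfolding sat_Conjs[OF countable(1)] sat_connectives(3,4)
      by (intro ball_cong refl) (simp add: sat_holder_fm model del: sat_connectives(2))
    show "sat M (Conjs I (\<lambda>t. Conjs (I - {t}) (\<lambda>t'. All 0 (Imp (holder_fm t 0) (Neg (holder_fm t' 0)))))) e \<longleftrightarrow>
      (\<forall>t \<in> I. \<forall>t' \<in> I - {t}. \<forall>h \<in> carrier M. holder M t h \<longrightarrow> \<not> holder M t' h)"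
      using countable(1) by (simp add: sat_holder_fm)
    show "sat M (Conjs I (\<lambda>i. Conjs I (\<lambda>j. All 0 (All 1 (Imp (alive_fm (STok i) 0) (Imp (alive_fm (STok j) 1)
       (if i = j then Eq (Var 0) (Var 1) else Falsum))))))) e \<longleftrightarrow>
      (\<forall>i \<in> I. \<forall>j \<in> I. \<forall>c \<in> carrier M. \<forall>c' \<in> carrier M. token M i c \<longrightarrow> token M j c' \<longrightarrow> i = j \<and> c = c')"
      unfolding sat_Conjs[OF countable(1)]
      by (intro ball_cong refl) (auto simp: sat_alive_fm symbolsI tok)
    show "sat M (Conjs I (\<lambda>i. All 0 (Imp (alive_fm (STok i) 0) (token_fm i)))) e \<longleftrightarrow>
      (\<forall>i \<in> I. \<forall>c \<in> carrier M. token M i c \<longrightarrow> token_ok M i c)"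
      using countable(1) by (simp add: sat_alive_fm symbolsI tok sat_token_fm)
  qed (simp_all add: sat_alive_fm symbolsI lk sat_lock_fm)
  also have "\<dots> \<longleftrightarrow> (\<forall>t h. holder M t h \<longrightarrow> part M t h \<in> models (K t)) \<and>
      (\<forall>t t' h. holder M t h \<longrightarrow> holder M t' h \<longrightarrow> t = t') \<and>
      (\<forall>x d d'. Kill M x d \<longrightarrow> Kill M x d' \<longrightarrow> d = d') \<and>
      (\<forall>i c j c'. token M i c \<longrightarrow> token M j c' \<longrightarrow> i = j \<and> c = c') \<and>
      (\<forall>l l'. lock M l \<longrightarrow> lock M l' \<longrightarrow> l = l') \<and>
      (\<forall>i c. token M i c \<longrightarrow> token_ok M i c) \<and> (\<forall>l. lock M l \<longrightarrow> lock_ok M l)"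
  proof (intro arg_cong2[of _ _ _ _ "(\<and>)"])
    note H = holder_type[of M] holder_carrier[OF M] and T = token_type[of M] token_carrier[OF M]
    show "(\<forall>t \<in> I. \<forall>h \<in> carrier M. holder M t h \<longrightarrow> part M t h \<in> models (K t)) \<longleftrightarrow>
      (\<forall>t h. holder M t h \<longrightarrow> part M t h \<in> models (K t))" using H by blast
    show "(\<forall>t \<in> I. \<forall>t' \<in> I - {t}. \<forall>h \<in> carrier M. holder M t h \<longrightarrow> \<not> holder M t' h) \<longleftrightarrow>
      (\<forall>t t' h. holder M t h \<longrightarrow> holder M t' h \<longrightarrow> t = t')" using H by blast
    show "(\<forall>x \<in> carrier M. \<forall>d \<in> carrier M. \<forall>d' \<in> carrier M. Kill M x d \<longrightarrow> Kill M x d' \<longrightarrow> d = d') \<longleftrightarrow>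
      (\<forall>x d d'. Kill M x d \<longrightarrow> Kill M x d' \<longrightarrow> d = d')" using C(2) by meson
    show "(\<forall>i \<in> I. \<forall>j \<in> I. \<forall>c \<in> carrier M. \<forall>c' \<in> carrier M. token M i c \<longrightarrow> token M j c' \<longrightarrow> i = j \<and> c = c') \<longleftrightarrow>
      (\<forall>i c j c'. token M i c \<longrightarrow> token M j c' \<longrightarrow> i = j \<and> c = c')" using T by meson
    show "(\<forall>l \<in> carrier M. \<forall>l' \<in> carrier M. lock M l \<longrightarrow> lock M l' \<longrightarrow> l = l') \<longleftrightarrow>
      (\<forall>l l'. lock M l \<longrightarrow> lock M l' \<longrightarrow> l = l')" using lock_carrier[OF M] by blast
    show "(\<forall>i \<in> I. \<forall>c \<in> carrier M. token M i c \<longrightarrow> token_ok M i c) \<longleftrightarrow> (\<forall>i c. token M i c \<longrightarrow> token_ok M i c)"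
      using T by blast
    show "(\<forall>l \<in> carrier M. lock M l \<longrightarrow> lock_ok M l) \<longleftrightarrow> (\<forall>l. lock M l \<longrightarrow> lock_ok M l)"
      using lock_carrier[OF M] by blast
  qed
  also have "\<dots> \<longleftrightarrow> ok M" unfolding ok_def using M by (simp only: simp_thms)
  finally show ?thesis .
qed

end

lemma L_axiomatizable:
  assumes ax: "\<And>i. i \<in> I \<Longrightarrow> L\<omega>1\<omega>_axiomatizable (K i)"
  shows "L\<omega>1\<omega>_axiomatizable L"
proof -
  obtain \<phi> where \<phi>: "\<And>t. t \<in> I \<Longrightarrow> sentence (vocab (K t)) (\<phi> t)"
    "\<And>t. t \<in> I \<Longrightarrow> models (K t) = Mod (vocab (K t)) (\<phi> t)"
    using ax unfolding L\<omega>1\<omega>_axiomatizable_def by metis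
  have "countable voc" unfolding voc_def by (rule countable_image[OF countable_symbols])
  moreover have "models L = Mod voc (ok_fm \<phi>)"
  proof -
    have "ok M \<longleftrightarrow> is_struct voc M \<and> (\<forall>e. range e \<subseteq> carrier M \<longrightarrow> sat M (ok_fm \<phi>) e)" for M
    proof (cases "is_struct voc M")
      case True
      then obtain a where "a \<in> carrier M" by (auto simp: is_struct_def)
      then have "range (\<lambda>_ :: nat. a) \<subseteq> carrier M" by auto
      then show ?thesis using True sat_ok_fm[OF True \<phi>] by blast
    qed (simp add: ok_def)
    then show ?thesis by (simp add: Mod_def)
  qed
  ultimately show ?thesis
    using ok_fm_sentence[OF \<phi>(1)] unfolding L\<omega>1\<omega>_axiomatizable_def L_simps by blast
qed

end


end

section \<open>Classes of labelled sets\<close>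

text \<open>
  Every element carries exactly one label from the field of \<open>\<kappa>\<close>, and different elements carry different
  labels.  These classes replace the given ones when no axiomatization is asked for, as nothing is
  known about the size of the given vocabularies.
\<close>

definition labelled :: "'u rel \<Rightarrow> 'u eclass" where
  "labelled \<kappa> = (let V = Rel 1 ` Field \<kappa>;
       \<M> = {M. is_struct V M \<and> (\<forall>a \<in> carrier M. \<exists>!u. u \<in> Field \<kappa> \<and> [a] \<in> interp M (Rel 1 u)) \<and>
         (\<forall>u a b. [a] \<in> interp M (Rel 1 u) \<longrightarrow> [b] \<in> interp M (Rel 1 u) \<longrightarrow> a = b)}
     in \<lparr>vocab = V, models = \<M>, strong = (\<lambda>M N. M \<in> \<M> \<and> N \<in> \<M> \<and> substruct M N)\<rparr>)"

context
  fixes \<kappa> :: "'u rel"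
begin

lemma vocab_labelled [simp]: "vocab (labelled \<kappa>) = Rel 1 ` Field \<kappa>"
  by (simp add: labelled_def Let_def)

lemma models_labelled: "M \<in> models (labelled \<kappa>) \<longleftrightarrow>
    is_struct (Rel 1 ` Field \<kappa>) M \<and> (\<forall>a \<in> carrier M. \<exists>!u. u \<in> Field \<kappa> \<and> [a] \<in> interp M (Rel 1 u)) \<and>
    (\<forall>u a b. [a] \<in> interp M (Rel 1 u) \<longrightarrow> [b] \<in> interp M (Rel 1 u) \<longrightarrow> a = b)"
  by (simp add: labelled_def Let_def)

lemma strong_labelled: "strong (labelled \<kappa>) M N \<longleftrightarrow>
    M \<in> models (labelled \<kappa>) \<and> N \<in> models (labelled \<kappa>) \<and> substruct M N"
  by (simp add: labelled_def Let_def)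

definition label :: "'u struct \<Rightarrow> 'u \<Rightarrow> 'u" where
  "label M a = (THE u. u \<in> Field \<kappa> \<and> [a] \<in> interp M (Rel 1 u))"

lemma labelled_struct:
  assumes "is_struct (Rel 1 ` Field \<kappa>) M"
  shows "xs \<in> interp M s \<longleftrightarrow> (\<exists>u \<in> Field \<kappa>. \<exists>a \<in> carrier M. s = Rel 1 u \<and> xs = [a] \<and> [a] \<in> interp M (Rel 1 u))"
proof
  assume xs: "xs \<in> interp M s"
  then have "s \<in> Rel 1 ` Field \<kappa>" using assms unfolding is_struct_def by blast
  then obtain u where u: "u \<in> Field \<kappa>" "s = Rel 1 u" by blast
  then have "interp M s \<subseteq> tuples 1 (carrier M)" using assms by (auto simp: is_struct_def)
  then have "length xs = 1" "set xs \<subseteq> carrier M" using xs by (auto simp: tuples_def)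
  then show "\<exists>u \<in> Field \<kappa>. \<exists>a \<in> carrier M. s = Rel 1 u \<and> xs = [a] \<and> [a] \<in> interp M (Rel 1 u)"
    using u xs by (cases xs) auto
qed auto

lemma labelled_singleton: "is_struct (Rel 1 ` Field \<kappa>) M \<Longrightarrow> xs \<in> interp M s \<Longrightarrow> \<exists>a \<in> carrier M. xs = [a]"
  using labelled_struct by blast

lemma label:
  assumes M: "M \<in> models (labelled \<kappa>)"
  shows "a \<in> carrier M \<Longrightarrow> label M a \<in> Field \<kappa>"
    and "a \<in> carrier M \<Longrightarrow> [a] \<in> interp M (Rel 1 u) \<longleftrightarrow> u = label M a"
    and "inj_on (label M) (carrier M)"
proof -
  note m = M[unfolded models_labelled]
  have *: "label M a \<in> Field \<kappa> \<and> [a] \<in> interp M (Rel 1 (label M a))" if "a \<in> carrier M" for a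
  proof -
    have "\<exists>!u. u \<in> Field \<kappa> \<and> [a] \<in> interp M (Rel 1 u)" using m that by blast
    then show ?thesis unfolding label_def by (rule theI')
  qed
  show "label M a \<in> Field \<kappa>" if "a \<in> carrier M" using *[OF that] by blast
  show "[a] \<in> interp M (Rel 1 u) \<longleftrightarrow> u = label M a" if a: "a \<in> carrier M"
  proof
    assume H: "[a] \<in> interp M (Rel 1 u)"
    then have "u \<in> Field \<kappa>" using labelled_struct[OF conjunct1[OF m], of "[a]" "Rel 1 u"] by auto
    then show "u = label M a" using m a H *[OF a] by blast
  qed (use *[OF a] in simp)
  show "inj_on (label M) (carrier M)"
  proof (rule inj_onI)
    fix x y assume "x \<in> carrier M" "y \<in> carrier M" "label M x = label M y"
    then have "[x] \<in> interp M (Rel 1 (label M x))" "[y] \<in> interp M (Rel 1 (label M x))" using * by metis+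
    then show "x = y" using m by blast
  qed
qed

lemma labelled_bound: "Card_order \<kappa> \<Longrightarrow> M \<in> models (labelled \<kappa>) \<Longrightarrow> |carrier M| \<le>o \<kappa>"
  using label(1,3)[of M] card_of_ordLeqI[of "label M" "carrier M" "Field \<kappa>"] card_of_Field_ordIso[of \<kappa>]
    ordLeq_ordIso_trans by blast

text \<open>The defining conditions are universal in the points, so every nonempty subset is a
  strong submodel. Hence the Loewenheim-Skolem property holds for every infinite cardinal.\<close>

lemma labelled_restrict:
  assumes M: "M \<in> models (labelled \<kappa>)" and Z: "Z \<subseteq> carrier M" "Z \<noteq> {}"
  shows "strong (labelled \<kappa>) (restrict_struct Z M) M" "carrier (restrict_struct Z M) = Z"
proof -
  note m = M[unfolded models_labelled]
  have sM: "is_struct (Rel 1 ` Field \<kappa>) M" using m by blast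
  have r: "[a] \<in> interp (restrict_struct Z M) s \<longleftrightarrow> a \<in> Z \<and> [a] \<in> interp M s" for a s
    by (auto simp: restrict_struct_def)
  show c: "carrier (restrict_struct Z M) = Z" by (simp add: restrict_struct_def)
  have "is_struct (Rel 1 ` Field \<kappa>) (restrict_struct Z M)"
    unfolding is_struct_def c
  proof (intro conjI ballI allI impI Z(2))
    show "small Z" using small_subset[OF Z(1)] sM by (simp add: is_struct_def)
    show "wf_interp Z s (interp (restrict_struct Z M) s)" if s: "s \<in> Rel 1 ` Field \<kappa>" for s
    proof -
      obtain u where u: "s = Rel 1 u" using s by blast
      have "interp M s \<subseteq> tuples 1 (carrier M)" using sM s u by (auto simp: is_struct_def)
      then show ?thesis unfolding u by (auto simp: restrict_struct_def tuples_def lists_eq_set)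
    qed
    show "interp (restrict_struct Z M) s = {}" if "s \<notin> Rel 1 ` Field \<kappa>" for s
      using sM that by (simp add: is_struct_def restrict_struct_def)
  qed
  then have "restrict_struct Z M \<in> models (labelled \<kappa>)"
    unfolding models_labelled c r using m Z(1) by blast
  then show "strong (labelled \<kappa>) (restrict_struct Z M) M"
    using M substruct_restrict[OF Z(1)] by (simp add: strong_labelled)
qed

lemma labelled_LS:
  assumes "Cinfinite \<nu>"
  shows "has_LS_property (labelled \<kappa>) \<nu>"
  unfolding has_LS_property_def
proof (intro ballI allI impI)
  fix N X assume N: "N \<in> models (labelled \<kappa>)" "X \<subseteq> carrier N"
  obtain a where a: "a \<in> carrier N" using N(1) by (auto simp: models_labelled is_struct_def)
  have inf: "Cinfinite ( |X| +c \<nu>)" using Cinfinite_csum assms by metis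
  have "|insert a X| \<le>o |X| +c \<nu>" by (rule card_of_insert_le[OF inf ordLeq_csum1]) simp
  then show "\<exists>M. strong (labelled \<kappa>) M N \<and> X \<subseteq> carrier M \<and> |carrier M| \<le>o |X| +c \<nu>"
    using labelled_restrict[OF N(1), of "insert a X"] a N(2)
    by (intro exI[of _ "restrict_struct (insert a X) N"]) auto
qed

lemma labelled_iso:
  assumes M: "M \<in> models (labelled \<kappa>)" and f: "iso f M N"
  shows "N \<in> models (labelled \<kappa>)"
proof -
  note m = M[unfolded models_labelled]
  have sM: "is_struct (Rel 1 ` Field \<kappa>) M" using m by blast
  have b: "carrier N = f ` carrier M" "inj_on f (carrier M)" using f by (auto simp: iso_def bij_betw_def)
  have i: "[y] \<in> interp N s \<longleftrightarrow> (\<exists>x \<in> carrier M. y = f x \<and> [x] \<in> interp M s)" for y s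
  proof
    assume "[y] \<in> interp N s"
    then obtain xs where xs: "xs \<in> interp M s" "[y] = map f xs" using f by (auto simp: iso_def)
    then show "\<exists>x \<in> carrier M. y = f x \<and> [x] \<in> interp M s" using labelled_singleton[OF sM xs(1)] by auto
  next
    assume "\<exists>x \<in> carrier M. y = f x \<and> [x] \<in> interp M s"
    then obtain x where x: "y = f x" "[x] \<in> interp M s" by blast
    then have "map f [x] \<in> interp N s" using f unfolding iso_def by blast
    then show "[y] \<in> interp N s" using x(1) by simp
  qed
  have i': "[f x] \<in> interp N s \<longleftrightarrow> [x] \<in> interp M s" if "x \<in> carrier M" for x s
    unfolding i using inj_onD[OF b(2)] that by blast
  have sN: "is_struct (Rel 1 ` Field \<kappa>) N"
    unfolding is_struct_def
  proof (intro conjI ballI allI impI)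
    show "carrier N \<noteq> {}" "small (carrier N)" using sM small_image unfolding b(1) by (auto simp: is_struct_def)
    show "wf_interp (carrier N) s (interp N s)" if s: "s \<in> Rel 1 ` Field \<kappa>" for s
    proof -
      obtain u where u: "s = Rel 1 u" using s by blast
      have "interp N s \<subseteq> tuples 1 (carrier N)"
      proof
        fix ys assume "ys \<in> interp N s"
        then obtain xs where xs: "xs \<in> interp M s" "ys = map f xs" using f by (auto simp: iso_def)
        then show "ys \<in> tuples 1 (carrier N)"
          using labelled_singleton[OF sM xs(1)] by (auto simp: tuples_def b(1))
      qed
      then show ?thesis by (simp add: u)
    qed
    show "interp N s = {}" if "s \<notin> Rel 1 ` Field \<kappa>" for s
      using sM f that by (simp add: is_struct_def iso_def)
  qed
  moreover have "\<forall>a \<in> carrier N. \<exists>!u. u \<in> Field \<kappa> \<and> [a] \<in> interp N (Rel 1 u)"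
    unfolding b(1) using m i' by simp
  moreover have "\<forall>u a b. [a] \<in> interp N (Rel 1 u) \<longrightarrow> [b] \<in> interp N (Rel 1 u) \<longrightarrow> a = b"
    unfolding i using m by blast
  ultimately show ?thesis by (simp add: models_labelled)
qed

text \<open>Here every label is carried by itself. This model is universal: \<open>label M\<close>
  embeds any labelled set \<open>M\<close> into it, which gives joint embedding for all pairs and
  attains the cardinality \<kappa>.\<close>

definition full_labelled :: "'u struct" where
  "full_labelled = \<lparr>carrier = Field \<kappa>,
     interp = (\<lambda>s. case s of Rel n u \<Rightarrow> if n = 1 \<and> u \<in> Field \<kappa> then {[u]} else {} | Fun _ _ \<Rightarrow> {})\<rparr>"

lemma full_labelled:
  assumes "infinite_cardinal \<kappa>"
  shows "full_labelled \<in> models (labelled \<kappa>)" "|carrier full_labelled| =o \<kappa>"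
    "M \<in> models (labelled \<kappa>) \<Longrightarrow> \<exists>f. embedding (labelled \<kappa>) f M full_labelled"
proof -
  note c = Cinfinite_infinite_cardinal[OF assms]
  show s: "|carrier full_labelled| =o \<kappa>" using c by (simp add: full_labelled_def card_of_Field_ordIso)
  have i: "[a] \<in> interp full_labelled (Rel 1 u) \<longleftrightarrow> a = u \<and> u \<in> Field \<kappa>" for a u
    by (auto simp: full_labelled_def)
  have "Field \<kappa> \<noteq> {}" using c by (auto simp: cinfinite_def)
  moreover have "small (Field \<kappa>)"
    unfolding small_def
    using ordIso_ordLess_trans[OF card_of_Field_ordIso infinite_cardinal_small[OF assms]] c by blast
  ultimately have st: "is_struct (Rel 1 ` Field \<kappa>) full_labelled"
    by (auto simp: is_struct_def full_labelled_def tuples_def split: symb.split)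
  then show f: "full_labelled \<in> models (labelled \<kappa>)"
    unfolding models_labelled i by (auto simp: full_labelled_def)
  show "\<exists>f. embedding (labelled \<kappa>) f M full_labelled" if M: "M \<in> models (labelled \<kappa>)"
  proof -
    have sM: "is_struct (Rel 1 ` Field \<kappa>) M" using M models_labelled by blast
    let ?N = "image_struct (label M) M"
    have iso: "iso (label M) M ?N" by (rule iso_image_struct[OF label(3)[OF M]])
    have N: "?N \<in> models (labelled \<kappa>)" by (rule labelled_iso[OF M iso])
    have C: "carrier ?N = label M ` carrier M" by (simp add: image_struct_def)
    then have sub: "carrier ?N \<subseteq> Field \<kappa>" using label(1)[OF M] by auto
    have "interp ?N s = interp full_labelled s \<inter> lists (carrier ?N)" for s
    proof (cases "s \<in> Rel 1 ` Field \<kappa>")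
      case True
      then obtain u where u: "u \<in> Field \<kappa>" "s = Rel 1 u" by blast
      have "interp M s = (\<lambda>a. [a]) ` {a \<in> carrier M. u = label M a}"
      proof (intro set_eqI)
        show "xs \<in> interp M s \<longleftrightarrow> xs \<in> (\<lambda>a. [a]) ` {a \<in> carrier M. u = label M a}" for xs
          unfolding labelled_struct[OF sM, of xs s] using label(2)[OF M] u by auto
      qed
      then have "interp ?N s = (\<lambda>a. [label M a]) ` {a \<in> carrier M. u = label M a}"
        by (simp add: image_struct_def image_image)
      then have "xs \<in> interp ?N s \<longleftrightarrow> (\<exists>a \<in> carrier M. xs = [label M a] \<and> u = label M a)" for xs by blast
      moreover have "interp full_labelled s = {[u]}" using u by (simp add: full_labelled_def)
      ultimately show ?thesis unfolding C by fastforce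
    next
      case False
      then show ?thesis using st N unfolding models_labelled by (auto simp: is_struct_def)
    qed
    then have "substruct ?N full_labelled" using sub by (simp add: substruct_def full_labelled_def)
    then show ?thesis using iso N f unfolding embedding_def strong_labelled by blast
  qed
qed

lemma labelled_chain:
  assumes r: "Well_order r" "Field r \<noteq> {}"
    and chain: "\<And>i j. (i, j) \<in> r \<Longrightarrow> strong (labelled \<kappa>) (Mi i) (Mi j)" and sm: "small (\<Union>i \<in> Field r. carrier (Mi i))"
  shows "union_struct (Field r) Mi \<in> models (labelled \<kappa>)"
    and "i \<in> Field r \<Longrightarrow> substruct (Mi i) (union_struct (Field r) Mi)"
proof -
  let ?U = "union_struct (Field r) Mi"
  have rr: "(i, i) \<in> r" if "i \<in> Field r" for i
    using r(1) that unfolding order_on_defs refl_on_def by blast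
  have M: "Mi i \<in> models (labelled \<kappa>)" if "i \<in> Field r" for i
    using chain[OF rr[OF that]] by (simp add: strong_labelled)
  note m = M[unfolded models_labelled]
  have tot: "(i, j) \<in> r \<or> (j, i) \<in> r" if "i \<in> Field r" "j \<in> Field r" for i j
    using r(1) rr[OF that(1)] that unfolding order_on_defs total_on_def by (cases "i = j") auto
  have sub: "substruct (Mi i) (Mi j) \<or> substruct (Mi j) (Mi i)" if "i \<in> Field r" "j \<in> Field r" for i j
    using tot[OF that] chain[of i j] chain[of j i] unfolding strong_labelled by blast
  have U: "[a] \<in> interp ?U s \<longleftrightarrow> (\<exists>i \<in> Field r. [a] \<in> interp (Mi i) s)" for a s by (simp add: union_struct_def)
  have C: "a \<in> carrier ?U \<longleftrightarrow> (\<exists>i \<in> Field r. a \<in> carrier (Mi i))" for a by (simp add: union_struct_def)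
  have old: "[a] \<in> interp ?U s \<longleftrightarrow> [a] \<in> interp (Mi i) s" if a: "a \<in> carrier (Mi i)" and i: "i \<in> Field r" for a s i
  proof
    assume "[a] \<in> interp ?U s"
    then obtain j where j: "j \<in> Field r" "[a] \<in> interp (Mi j) s" unfolding U by blast
    have "a \<in> carrier (Mi j)"
      using labelled_singleton[OF conjunct1[OF m[OF j(1)]] j(2)] by auto
    then show "[a] \<in> interp (Mi i) s" using sub[OF i j(1)] j(2) a by (auto simp: substruct_def)
  qed (use i U in blast)
  have st: "is_struct (Rel 1 ` Field \<kappa>) ?U"
    unfolding is_struct_def
  proof (intro conjI ballI allI impI)
    obtain i where i: "i \<in> Field r" using r(2) by blast
    then have "carrier (Mi i) \<noteq> {}" using m[OF i] unfolding is_struct_def by blast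
    then show "carrier ?U \<noteq> {}" using i by (auto simp: union_struct_def)
    show "small (carrier ?U)" using sm by (simp add: union_struct_def)
    show "wf_interp (carrier ?U) s (interp ?U s)" if s: "s \<in> Rel 1 ` Field \<kappa>" for s
    proof -
      obtain u where u: "s = Rel 1 u" using s by blast
      have "interp (Mi i) s \<subseteq> tuples 1 (carrier ?U)" if i: "i \<in> Field r" for i
      proof -
        have "wf_interp (carrier (Mi i)) s (interp (Mi i) s)" using m[OF i] s unfolding is_struct_def by blast
        then have "interp (Mi i) s \<subseteq> tuples 1 (carrier (Mi i))" by (simp add: u)
        also have "\<dots> \<subseteq> tuples 1 (carrier ?U)" using i by (auto simp: tuples_def union_struct_def)
        finally show ?thesis .
      qed
      then have "interp ?U s \<subseteq> tuples 1 (carrier ?U)" by (auto simp: union_struct_def)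
      then show ?thesis by (simp add: u)
    qed
    show "interp ?U s = {}" if s: "s \<notin> Rel 1 ` Field \<kappa>" for s
    proof -
      have "interp (Mi i) s = {}" if "i \<in> Field r" for i using m[OF that] s unfolding is_struct_def by blast
      then show ?thesis by (simp add: union_struct_def)
    qed
  qed
  moreover have "\<exists>!u. u \<in> Field \<kappa> \<and> [a] \<in> interp ?U (Rel 1 u)" if "a \<in> carrier ?U" for a
  proof -
    obtain i where i: "i \<in> Field r" "a \<in> carrier (Mi i)" using \<open>a \<in> carrier ?U\<close> C by blast
    show ?thesis unfolding old[OF i(2,1)] using m[OF i(1)] i(2) by blast
  qed
  moreover have "a = b" if H: "[a] \<in> interp ?U (Rel 1 u)" "[b] \<in> interp ?U (Rel 1 u)" for u a b
  proof -
    have mem: "x \<in> carrier (Mi i)" if "[x] \<in> interp (Mi i) s" "i \<in> Field r" for x i s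
      using labelled_singleton[OF conjunct1[OF m[OF that(2)]] that(1)] by auto
    obtain i j where ij: "i \<in> Field r" "[a] \<in> interp (Mi i) (Rel 1 u)" "j \<in> Field r" "[b] \<in> interp (Mi j) (Rel 1 u)"
      using H unfolding U by blast
    have c: "a \<in> carrier (Mi i)" "b \<in> carrier (Mi j)" using mem ij by blast+
    have "\<exists>k \<in> Field r. a \<in> carrier (Mi k) \<and> b \<in> carrier (Mi k)"
      using sub[OF ij(1,3)] c ij(1,3) unfolding substruct_def by blast
    then obtain k where k: "k \<in> Field r" "a \<in> carrier (Mi k)" "b \<in> carrier (Mi k)" by blast
    then show ?thesis using H m[OF k(1)] old by blast
  qed
  ultimately show "?U \<in> models (labelled \<kappa>)" unfolding models_labelled by blast
  show "substruct (Mi i) ?U" if i: "i \<in> Field r"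
    unfolding substruct_def
  proof (intro conjI allI set_eqI)
    show "carrier (Mi i) \<subseteq> carrier ?U" using C i by blast
    show "xs \<in> interp (Mi i) s \<longleftrightarrow> xs \<in> interp ?U s \<inter> lists (carrier (Mi i))" for s xs
    proof
      assume xs: "xs \<in> interp (Mi i) s"
      obtain a where a: "a \<in> carrier (Mi i)" "xs = [a]" using labelled_singleton[OF conjunct1[OF m[OF i]] xs] by blast
      then show "xs \<in> interp ?U s \<inter> lists (carrier (Mi i))" using old[OF a(1) i, of s] xs by simp
    next
      assume xs: "xs \<in> interp ?U s \<inter> lists (carrier (Mi i))"
      then obtain a where a: "xs = [a]" using labelled_singleton[OF st, of xs s] by blast
      then show "xs \<in> interp (Mi i) s" using old[OF _ i, of a s] xs by simp
    qed
  qed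
qed

lemma labelled_AEC:
  assumes "infinite_cardinal \<kappa>"
  shows "AEC (labelled \<kappa>)"
proof
  show "|vocab (labelled \<kappa>)| <o |UNIV :: 'u set|"
    unfolding vocab_labelled
    using ordLeq_ordLess_trans[OF card_of_image
        ordIso_ordLess_trans[OF card_of_Field_ordIso infinite_cardinal_small[OF assms]]]
      Card_order_infinite_cardinal[OF assms] by blast
  show "\<exists>\<nu>. infinite_cardinal \<nu> \<and> has_LS_property (labelled \<kappa>) \<nu>"
    using assms labelled_LS[OF Cinfinite_infinite_cardinal[OF assms]] by blast
  show "is_struct (vocab (labelled \<kappa>)) M" if "M \<in> models (labelled \<kappa>)" for M
    using that by (simp add: models_labelled)
  show "strong (labelled \<kappa>) M' N'" if H: "strong (labelled \<kappa>) M N" "iso f N N'" "iso f M M'" for M N f N' M'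
  proof -
    have "substruct M' N'"
    proof -
      note s = H(1)[unfolded strong_labelled, THEN conjunct2, THEN conjunct2]
      have b: "carrier N' = f ` carrier N" "carrier M' = f ` carrier M" "inj_on f (carrier N)"
        using H(2,3) by (auto simp: iso_def bij_betw_def)
      have st: "is_struct (Rel 1 ` Field \<kappa>) N" using H(1) by (simp add: strong_labelled models_labelled)
      have "map f ` (interp N s \<inter> lists (carrier M)) = map f ` interp N s \<inter> lists (f ` carrier M)" for s
      proof (intro equalityI subsetI)
        fix ys assume "ys \<in> map f ` interp N s \<inter> lists (f ` carrier M)"
        then obtain xs where xs: "xs \<in> interp N s" "ys = map f xs" "set ys \<subseteq> f ` carrier M" by (auto simp: lists_eq_set)
        have xN: "set xs \<subseteq> carrier N" using is_struct_interp[OF st xs(1)] by blast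
        have "set xs \<subseteq> carrier M"
        proof
          fix x assume x: "x \<in> set xs"
          then have "f x \<in> f ` carrier M" using xs(2,3) by auto
          then obtain y where y: "y \<in> carrier M" "f x = f y" by blast
          have "x = y" by (rule inj_onD[OF b(3) y(2)]) (use x xN y(1) substruct_carrier[OF s] in blast)+
          then show "x \<in> carrier M" using y(1) by simp
        qed
        then show "ys \<in> map f ` (interp N s \<inter> lists (carrier M))" using xs by (auto simp: lists_eq_set)
      qed auto
      then show ?thesis using s H(2,3) b(1,2) unfolding substruct_def iso_def by (simp add: image_mono)
    qed
    then show ?thesis using H labelled_iso unfolding strong_labelled by blast
  qed
next
  show "N \<in> models (labelled \<kappa>)" if "M \<in> models (labelled \<kappa>)" "iso f M N" for M f N
    using labelled_iso that by blast
  show "M \<in> models (labelled \<kappa>) \<and> N \<in> models (labelled \<kappa>)" "substruct M N" if "strong (labelled \<kappa>) M N" for M N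
    using that by (simp_all add: strong_labelled)
  show "strong (labelled \<kappa>) M M" if "M \<in> models (labelled \<kappa>)" for M
    using that substruct_refl by (auto simp: strong_labelled models_labelled)
  show "strong (labelled \<kappa>) M P" if "strong (labelled \<kappa>) M N" "strong (labelled \<kappa>) N P" for M N P
    using that substruct_trans unfolding strong_labelled by blast
  show "strong (labelled \<kappa>) M N" if "strong (labelled \<kappa>) M P" "strong (labelled \<kappa>) N P" "substruct M N" for M N P
    using that unfolding strong_labelled by blast
next
  fix r :: "'u rel" and Mi :: "'u \<Rightarrow> 'u struct"
  assume r: "Well_order r" "Field r \<noteq> {}"
    and c: "\<And>i j. (i, j) \<in> r \<Longrightarrow> strong (labelled \<kappa>) (Mi i) (Mi j)" "small (\<Union>i \<in> Field r. carrier (Mi i))"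
  let ?U = "union_struct (Field r) Mi"
  note U = labelled_chain[OF r c]
  show "?U \<in> models (labelled \<kappa>)" by (rule U(1))
  have M: "Mi i \<in> models (labelled \<kappa>)" if "i \<in> Field r" for i
  proof -
    have "(i, i) \<in> r" using r(1) that unfolding order_on_defs refl_on_def by blast
    then show ?thesis using c(1) unfolding strong_labelled by blast
  qed
  show "strong (labelled \<kappa>) (Mi i) ?U" if "i \<in> Field r" for i
    using U M that unfolding strong_labelled by blast
  show "strong (labelled \<kappa>) ?U N" if N: "\<And>i. i \<in> Field r \<Longrightarrow> strong (labelled \<kappa>) (Mi i) N" for N
  proof -
    note N' = N[unfolded strong_labelled]
    have mN: "N \<in> models (labelled \<kappa>)" using r(2) N' by blast
    have sN: "is_struct (Rel 1 ` Field \<kappa>) N" using mN models_labelled by blast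
    have "substruct ?U N"
      unfolding substruct_def
    proof (intro conjI allI set_eqI iffI)
      show "carrier ?U \<subseteq> carrier N" using N' substruct_carrier by (fastforce simp: union_struct_def)
      fix s xs
      {
        assume "xs \<in> interp ?U s"
        then obtain i where i: "i \<in> Field r" "xs \<in> interp (Mi i) s" by (auto simp: union_struct_def)
        then have "xs \<in> interp N s" "xs \<in> lists (carrier (Mi i))" using N'[OF i(1)] unfolding substruct_def by blast+
        then show "xs \<in> interp N s \<inter> lists (carrier ?U)" using i(1) by (auto simp: union_struct_def lists_eq_set)
      }
      assume xs: "xs \<in> interp N s \<inter> lists (carrier ?U)"
      then obtain a where a: "xs = [a]" using labelled_struct[OF sN, of xs s] by blast
      then have "a \<in> carrier ?U" using xs by simp
      then obtain i where i: "i \<in> Field r" "a \<in> carrier (Mi i)" by (auto simp: union_struct_def)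
      then have "xs \<in> interp (Mi i) s" using N'[OF i(1)] xs a unfolding substruct_def by auto
      then show "xs \<in> interp ?U s" using i(1) by (auto simp: union_struct_def)
    qed
    then show ?thesis using U(1) mN by (simp add: strong_labelled)
  qed
qed

end

section \<open>Assembling the class\<close>

context AEC
begin

text \<open>The model given by the joint embedding may be larger than \<theta>, and nothing is
  assumed about joint embeddings of larger models. A strong submodel containing both images is cut
  out of it; by coherence the images are strong in it.\<close>

lemma joint_embedding_cut:
  assumes J: "jointly_embeddable K A A'" and LS: "has_LS_property K \<nu>" "Card_order \<nu>" "\<nu> \<le>o \<theta>" "Cinfinite \<theta>"
    and le: "|carrier A| \<le>o \<theta>" "|carrier A'| \<le>o \<theta>"
  shows "\<exists>B f g A1 A1'. iso f A A1 \<and> strong K A1 B \<and> iso g A' A1' \<and> strong K A1' B \<and> |carrier B| \<le>o \<theta>"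
proof -
  obtain P f g A1 A1' where P: "P \<in> models K" "iso f A A1" "strong K A1 P" "iso g A' A1'" "strong K A1' P"
    using J unfolding jointly_embeddable_def embedding_def by blast
  have "|carrier A1| \<le>o \<theta>" "|carrier A1'| \<le>o \<theta>"
    using ordIso_ordLeq_trans[OF ordIso_symmetric[OF iso_card[OF P(2)]] le(1)]
      ordIso_ordLeq_trans[OF ordIso_symmetric[OF iso_card[OF P(4)]] le(2)] .
  then have "|carrier A1 \<union> carrier A1'| \<le>o \<theta>" using LS(4) by (intro Un_Cinfinite_bound)
  moreover have "carrier A1 \<union> carrier A1' \<subseteq> carrier P" using strong_carrier P by blast
  ultimately obtain B where B: "strong K B P" "carrier A1 \<union> carrier A1' \<subseteq> carrier B" "|carrier B| \<le>o \<theta>"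
    using has_LS_propertyD[OF LS(1) P(1) _ _ LS(3,4,2)] by blast
  have "strong K A1 B" "strong K A1' B"
    using coherence[OF P(3) B(1)] coherence[OF P(5) B(1)] B(2)
      substruct_common[OF strong_substruct[OF P(3)] strong_substruct[OF B(1)]]
      substruct_common[OF strong_substruct[OF P(5)] strong_substruct[OF B(1)]] by blast+
  then show ?thesis using P(2,4) B(3) by blast
qed

text \<open>A second joint embedding, of the cut model with \<open>Q\<close>, makes the common
  extension at least as large as \<open>Q\<close>. Cutting first keeps the model within the range
  where the assumption on \<open>Q\<close> applies.\<close>

lemma joint_embedding_above:
  assumes J: "jointly_embeddable K A A'" and LS: "has_LS_property K \<nu>" "Card_order \<nu>" "\<nu> \<le>o \<theta>" "Cinfinite \<theta>"
    and le: "|carrier A| \<le>o \<theta>" "|carrier A'| \<le>o \<theta>" and A: "\<nu> \<le>o |carrier A|"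
    and Q: "\<And>X. X \<in> models K \<Longrightarrow> \<nu> \<le>o |carrier X| \<Longrightarrow> |carrier X| \<le>o \<theta> \<Longrightarrow> jointly_embeddable K X Q"
  shows "\<exists>f g A1 A1' B. iso f A A1 \<and> strong K A1 B \<and> iso g A' A1' \<and> strong K A1' B \<and> |carrier Q| \<le>o |carrier B|"
proof -
  obtain B0 f g A1 A1' where B0: "iso f A A1" "strong K A1 B0" "iso g A' A1'" "strong K A1' B0" "|carrier B0| \<le>o \<theta>"
    using joint_embedding_cut[OF J LS le] by blast
  have "|carrier A| =o |carrier A1|" by (rule iso_card[OF B0(1)])
  then have "\<nu> \<le>o |carrier B0|"
    using ordLeq_transitive[OF ordLeq_ordIso_trans[OF A] card_of_mono1[OF strong_carrier[OF B0(2)]]] by blast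
  then have "jointly_embeddable K B0 Q" using Q B0(5) strong_models[OF B0(2)] by blast
  then obtain B h k B1 Q1 where B: "B \<in> models K" "iso h B0 B1" "strong K B1 B" "iso k Q Q1" "strong K Q1 B"
    unfolding jointly_embeddable_def embedding_def by blast
  have *: "\<exists>Y'. iso h Y Y' \<and> strong K Y' B" if Y: "strong K Y B0" for Y
  proof -
    have "inj_on h (carrier Y)"
      using B(2) strong_carrier[OF Y] by (auto simp: iso_def bij_betw_def intro: inj_on_subset)
    then have i: "iso h Y (image_struct h Y)" by (rule iso_image_struct)
    show ?thesis using i strong_trans[OF strong_iso[OF Y B(2) i] B(3)] by blast
  qed
  have "|carrier Q| \<le>o |carrier B|"
    by (rule ordIso_ordLeq_trans[OF iso_card[OF B(4)] card_of_mono1[OF strong_carrier[OF B(5)]]])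
  then show ?thesis
    using *[OF B0(2)] *[OF B0(4)] iso_comp[OF B0(1)] iso_comp[OF B0(3)] by blast
qed

end

text \<open>Each \<kappa> \<open>i\<close> with \<open>i\<close> below \<alpha> is isomorphic to a
  proper initial segment of \<kappa> \<open>\<alpha>\<close>, and different cardinals give different
  segments. So the positions where these segments end embed the indices below \<alpha> into the
  field of \<kappa> \<open>\<alpha>\<close>.\<close>

lemma initial_segment_small:
  fixes \<kappa> :: "'i :: wellorder \<Rightarrow> 'u rel"
  assumes \<kappa>: "\<And>i. i \<le> \<alpha> \<Longrightarrow> infinite_cardinal (\<kappa> i)" "\<And>i j. i < j \<Longrightarrow> j \<le> \<alpha> \<Longrightarrow> \<kappa> i <o \<kappa> j"
  shows "|{..\<alpha>}| \<le>o \<kappa> \<alpha>"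
proof -
  have c: "Cinfinite (\<kappa> i)" if "i \<le> \<alpha>" for i using Cinfinite_infinite_cardinal[OF \<kappa>(1)[OF that]] .
  have wo: "Well_order (\<kappa> i)" if "i \<le> \<alpha>" for i using c[OF that] card_order_on_well_order_on by blast
  have "\<exists>a \<in> Field (\<kappa> \<alpha>). \<kappa> i =o Restr (\<kappa> \<alpha>) (underS (\<kappa> \<alpha>) a)" if i: "i < \<alpha>" for i
    using \<kappa>(2)[OF i order_refl] ordLess_iff_ordIso_Restr[OF wo[OF order_refl] wo[of i]] i by auto
  then obtain a where a: "\<And>i. i < \<alpha> \<Longrightarrow> a i \<in> Field (\<kappa> \<alpha>)"
    "\<And>i. i < \<alpha> \<Longrightarrow> \<kappa> i =o Restr (\<kappa> \<alpha>) (underS (\<kappa> \<alpha>) (a i))" by metis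
  have ne: "a i \<noteq> a j" if ij: "i < j" "j < \<alpha>" for i j
  proof
    assume eq: "a i = a j"
    have "\<kappa> i =o \<kappa> j"
      using ordIso_transitive[OF a(2)[of i] ordIso_symmetric[OF a(2)[of j, folded eq]]] ij by auto
    then show False using \<kappa>(2)[OF ij(1)] ij(2) not_ordLess_ordIso by (metis less_imp_le)
  qed
  have "inj_on a {..<\<alpha>}"
  proof (rule inj_onI)
    fix i j assume "i \<in> {..<\<alpha>}" "j \<in> {..<\<alpha>}" "a i = a j"
    then show "i = j" using ne[of i j] ne[of j i] by (cases i j rule: linorder_cases) auto
  qed
  then have "|{..<\<alpha>}| \<le>o |Field (\<kappa> \<alpha>)|" by (rule card_of_ordLeqI) (use a(1) in auto)
  then have "|{..<\<alpha>}| \<le>o \<kappa> \<alpha>"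
    using ordLeq_ordIso_trans[OF _ card_of_Field_ordIso] c[OF order_refl] by blast
  then have "|insert \<alpha> {..<\<alpha>}| \<le>o \<kappa> \<alpha>" by (rule card_of_insert_le[OF c[OF order_refl]])
  moreover have "insert \<alpha> {..<\<alpha>} = {..\<alpha>}" by auto
  ultimately show ?thesis by simp
qed

lemma assembled_class:
  fixes \<alpha> :: "'i :: {wellorder, order_bot}" and \<kappa> :: "'i \<Rightarrow> 'u rel" and K :: "'i \<Rightarrow> 'u eclass"
  assumes universe: "universe TYPE('u)"
    and cardinals: "\<And>i. i \<le> \<alpha> \<Longrightarrow> infinite_cardinal (\<kappa> i)"
    and increasing: "\<And>i j. i < j \<Longrightarrow> j \<le> \<alpha> \<Longrightarrow> \<kappa> i <o \<kappa> j"
    and \<nu>: "infinite_cardinal \<nu>"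
    and aecs: "\<And>i. i \<le> \<alpha> \<Longrightarrow> AEC (K i)" "\<And>i. i \<le> \<alpha> \<Longrightarrow> has_LS_property (K i) \<nu>"
    and vocabs: "\<And>i. i \<le> \<alpha> \<Longrightarrow> |vocab (K i)| \<le>o \<kappa> \<alpha>"
    and attained: "\<And>i. i \<le> \<alpha> \<Longrightarrow> \<exists>M \<in> models (K i). |carrier M| =o \<kappa> i"
    and bounded: "\<And>i M. i \<le> \<alpha> \<Longrightarrow> M \<in> models (K i) \<Longrightarrow> |carrier M| \<le>o \<kappa> i"
    and jep: "\<And>A A'. A \<in> models (K bot) \<Longrightarrow> A' \<in> models (K bot) \<Longrightarrow> \<nu> \<le>o |carrier A| \<Longrightarrow>
      |carrier A| <o \<kappa> bot \<Longrightarrow> \<nu> \<le>o |carrier A'| \<Longrightarrow> |carrier A'| <o \<kappa> bot \<Longrightarrow> jointly_embeddable (K bot) A A'"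
  shows "\<exists>L :: 'u eclass. AEC L \<and> LS L =o \<nu> \<and> JEP_less L (\<kappa> bot) \<and>
    (\<forall>\<mu>. relevant_cardinal L \<mu> \<and> \<kappa> bot \<le>o \<mu> \<longrightarrow> \<not> JEP L \<mu>) \<and>
    (\<forall>\<mu>. relevant_cardinal L \<mu> \<longrightarrow> \<not> AP L \<mu>) \<and>
    (\<forall>i \<le> \<alpha>. \<exists>\<M> \<subseteq> models L. |\<M>| =o ctwo ^c cardSuc (\<kappa> i) \<and>
        (\<forall>M \<in> \<M>. maximal_model L M \<and> |carrier M| =o cardSuc (\<kappa> i)) \<and>
        (\<forall>M \<in> \<M>. \<forall>N \<in> \<M>. M \<noteq> N \<longrightarrow> \<not> isomorphic M N)) \<and>
    (\<forall>M. maximal_model L M \<and> LS L \<le>o |carrier M| \<longrightarrow> (\<exists>i \<le> \<alpha>. |carrier M| =o cardSuc (\<kappa> i))) \<and>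
    arbitrarily_large_models L \<and> pure L \<and>
    (countable {..\<alpha>} \<and> (\<forall>i \<le> \<alpha>. L\<omega>1\<omega>_axiomatizable (K i)) \<longrightarrow> L\<omega>1\<omega>_axiomatizable L)"
proof -
  define R where "R i = raise_LS \<nu> (K i)" for i
  \<comment> \<open>With fewer than \<nu> points no joint embeddings are available, so such models
    must not be made permanent. If \<kappa> \<open>bot\<close> is below \<nu>, there is no
    cardinality left for which joint embedding is required, and every model is declared heavy, as a
    lock with a model of cardinality \<kappa> \<open>bot\<close> must stay active.\<close>
  define heavy where "heavy A \<longleftrightarrow> \<nu> \<le>o |carrier A| \<or> \<kappa> bot <o \<nu>" for A :: "'u struct"
  define loose where "loose \<longleftrightarrow> (\<exists>A \<in> models (R bot). \<exists>A' \<in> models (R bot).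
      heavy A \<and> heavy A' \<and> \<not> jointly_embeddable (R bot) A A')"
  define Sy :: "('i, 'u) sym set" where "Sy = STyp ` {..\<alpha>} \<union> STok ` {..\<alpha>} \<union>
      {SLock, SRed, SMem, SBel, SRow, SKill, SPick, SCol} \<union>
      {SCode t s | t s. t \<in> {..\<alpha>} \<and> s \<in> vocab (R t)}"
  have c\<alpha>: "Cinfinite (\<kappa> \<alpha>)" using Cinfinite_infinite_cardinal[OF cardinals] by simp
  have seg: "|{..\<alpha>}| \<le>o \<kappa> \<alpha>" by (rule initial_segment_small[OF cardinals increasing])
  \<comment> \<open>The symbols of all classes have to be named by points simultaneously. The bound
    by \<kappa> \<open>\<alpha>\<close> ensures that there are enough names.\<close>
  have "|Sy| \<le>o \<kappa> \<alpha>"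
  proof -
    have "{SCode t s | t s. t \<in> {..\<alpha>} \<and> s \<in> vocab (R t)} = (\<Union>t \<in> {..\<alpha>}. SCode t ` vocab (R t))" by auto
    moreover have "|\<Union>t \<in> {..\<alpha>}. SCode t ` vocab (R t)| \<le>o \<kappa> \<alpha>"
      by (rule card_of_UNION_ordLeq_infinite_Field) (use c\<alpha> seg vocabs card_of_image_le in \<open>auto simp: cinfinite_def R_def\<close>)
    moreover have "|{SLock, SRed, SMem, SBel, SRow, SKill, SPick, SCol} :: ('i, 'u) sym set| \<le>o \<kappa> \<alpha>"
      by (rule card_of_finite_le[OF c\<alpha>]) simp
    ultimately show ?thesis
      unfolding Sy_def using c\<alpha> seg by (intro Un_Cinfinite_bound card_of_image_le) simp_all
  qed
  then have Sy_small: "|Sy| <o |UNIV :: 'u set|"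
    using ordLeq_ordLess_trans infinite_cardinal_small[OF cardinals] by blast
  then obtain name where name: "inj_on (name :: _ \<Rightarrow> 'u) Sy" using inj_into_of_le ordLess_imp_ordLeq by metis
  have \<kappa>_least: "\<kappa> bot \<le>o \<kappa> i" if i: "i \<le> \<alpha>" for i
  proof (cases "i = bot")
    case True
    have "Card_order (\<kappa> bot)" using Card_order_infinite_cardinal[OF cardinals[of bot]] by simp
    then show ?thesis using True ordLeq_reflexive card_order_on_well_order_on by blast
  next
    case False
    then show ?thesis using increasing[of bot i] i bot.not_eq_extremum ordLess_imp_ordLeq by blast
  qed
  have \<nu>c: "Cinfinite \<nu>" "Card_order \<nu>" using \<nu> Cinfinite_infinite_cardinal Card_order_infinite_cardinal by auto
  have woc: "Well_order \<nu>" "Well_order (\<kappa> bot)"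
    using \<nu>c Card_order_infinite_cardinal[OF cardinals[of bot]] card_order_on_well_order_on by auto
  have R: "AEC (R i)" "has_LS_property (R i) \<nu>" if "i \<le> \<alpha>" for i
    unfolding R_def using raise_LS_AEC raise_LS_has_LS aecs that \<nu> by blast+
  interpret C: sized_lock_construction Sy "{..\<alpha>}" bot R \<nu> heavy loose name \<kappa>
  proof (intro sized_lock_construction.intro lock_construction.intro sized_lock_construction_axioms.intro)
    show "universe TYPE('u)" "infinite_cardinal \<nu>" "bot \<in> {..\<alpha>}"
      using universe \<nu> by simp_all
    show "inj_on name (STyp ` {..\<alpha>} \<union> STok ` {..\<alpha>} \<union>
      {SLock, SRed, SMem, SBel, SRow, SKill, SPick, SCol} \<union> {SCode t s | t s. t \<in> {..\<alpha>} \<and> s \<in> vocab (R t)})"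
      using name unfolding Sy_def .
    show "|STyp ` {..\<alpha>} \<union> STok ` {..\<alpha>} \<union>
      {SLock, SRed, SMem, SBel, SRow, SKill, SPick, SCol} \<union> {SCode t s | t s. t \<in> {..\<alpha>} \<and> s \<in> vocab (R t)}|
      <o |UNIV :: 'u set|"
      using Sy_small unfolding Sy_def .
    show "AEC (R i)" "has_LS_property (R i) \<nu>" "infinite_cardinal (\<kappa> i)" "\<kappa> bot \<le>o \<kappa> i" if "i \<in> {..\<alpha>}" for i
      using R \<kappa>_least cardinals that by simp_all
    show "|carrier A| \<le>o \<kappa> i" if "i \<in> {..\<alpha>}" "A \<in> models (R i)" for i A
      using bounded that by (simp add: R_def)
    show "\<exists>A \<in> models (R i). |carrier A| =o \<kappa> i" if "i \<in> {..\<alpha>}" for i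
      using attained that by (simp add: R_def)
    show "heavy A \<longleftrightarrow> heavy B" if S: "strong (R bot) A B" for A B
    proof -
      have "A = B \<or> \<nu> \<le>o |carrier A|" using S by (simp add: R_def)
      moreover have "|carrier A| \<le>o |carrier B|"
        by (rule card_of_mono1) (use AEC.strong_carrier[OF R(1) S] in simp)
      ultimately show ?thesis unfolding heavy_def using ordLeq_transitive by blast
    qed
    show "heavy A \<longleftrightarrow> heavy B" if "iso f A B" for f A B
      unfolding heavy_def using iso_card[OF that] ordLeq_ordIso_trans ordIso_symmetric by blast
    show "heavy A" if "A \<in> models (R bot)" "\<kappa> bot \<le>o |carrier A|" for A
      unfolding heavy_def using that(2) woc not_ordLess_iff_ordLeq[OF woc(1,2)] ordLeq_transitive by blast
    show "\<exists>A \<in> models (R bot). \<exists>A' \<in> models (R bot). heavy A \<and> heavy A' \<and> \<not> jointly_embeddable (R bot) A A'"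
      if loose using that loose_def by blast
  qed (rule Sy_def[THEN eq_reflection])
  \<comment> \<open>Raising is applied at two levels: in the given classes it makes heaviness
    invariant under strong extension, and in the finished class it makes \<nu> the exact
    Loewenheim-Skolem number.\<close>
  let ?L = "raise_LS \<nu> C.L"
  have AEC_L: "AEC ?L" by (rule raise_LS_AEC[OF C.L_AEC \<nu> C.L_LS])
  have plain: "\<exists>M \<in> models ?L. |carrier M| =o \<mu>" if \<mu>: "infinite_cardinal \<mu>" for \<mu> :: "'u rel"
  proof -
    have \<mu>c: "Card_order \<mu>" "Cinfinite \<mu>" using \<mu> by (simp_all add: infinite_cardinal_def)
    have F: "|Field \<mu>| =o \<mu>" by (rule card_of_Field_ordIso[OF \<mu>c(1)])
    have "Field \<mu> \<noteq> {}" using \<mu>c(2) by (auto simp: cinfinite_def)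
    moreover have "small (Field \<mu>)"
      unfolding small_def by (rule ordIso_ordLess_trans[OF F infinite_cardinal_small[OF \<mu>]])
    ultimately have "C.ok (C.mk_struct (Field \<mu>) (\<lambda>_. {}))" by (rule C.plain_ok)
    then show ?thesis using F by (intro bexI[of _ "C.mk_struct (Field \<mu>) (\<lambda>_. {})"]) simp_all
  qed
  have LS_L: "LS ?L =o \<nu>"
  proof -
    obtain N where N: "N \<in> models ?L" "|carrier N| =o \<nu>" using plain[OF \<nu>] by blast
    have "\<nu> \<le>o |carrier N|" using N(2) ordIso_iff_ordLeq by blast
    then have "is_LS ?L \<nu>" using raise_LS_is_LS[OF C.L_AEC \<nu> C.L_LS, of N] N(1) by simp
    then show ?thesis using is_LS_unique[OF AEC.is_LS_LS[OF AEC_L]] by blast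
  qed
  have \<nu>_le: "\<nu> \<le>o r" if "LS ?L \<le>o r" for r :: "'u rel"
    by (rule ordIso_ordLeq_trans[OF ordIso_symmetric[OF LS_L] that])
  have \<nu>_le': "\<nu> \<le>o |carrier M|" if "LS ?L \<le>o \<mu>" "|carrier M| =o \<mu>" for \<mu> :: "'u rel" and M :: "'u struct"
    by (rule ordLeq_ordIso_trans[OF \<nu>_le[OF that(1)] ordIso_symmetric[OF that(2)]])
  have S: "strong ?L M N \<Longrightarrow> C.ext M N" "\<nu> \<le>o |carrier M| \<Longrightarrow> C.ext M N \<Longrightarrow> strong ?L M N" for M N by simp_all
  have JL: "jointly_embeddable C.L M N" if "jointly_embeddable ?L M N" for M N
    using that unfolding jointly_embeddable_def embedding_def by auto
  have JR: "jointly_embeddable ?L M N"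
    if J: "jointly_embeddable C.L M N" and le: "\<nu> \<le>o |carrier M|" "\<nu> \<le>o |carrier N|" for M N
  proof -
    have *: "embedding ?L f X P" if "embedding C.L f X P" "\<nu> \<le>o |carrier X|" for f X P
      using that S(2) ordLeq_ordIso_trans[OF that(2) iso_card] unfolding embedding_def by fastforce
    show ?thesis using J * le unfolding jointly_embeddable_def by fastforce
  qed
  have "JEP_less ?L (\<kappa> bot)"
    unfolding JEP_less_def
  proof (intro ballI impI, elim conjE)
    fix M N assume MN: "M \<in> models ?L" "N \<in> models ?L"
      and M: "LS ?L \<le>o |carrier M|" "|carrier M| <o \<kappa> bot" and N: "LS ?L \<le>o |carrier N|" "|carrier N| <o \<kappa> bot"
    \<comment> \<open>The larger of the two carriers provides one cardinal below \<kappa>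
      \<open>bot\<close> that bounds both models and is at least \<nu>.\<close>
    have "\<exists>T. (T = carrier M \<or> T = carrier N) \<and> |carrier M| \<le>o |T| \<and> |carrier N| \<le>o |T|"
      using ordLeq_total[of "|carrier M|" "|carrier N|"] card_of_mono1[OF subset_refl] by auto
    then obtain T where T: "T = carrier M \<or> T = carrier N" "|carrier M| \<le>o |T|" "|carrier N| \<le>o |T|" by blast
    have T': "\<nu> \<le>o |T|" "|T| <o \<kappa> bot" using T(1) M N \<nu>_le by blast+
    have inf: "Cinfinite |T|" using cinfinite_mono[OF T'(1)] \<nu>c by simp
    have \<nu>\<kappa>: "\<not> \<kappa> bot <o \<nu>"
      using ordLeq_ordLess_trans[OF T'] not_ordLess_ordLeq ordLess_imp_ordLeq by blast
    interpret B: AEC "R bot" by (rule R(1)) simp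
    note LSB = R(2)[of bot, OF bot_least]
    have jepR: "jointly_embeddable (R bot) A A'"
      if A: "A \<in> models (R bot)" "\<nu> \<le>o |carrier A|" "|carrier A| \<le>o |T|"
        "A' \<in> models (R bot)" "\<nu> \<le>o |carrier A'|" "|carrier A'| \<le>o |T|" for A A'
    proof -
      have "jointly_embeddable (K bot) A A'"
        using jep[of A A'] A ordLeq_ordLess_trans[OF A(3) T'(2)] ordLeq_ordLess_trans[OF A(6) T'(2)]
        by (simp add: R_def)
      moreover have "embedding (R bot) f X P" if "embedding (K bot) f X P" "\<nu> \<le>o |carrier X|" for f X P
        using that ordLeq_ordIso_trans[OF that(2) iso_card] unfolding embedding_def R_def by fastforce
      ultimately show ?thesis using A unfolding jointly_embeddable_def by (fastforce simp: R_def)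
    qed
    obtain Q where Q: "Q \<in> models (R bot)" "|carrier Q| =o \<kappa> bot" using C.attained[of bot] by auto
    have TQ: "|T| \<le>o |carrier Q|"
      by (rule ordLeq_ordIso_trans[OF ordLess_imp_ordLeq[OF T'(2)] ordIso_symmetric[OF Q(2)]])
    \<comment> \<open>A heavy model \<open>A0\<close> of cardinality exactly that of
      \<open>T\<close> is cut out of a largest model of the least class. It is used for locks in
      models that lack a heavy one, and in the loose case also to make the common extension
      large.\<close>
    obtain X where X: "X \<subseteq> carrier Q" "|X| =o |T|" using subset_of_card[OF _ TQ] by auto
    have "|X| \<le>o |T|" using X(2) ordIso_iff_ordLeq by blast
    then obtain A0 where A0: "strong (R bot) A0 Q" "X \<subseteq> carrier A0" "|carrier A0| \<le>o |T|"
      using has_LS_propertyD[OF LSB Q(1) X(1) _ T'(1) inf \<nu>c(2)] by blast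
    have mA0: "A0 \<in> models (R bot)" using B.strong_models[OF A0(1)] by blast
    have TA0: "|T| \<le>o |carrier A0|"
      by (rule ordIso_ordLeq_trans[OF ordIso_symmetric[OF X(2)] card_of_mono1[OF A0(2)]])
    have \<nu>A0: "\<nu> \<le>o |carrier A0|" by (rule ordLeq_transitive[OF T'(1) TA0])
    have heavyD: "\<nu> \<le>o |carrier A|" if "heavy A" for A using that \<nu>\<kappa> by (simp add: heavy_def)
    have "jointly_embeddable C.L M N"
    proof (rule C.joint_embedding[where ?A0.0 = A0 and \<theta> = "|T|"])
      show "C.ok M" "C.ok N" using MN by simp_all
      show "A0 \<in> models (R bot)" "|carrier M| \<le>o |T|" "|carrier N| \<le>o |T|" "|carrier A0| \<le>o |T|" by fact+
      show "heavy A0" using \<nu>A0 by (simp add: heavy_def)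
      show "Cinfinite |T|" by fact
      fix A A' assume A: "A \<in> models (R bot)" "A' \<in> models (R bot)" "heavy A" "heavy A'"
        "|carrier A| \<le>o |T|" "|carrier A'| \<le>o |T|"
      note hA = heavyD[OF A(3)] heavyD[OF A(4)]
      have J: "jointly_embeddable (R bot) A A'" using jepR[OF A(1) hA(1) A(5) A(2) hA(2) A(6)] .
      note above = B.joint_embedding_above[OF J LSB \<nu>c(2) T'(1) inf A(5,6) hA(1)]
      show "\<exists>f g A1 A1' B D. iso f A A1 \<and> strong (R bot) A1 B \<and> iso g A' A1' \<and> strong (R bot) A1' B \<and>
        D \<subseteq> carrier B \<and> |T| \<le>o |D| \<and> (loose \<or> D \<inter> (carrier A1 \<union> carrier A1') = {})"
      proof (cases loose)
        case True
        \<comment> \<open>A loose lock may reuse old colours, so the whole common extension can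
          serve as reservoir. It needs only the cardinality of \<open>T\<close>, and all joint
          embeddings involved are between models below \<kappa> \<open>bot\<close>.\<close>
        have "jointly_embeddable (R bot) X A0"
          if "X \<in> models (R bot)" "\<nu> \<le>o |carrier X|" "|carrier X| \<le>o |T|" for X
          using jepR[OF that mA0 \<nu>A0 A0(3)] .
        then obtain f g A1 A1' B where B: "iso f A A1" "strong (R bot) A1 B" "iso g A' A1'" "strong (R bot) A1' B"
          "|carrier A0| \<le>o |carrier B|" using above[of A0] by blast
        then show ?thesis using True ordLeq_transitive[OF TA0 B(5)] by blast
      next
        case False
        have hQ: "heavy Q"
          unfolding heavy_def using ordLeq_transitive[OF T'(1) TQ] by blast
        \<comment> \<open>Without incompatible heavy models, even the model \<open>Q\<close> of
          cardinality \<kappa> \<open>bot\<close> can be jointly embedded with the models at hand.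
          The common extension then exceeds the two images so far that the points outside them
          suffice as colours.\<close>
        have "jointly_embeddable (R bot) X Q"
          if "X \<in> models (R bot)" "\<nu> \<le>o |carrier X|" "|carrier X| \<le>o |T|" for X
          using False that hQ Q(1) unfolding loose_def heavy_def by blast
        then obtain f g A1 A1' B where B: "iso f A A1" "strong (R bot) A1 B" "iso g A' A1'" "strong (R bot) A1' B"
          "|carrier Q| \<le>o |carrier B|" using above[of Q] by blast
        let ?D = "carrier B - (carrier A1 \<union> carrier A1')"
        have "|carrier A1| \<le>o |T|" "|carrier A1'| \<le>o |T|"
          using ordIso_ordLeq_trans[OF ordIso_symmetric[OF iso_card[OF B(1)]] A(5)]
            ordIso_ordLeq_trans[OF ordIso_symmetric[OF iso_card[OF B(3)]] A(6)] .
        then have AA: "|carrier A1 \<union> carrier A1'| \<le>o |T|" using inf by (intro Un_Cinfinite_bound)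
        have "|T| \<le>o |?D|"
        proof (rule ccontr)
          assume "\<not> |T| \<le>o |?D|"
          then have "|?D| \<le>o |T|" using ordLeq_total[of "|T|" "|?D|"] by auto
          then have "|?D \<union> (carrier A1 \<union> carrier A1')| \<le>o |T|" by (rule Un_Cinfinite_bound[OF _ AA inf])
          then have "|carrier B| \<le>o |T|" by (rule card_of_subset_le[rotated]) blast
          then have "|carrier Q| <o \<kappa> bot"
            by (rule ordLeq_ordLess_trans[OF ordLeq_transitive[OF B(5)] T'(2)])
          then show False using Q(2) not_ordLess_ordIso by blast
        qed
        then show ?thesis using B(1-4) by blast
      qed
    qed
    then show "jointly_embeddable ?L M N" using JR \<nu>_le M(1) N(1) by blast
  qed
  moreover have "\<forall>\<mu>. relevant_cardinal ?L \<mu> \<and> \<kappa> bot \<le>o \<mu> \<longrightarrow> \<not> JEP ?L \<mu>"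
  proof (intro allI impI)
    fix \<mu> :: "'u rel" assume \<mu>: "relevant_cardinal ?L \<mu> \<and> \<kappa> bot \<le>o \<mu>"
    then have "infinite_cardinal \<mu>" "\<kappa> bot \<le>o \<mu>" by (auto simp: relevant_cardinal_def)
    from C.joint_embedding_fails[OF this]
    obtain M N where "C.ok M" "C.ok N" "|carrier M| =o \<mu>" "|carrier N| =o \<mu>" "\<not> jointly_embeddable C.L M N" by blast
    then show "\<not> JEP ?L \<mu>" using JL unfolding JEP_def by auto
  qed
  moreover have "\<forall>\<mu>. relevant_cardinal ?L \<mu> \<longrightarrow> \<not> AP ?L \<mu>"
  proof (intro allI impI notI)
    fix \<mu> :: "'u rel" assume \<mu>: "relevant_cardinal ?L \<mu>" and AP: "AP ?L \<mu>"
    have i\<mu>: "infinite_cardinal \<mu>" "LS ?L \<le>o \<mu>" using \<mu> by (auto simp: relevant_cardinal_def)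
    obtain M0 M1 M2 where M: "|carrier M0| =o \<mu>" "|carrier M1| =o \<mu>" "|carrier M2| =o \<mu>" "C.ext M0 M1" "C.ext M0 M2"
      "\<not> (\<exists>f g M1' M2' P. iso f M1 M1' \<and> C.ext M1' P \<and> iso g M2 M2' \<and> C.ext M2' P \<and> (\<forall>x \<in> carrier M0. f x = g x))"
      using C.L_amalgamation_fails[OF i\<mu>(1)] by blast
    have "strong ?L M0 M1" "strong ?L M0 M2" using S(2)[OF \<nu>_le'[OF i\<mu>(2) M(1)]] M(4,5) by blast+
    then obtain P f g where P: "embedding ?L f M1 P" "embedding ?L g M2 P" "\<forall>x \<in> carrier M0. f x = g x"
      using AP M(1-3) unfolding AP_def by blast
    obtain M1' M2' where "iso f M1 M1'" "strong ?L M1' P" "iso g M2 M2'" "strong ?L M2' P"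
      using P(1,2) unfolding embedding_def by blast
    then show False using M(6) P(3) S(1) by blast
  qed
  moreover have "\<forall>i \<le> \<alpha>. \<exists>\<M> \<subseteq> models ?L. |\<M>| =o ctwo ^c cardSuc (\<kappa> i) \<and>
        (\<forall>M \<in> \<M>. maximal_model ?L M \<and> |carrier M| =o cardSuc (\<kappa> i)) \<and>
        (\<forall>M \<in> \<M>. \<forall>N \<in> \<M>. M \<noteq> N \<longrightarrow> \<not> isomorphic M N)"
  proof (intro allI impI)
    fix i assume "i \<le> \<alpha>"
    then have "i \<in> {..\<alpha>}" by simp
    from C.maximal_family[OF this]
    obtain F where F: "\<forall>M \<in> F. C.ok M \<and> (\<forall>P. C.ext M P \<longrightarrow> P = M) \<and> |carrier M| =o cardSuc (\<kappa> i)"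
      "|F| =o ctwo ^c cardSuc (\<kappa> i)" "\<forall>M \<in> F. \<forall>N \<in> F. M \<noteq> N \<longrightarrow> \<not> isomorphic M N" by blast
    have "F \<subseteq> models ?L" using F(1) by auto
    moreover have "\<forall>M \<in> F. maximal_model ?L M \<and> |carrier M| =o cardSuc (\<kappa> i)"
      using F(1) unfolding maximal_model_def by simp
    ultimately show "\<exists>\<M> \<subseteq> models ?L. |\<M>| =o ctwo ^c cardSuc (\<kappa> i) \<and>
        (\<forall>M \<in> \<M>. maximal_model ?L M \<and> |carrier M| =o cardSuc (\<kappa> i)) \<and>
        (\<forall>M \<in> \<M>. \<forall>N \<in> \<M>. M \<noteq> N \<longrightarrow> \<not> isomorphic M N)" using F(2,3) by blast
  qed
  moreover have "\<forall>M. maximal_model ?L M \<and> LS ?L \<le>o |carrier M| \<longrightarrow> (\<exists>i \<le> \<alpha>. |carrier M| =o cardSuc (\<kappa> i))"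
  proof (intro allI impI, elim conjE)
    fix M assume M: "maximal_model ?L M" "LS ?L \<le>o |carrier M|"
    have "\<exists>i \<in> {..\<alpha>}. |carrier M| =o cardSuc (\<kappa> i)"
    proof (rule C.maximal_size)
      show "C.ok M" using M(1) by (simp add: maximal_model_def)
      show "N = M" if "C.ext M N" for N
        using M(1) S(2)[OF \<nu>_le[OF M(2)] that] unfolding maximal_model_def by blast
    qed
    then show "\<exists>i \<le> \<alpha>. |carrier M| =o cardSuc (\<kappa> i)" by auto
  qed
  moreover have "arbitrarily_large_models ?L"
    unfolding arbitrarily_large_models_def using plain ordIso_iff_ordLeq by blast
  moreover have "pure ?L"
    using C.L_pure unfolding pure_def hybrid_def models_in_def by simp
  moreover have "L\<omega>1\<omega>_axiomatizable ?L" if "countable {..\<alpha>}" "\<forall>i \<le> \<alpha>. L\<omega>1\<omega>_axiomatizable (K i)"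
  proof -
    have "L\<omega>1\<omega>_axiomatizable (R i)" if "i \<le> \<alpha>" for i
      using \<open>\<forall>i \<le> \<alpha>. L\<omega>1\<omega>_axiomatizable (K i)\<close> that by (simp add: L\<omega>1\<omega>_axiomatizable_def R_def)
    then have "L\<omega>1\<omega>_axiomatizable C.L"
      using that(1) by (intro C.L_axiomatizable) (auto simp: L\<omega>1\<omega>_axiomatizable_def)
    then show ?thesis by (simp add: L\<omega>1\<omega>_axiomatizable_def)
  qed
  ultimately show ?thesis using AEC_L LS_L by (intro exI[of _ ?L]) blast
qed

theorem theorem3p5p2:
  fixes \<alpha> :: "'i :: {wellorder, order_bot}"
    and \<kappa> :: "'i \<Rightarrow> 'u rel"
    and K\<^sub>0 :: "'i \<Rightarrow> 'u eclass"
  assumes universe: "universe TYPE('u)"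
    and cardinals: "\<And>i. i \<le> \<alpha> \<Longrightarrow> infinite_cardinal (\<kappa> i)"
    and increasing: "\<And>i j. i < j \<Longrightarrow> j \<le> \<alpha> \<Longrightarrow> \<kappa> i <o \<kappa> j"
    and aecs: "\<And>i. i \<le> \<alpha> \<Longrightarrow> AEC (K\<^sub>0 i)"
    and has_models: "\<And>i. i \<le> \<alpha> \<Longrightarrow> \<exists>M \<in> models (K\<^sub>0 i). |carrier M| =o \<kappa> i"
    and no_larger: "\<And>i. i \<le> \<alpha> \<Longrightarrow> \<not> (\<exists>M \<in> models (K\<^sub>0 i). \<kappa> i <o |carrier M| )"
    and jep: "\<And>i. i \<le> \<alpha> \<Longrightarrow> JEP_less (K\<^sub>0 i) (\<kappa> bot)"
  shows "\<exists>K :: 'u eclass. AEC K \<and>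
    (JEP_less K (\<kappa> bot) \<and>
      (\<forall>\<mu>. relevant_cardinal K \<mu> \<and> \<kappa> bot \<le>o \<mu> \<longrightarrow> \<not> JEP K \<mu>)) \<and>
    (\<forall>\<mu>. relevant_cardinal K \<mu> \<longrightarrow> \<not> AP K \<mu>) \<and>
    ((\<forall>i \<le> \<alpha>. \<exists>\<M> \<subseteq> models K.
        |\<M>| =o ctwo ^c cardSuc (\<kappa> i) \<and>
        (\<forall>M \<in> \<M>. maximal_model K M \<and> |carrier M| =o cardSuc (\<kappa> i)) \<and>
        (\<forall>M \<in> \<M>. \<forall>N \<in> \<M>. M \<noteq> N \<longrightarrow> \<not> isomorphic M N)) \<and>
      (\<forall>M. maximal_model K M \<and> LS K \<le>o |carrier M| \<longrightarrow>
        (\<exists>i \<le> \<alpha>. |carrier M| =o cardSuc (\<kappa> i)))) \<and>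
    arbitrarily_large_models K \<and>
    is_cardinal_sup (LS K) {..\<alpha>} (\<lambda>i. LS (K\<^sub>0 i)) \<and>
    ((\<forall>i \<le> \<alpha>. pure (K\<^sub>0 i)) \<longrightarrow> pure K) \<and>
    (countable {..<\<alpha>} \<and> (\<forall>i \<le> \<alpha>. L\<omega>1\<omega>_axiomatizable (K\<^sub>0 i)) \<longrightarrow> L\<omega>1\<omega>_axiomatizable K)"
proof -
  have card: "Card_order (\<kappa> i)" "Cinfinite (\<kappa> i)" "Well_order (\<kappa> i)" if "i \<le> \<alpha>" for i
    using cardinals[OF that] Card_order_infinite_cardinal Cinfinite_infinite_cardinal card_order_on_well_order_on by blast+
  have bounded: "|carrier M| \<le>o \<kappa> i" if i: "i \<le> \<alpha>" and M: "M \<in> models (K\<^sub>0 i)" for i M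
  proof -
    have "\<not> \<kappa> i <o |carrier M|" using no_larger[OF i] M by blast
    then show ?thesis using not_ordLess_iff_ordLeq[of "|carrier M|" "\<kappa> i"] card(3)[OF i] by simp
  qed
  have le: "\<kappa> i \<le>o \<kappa> \<alpha>" if i: "i \<le> \<alpha>" for i
  proof (cases "i = \<alpha>")
    case True
    then show ?thesis using ordLeq_reflexive[OF card(3)[OF i]] by simp
  next
    case False
    then have "i < \<alpha>" using i by (simp add: less_le)
    then show ?thesis by (rule ordLess_imp_ordLeq[OF increasing[OF _ order_refl]])
  qed
  have LS: "is_LS (K\<^sub>0 i) (LS (K\<^sub>0 i))" if "i \<le> \<alpha>" for i using AEC.is_LS_LS[OF aecs[OF that]] .
  \<comment> \<open>Every model has at most \<kappa> \<open>i\<close> points and may serve as its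
    own small submodel.\<close>
  have LS_le: "LS (K\<^sub>0 i) \<le>o \<kappa> i" if i: "i \<le> \<alpha>" for i
  proof -
    have "has_LS_property (K\<^sub>0 i) (\<kappa> i)"
      unfolding has_LS_property_def
    proof (intro ballI allI impI)
      fix N X assume N: "N \<in> models (K\<^sub>0 i)" "X \<subseteq> carrier N"
      have "|carrier N| \<le>o |X| +c \<kappa> i"
        by (rule ordLeq_transitive[OF bounded[OF i N(1)] ordLeq_csum2[OF card(1)[OF i]]])
      then show "\<exists>M. strong (K\<^sub>0 i) M N \<and> X \<subseteq> carrier M \<and> |carrier M| \<le>o |X| +c \<kappa> i"
        using N AEC.strong_refl[OF aecs[OF i]] by blast
    qed
    moreover have "\<forall>\<mu>. infinite_cardinal \<mu> \<and> has_LS_property (K\<^sub>0 i) \<mu> \<longrightarrow> LS (K\<^sub>0 i) \<le>o \<mu>"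
      using LS[OF i] by (simp add: is_LS_def)
    ultimately show ?thesis using cardinals[OF i] by simp
  qed
  \<comment> \<open>The least element of \<open>U\<close> is the required Loewenheim-Skolem number;
    \<kappa> \<open>\<alpha>\<close> shows that there are candidates.\<close>
  define U :: "'u rel set" where "U = {\<nu>. infinite_cardinal \<nu> \<and> (\<forall>i \<in> {..\<alpha>}. LS (K\<^sub>0 i) \<le>o \<nu>)}"
  have "LS (K\<^sub>0 i) \<le>o \<kappa> \<alpha>" if "i \<le> \<alpha>" for i by (rule ordLeq_transitive[OF LS_le[OF that] le[OF that]])
  then have "\<kappa> \<alpha> \<in> U" using cardinals[OF order_refl] by (simp add: U_def)
  then have "U \<noteq> {}" using empty_iff[of "\<kappa> \<alpha>"] by metis
  moreover have "\<forall>r \<in> U. Card_order r" by (simp add: U_def Card_order_infinite_cardinal)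
  ultimately have "\<exists>\<nu> \<in> U. \<forall>\<mu> \<in> U. \<nu> \<le>o \<mu>" by (rule exists_minim_Card_order)
  then obtain \<nu> where \<nu>: "\<nu> \<in> U" "\<forall>\<mu> \<in> U. \<nu> \<le>o \<mu>" by (rule bexE)
  have i\<nu>: "infinite_cardinal \<nu>" using \<nu>(1) by (simp add: U_def)
  have LS_\<nu>: "LS (K\<^sub>0 i) \<le>o \<nu>" if "i \<le> \<alpha>" for i
    using \<nu>(1) that by (simp add: U_def)
  have sup: "is_cardinal_sup \<mu> {..\<alpha>} (\<lambda>i. LS (K\<^sub>0 i))" if \<mu>: "\<mu> =o \<nu>" for \<mu> :: "'u rel"
    unfolding is_cardinal_sup_def
  proof (intro conjI ballI allI impI)
    show "infinite_cardinal \<mu>" by (rule infinite_cardinal_cong[OF i\<nu> \<mu>])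
    show "LS (K\<^sub>0 i) \<le>o \<mu>" if "i \<in> {..\<alpha>}" for i
      by (rule ordLeq_ordIso_trans[OF LS_\<nu> ordIso_symmetric[OF \<mu>]]) (use that in simp)
    show "\<mu> \<le>o \<rho>" if "infinite_cardinal \<rho> \<and> (\<forall>i\<in>{..\<alpha>}. LS (K\<^sub>0 i) \<le>o \<rho>)" for \<rho> :: "'u rel"
      by (rule ordIso_ordLeq_trans[OF \<mu> bspec[OF \<nu>(2)]]) (use that in \<open>simp add: U_def\<close>)
  qed
  define ax where "ax \<longleftrightarrow> countable {..\<alpha>} \<and> (\<forall>i \<le> \<alpha>. L\<omega>1\<omega>_axiomatizable (K\<^sub>0 i))"
  \<comment> \<open>With an axiomatization the given classes are kept and their vocabularies are
    countable. In the other case all of them are replaced at once by labelled sets, which have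
    models of the same largest cardinality, the property for \<nu>, and joint embedding.\<close>
  define K where "K i = (if ax then K\<^sub>0 i else labelled (\<kappa> i))" for i
  have "\<exists>L :: 'u eclass. AEC L \<and> LS L =o \<nu> \<and> JEP_less L (\<kappa> bot) \<and>
    (\<forall>\<mu>. relevant_cardinal L \<mu> \<and> \<kappa> bot \<le>o \<mu> \<longrightarrow> \<not> JEP L \<mu>) \<and>
    (\<forall>\<mu>. relevant_cardinal L \<mu> \<longrightarrow> \<not> AP L \<mu>) \<and>
    (\<forall>i \<le> \<alpha>. \<exists>\<M> \<subseteq> models L. |\<M>| =o ctwo ^c cardSuc (\<kappa> i) \<and>
        (\<forall>M \<in> \<M>. maximal_model L M \<and> |carrier M| =o cardSuc (\<kappa> i)) \<and>
        (\<forall>M \<in> \<M>. \<forall>N \<in> \<M>. M \<noteq> N \<longrightarrow> \<not> isomorphic M N)) \<and>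
    (\<forall>M. maximal_model L M \<and> LS L \<le>o |carrier M| \<longrightarrow> (\<exists>i \<le> \<alpha>. |carrier M| =o cardSuc (\<kappa> i))) \<and>
    arbitrarily_large_models L \<and> pure L \<and>
    (countable {..\<alpha>} \<and> (\<forall>i \<le> \<alpha>. L\<omega>1\<omega>_axiomatizable (K i)) \<longrightarrow> L\<omega>1\<omega>_axiomatizable L)"
  proof (rule assembled_class[OF universe cardinals increasing i\<nu>])
    fix i assume i: "i \<le> \<alpha>"
    show "AEC (K i)" using aecs[OF i] labelled_AEC[OF cardinals[OF i]] by (simp add: K_def)
    have "has_LS_property (K\<^sub>0 i) \<nu>"
      by (rule has_LS_property_mono[OF _ LS_\<nu>[OF i]]) (use LS[OF i] in \<open>simp add: is_LS_def\<close>)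
    then show "has_LS_property (K i) \<nu>"
      using labelled_LS[OF Cinfinite_infinite_cardinal[OF i\<nu>]] by (simp add: K_def)
    show "|vocab (K i)| \<le>o \<kappa> \<alpha>"
    proof (cases ax)
      case True
      then have "countable (vocab (K\<^sub>0 i))" using i by (simp add: ax_def L\<omega>1\<omega>_axiomatizable_def)
      then show ?thesis using True card_of_countable_le[OF card(2)[OF order_refl]] by (simp add: K_def)
    next
      case False
      have "|Field (\<kappa> i)| \<le>o \<kappa> \<alpha>"
        by (rule ordIso_ordLeq_trans[OF card_of_Field_ordIso[OF card(1)[OF i]] le[OF i]])
      then show ?thesis using False card_of_image_le by (simp add: K_def)
    qed
    show "\<exists>M \<in> models (K i). |carrier M| =o \<kappa> i"
      using has_models[OF i] full_labelled[OF cardinals[OF i]] by (auto simp: K_def)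
    show "|carrier M| \<le>o \<kappa> i" if "M \<in> models (K i)" for M
      using that bounded[OF i, of M] labelled_bound[OF card(1)[OF i], of M] by (auto simp: K_def split: if_splits)
  next
    fix A A' assume A: "A \<in> models (K bot)" "A' \<in> models (K bot)" "\<nu> \<le>o |carrier A|" "|carrier A| <o \<kappa> bot"
      "\<nu> \<le>o |carrier A'|" "|carrier A'| <o \<kappa> bot"
    show "jointly_embeddable (K bot) A A'"
    proof (cases ax)
      case True
      then show ?thesis
        using A jep[of bot] ordLeq_transitive[OF LS_\<nu>[of bot] A(3)] ordLeq_transitive[OF LS_\<nu>[of bot] A(5)]
        by (simp add: K_def JEP_less_def)
    next
      case False
      have "infinite_cardinal (\<kappa> bot)" by (rule cardinals) simp
      note F = full_labelled[OF this]
      have "A \<in> models (labelled (\<kappa> bot))" "A' \<in> models (labelled (\<kappa> bot))" using A(1,2) False by (simp_all add: K_def)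
      then have "jointly_embeddable (labelled (\<kappa> bot)) A A'"
        using F(1) F(3)[of A] F(3)[of A'] unfolding jointly_embeddable_def by blast
      then show ?thesis using False by (simp add: K_def)
    qed
  qed
  then obtain L :: "'u eclass" where L: "AEC L" "LS L =o \<nu>" "JEP_less L (\<kappa> bot)"
    "\<forall>\<mu>. relevant_cardinal L \<mu> \<and> \<kappa> bot \<le>o \<mu> \<longrightarrow> \<not> JEP L \<mu>" "\<forall>\<mu>. relevant_cardinal L \<mu> \<longrightarrow> \<not> AP L \<mu>"
    "\<forall>i \<le> \<alpha>. \<exists>\<M> \<subseteq> models L. |\<M>| =o ctwo ^c cardSuc (\<kappa> i) \<and>
        (\<forall>M \<in> \<M>. maximal_model L M \<and> |carrier M| =o cardSuc (\<kappa> i)) \<and>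
        (\<forall>M \<in> \<M>. \<forall>N \<in> \<M>. M \<noteq> N \<longrightarrow> \<not> isomorphic M N)"
    "\<forall>M. maximal_model L M \<and> LS L \<le>o |carrier M| \<longrightarrow> (\<exists>i \<le> \<alpha>. |carrier M| =o cardSuc (\<kappa> i))"
    "arbitrarily_large_models L" "pure L"
    "countable {..\<alpha>} \<and> (\<forall>i \<le> \<alpha>. L\<omega>1\<omega>_axiomatizable (K i)) \<longrightarrow> L\<omega>1\<omega>_axiomatizable L"
    by (elim exE conjE)
  have "L\<omega>1\<omega>_axiomatizable L" if H: "countable {..<\<alpha>}" "\<forall>i \<le> \<alpha>. L\<omega>1\<omega>_axiomatizable (K\<^sub>0 i)"
  proof -
    have "{..\<alpha>} = insert \<alpha> {..<\<alpha>}" by auto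
    then have "countable {..\<alpha>}" using H(1) by simp
    then show ?thesis using L(10) H(2) by (simp add: K_def ax_def)
  qed
  then show ?thesis using L(1,3-9) sup[OF L(2)] by (intro exI[of _ L]) simp
qed

end
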